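(* Let $Z$ be a reduced analytic variety of pure codimension. There is a natural number $m$ such that if $\phi\in C^m(Z)$ is holomorphic on $Z_{\mathrm{reg}}$, then $\phi$ is strongly holomorphic on $Z$.
   Context: $Z$ is an analytic variety in a neighborhood of the closed unit ball in $\mathbb C^n$ (the neighborhood may be replaced by a smaller neighborhood of the closed ball). $Z_{\mathrm{reg}}$ is the regular part of $Z$. $\mathcal I_Z$ is the sheaf of holomorphic functions vanishing on $Z$; sections of $\mathcal O_Z=\mathcal O/\mathcal I_Z$ are the strongly holomorphic functions, i.e. functions on $Z$ that are locally restrictions of holomorphic functions in the ambient space. A function $\phi$ on $Z$ is in $C^k(Z)$ if it is locally the restriction to $Z$ of a $C^k$-function in the ambient space. *)

theory Defs
  imports "HOL-Analysis.Analysis"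
begin

text \<open>
  Holomorphic functions of several complex variables. The predicate follows the library's
  one-variable \<open>holomorphic_on\<close> in differentiating within \<open>S\<close>. It is used below for
  open sets and for relatively open subsets of coordinate subspaces; in the latter case the
  derivative within \<open>S\<close> only sees the coordinates of the subspace.
\<close>

definition holo_on :: "(complex^'n \<Rightarrow> complex) \<Rightarrow> (complex^'n) set \<Rightarrow> bool" where
  "holo_on f S \<longleftrightarrow>
     (\<forall>z\<in>S. \<exists>L. Vector_Spaces.linear (*s) (*) L \<and> (f has_derivative L) (at z within S))"

definition biholomorphic_on ::
    "(complex^'n \<Rightarrow> complex^'n) \<Rightarrow> (complex^'n) set \<Rightarrow> bool" where
  "biholomorphic_on \<Phi> W \<longleftrightarrow>
     open W \<and> open (\<Phi> ` W) \<and> inj_on \<Phi> W \<and>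
     (\<forall>i. holo_on (\<lambda>z. \<Phi> z $ i) W) \<and>
     (\<forall>i. holo_on (\<lambda>w. inv_into W \<Phi> w $ i) (\<Phi> ` W))"

text \<open>
  Varieties are represented by their point sets. This is no loss in the reduced case, where the
  structure sheaf is the quotient by the full ideal sheaf of the set.
\<close>

definition analytic_subset :: "(complex^'n) set \<Rightarrow> (complex^'n) set \<Rightarrow> bool" where
  "analytic_subset U Z \<longleftrightarrow>
     Z \<subseteq> U \<and>
     (\<forall>a\<in>U. \<exists>W F. open W \<and> a \<in> W \<and> W \<subseteq> U \<and> finite F \<and> (\<forall>f\<in>F. holo_on f W) \<and>
        Z \<inter> W = {z\<in>W. \<forall>f\<in>F. f z = 0})"

definition submanifold_chart ::
    "(complex^'n) set \<Rightarrow> (complex^'n) set \<Rightarrow> (complex^'n \<Rightarrow> complex^'n) \<Rightarrow> 'n set \<Rightarrow> bool" where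
  "submanifold_chart Z W \<Phi> I \<longleftrightarrow>
     biholomorphic_on \<Phi> W \<and> \<Phi> ` (Z \<inter> W) = {w \<in> \<Phi> ` W. \<forall>i\<in>I. w $ i = 0}"

definition regular_part_codim :: "(complex^'n) set \<Rightarrow> nat \<Rightarrow> (complex^'n) set" where
  "regular_part_codim Z p =
     {a\<in>Z. \<exists>W \<Phi> I. submanifold_chart Z W \<Phi> I \<and> a \<in> W \<and> card I = p}"

definition regular_part :: "(complex^'n) set \<Rightarrow> (complex^'n) set" where
  "regular_part Z = (\<Union>p. regular_part_codim Z p)"

text \<open>
  The dimension of a variety at a point is the largest dimension of the regular part arbitrarily
  close to that point, so the codimension is the smallest one.
\<close>

definition has_codim_at :: "(complex^'n) set \<Rightarrow> complex^'n \<Rightarrow> nat \<Rightarrow> bool" where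
  "has_codim_at Z a p \<longleftrightarrow>
     a \<in> closure (regular_part_codim Z p) \<and> (\<forall>q<p. a \<notin> closure (regular_part_codim Z q))"

definition pure_codim :: "(complex^'n) set \<Rightarrow> nat \<Rightarrow> bool" where
  "pure_codim Z p \<longleftrightarrow> (\<forall>a\<in>Z. has_codim_at Z a p)"

text \<open>Functions on \<open>Z\<close> are total functions whose values outside \<open>Z\<close> play no role.\<close>

definition strongly_holomorphic_on ::
    "(complex^'n \<Rightarrow> complex) \<Rightarrow> (complex^'n) set \<Rightarrow> bool" where
  "strongly_holomorphic_on \<phi> Z \<longleftrightarrow>
     (\<forall>a\<in>Z. \<exists>W g. open W \<and> a \<in> W \<and> holo_on g W \<and> (\<forall>z\<in>Z \<inter> W. \<phi> z = g z))"

text \<open>Holomorphy on the complex manifold \<open>regular_part Z\<close>, read off in its charts.\<close>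

definition holomorphic_on_regular_part ::
    "(complex^'n \<Rightarrow> complex) \<Rightarrow> (complex^'n) set \<Rightarrow> bool" where
  "holomorphic_on_regular_part \<phi> Z \<longleftrightarrow>
     (\<forall>W \<Phi> I. submanifold_chart Z W \<Phi> I \<longrightarrow> holo_on (\<phi> \<circ> inv_into W \<Phi>) (\<Phi> ` (Z \<inter> W)))"

text \<open>
  Real \<open>C\<^sup>k\<close> regularity on an open set. In finite dimensions, continuity of all iterated
  directional derivatives is the same as continuity of the derivatives as multilinear maps.
\<close>

primrec Ck_on ::
    "nat \<Rightarrow> ('a::euclidean_space \<Rightarrow> 'b::real_normed_vector) \<Rightarrow> 'a set \<Rightarrow> bool" where
  "Ck_on 0 f W \<longleftrightarrow> continuous_on W f"
| "Ck_on (Suc k) f W \<longleftrightarrow>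
     (\<forall>x\<in>W. f differentiable (at x)) \<and>
     (\<forall>v. Ck_on k (\<lambda>x. frechet_derivative f (at x) v) W)"

definition Ck_on_variety ::
    "nat \<Rightarrow> (complex^'n \<Rightarrow> complex) \<Rightarrow> (complex^'n) set \<Rightarrow> bool" where
  "Ck_on_variety k \<phi> Z \<longleftrightarrow>
     (\<forall>a\<in>Z. \<exists>W g. open W \<and> a \<in> W \<and> Ck_on k g W \<and> (\<forall>z\<in>Z \<inter> W. \<phi> z = g z))"

end

theory Submission
 imports Defs "HOL-Complex_Analysis.Complex_Analysis"
begin

text \<open>Near each of its points \<open>Z\<close> is, in suitable linear coordinates, a branched cover of a convex open set \<open>D\<close>
 of dimension \<open>n - p\<close>, with sheets off the zero set of a discriminant. Finitely many monomials \<open>m\<^sub>\<kappa>\<close> generate the functions on \<open>Z\<close> over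
 those on \<open>D\<close>, and the fibre traces \<open>Tr (\<phi> m\<^sub>\<kappa>)\<close> extend holomorphically to \<open>D\<close> since \<open>\<phi>\<close> is continuous and
 holomorphic on the sheets. At a point \<open>b\<close> subtract from \<open>\<phi>\<close> a polynomial \<open>P\<close> interpolating the holomorphic parts of its
 Taylor polynomials over \<open>b\<close>. Along a line through \<open>b\<close> the remaining mixed terms \<open>A (cnj B)\<close> with \<open>B\<close> vanishing at \<open>b\<close>
 cannot contribute low order terms to a holomorphic function of the parameter, so \<open>Tr ((\<phi> - P) m\<^sub>\<kappa>)\<close> vanishes to order
 \<open>N\<close> at \<open>b\<close>. Hence the trace vector of \<open>\<phi>\<close> agrees to order \<open>N\<close> at every \<open>b\<close> with an element of the module spanned by
 the trace vectors of the monomials; for \<open>N\<close> large this forces membership (Weierstrass division and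
 induction on the dimension), so \<open>\<phi>\<close> is a combination of the \<open>m\<^sub>\<kappa>\<close> with coefficients holomorphic on \<open>D\<close>.
 Compactness of the ball makes \<open>m\<close> uniform.\<close>

section \<open>Holomorphic functions on subspaces\<close>

text \<open>The exponent is \<open>m = K * N\<close>. Here \<open>K\<close> is a Hoelder exponent of
  the fibres, |y - y0|^K = O(|x - b|) for y over x and y0 over b, which turns Taylor errors of order
  \<open>K * N\<close> on the variety into errors of order \<open>N\<close> on the base. The number
  \<open>N\<close> depends only on the matrix of traces of products of two monomials and not on
  \<phi>; each step of the induction behind it replaces N' by (d + 1) N' + 1, with d the degree of
  the polynomial divided by. Agreement to finite order at a single point would not give membership
  in a module: it is essential that one \<open>N\<close> serves all points b, with approximants that
  vary freely with b. Nothing is lost by passing to traces, because the monomials span all functions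
  on an unbranched fibre. Dimension enters only topologically. Charts of the regular part and sheets
  of the cover are compared by invariance of domain; this identifies the base dimension with n - p,
  shows that a sheet meeting the variety lies on it, and makes the unbranched points dense, so that
  continuity of \<phi> settles the branch locus.\<close>

abbreviation ropen :: "'a::topological_space set => 'a set => bool" where
 "ropen V S \<equiv> openin (top_of_set V) S"

lemma norm_smult [simp]: "norm (c *s (v::complex^'n)) = cmod c * norm v"
proof -
 have "norm (c *s v) = L2_set (%i. cmod c * cmod (v $ i)) UNIV"
  by (simp add: norm_vec_def norm_mult)
 then show ?thesis
  by (simp add: L2_set_right_distrib norm_vec_def)
qed

lemma smult_of_real: "complex_of_real r *s (v::complex^'n) = r *\<^sub>R v"
 unfolding vec_eq_iff vector_smult_component vector_scaleR_component
 by (simp add: scaleR_conv_of_real)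

lemma continuous_on_smult [continuous_intros]:
 fixes g :: "'a::topological_space => complex^'n"
 assumes "continuous_on S f" "continuous_on S g"
 shows "continuous_on S (%x. f x *s g x)"
 unfolding vector_scalar_mult_def
 by (intro continuous_on_vec_lambda continuous_intros assms)

lemma csubspace_subspace: "vec.subspace (V::(complex^'n) set) ==> subspace V"
 unfolding subspace_def vec.subspace_def by (metis smult_of_real)

lemma ropen_ballE:
 assumes "ropen V S" "z \<in> S"
 obtains e where "e > 0" "!!y. y \<in> V ==> dist y z < e ==> y \<in> S"
 using assms unfolding openin_euclidean_subtopology_iff by (metis dist_commute)

lemma ropen_subset: "ropen V S ==> S \<subseteq> V"
 using openin_imp_subset by auto

text \<open>Osgood's form of holomorphy: continuity plus one-variable differentiability along the
  complex lines in directions of \<open>V\<close>. Most arguments restrict to such lines, and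
  continuity is what makes integrals over parameters work. \<open>hol_imp_holo_on\<close> recovers
  Frechet differentiability.\<close>

definition hol :: "(complex^'n) set => (complex^'n) set => (complex^'n => complex) => bool" where
 "hol V S f \<longleftrightarrow> continuous_on S f &
   (\<forall>z\<in>S. \<forall>v\<in>V. (%t. f (z + t *s v)) field_differentiable (at 0))"

lemma line_open:
 fixes V :: "(complex^'n) set"
 assumes "vec.subspace V" "ropen V S" "z \<in> V" "v \<in> V"
 shows "open {t. z + t *s v \<in> S}"
proof -
 obtain O1 where O: "open O1" "S = V \<inter> O1"
  using assms(2) unfolding openin_open by auto
 have "{t. z + t *s v \<in> S} = (%t. z + t *s v) -` O1"
  using O assms by (auto simp: vec.subspace_def)
 moreover have "open ((%t. z + t *s v) -` O1)"
  by (intro open_vimage O continuous_intros)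
 ultimately show ?thesis by simp
qed

lemma hol_line:
 fixes V :: "(complex^'n) set"
 assumes V: "vec.subspace V" "ropen V S" "hol V S f" "z \<in> V" "v \<in> V"
 shows "(%t. f (z + t *s v)) holomorphic_on {t. z + t *s v \<in> S}"
proof -
 have "(%t. f (z + t *s v)) field_differentiable (at t0)" if t0: "z + t0 *s v \<in> S" for t0
 proof -
  have "(%t. f ((z + t0 *s v) + t *s v)) field_differentiable (at 0)"
   using V t0 unfolding hol_def by blast
  then have "(%t. f ((z + t0 *s v) + t *s v)) field_differentiable (at (t0 - t0))"
   by simp
  moreover have "(%t. t - t0) field_differentiable at t0"
   by (intro derivative_intros)
  ultimately have "((%t. f ((z + t0 *s v) + t *s v)) \<circ> (%t. t - t0)) field_differentiable (at t0)"
   by (intro field_differentiable_compose) auto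
  then show ?thesis
   by (simp add: o_def algebra_simps vector_sub_rdistrib)
 qed
 then show ?thesis
  by (metis (mono_tags, lifting) field_differentiable_at_within holomorphic_onI mem_Collect_eq)
qed

lemma hol_continuous: "hol V S f ==> continuous_on S f"
 unfolding hol_def by blast

lemma hol_subset: "hol V S f ==> T \<subseteq> S ==> hol V T f"
 unfolding hol_def by (meson continuous_on_subset subsetD)

lemma hol_subspace: "hol V S f ==> W \<subseteq> V ==> hol W S f"
 unfolding hol_def by blast

lemma hol_const [simp, intro]: "hol V S (%_. c)"
 unfolding hol_def by auto

lemma hol_add: "hol V S f ==> hol V S g ==> hol V S (%z. f z + g z)"
 unfolding hol_def by (intro conjI ballI continuous_intros field_differentiable_add) auto

lemma hol_mult: "hol V S f ==> hol V S g ==> hol V S (%z. f z * g z)"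
 unfolding hol_def by (intro conjI ballI continuous_intros field_differentiable_mult) auto

lemma hol_uminus: "hol V S f ==> hol V S (%z. - f z)"
 unfolding hol_def by (intro conjI ballI continuous_intros field_differentiable_minus) auto

lemma hol_diff: "hol V S f ==> hol V S g ==> hol V S (%z. f z - g z)"
 unfolding hol_def by (intro conjI ballI continuous_intros field_differentiable_diff) auto

lemma hol_divide:
 assumes "hol V S f" "hol V S g" "!!z. z \<in> S ==> g z ~= 0"
 shows "hol V S (%z. f z / g z)"
 using assms unfolding hol_def
 by (intro conjI ballI continuous_intros field_differentiable_divide) auto

lemma hol_power: "hol V S f ==> hol V S (%z. f z ^ n)"
 by (induction n) (auto intro: hol_mult)

lemma hol_sum: "(!!i. i \<in> A ==> hol V S (f i)) ==> hol V S (%z. \<Sum>i\<in>A. f i z)"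
 by (induction A rule: infinite_finite_induct) (auto intro: hol_add)

lemma hol_prod: "(!!i. i \<in> A ==> hol V S (f i)) ==> hol V S (%z. \<Prod>i\<in>A. f i z)"
 by (induction A rule: infinite_finite_induct) (auto intro: hol_mult)

text \<open>The inner map is affine with linear part \<open>M\<close>, so it carries lines to lines.
  Translations, coordinate projections and shifts along a slice are covered, also between different
  subspaces.\<close>

lemma hol_compose_lin:
 assumes f: "hol W T f" and c: "continuous_on S L" and m: "!!z. z \<in> S ==> L z \<in> T"
  and lin: "!!z v t. z \<in> S ==> v \<in> V ==> M v \<in> W & L (z + t *s v) = L z + t *s M v"
 shows "hol V S (%z. f (L z))"
proof -
 have "continuous_on S (%z. f (L z))"
  by (rule continuous_on_compose2[OF hol_continuous[OF f] c]) (use m in auto)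
 moreover have "(%t. f (L (z + t *s v))) field_differentiable (at 0)" if "z \<in> S" "v \<in> V" for z v
  using f m[OF that(1)] lin[OF that] unfolding hol_def by simp
 ultimately show ?thesis unfolding hol_def by blast
qed

lemma hol_component: "hol V S (%z. z $ i)"
 unfolding hol_def
 by (auto intro!: continuous_intros derivative_intros simp: vector_scalar_mult_def)

lemma hol_eventually_cong:
 fixes V :: "(complex^'n) set"
 assumes V: "vec.subspace V" "ropen V S" "z \<in> S"
  and f: "hol V S f" and eq: "!!y. y \<in> S ==> f y = g y" and v: "v \<in> V"
 shows "(%t. g (z + t *s v)) field_differentiable (at 0)"
proof -
 have z: "z \<in> V" using V ropen_subset by blast
 have "open {t. z + t *s v \<in> S}" by (rule line_open) (use V v z in auto)
 moreover have "0 \<in> {t. z + t *s v \<in> S}" using V by simp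
 ultimately obtain e where e: "e > 0" "ball 0 e \<subseteq> {t. z + t *s v \<in> S}"
  by (meson open_contains_ball)
 show ?thesis
 proof (rule field_differentiable_transform_within[OF e(1)])
  show "(%t. f (z + t *s v)) field_differentiable (at 0)"
   using f V v unfolding hol_def by auto
  show "f (z + x' *s v) = g (z + x' *s v)" if "x' \<in> UNIV" "dist x' 0 < e" for x'
   using that e eq by (auto simp: dist_commute subset_iff)
 qed simp
qed

lemma hol_cong:
 fixes V :: "(complex^'n) set"
 assumes "vec.subspace V" "ropen V S" "hol V S f" "!!y. y \<in> S ==> f y = g y"
 shows "hol V S g"
proof -
 have "continuous_on S g"
  using assms continuous_on_cong unfolding hol_def by metis
 then show ?thesis
  using hol_eventually_cong[OF assms(1,2) _ assms(3,4)] unfolding hol_def by blast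
qed

lemma hol_local:
 fixes V :: "(complex^'n) set"
 assumes V: "vec.subspace V"
  and loc: "!!z. z \<in> S ==> \<exists>B g. ropen V B & z \<in> B & hol V B g & (\<forall>y\<in>B. g y = f y)"
  and SV: "S \<subseteq> V"
 shows "hol V S f"
proof -
 have *: "\<exists>B. ropen V B & z \<in> B & hol V B f" if "z \<in> S" for z
  using loc[OF that] hol_cong[OF V] by metis
 have "continuous_on S f"
  unfolding continuous_on_eq_continuous_within
 proof
  fix z assume z: "z \<in> S"
  obtain B where B: "ropen V B" "z \<in> B" "hol V B f" using *[OF z] by auto
  obtain O1 where O: "open O1" "B = V \<inter> O1" using B(1) unfolding openin_open by auto
  have "continuous_on (S \<inter> O1) f"
   using B(3) O SV by (intro continuous_on_subset[OF hol_continuous[OF B(3)]]) auto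
  moreover have "z \<in> S \<inter> O1" using z B O by auto
  ultimately have "continuous (at z within S \<inter> O1) f"
   using continuous_on_eq_continuous_within by blast
  then show "continuous (at z within S) f"
   unfolding continuous_within
   using at_within_nhd[of z O1 "S \<inter> O1" S] O \<open>z \<in> S \<inter> O1\<close> by auto
 qed
 moreover have "(%t. f (z + t *s v)) field_differentiable (at 0)" if "z \<in> S" "v \<in> V" for z v
  using *[OF that(1)] that unfolding hol_def by blast
 ultimately show ?thesis unfolding hol_def by blast
qed

lemma convex_line:
 fixes S :: "(complex^'n) set"
 assumes "convex S"
 shows "convex {t. z + t *s v \<in> S}"
proof (rule convexI)
 fix x y and a b :: real
 assume xy: "x \<in> {t. z + t *s v \<in> S}" "y \<in> {t. z + t *s v \<in> S}" and ab: "0 <= a" "0 <= b" "a + b = 1"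
 have "z + (a *\<^sub>R x + b *\<^sub>R y) *s v = a *\<^sub>R (z + x *s v) + b *\<^sub>R (z + y *s v)"
 proof -
  have "z = a *\<^sub>R z + b *\<^sub>R z" using ab by (metis scaleR_add_left scaleR_one)
  moreover have "(a *\<^sub>R x + b *\<^sub>R y) *s v = a *\<^sub>R (x *s v) + b *\<^sub>R (y *s v)"
   by (simp add: vec_eq_iff scaleR_conv_of_real[where 'a=complex] algebra_simps)
  ultimately show ?thesis by (metis (no_types, lifting) add.assoc add.left_commute scaleR_add_right)
 qed
 also have "\<dots> \<in> S" using assms xy ab by (auto simp: convex_def)
 finally show "a *\<^sub>R x + b *\<^sub>R y \<in> {t. z + t *s v \<in> S}" by simp
qed

text \<open>The complex line through \<open>z0\<close> and \<open>z\<close> meets the convex set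
  \<open>S\<close> in a convex, hence connected, open subset of the plane; the one-variable identity
  theorem applies there.\<close>

lemma hol_identity:
 fixes V :: "(complex^'n) set"
 assumes V: "vec.subspace V" "ropen V S" "convex S" "hol V S f"
  and z0: "z0 \<in> S" "e > 0" "!!y. y \<in> S ==> dist y z0 < e ==> f y = 0" and z: "z \<in> S"
 shows "f z = 0"
proof -
 have SV: "S \<subseteq> V" using V ropen_subset by blast
 define v where "v = z - z0"
 have v: "v \<in> V" unfolding v_def using V SV z z0 vec.subspace_diff by blast
 define T where "T = {t. z0 + t *s v \<in> S}"
 have T: "open T" unfolding T_def by (rule line_open) (use V v z0 SV in auto)
 have Tc: "connected T" unfolding T_def using convex_line[OF V(3)] convex_connected by blast
 define d where "d = e / (norm v + 1)"
 have d: "d > 0" using z0 by (simp add: d_def add_nonneg_pos)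
 have "(%t. f (z0 + t *s v)) holomorphic_on T"
  unfolding T_def by (rule hol_line) (use V v z0 SV in auto)
 moreover have "f (z0 + t *s v) = 0" if "t \<in> T \<inter> ball 0 d" for t
 proof -
  have "cmod t * (norm v + 1) < e"
   using that d z0(2) by (simp add: d_def pos_less_divide_eq add_nonneg_pos)
  then have "cmod t * norm v < e" by (smt (verit) mult_left_mono norm_ge_zero)
  then show ?thesis using that z0 by (auto simp: T_def dist_norm)
 qed
 moreover have "0 \<in> T" "1 \<in> T" using z z0 by (auto simp: T_def v_def)
 ultimately have "f (z0 + 1 *s v) = 0"
  using analytic_continuation_open[of "T \<inter> ball 0 d" T "%t. f (z0 + t *s v)" "%_. 0" 1] T Tc d
   IntI[of 0 T "ball 0 d"] open_Int[OF T open_ball[of 0 d]]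
  by (metis centre_in_ball empty_iff holomorphic_on_const inf_le1)
 then show ?thesis by (simp add: v_def)
qed

lemma hol_nonzero_dense:
 fixes V :: "(complex^'n) set"
 assumes V: "vec.subspace V" "ropen V S" "convex S" "hol V S f"
  and z1: "z1 \<in> S" "f z1 ~= 0" and z: "z \<in> S" "e > 0"
 obtains y where "y \<in> S" "dist y z < e" "f y ~= 0"
 using hol_identity[OF V z(1,2) _ z1(1)] z1 that by blast

lemma hol_mult_zero:
 fixes V :: "(complex^'n) set"
 assumes V: "vec.subspace V" "ropen V S" "convex S" "hol V S f" "hol V S g"
  and fg: "!!z. z \<in> S ==> f z * g z = 0" and z: "z \<in> S" "f z ~= 0" and y: "y \<in> S"
 shows "g y = 0"
proof -
 have "\<exists>e>0. \<forall>y\<in>S. dist y z < e --> f y ~= 0"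
 proof -
  have "continuous_on S f" using V hol_continuous by blast
  then have "\<exists>e>0. \<forall>y\<in>S. dist y z < e --> dist (f y) (f z) < cmod (f z)"
   using z unfolding continuous_on_iff by (meson zero_less_norm_iff)
  then show ?thesis by (metis dist_0_norm less_irrefl)
 qed
 then obtain e where e: "e > 0" "!!y. y \<in> S ==> dist y z < e ==> f y ~= 0" by blast
 show ?thesis
 proof (rule hol_identity[OF V(1-3) V(5) z(1) e(1) _ y])
  show "g y = 0" if "y \<in> S" "dist y z < e" for y
   using fg[OF that(1)] e(2)[OF that] by simp
 qed
qed

lemma hol_prod_nonzero:
 fixes V :: "(complex^'n) set"
 assumes V: "vec.subspace V" "ropen V S" "convex S" "S ~= {}"
  and A: "finite A" "!!i. i \<in> A ==> hol V S (f i)" "!!i. i \<in> A ==> \<exists>z\<in>S. f i z ~= 0"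
 shows "\<exists>z\<in>S. (\<Prod>i\<in>A. f i z) ~= 0"
 using A
proof (induction A rule: finite_induct)
 case empty
 then show ?case using V by auto
next
 case (insert i A)
 then obtain y where y: "y \<in> S" "(\<Prod>i\<in>A. f i y) ~= 0" by auto
 obtain z where z: "z \<in> S" "f i z ~= 0" using insert.prems(2)[of i] by auto
 have "hol V S (%z. \<Prod>i\<in>A. f i z)" by (intro hol_prod insert.prems) auto
 then have "\<exists>z\<in>S. f i z * (\<Prod>i\<in>A. f i z) ~= 0"
  using hol_mult_zero[of V S "f i" "%z. \<Prod>i\<in>A. f i z" z y] V z y insert.prems(1)[of i] by blast
 then show ?case using insert by simp
qed

section \<open>Cauchy integrals depending on parameters\<close>

definition cI :: "real => (complex => complex) => complex" where
 "cI r k = contour_integral (circlepath 0 r) k / (2 * of_real pi * \<i>)"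

definition cpt :: "real => real => complex" where
 "cpt r t = of_real r * exp (2 * of_real pi * \<i> * of_real t)"

lemma norm_cpt: "r > 0 ==> cmod (cpt r t) = r"
 by (simp add: norm_mult cpt_def)

lemma cpt_sphere: "r > 0 ==> cpt r t \<in> sphere 0 r"
 by (simp add: norm_cpt)

lemma continuous_on_cpt [continuous_intros]:
 "continuous_on S f ==> continuous_on S (%x. cpt r (f x))"
 unfolding cpt_def by (intro continuous_intros)

text \<open>On a fixed real interval the theorems on integrals with parameters become applicable;
  the factor 2 pi i in the derivative of the circle cancels against the normalisation.\<close>

lemma cI_integral:
 "cI r k = integral (cbox 0 1) (%t. k (cpt r t) * cpt r t)"
proof -
 have "contour_integral (circlepath 0 r) k
   = integral {0..1} (%t. k (cpt r t) * (2 * of_real pi * \<i> * cpt r t))"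
  unfolding contour_integral_integral
 proof (intro integral_cong)
  fix x :: real assume "x \<in> {0..1}"
  then show "k (circlepath 0 r x) * vector_derivative (circlepath 0 r) (at x) =
    k (cpt r x) * (2 * of_real pi * \<i> * cpt r x)"
   unfolding vector_derivative_circlepath by (simp add: circlepath cpt_def mult_ac)
 qed
 also have "\<dots> = integral {0..1} (%t. (2 * of_real pi * \<i>) * (k (cpt r t) * cpt r t))"
  by (simp add: mult_ac)
 also have "\<dots> = (2 * of_real pi * \<i>) * integral {0..1} (%t. k (cpt r t) * cpt r t)"
  by simp
 finally show ?thesis by (simp add: cI_def)
qed

lemma cI_cong: "r > 0 ==> (!!s. s \<in> sphere 0 r ==> k s = h s) ==> cI r k = cI r h"
 using cpt_sphere[of r] unfolding cI_integral by (metis (no_types, lifting))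

lemma cI_integrable:
 assumes "r > 0" "continuous_on (sphere 0 r) k"
 shows "(%t. k (cpt r t) * cpt r t) integrable_on cbox 0 1"
 by (intro integrable_continuous continuous_intros continuous_on_compose2[OF assms(2)])
  (use cpt_sphere[OF assms(1)] in auto)

lemma cI_add: "r > 0 ==> continuous_on (sphere 0 r) k ==> continuous_on (sphere 0 r) g
  ==> cI r (%s. k s + g s) = cI r k + cI r g"
 unfolding cI_integral using integral_add[OF cI_integrable[of r k] cI_integrable[of r g]]
 by (simp add: distrib_right)

lemma cI_cmult: "cI r (%s. c * k s) = c * cI r k"
 unfolding cI_integral by (simp add: mult.assoc)

lemma cI_diff:
 assumes "r > 0" "continuous_on (sphere 0 r) k" "continuous_on (sphere 0 r) g"
 shows "cI r (%s. k s - g s) = cI r k - cI r g"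
 using cI_add[OF assms(1,2), of "%s. (-1) * g s"] assms(3) cI_cmult[of r "-1" g]
 by (simp add: continuous_on_minus)

lemma cI_zero [simp]: "cI r (%s. 0) = 0"
 unfolding cI_integral by simp

lemma cI_sum:
 assumes "r > 0" "finite A" "!!i. i \<in> A ==> continuous_on (sphere 0 r) (k i)"
 shows "cI r (%s. \<Sum>i\<in>A. k i s) = (\<Sum>i\<in>A. cI r (k i))"
 using assms(2,3)
 by (induction A rule: finite_induct) (auto simp: cI_add[OF assms(1)] continuous_on_sum)

lemma cI_bound:
 assumes "r > 0" "continuous_on (sphere 0 r) k" "!!s. s \<in> sphere 0 r ==> cmod (k s) <= B"
 shows "cmod (cI r k) <= B * r"
proof -
 have "B >= 0" using assms(3)[OF cpt_sphere[OF assms(1), of 0]] norm_ge_zero order_trans by blast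
 have "norm (integral (cbox 0 (1::real)) (%t. k (cpt r t) * cpt r t)) <= (B * r) * measure lborel (cbox 0 (1::real))"
 proof (rule integrable_bound)
  show "0 <= B * r" using assms \<open>B >= 0\<close> by simp
  show "(%t. k (cpt r t) * cpt r t) integrable_on cbox 0 1" by (rule cI_integrable[OF assms(1,2)])
  show "norm (k (cpt r t) * cpt r t) <= B * r" if "t \<in> cbox 0 1" for t
  proof -
   show ?thesis
    using assms(3)[OF cpt_sphere[OF assms(1), of t]] assms(1) norm_cpt[OF assms(1), of t]
    by (simp add: norm_mult)
  qed
 qed
 then show ?thesis by (simp add: cI_integral)
qed

lemma cI_Cauchy0:
 assumes "r > 0" "k holomorphic_on ball 0 R" "r < R"
 shows "cI r k = 0"
proof -
 have "(k has_contour_integral 0) (circlepath 0 r)"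
  by (rule Cauchy_theorem_convex_simple[OF assms(2) convex_ball]) (use assms in auto)
 then show ?thesis by (simp add: cI_def contour_integral_unique)
qed

lemma cI_Cauchy:
 assumes "r > 0" "k holomorphic_on ball 0 R" "r < R" "cmod w < r"
 shows "cI r (%s. k s / (s - w)) = k w"
proof -
 have "((%s. k s / (s - w)) has_contour_integral (2 * of_real pi * \<i> * k w)) (circlepath 0 r)"
  by (rule Cauchy_integral_circlepath_simple[OF holomorphic_on_subset[OF assms(2)]]) (use assms in auto)
 then show ?thesis by (simp add: cI_def contour_integral_unique)
qed

lemma cI_Cauchy2:
 assumes "r > 0" "k holomorphic_on ball 0 R" "r < R" "cmod w < r"
 shows "cI r (%s. k s / (s - w)^2) = deriv k w"
proof -
 have c: "continuous_on (cball 0 r) k"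
  by (rule holomorphic_on_imp_continuous_on[OF holomorphic_on_subset[OF assms(2)]]) (use assms in auto)
 have h: "k holomorphic_on ball 0 r"
  by (rule holomorphic_on_subset[OF assms(2)]) (use assms in auto)
 have "contour_integral (circlepath 0 r) (%s. k s / (s - w)^2) = (2 * of_real pi * \<i>) * deriv k w"
  using Cauchy_contour_integral_circlepath_2[OF c h, of w] assms by simp
 then show ?thesis by (simp add: cI_def)
qed

text \<open>Leibniz' rule asks for a jointly continuous derivative in \<open>x\<close>. Cauchy's
  formula on the circle of radius \<open>e / 2\<close> writes that derivative as an integral of
  \<open>f\<close> itself, so joint continuity of \<open>f\<close> suffices.\<close>

lemma param_integral_differentiable:
 fixes f :: "complex => real => complex"
 assumes e: "e > 0"
  and c: "continuous_on (ball 0 e \<times> cbox 0 1) (%(x, t). f x t)"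
  and h: "!!t. t \<in> cbox 0 1 ==> (%x. f x t) holomorphic_on ball 0 e"
 shows "(%x. integral (cbox 0 1) (f x)) field_differentiable (at 0)"
proof -
 define r where "r = e / 2"
 have r: "0 < r" "r < e" using e by (auto simp: r_def)
 define fx where "fx x t = cI r (%s. f s t / (s - x)^2)" for x t
 have D: "((%x. f x t) has_field_derivative fx x t) (at x)" if "x \<in> ball 0 r" "t \<in> cbox 0 1" for x t
 proof -
  have "fx x t = deriv (%x. f x t) x"
   unfolding fx_def by (rule cI_Cauchy2[OF r(1) h[OF that(2)] r(2)]) (use that in auto)
  moreover have "x \<in> ball 0 e" using that r by auto
  ultimately show ?thesis
   using holomorphic_derivI[OF h[OF that(2)] open_ball] by simp
 qed
 have "continuous_on ((ball 0 r \<times> cbox 0 1) \<times> cbox 0 1)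
   (%(p, u). f (cpt r u) (snd p) / (cpt r u - fst p)^2 * cpt r u)"
 proof -
  have "continuous_on ((ball 0 r \<times> cbox 0 1) \<times> cbox 0 1)
    (%q. (%(x, t). f x t) (cpt r (snd q), snd (fst q)))"
   by (rule continuous_on_compose2[OF c])
    (use r norm_cpt[OF r(1)] in \<open>auto intro!: continuous_intros simp del: cbox_interval\<close>)
  then have a: "continuous_on ((ball 0 r \<times> cbox 0 1) \<times> cbox 0 1)
    (%q. f (cpt r (snd q)) (snd (fst q)))" by simp
  show ?thesis
   unfolding case_prod_beta by (intro continuous_intros a) (auto simp: norm_cpt[OF r(1)])
 qed
 then have "continuous_on (ball 0 r \<times> cbox 0 1) (%p. fx (fst p) (snd p))"
  unfolding fx_def cI_integral by (intro integral_continuous_on_param) (simp add: case_prod_beta)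
 then have fxc: "continuous_on (ball 0 r \<times> cbox 0 1) (%(x, t). fx x t)" by (simp add: case_prod_beta)
 have "(%x. integral (cbox 0 1) (f x)) field_differentiable at 0 within ball 0 r"
 proof (rule leibniz_rule_field_differentiable[OF _ _ fxc])
  show "((%x. f x t) has_field_derivative fx x t) (at x within ball 0 r)" if "x \<in> ball 0 r" "t \<in> cbox 0 1" for x t
   using D[OF that] has_field_derivative_at_within by blast
  show "f x integrable_on cbox 0 1" if "x \<in> ball 0 r" for x
  proof (rule integrable_continuous)
   show "continuous_on (cbox 0 1) (f x)"
   proof -
    have "continuous_on (cbox 0 1) (%t. (%(x, t). f x t) (x, t))"
     by (rule continuous_on_compose2[OF c])
      (use that r in \<open>auto intro!: continuous_intros simp del: cbox_interval\<close>)
    then show ?thesis by simp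
   qed
  qed
 qed (use r in auto)
 then show ?thesis
  using r(1) by (simp add: at_within_open[of 0 "ball 0 r"])
qed

lemma hol_cI:
 fixes V :: "(complex^'n) set"
 assumes V: "vec.subspace V" "ropen V S" and r: "r > 0"
  and c: "continuous_on (S \<times> sphere 0 r) (%(z, s). k z s)"
  and h: "!!s. s \<in> sphere 0 r ==> hol V S (%z. k z s)"
 shows "hol V S (%z. cI r (k z))"
proof -
 have c1: "continuous_on (A \<times> cbox (0::real) 1) (%(x, t). k (L x) (cpt r t) * cpt r t)"
  if "continuous_on A L" "L ` A \<subseteq> S" for L and A :: "'b::topological_space set"
 proof -
  have "continuous_on (A \<times> cbox (0::real) 1) (%q. (L (fst q), cpt r (snd q)))"
   by (intro continuous_intros continuous_on_compose2[OF that(1)]) auto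
  then have "continuous_on (A \<times> cbox (0::real) 1) (%q. (%(z, s). k z s) (L (fst q), cpt r (snd q)))"
   by (rule continuous_on_compose2[OF c]) (use that norm_cpt[OF r] in auto)
  then have "continuous_on (A \<times> cbox (0::real) 1) (%q. k (L (fst q)) (cpt r (snd q)))" by simp
  then show ?thesis unfolding case_prod_beta by (intro continuous_intros)
 qed
 have "continuous_on S (%z. cI r (k z))"
  unfolding cI_integral
  using integral_continuous_on_param[OF c1[of S "%x. x"]] by simp
 moreover have "(%t. cI r (k (z + t *s v))) field_differentiable (at 0)" if z: "z \<in> S" "v \<in> V" for z v
 proof -
  have zV: "z \<in> V" using z V ropen_subset by blast
  have "open {t. z + t *s v \<in> S}" by (rule line_open) (use V z zV in auto)
  moreover have "0 \<in> {t. z + t *s v \<in> S}" using z by simp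
  ultimately obtain e where e: "e > 0" "ball 0 e \<subseteq> {t. z + t *s v \<in> S}"
   by (meson open_contains_ball)
  show ?thesis unfolding cI_integral
  proof (rule param_integral_differentiable[OF e(1)])
   show "continuous_on (ball 0 e \<times> cbox 0 1) (%(x, t). k (z + x *s v) (cpt r t) * cpt r t)"
    by (rule c1[of "ball 0 e" "%x. z + x *s v"]) (use e in \<open>auto intro!: continuous_intros\<close>)
   show "(%x. k (z + x *s v) (cpt r t) * cpt r t) holomorphic_on ball 0 e" for t
    by (intro holomorphic_intros holomorphic_on_subset[OF hol_line[OF V h[OF cpt_sphere[OF r]]]])
     (use zV z e in auto)
  qed
 qed
 ultimately show ?thesis unfolding hol_def by blast
qed

no_notation fps_nth (infixl "$" 75)

text \<open>Tube lemma, by sequences: zeros over points tending to \<open>b\<close> would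
  accumulate, by compactness of \<open>K\<close>, at a zero over \<open>b\<close>.\<close>

lemma tube_nonzero:
 fixes F :: "'a::metric_space => 'b::metric_space => complex"
 assumes c: "continuous_on (S \<times> K) (%(x, t). F x t)" and K: "compact K" and b: "b \<in> S"
  and nz: "!!t. t \<in> K ==> F b t ~= 0"
 shows "\<exists>e>0. \<forall>x\<in>S. \<forall>t\<in>K. dist x b < e --> F x t ~= 0"
proof (rule ccontr)
 assume "~ ?thesis"
 then have neg: "\<exists>x t. x \<in> S & dist x b < e & t \<in> K & F x t = 0" if e0: "e > 0" for e
  using e0 by blast
 have "\<forall>n. \<exists>x t. x \<in> S & dist x b < inverse (of_nat (Suc n)) & t \<in> K & F x t = 0"
  using neg[of "inverse (real (Suc n))" for n] by simp
 then obtain x t where xt: "!!n. x n \<in> S" "!!n. dist (x n) b < inverse (of_nat (Suc n))"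
   "!!n. t n \<in> K" "!!n. F (x n) (t n) = 0"
  by metis
 obtain l r where l: "l \<in> K" "strict_mono r" "(t \<circ> r) \<longlonglongrightarrow> l"
  using K xt(3) unfolding compact_def by metis
 have "(%n. dist (x n) b) \<longlonglongrightarrow> 0"
  by (rule tendsto_sandwich[OF _ _ tendsto_const LIMSEQ_inverse_real_of_nat])
   (use xt(2) less_imp_le in \<open>auto simp: eventually_sequentially\<close>)
 then have "x \<longlonglongrightarrow> b" using tendsto_dist_iff by blast
 then have "(x \<circ> r) \<longlonglongrightarrow> b" using l(2) LIMSEQ_subseq_LIMSEQ by blast
 then have "(%n. (x (r n), t (r n))) \<longlonglongrightarrow> (b, l)"
  using tendsto_Pair l(3) unfolding o_def by blast
 then have "(%n. (%(x, t). F x t) (x (r n), t (r n))) \<longlonglongrightarrow> (%(x, t). F x t) (b, l)"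
  by (rule continuous_on_tendsto_compose[OF c]) (use b l xt in auto)
 then have "(%n. 0) \<longlonglongrightarrow> F b l" using xt by simp
 then show False using nz[OF l(1)] LIMSEQ_const_iff by metis
qed

lemma isolated_zero_radius:
 assumes "f holomorphic_on S" "open S" "connected S" "0 \<in> S" "\<beta> \<in> S" "f \<beta> ~= 0"
 obtains r where "r > 0" "ball 0 r \<subseteq> S" "!!z. z \<in> ball 0 r - {0} ==> f z ~= 0"
proof (cases "f 0 = 0")
 case True
 show ?thesis
  by (rule isolated_zeros[OF assms(1-4) True assms(5,6)]) (use that in auto)
next
 case False
 have "continuous_on S f" using assms holomorphic_on_imp_continuous_on by blast
 then have "open (S \<inter> f -` (- {0}))"
  using continuous_open_preimage assms(2) by blast
 moreover have "0 \<in> S \<inter> f -` (- {0})" using False assms by simp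
 ultimately obtain r where r: "r > 0" "ball 0 r \<subseteq> S \<inter> f -` (- {0})" by (meson openE)
 show ?thesis by (rule that[OF r(1)]) (use r(2) in auto)
qed

text \<open>The constant \<open>C\<close>, valid only near 0, serves to extend
  \<open>f t / t ^ N\<close> holomorphically. The maximum principle on radius \<open>e / 2\<close>
  then yields a constant in terms of \<open>B\<close> and \<open>e\<close> alone, independent of
  \<open>C\<close> and \<open>d\<close>.\<close>

lemma schwarz_order:
 assumes f: "f holomorphic_on ball 0 e" and e: "e > 0" and B: "!!t. t \<in> ball 0 e ==> cmod (f t) <= B"
  and d: "d > 0" "!!t. cmod t < d ==> cmod (f t) <= C * cmod t ^ N" and t: "cmod t < e / 2"
 shows "cmod (f t) <= B * (2 / e) ^ N * cmod t ^ N"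
proof -
 have "\<exists>g. g holomorphic_on ball 0 e & (\<forall>z\<in>ball 0 e - {0}. g z = f z / z ^ N)"
 proof (subst holomorphic_on_extend_bounded)
  show "(%z. f z / z ^ N) holomorphic_on ball 0 e - {0}"
   by (intro holomorphic_intros holomorphic_on_subset[OF f]) auto
  show "\<exists>B. \<forall>\<^sub>F z in at 0. cmod (f z / z ^ N) <= B"
  proof (intro exI)
   show "\<forall>\<^sub>F z in at 0. cmod (f z / z ^ N) <= C"
    unfolding eventually_at using d
    by (intro exI[of _ d]) (auto simp: norm_divide norm_power pos_divide_le_eq)
  qed
 qed (use e in auto)
 then obtain g where g: "g holomorphic_on ball 0 e" "!!z. z \<in> ball 0 e - {0} ==> g z = f z / z ^ N"
  by blast
 have B0: "0 <= B" using B[of 0] e norm_ge_zero order_trans by (metis centre_in_ball)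
 have gb: "cmod (g z) <= B * (2 / e) ^ N" if "cmod z < e / 2" for z
 proof (rule maximum_modulus_frontier[of g "ball 0 (e / 2)"])
  show "g holomorphic_on interior (ball 0 (e / 2))"
   by (rule holomorphic_on_subset[OF g(1)]) (use e in auto)
  show "continuous_on (closure (ball 0 (e / 2))) g"
   by (rule holomorphic_on_imp_continuous_on[OF holomorphic_on_subset[OF g(1)]]) (use e in auto)
  show "cmod (g z) <= B * (2 / e) ^ N" if "z \<in> frontier (ball 0 (e / 2))" for z
  proof -
   have z: "cmod z = e / 2" using that e by simp
   then have "z \<in> ball 0 e - {0}" using e by auto
   then have "cmod (g z) = cmod (f z) / (e / 2) ^ N"
    unfolding z[symmetric] using g(2)[of z] by (simp add: norm_divide norm_power)
   also have "\<dots> = cmod (f z) * (2 / e) ^ N" by (simp add: power_divide)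
   finally have "cmod (g z) = cmod (f z) * (2 / e) ^ N" .
   then show ?thesis using B[of z] \<open>z \<in> ball 0 e - {0}\<close> e by (simp add: mult_right_mono)
  qed
 qed (use that in auto)
 show ?thesis
 proof (cases "t = 0")
  case True
  then show ?thesis
  proof (cases N)
   case 0
   then show ?thesis using B[of t] True e by simp
  next
   case (Suc m)
   then show ?thesis using d(2)[of 0] d(1) True by simp
  qed
 next
  case False
  then have "t \<in> ball 0 e - {0}" using t e by auto
  then have "f t = g t * t ^ N" using g(2)[of t] by simp
  then show ?thesis
   using gb[OF t] by (simp add: norm_mult norm_power mult_right_mono)
 qed
qed

section \<open>Order of vanishing as an estimate along a subspace\<close>

definition vo :: "(complex^'n) set => nat => (complex^'n => complex) => complex^'n => bool" where
 "vo V N h b \<longleftrightarrow> (\<exists>C e. e > 0 & (\<forall>z\<in>V. dist z b < e --> cmod (h z) <= C * norm (z - b) ^ N))"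

lemma voE:
 assumes "vo V N h b"
 obtains C e where "e > 0" "C >= 0" "!!z. z \<in> V ==> dist z b < e ==> cmod (h z) <= C * norm (z - b) ^ N"
proof -
 obtain C e where *: "e > 0" "!!z. z \<in> V ==> dist z b < e ==> cmod (h z) <= C * norm (z - b) ^ N"
  using assms unfolding vo_def by blast
 have "C * norm (z - b) ^ N <= max C 0 * norm (z - b) ^ N" for z
  by (intro mult_right_mono) auto
 then show ?thesis using that[of e "max C 0"] * order_trans by (metis max.cobounded2)
qed

lemma vo_add:
 assumes "vo V N h b" "vo V N k b"
 shows "vo V N (%z. h z + k z) b"
proof -
 obtain C e where 1: "e > 0" "!!z. z \<in> V ==> dist z b < e ==> cmod (h z) <= C * norm (z - b) ^ N"
  using voE[OF assms(1)] by metis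
 obtain D d where 2: "d > 0" "!!z. z \<in> V ==> dist z b < d ==> cmod (k z) <= D * norm (z - b) ^ N"
  using voE[OF assms(2)] by metis
 have "cmod (h z + k z) <= (C + D) * norm (z - b) ^ N" if "z \<in> V" "dist z b < min e d" for z
  using 1(2)[of z] 2(2)[of z] that norm_triangle_ineq[of "h z" "k z"] by (simp add: distrib_right)
 then show ?thesis unfolding vo_def using 1 2 by (metis min_less_iff_conj)
qed

lemma vo_zero [simp]: "vo V N (%z. 0) b"
 unfolding vo_def by (rule exI[of _ 0], rule exI[of _ 1]) auto

lemma vo_sum: "(!!i. i \<in> A ==> vo V N (h i) b) ==> vo V N (%z. \<Sum>i\<in>A. h i z) b"
 by (induction A rule: infinite_finite_induct) (auto intro: vo_add)

lemma vo_mult_bounded: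
 assumes "vo V N h b" "e > 0" "!!z. z \<in> V ==> dist z b < e ==> cmod (k z) <= B"
 shows "vo V N (%z. k z * h z) b"
proof -
 obtain C d where 1: "d > 0" "C >= 0" "!!z. z \<in> V ==> dist z b < d ==> cmod (h z) <= C * norm (z - b) ^ N"
  using voE[OF assms(1)] by metis
 have "cmod (k z * h z) <= (max B 0 * C) * norm (z - b) ^ N" if "z \<in> V" "dist z b < min e d" for z
 proof -
  have "cmod (k z) * cmod (h z) <= max B 0 * (C * norm (z - b) ^ N)"
   using 1(3)[of z] assms(3)[of z] that 1(2) by (intro mult_mono) auto
  then show ?thesis by (simp add: norm_mult mult.assoc)
 qed
 then show ?thesis unfolding vo_def using 1 assms by (metis min_less_iff_conj)
qed

lemma ropen_bounded_near:
 assumes "continuous_on S k" "ropen V S" "b \<in> S"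
 obtains e where "e > 0" "!!z. z \<in> V ==> dist z b < e ==> z \<in> S & norm (k z) <= norm (k b) + 1"
proof -
 obtain e where e: "e > 0" "!!y. y \<in> V ==> dist y b < e ==> y \<in> S"
  using ropen_ballE[OF assms(2,3)] by metis
 obtain d where d: "d > 0" "!!y. y \<in> S ==> dist y b < d ==> dist (k y) (k b) < 1"
  using assms(1,3) unfolding continuous_on_iff by (metis zero_less_one)
 have "z \<in> S & norm (k z) <= norm (k b) + 1" if "z \<in> V" "dist z b < min e d" for z
 proof -
  have "z \<in> S" using e that by simp
  then show ?thesis
   using d(2)[of z] that norm_triangle_sub[of "k z" "k b"] by (simp add: dist_norm)
 qed
 then show ?thesis using that[of "min e d"] e d by simp
qed

lemma vo_mult:
 assumes "vo V N h b" "continuous_on S k" "ropen V S" "b \<in> S"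
 shows "vo V N (%z. k z * h z) b"
proof -
 obtain e where "e > 0" "!!z. z \<in> V ==> dist z b < e ==> z \<in> S & cmod (k z) <= cmod (k b) + 1"
  by (rule ropen_bounded_near[OF assms(2-4)]) blast
 then show ?thesis using vo_mult_bounded[OF assms(1)] by metis
qed

lemma vo_cong:
 assumes "vo V N h b" "ropen V S" "b \<in> S" "!!z. z \<in> S ==> h z = k z"
 shows "vo V N k b"
proof -
 obtain e where e: "e > 0" "!!y. y \<in> V ==> dist y b < e ==> y \<in> S"
  using ropen_ballE[OF assms(2,3)] by metis
 obtain C d where "d > 0" "!!z. z \<in> V ==> dist z b < d ==> cmod (h z) <= C * norm (z - b) ^ N"
  using voE[OF assms(1)] by metis
 then have "!!z. z \<in> V ==> dist z b < min e d ==> cmod (k z) <= C * norm (z - b) ^ N"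
  using e assms(4) by (metis min_less_iff_conj)
 then show ?thesis unfolding vo_def using e \<open>d > 0\<close> by (metis min_less_iff_conj)
qed

lemma vo_zero_at: "vo V N h b ==> N >= 1 ==> b \<in> V ==> h b = 0"
 by (erule voE) (metis dist_self diff_self mult_zero_right norm_le_zero_iff norm_zero power_0_left not_one_le_zero)

text \<open>By the Schwarz lemma the constants on the individual lines are automatically uniform.\<close>

lemma vo_from_lines:
 fixes V :: "(complex^'n) set"
 assumes V: "vec.subspace V" "ropen V S" "hol V S h" "b \<in> S"
  and e0: "e0 > 0"
  and dense: "!!y e. y \<in> V ==> norm y < e0 ==> e > 0 ==> \<exists>v\<in>V. dist v y < e & P v"
  and lines: "!!v. v \<in> V ==> P v ==> \<exists>C d. d > 0 & (\<forall>t. cmod t < d --> cmod (h (b + t *s v)) <= C * cmod t ^ N)"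
 shows "vo V N h b"
proof -
 have bV: "b \<in> V" using V ropen_subset by blast
 obtain e1 where e1: "e1 > 0" "!!z. z \<in> V ==> dist z b < e1 ==> z \<in> S & cmod (h z) <= cmod (h b) + 1"
  by (rule ropen_bounded_near[OF hol_continuous[OF V(3)] V(2,4)]) blast
 define B where "B = cmod (h b) + 1"
 define e where "e = min e0 e1"
 have e: "e > 0" using e0 e1 by (simp add: e_def)
 define K where "K = B * (2 / e) ^ N"
 have K0: "K >= 0" by (simp add: K_def B_def e less_imp_le)
 have good: "cmod (h (b + v)) <= K * norm v ^ N" if v: "v \<in> V" "norm v < e / 2" "P v" for v
 proof (cases "v = 0")
  case True
  show ?thesis
  proof (cases N)
   case 0
   then show ?thesis using True by (simp add: K_def B_def)
  next
   case (Suc m)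
   obtain C d where "d > 0" "\<forall>t. cmod t < d --> cmod (h (b + t *s v)) <= C * cmod t ^ N"
    using lines[OF v(1,3)] by blast
   then have "cmod (h (b + 0 *s v)) <= C * cmod 0 ^ N" by (metis norm_zero)
   then show ?thesis using True Suc by simp
  qed
 next
  case False
  define g where "g = (%t. h (b + t *s v))"
  have T: "b + t *s v \<in> S & cmod (g t) <= B" if "t \<in> ball 0 (e / norm v)" for t
  proof -
   have "norm (t *s v) < e" using that False by (simp add: pos_less_divide_eq)
   moreover have "b + t *s v \<in> V" using bV v V by (simp add: vec.subspace_add vec.subspace_scale)
   ultimately show ?thesis using e1(2)[of "b + t *s v"] by (simp add: dist_norm e_def g_def B_def)
  qed
  have gh: "g holomorphic_on ball 0 (e / norm v)"
   unfolding g_def by (rule holomorphic_on_subset[OF hol_line[OF V(1-3) bV v(1)]]) (use T in auto)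
  obtain C d where d: "d > 0" "!!t. cmod t < d ==> cmod (g t) <= C * cmod t ^ N"
   using lines[OF v(1,3)] unfolding g_def by blast
  have "cmod (g 1) <= B * (2 / (e / norm v)) ^ N * cmod 1 ^ N"
   by (rule schwarz_order[OF gh _ _ d]) (use T e False v(2) in \<open>auto simp: field_simps\<close>)
  also have "\<dots> = K * norm v ^ N" by (simp add: K_def power_mult_distrib power_divide)
  finally show ?thesis by (simp add: g_def)
 qed
 have "cmod (h z) <= K * norm (z - b) ^ N" if z: "z \<in> V" "dist z b < e / 2" for z
 proof (rule ccontr)
  assume neg: "~ ?thesis"
  have zS: "z \<in> S" using z e1 e by (auto simp: e_def)
  \<comment> \<open>Directions satisfying \<open>P\<close> are only dense. A violation at
    \<open>z\<close> is an open condition by continuity of \<open>q\<close>, so it would persist at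
    a point \<open>b + v\<close> with \<open>P v\<close>.\<close>
  define q where "q = (%z. cmod (h z) - K * norm (z - b) ^ N)"
  have "continuous_on S q" unfolding q_def
   by (intro continuous_intros hol_continuous[OF V(3)])
  then obtain d where d: "d > 0" "!!y. y \<in> S ==> dist y z < d ==> dist (q y) (q z) < q z"
   using neg zS unfolding continuous_on_iff q_def by (metis diff_gt_0_iff_gt not_le)
  define d' where "d' = min d (e / 2 - dist z b)"
  have "d' > 0" using d z by (simp add: d'_def)
  moreover have "z - b \<in> V" using z bV V by (simp add: vec.subspace_diff)
  moreover have "norm (z - b) < e0" using z e by (simp add: dist_norm e_def)
  ultimately obtain v where v: "v \<in> V" "dist v (z - b) < d'" "P v" using dense by blast
  have 1: "dist (b + v) z < d'" using v by (simp add: dist_norm algebra_simps)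
  then have 2: "norm v < e / 2"
   using norm_triangle_ineq[of "b + v - z" "z - b"] by (simp add: d'_def dist_norm)
  have "b + v \<in> V" using v bV V by (simp add: vec.subspace_add)
  then have "b + v \<in> S" using 2 e e1(2)[of "b + v"] by (simp add: dist_norm e_def)
  then have "q (b + v) > 0" using d(2)[of "b + v"] 1 by (simp add: d'_def dist_real_def)
  then show False using good[OF v(1) 2 v(3)] by (simp add: q_def)
 qed
 then show ?thesis unfolding vo_def using e by (metis half_gt_zero)
qed

text \<open>Near \<open>z0\<close> the directional derivative is a Cauchy integral over a fixed
  circle in direction \<open>v\<close>, so \<open>hol_cI\<close> applies; the radius
  \<open>R / 2\<close> keeps all these circles in \<open>S\<close>.\<close>

lemma hol_dirderiv:
 fixes V :: "(complex^'n) set"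
 assumes V: "vec.subspace V" "ropen V S" "hol V S f" "v \<in> V"
 shows "hol V S (%z. deriv (%t. f (z + t *s v)) 0)"
proof (rule hol_local[OF V(1)])
 show "S \<subseteq> V" using V ropen_subset by blast
 fix z0 assume z0: "z0 \<in> S"
 then have z0V: "z0 \<in> V" using \<open>S \<subseteq> V\<close> by blast
 obtain e where e: "e > 0" "!!y. y \<in> V ==> dist y z0 < e ==> y \<in> S"
  using ropen_ballE[OF V(2) z0] by metis
 define B where "B = V \<inter> ball z0 (e / 2)"
 have B: "ropen V B" unfolding B_def by (simp add: openin_open_Int)
 define R where "R = e / 2 / (norm v + 1)"
 have R: "R > 0" using e by (simp add: R_def add_nonneg_pos)
 have in_S: "z + s *s v \<in> S" if "z \<in> B" "cmod s < R" for z s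
 proof -
  have "0 < norm v + 1" by (simp add: add_nonneg_pos)
  then have "cmod s * (norm v + 1) < e / 2"
   using that(2) by (metis R_def pos_less_divide_eq)
  moreover have "cmod s * norm v <= cmod s * (norm v + 1)" by (intro mult_left_mono) auto
  ultimately have "norm (s *s v) < e / 2" by simp
  moreover have "dist z z0 < e / 2" using that by (simp add: B_def dist_commute)
  ultimately have "dist (z + s *s v) z0 < e"
   using norm_triangle_ineq[of "z - z0" "s *s v"] by (simp add: dist_norm algebra_simps)
  moreover have "z + s *s v \<in> V" using that V by (simp add: B_def vec.subspace_add vec.subspace_scale)
  ultimately show ?thesis using e by simp
 qed
 define r where "r = R / 2"
 have r: "0 < r" "r < R" using R by (auto simp: r_def)
 define g where "g = (%z. cI r (%s. f (z + s *s v) / (s - 0)^2))"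
 have "hol V B g"
  unfolding g_def
 proof (rule hol_cI[OF V(1) B r(1)])
  have "continuous_on (B \<times> sphere 0 r) (%q. f (fst q + snd q *s v))"
   by (rule continuous_on_compose2[OF hol_continuous[OF V(3)]])
    (use in_S r in \<open>auto intro!: continuous_intros\<close>)
  then have "continuous_on (B \<times> sphere 0 r) (%q. f (fst q + snd q *s v) / (snd q - 0)^2)"
   by (intro continuous_intros) (use r in auto)
  then show "continuous_on (B \<times> sphere 0 r) (%(z, s). f (z + s *s v) / (s - 0)^2)"
   by (simp add: case_prod_beta)
  show "hol V B (%z. f (z + s *s v) / (s - 0)^2)" if "s \<in> sphere 0 r" for s
  proof (intro hol_divide hol_const hol_compose_lin[OF V(3), where M = "%v. v"])
   show "z + s *s v \<in> S" if "z \<in> B" for z using in_S[OF that, of s] \<open>s \<in> sphere 0 r\<close> r by simp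
  qed (use that r in \<open>auto intro!: continuous_intros\<close>)
 qed
 moreover have "g z = deriv (%t. f (z + t *s v)) 0" if "z \<in> B" for z
  unfolding g_def
 proof (rule cI_Cauchy2[OF r(1) _ r(2)])
  have "z \<in> V" using that by (simp add: B_def)
  show "(%s. f (z + s *s v)) holomorphic_on ball 0 R"
   by (rule holomorphic_on_subset[OF hol_line[OF V(1-3) \<open>z \<in> V\<close> V(4)]]) (use in_S that in auto)
 qed (use r in auto)
 moreover have "z0 \<in> B" using e z0V by (simp add: B_def)
 ultimately show "\<exists>B g. ropen V B & z0 \<in> B & hol V B g & (\<forall>y\<in>B. g y = deriv (%t. f (y + t *s v)) 0)"
  using B by blast
qed

section \<open>Comparison with Frechet differentiability and extension over zero sets\<close>

lemma vec_subspace_UNIV [simp]: "vec.subspace (UNIV :: (complex^'n) set)"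
 by (rule vec.subspace_UNIV)

text \<open>The partial derivatives are continuous by \<open>hol_dirderiv\<close>, so the classical
  argument works: change one coordinate at a time and compare with the derivative at
  \<open>z0\<close> by the mean value estimate.\<close>

lemma hol_imp_holo_on:
 fixes f :: "complex^'n => complex"
 assumes S: "open S" and f: "hol UNIV S f"
 shows "holo_on f S"
 unfolding holo_on_def
proof
 fix z0 assume z0: "z0 \<in> S"
 define e :: "'n => complex^'n" where "e = (%i. axis i 1)"
 define G where "G = (%i z. deriv (%t. f (z + t *s e i)) 0)"
 define L where "L = (%y::complex^'n. \<Sum>i\<in>UNIV. y $ i * G i z0)"
 have Sr: "ropen UNIV S" using S by simp
 have Gc: "continuous_on S (G i)" for i
  unfolding G_def by (rule hol_continuous[OF hol_dirderiv[OF _ Sr f]]) auto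
 \<comment> \<open>The vector with the coordinates of \<open>y\<close> in \<open>A\<close> and zeros
   elsewhere; the induction below lets \<open>A\<close> grow to all indices.\<close>
 define pt where "pt = (%A (y::complex^'n). \<Sum>i\<in>A. (y $ i) *s e i)"
 have pt_norm: "norm (pt A y + s *s e j) <= norm y" if "j \<notin> A" "cmod s <= cmod (y $ j)"
  for A and y :: "complex^'n" and s :: complex and j
 proof (rule norm_le_componentwise_cart)
  fix k
  have "(pt A y + s *s e j) $ k = (if k \<in> A then y $ k else 0) + (if k = j then s else 0)"
   by (simp add: pt_def e_def axis_def if_distrib[of "%x. _ * x"] cong: if_cong)
  then show "norm ((pt A y + s *s e j) $ k) <= norm (y $ k)" using that by auto
 qed
 have main: "\<forall>E>0. \<exists>d>0. \<forall>y. norm y < d -->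
   cmod (f (z0 + pt A y) - f z0 - (\<Sum>i\<in>A. y $ i * G i z0)) <= E * norm y" if "finite A" for A
  using that
 proof (induction A rule: finite_induct)
  case empty
  then show ?case by (auto simp: pt_def intro: exI[of _ 1])
 next
  case (insert j A)
  show ?case
  proof (intro allI impI)
   fix E :: real assume E: "E > 0"
   obtain d1 where d1: "d1 > 0" "!!y. norm y < d1 ==>
     cmod (f (z0 + pt A y) - f z0 - (\<Sum>i\<in>A. y $ i * G i z0)) <= E / 2 * norm y"
    using insert.IH E by (metis half_gt_zero)
   obtain d2 where d2: "d2 > 0" "!!y. y \<in> S ==> dist y z0 < d2 ==> dist (G j y) (G j z0) < E / 2"
    using Gc[of j] z0 E unfolding continuous_on_iff by (metis half_gt_zero)
   obtain d3 where d3: "d3 > 0" "ball z0 d3 \<subseteq> S" using S z0 open_contains_ball by blast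
   define d where "d = min d1 (min d2 d3)"
   have "cmod (f (z0 + pt (insert j A) y) - f z0 - (\<Sum>i\<in>insert j A. y $ i * G i z0)) <= E * norm y"
    if y: "norm y < d" for y
   proof -
    define p where "p = z0 + pt A y"
    define T where "T = cball (0::complex) (cmod (y $ j))"
    have near: "p + s *s e j \<in> S & dist (p + s *s e j) z0 < d2" if "s \<in> T" for s
    proof -
     have "norm (pt A y + s *s e j) < d"
      using pt_norm[OF insert(2), of s y] that y by (simp add: T_def)
     then have "dist (p + s *s e j) z0 < d" by (simp add: p_def dist_norm algebra_simps)
     then show ?thesis using d3 by (auto simp: d_def dist_commute subset_iff)
    qed
    have der: "((%s. f (p + s *s e j) - s * G j z0) has_field_derivative (G j (p + s *s e j) - G j z0)) (at s within T)"
     if "s \<in> T" for s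
    proof -
     have "(%t. f ((p + s *s e j) + t *s e j)) field_differentiable at 0"
      using f near[OF that] unfolding hol_def by blast
     then have "((%t. f ((p + s *s e j) + t *s e j)) has_field_derivative G j (p + s *s e j)) (at (s - s))"
      unfolding G_def by (simp add: field_differentiable_derivI)
     then have "((%t. f ((p + s *s e j) + (t - s) *s e j)) has_field_derivative G j (p + s *s e j) * 1) (at s)"
      by (rule DERIV_chain2) (auto intro!: derivative_eq_intros)
     then have "((%t. f (p + t *s e j)) has_field_derivative G j (p + s *s e j)) (at s)"
      by (simp add: algebra_simps vector_sub_rdistrib)
     moreover have "((%s. s * G j z0) has_field_derivative G j z0) (at s)"
      by (auto intro!: derivative_eq_intros)
     ultimately show ?thesis
      by (intro has_field_derivative_at_within[OF DERIV_diff])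
    qed
    have "cmod ((f (p + (y $ j) *s e j) - y $ j * G j z0) - (f (p + 0 *s e j) - 0 * G j z0))
      <= E / 2 * cmod (y $ j - 0)"
    proof (rule field_differentiable_bound[OF _ der])
     show "convex T" by (simp add: T_def)
     show "cmod (G j (p + s *s e j) - G j z0) <= E / 2" if "s \<in> T" for s
      using near[OF that] d2(2)[of "p + s *s e j"] by (simp add: dist_norm less_imp_le)
    qed (auto simp: T_def)
    also have "\<dots> <= E / 2 * norm y" using E by (simp add: Finite_Cartesian_Product.norm_nth_le)
    finally have 2: "cmod (f (p + (y $ j) *s e j) - y $ j * G j z0 - f p) <= E / 2 * norm y" by simp
    have 1: "cmod (f p - f z0 - (\<Sum>i\<in>A. y $ i * G i z0)) <= E / 2 * norm y"
     using d1(2)[of y] y by (simp add: p_def d_def)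
    have "f (z0 + pt (insert j A) y) - f z0 - (\<Sum>i\<in>insert j A. y $ i * G i z0)
     = (f (p + (y $ j) *s e j) - y $ j * G j z0 - f p) + (f p - f z0 - (\<Sum>i\<in>A. y $ i * G i z0))"
     using insert(1,2) by (simp add: p_def pt_def algebra_simps)
    then show ?thesis using norm_triangle_mono[OF 2 1] by (simp only:)
   qed
   moreover have "d > 0" using d1 d2 d3 by (simp add: d_def)
   ultimately show "\<exists>d>0. \<forall>y. norm y < d --> cmod (f (z0 + pt (insert j A) y) - f z0 -
     (\<Sum>i\<in>insert j A. y $ i * G i z0)) <= E * norm y" by blast
  qed
 qed
 have ptU: "pt UNIV y = y" for y
  by (simp add: pt_def e_def vec_eq_iff axis_def if_distrib[of "%x. _ * x"] cong: if_cong)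
 have "linear L"
  unfolding L_def
  by (rule linearI) (simp_all add: algebra_simps sum.distrib scaleR_sum_right)
 moreover have "\<forall>E>0. \<exists>d>0. \<forall>y. norm (y - z0) < d --> norm (f y - f z0 - L (y - z0)) <= E * norm (y - z0)"
 proof (intro allI impI)
  fix E :: real assume "E > 0"
  then obtain d where d: "d > 0" "!!y. norm y < d ==> cmod (f (z0 + y) - f z0 - L y) <= E * norm y"
   using main[OF finite, of UNIV] unfolding ptU L_def by blast
  then have "norm (f y - f z0 - L (y - z0)) <= E * norm (y - z0)" if "norm (y - z0) < d" for y
   using d(2)[OF that] by simp
  then show "\<exists>d>0. \<forall>y. norm (y - z0) < d --> norm (f y - f z0 - L (y - z0)) <= E * norm (y - z0)"
   using d(1) by blast
 qed
 ultimately have "(f has_derivative L) (at z0)"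
  unfolding has_derivative_at_alt by (simp add: linear_conv_bounded_linear)
 moreover have "Vector_Spaces.linear (*s) (*) L"
  unfolding L_def
  by unfold_locales (simp_all add: algebra_simps sum.distrib sum_distrib_left)
 ultimately show "\<exists>L. Vector_Spaces.linear (*s) (*) L & (f has_derivative L) (at z0 within S)"
  using has_derivative_at_withinI by blast
qed

lemma holo_on_imp_hol:
 fixes V :: "(complex^'n) set"
 assumes V: "vec.subspace V" "ropen V S" and f: "holo_on f S"
 shows "hol V S f"
 unfolding hol_def
proof (intro conjI ballI)
 show "continuous_on S f"
  using f has_derivative_continuous unfolding holo_on_def continuous_on_eq_continuous_within by blast
 fix z v assume z: "z \<in> S" and v: "v \<in> V"
 obtain L where L: "Vector_Spaces.linear (*s) (*) L" "(f has_derivative L) (at z within S)"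
  using f z unfolding holo_on_def by blast
 define T where "T = {t. z + t *s v \<in> S}"
 have T: "open T" "0 \<in> T"
  unfolding T_def using line_open[OF V _ v] z V ropen_subset by auto
 have "((%t. z + t *s v) has_derivative (%t. t *s v)) (at 0 within T)"
 proof -
  have "bounded_linear (%t::complex. t *s v)"
   by (intro linear_conv_bounded_linear[THEN iffD1] linearI)
    (simp_all add: vec_eq_iff scaleR_conv_of_real[where 'a=complex] algebra_simps)
  then show ?thesis
   by (auto intro!: derivative_eq_intros bounded_linear_imp_has_derivative)
 qed
 then have "((%t. f (z + t *s v)) has_derivative (%t. L (t *s v))) (at 0 within T)"
  using has_derivative_in_compose[of "%t. z + t *s v" "%t. t *s v" 0 T f L] L(2)
   has_derivative_subset[of f L z S "(%t. z + t *s v) ` T"] by (auto simp: T_def)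
 moreover have "(%t. L (t *s v)) = (*) (L v)"
  using L(1) by (auto simp: Vector_Spaces.linear_iff mult.commute)
 ultimately have "((%t. f (z + t *s v)) has_field_derivative L v) (at 0 within T)"
  by (simp add: has_field_derivative_def)
 then show "(%t. f (z + t *s v)) field_differentiable at 0"
  using T at_within_open[of 0 T] unfolding field_differentiable_def by auto
qed

lemma ropen_line_radius:
 fixes V :: "(complex^'n) set"
 assumes "vec.subspace V" "ropen V S" "z \<in> S" "v \<in> V"
 obtains e where "e > 0" "ball 0 e \<subseteq> {t. z + t *s v \<in> S}"
proof -
 have "z \<in> V" using assms ropen_subset by blast
 then have "open {t. z + t *s v \<in> S}" using line_open assms by blast
 moreover have "0 \<in> {t. z + t *s v \<in> S}" using assms by simp
 ultimately show ?thesis using that by (meson open_contains_ball)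
qed

text \<open>Riemann's extension theorem. In a direction in which \<delta> does not vanish
  identically, a small circle around \<open>b\<close> avoids the zeros of \<delta>, and so do its
  translates to nearby \<open>x\<close>. The Cauchy integral of \<open>h\<close> over these circles
  is holomorphic in \<open>x\<close> and returns \<open>h x\<close>, because the finitely many
  singularities inside are removable. The local extensions agree on the dense set where \<delta> is
  nonzero, hence everywhere.\<close>

lemma hol_riemann_extension:
 fixes V :: "(complex^'n) set"
 assumes V: "vec.subspace V" "ropen V D" "convex D"
  and d: "hol V D \<delta>" "z1 \<in> D" "\<delta> z1 ~= 0"
  and h: "hol V (D \<inter> {z. \<delta> z ~= 0}) h"
  and bd: "!!b. b \<in> D ==> \<exists>e>0. \<exists>B. \<forall>z\<in>D. dist z b < e & \<delta> z ~= 0 --> cmod (h z) <= B"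
 obtains H where "hol V D H" "!!z. z \<in> D ==> \<delta> z ~= 0 ==> H z = h z"
proof -
 have DV: "D \<subseteq> V" using V ropen_subset by blast
 have G_open: "ropen V (D \<inter> {z. \<delta> z ~= 0})"
 proof -
  have "ropen D (D \<inter> \<delta> -` (- {0}))"
   by (rule continuous_openin_preimage_gen) (use d hol_continuous in auto)
  then have "ropen V (D \<inter> \<delta> -` (- {0}))" using V(2) openin_trans by blast
  moreover have "D \<inter> \<delta> -` (- {0}) = D \<inter> {z. \<delta> z ~= 0}" by auto
  ultimately show ?thesis by simp
 qed
 have loc: "\<exists>B H. ropen V B & b \<in> B & B \<subseteq> D & hol V B H & (\<forall>z\<in>B. \<delta> z ~= 0 --> H z = h z)" if b: "b \<in> D" for b
 proof -
  have bV: "b \<in> V" using b DV by blast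
  \<comment> \<open>Pointing to \<open>z1\<close> makes \<delta> nonzero somewhere on the line, so
    \<open>b\<close> is an isolated zero at worst.\<close>
  define v0 where "v0 = z1 - b"
  have v0: "v0 \<in> V" using bV d DV V by (auto simp: v0_def vec.subspace_diff)
  define T0 where "T0 = {t. b + t *s v0 \<in> D}"
  have T0: "open T0" "connected T0" "0 \<in> T0" "1 \<in> T0"
   unfolding T0_def using line_open[OF V(1,2) bV v0] convex_connected[OF convex_line[OF V(3), of b v0]] b d
   by (auto simp: v0_def)
  obtain r0 where r0: "r0 > 0" "ball 0 r0 \<subseteq> T0" "!!t. t \<in> ball 0 r0 - {0} ==> \<delta> (b + t *s v0) ~= 0"
   using isolated_zero_radius[OF hol_line[OF V(1,2) d(1) bV v0, folded T0_def] T0, of thesis] d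
   by (auto simp: v0_def)
  obtain e1 B1 where e1: "e1 > 0" "!!z. z \<in> D ==> dist z b < e1 ==> \<delta> z ~= 0 ==> cmod (h z) <= B1"
   using bd[OF b] by blast
  obtain e2 where e2: "e2 > 0" "!!y. y \<in> V ==> dist y b < e2 ==> y \<in> D"
   using ropen_ballE[OF V(2) b] by metis
  define e where "e = min e1 e2"
  have e: "e > 0" using e1 e2 by (simp add: e_def)
  \<comment> \<open>Rescaling makes the unit disc in direction \<open>v\<close> stay inside
    \<open>D\<close> and inside the region where \<open>h\<close> is bounded, and the circle of
    radius 1/2 avoid the zeros of \<delta> on the line through \<open>b\<close>.\<close>
  define s0 where "s0 = min (r0 / 2) (e / 2 / (norm v0 + 1))"
  have nv: "norm v0 + 1 > 0" by (simp add: add_nonneg_pos)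
  have s0: "s0 > 0" "s0 < r0" using r0 e nv by (auto simp: s0_def)
  define v where "v = of_real s0 *s v0"
  have v: "v \<in> V" using v0 V by (simp add: v_def vec.subspace_scale)
  have nv2: "norm v < e / 2"
  proof -
   have "norm v = s0 * norm v0" using s0 by (simp add: v_def)
   also have "\<dots> < s0 * (norm v0 + 1)" using s0 by simp
   also have "\<dots> <= e / 2"
    unfolding pos_le_divide_eq[OF nv, symmetric] by (simp only: s0_def min.cobounded2)
   finally show ?thesis .
  qed
  define r where "r = (1/2 :: real)"
  have r: "r > 0" "r < 1" by (auto simp: r_def)
  have near: "x + t *s v \<in> D & dist (x + t *s v) b < e1" if "x \<in> V" "dist x b < e / 2" "cmod t < 1" for x t
  proof -
   have "cmod t * norm v <= 1 * norm v" by (rule mult_right_mono) (use that in auto)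
   then have "norm (t *s v) < e / 2" using nv2 by simp
   then have "dist (x + t *s v) b < e"
    using norm_triangle_ineq[of "x - b" "t *s v"] that by (simp add: dist_norm algebra_simps)
   moreover have "x + t *s v \<in> V" using that v V by (simp add: vec.subspace_add vec.subspace_scale)
   ultimately show ?thesis using e2 by (simp add: e_def)
  qed
  define B0 where "B0 = V \<inter> ball b (e / 2)"
  have B0: "ropen V B0" unfolding B0_def by (simp add: openin_open_Int)
  have B0n: "x + t *s v \<in> D & dist (x + t *s v) b < e1" if "x \<in> B0" "cmod t < 1" for x t
   using near[of x t] that by (auto simp: B0_def dist_commute)
  have "b \<in> B0" using bV e by (simp add: B0_def)
  have "continuous_on (B0 \<times> sphere 0 r) (%q. \<delta> (fst q + snd q *s v))"
   by (rule continuous_on_compose2[OF hol_continuous[OF d(1)]])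
    (use B0n r in \<open>auto intro!: continuous_intros\<close>)
  then have "\<exists>e>0. \<forall>x\<in>B0. \<forall>t\<in>sphere 0 r. dist x b < e --> \<delta> (x + t *s v) ~= 0"
  proof (intro tube_nonzero)
   show "\<delta> (b + t *s v) ~= 0" if "t \<in> sphere 0 r" for t
   proof -
    have "cmod (t * of_real s0) < r0" "t * of_real s0 ~= 0"
    proof -
     have ct: "cmod t = 1/2" using that by (simp add: r_def)
     show "cmod (t * of_real s0) < r0" unfolding norm_mult ct using s0 by simp
     show "t * of_real s0 ~= 0" using ct s0 by auto
    qed
    then show ?thesis using r0(3)[of "t * of_real s0"] by (simp add: v_def)
   qed
  qed (use \<open>b \<in> B0\<close> in \<open>auto simp: case_prod_beta\<close>)
  then obtain e3 where e3: "e3 > 0" "!!x t. x \<in> B0 ==> t \<in> sphere 0 r ==> dist x b < e3 ==> \<delta> (x + t *s v) ~= 0"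
   by blast
  define B where "B = B0 \<inter> ball b e3"
  have B: "ropen V B" unfolding B_def using B0 by (simp add: openin_Int_open)
  have bB: "b \<in> B" using \<open>b \<in> B0\<close> e3 by (simp add: B_def)
  have BG: "x + t *s v \<in> D \<inter> {z. \<delta> z ~= 0}" if "x \<in> B" "t \<in> sphere 0 r" for x t
   using that B0n[of x t] e3(2)[of x t] r by (auto simp: B_def dist_commute)
  define H where "H = (%x. cI r (%t. h (x + t *s v) / (t - 0)))"
  have "hol V B H"
   unfolding H_def
  proof (rule hol_cI[OF V(1) B r(1)])
   have "continuous_on (B \<times> sphere 0 r) (%q. h (fst q + snd q *s v))"
    by (rule continuous_on_compose2[OF hol_continuous[OF h]])
     (use BG in \<open>auto intro!: continuous_intros\<close>)
   then show "continuous_on (B \<times> sphere 0 r) (%(x, t). h (x + t *s v) / (t - 0))"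
    unfolding case_prod_beta by (intro continuous_intros) (use r in auto)
   show "hol V B (%x. h (x + t *s v) / (t - 0))" if "t \<in> sphere 0 r" for t
    by (intro hol_divide hol_const hol_compose_lin[OF h, where M = "%v. v"])
     (use BG that r in \<open>auto intro!: continuous_intros simp: algebra_simps\<close>)
  qed
  moreover have "H x = h x" if x: "x \<in> B" "\<delta> x ~= 0" for x
  proof -
   have xB0: "x \<in> B0" "x \<in> V" using x by (auto simp: B_def B0_def)
   define g where "g = (%t. h (x + t *s v))"
   define dx where "dx = (%t. \<delta> (x + t *s v))"
   have dxh: "dx holomorphic_on ball 0 1"
    unfolding dx_def by (rule holomorphic_on_subset[OF hol_line[OF V(1,2) d(1) xB0(2) v]]) (use B0n[OF xB0(1)] in auto)
   \<comment> \<open>Any radius between 1/2 and 1: a compact disc containing the circle in its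
     interior holds only finitely many zeros.\<close>
   define q where "q = (3/4 :: real)"
   define Z where "Z = {t \<in> cball 0 q. dx t = 0}"
   have "finite Z"
    unfolding Z_def
   proof (cases "dx constant_on ball 0 1")
    case True
    then have "dx t = dx 0" if "t \<in> ball 0 1" for t
     using that unfolding constant_on_def by (metis centre_in_ball zero_less_one)
    then have "{t \<in> cball 0 q. dx t = 0} = {}" using x by (auto simp: dx_def q_def)
    then show "finite {t \<in> cball 0 q. dx t = 0}" by (simp only: finite.emptyI)
   next
    case False
    show "finite {t \<in> cball 0 q. dx t = 0}"
     by (rule holomorphic_compact_finite_zeros[OF dxh _ _ _ _ False]) (auto simp: q_def)
   qed
   define Z' where "Z' = Z \<inter> ball 0 q"
   have Z': "finite Z'" "Z' \<subseteq> interior (ball 0 q)" using \<open>finite Z\<close> by (auto simp: Z'_def)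
   have mem: "x + t *s v \<in> D \<inter> {z. \<delta> z ~= 0}" if "t \<in> ball 0 q - Z'" for t
    using that B0n[OF xB0(1), of t] by (auto simp: Z'_def Z_def dx_def q_def)
   have gh: "g holomorphic_on ball 0 q - Z'"
    unfolding g_def by (rule holomorphic_on_subset[OF hol_line[OF V(1) G_open h xB0(2) v]]) (use mem in auto)
   have "g \<in> O[at t](%_. 1)" if "t \<in> Z'" for t
   proof (rule bigoI)
    have "open (ball 0 q - (Z' - {t}))" using Z' by (intro open_Diff finite_imp_closed) auto
    moreover have "t \<in> ball 0 q - (Z' - {t})" using that by (auto simp: Z'_def)
    ultimately have "\<forall>\<^sub>F s in at t. s \<in> ball 0 q - (Z' - {t})"
     by (rule eventually_at_in_open')
    moreover have "\<forall>\<^sub>F s in at t. s ~= t" by (simp add: eventually_at_filter)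
    ultimately have "\<forall>\<^sub>F s in at t. s \<in> ball 0 q - Z'"
     by eventually_elim auto
    then show "\<forall>\<^sub>F s in at t. norm (g s) <= B1 * norm (1::complex)"
    proof eventually_elim
     case (elim s)
     then show ?case using mem[OF elim] e1(2)[of "x + s *s v"] B0n[OF xB0(1), of s]
      by (auto simp: g_def q_def)
    qed
   qed
   then obtain k where k: "k holomorphic_on ball 0 q" "!!t. t \<in> ball 0 q - Z' ==> k t = g t"
    using removable_singularities[OF Z' gh] by blast
   have "H x = cI r (%t. k t / (t - 0))"
    unfolding H_def
   proof (rule cI_cong[OF r(1)])
    fix s :: complex assume s: "s \<in> sphere 0 r"
    then have "s \<in> ball 0 q - Z'"
     using BG[OF x(1) s] by (auto simp: q_def r_def Z'_def Z_def dx_def)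
    then show "h (x + s *s v) / (s - 0) = k s / (s - 0)" using k by (simp add: g_def)
   qed
   also have "\<dots> = k 0" by (rule cI_Cauchy[OF r(1) k(1)]) (auto simp: r_def q_def)
   also have "\<dots> = h x" using k(2)[of 0] x by (simp add: g_def Z'_def Z_def dx_def q_def)
   finally show ?thesis .
  qed
  moreover have "B \<subseteq> D" using B0n[of _ 0] by (auto simp: B_def)
  ultimately show ?thesis using B bB by blast
 qed
 obtain Bf Hf where BH: "!!b. b \<in> D ==> ropen V (Bf b) & b \<in> Bf b & Bf b \<subseteq> D & hol V (Bf b) (Hf b) &
   (\<forall>z\<in>Bf b. \<delta> z ~= 0 --> Hf b z = h z)"
  using loc by metis
 \<comment> \<open>Each point uses its own local extension; \<open>agree\<close> shows that the
   choice is immaterial.\<close>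
 define H where "H = (%z. Hf z z)"
 have agree: "Hf z z = Hf b z" if b: "b \<in> D" "z \<in> Bf b" for b z
 proof (rule ccontr)
  assume ne: "Hf z z ~= Hf b z"
  have z: "z \<in> D" using BH b by blast
  define C where "C = Bf z \<inter> Bf b"
  have C: "ropen V C" "z \<in> C" "C \<subseteq> D" using BH[OF z] BH[OF b(1)] b by (auto simp: C_def openin_Int)
  define q where "q = (%y. Hf z y - Hf b y)"
  have "hol V C q" unfolding q_def
   by (intro hol_diff) (use BH[OF z] BH[OF b(1)] in \<open>auto simp: C_def intro: hol_subset\<close>)
  then have "continuous_on C q" using hol_continuous by blast
  then obtain e where e: "e > 0" "!!y. y \<in> C ==> dist y z < e ==> dist (q y) (q z) < cmod (q z)"
   using C(2) ne unfolding continuous_on_iff q_def by (metis right_minus_eq zero_less_norm_iff)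
  obtain e' where e': "e' > 0" "!!y. y \<in> V ==> dist y z < e' ==> y \<in> C"
   using ropen_ballE[OF C(1,2)] by metis
  obtain y where y: "y \<in> D" "dist y z < min e e'" "\<delta> y ~= 0"
   using hol_nonzero_dense[OF V d z, of "min e e'"] e e' by auto
  have "y \<in> C" using y e' DV by auto
  then have "q y = 0" using y BH[OF z] BH[OF b(1)] by (auto simp: C_def q_def)
  then show False using e(2)[OF \<open>y \<in> C\<close>] y by simp
 qed
 show ?thesis
 proof
  show "hol V D H"
  proof (rule hol_local[OF V(1) _ DV])
   fix b assume b: "b \<in> D"
   show "\<exists>B g. ropen V B & b \<in> B & hol V B g & (\<forall>y\<in>B. g y = H y)"
    using BH[OF b] agree[OF b] unfolding H_def by metis
  qed
  show "H z = h z" if "z \<in> D" "\<delta> z ~= 0" for z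
   using BH[OF that(1)] that by (simp add: H_def)
 qed
qed

section \<open>Weierstrass preparation and division\<close>

text \<open>A function on the cylinder over \<open>S\<close> in direction \<open>v\<close>, with no
  zeros over the annulus from \<open>r\<close> to \<open>R\<close>: this keeps the number of zeros
  in a slice constant. The direction is any vector with \<open>v $ i = 1\<close> rather than a
  coordinate axis, so that it can be chosen freely within fixed coordinates.\<close>

locale weierstrass =
 fixes V :: "(complex^'n) set" and v :: "complex^'n" and i :: 'n
  and S :: "(complex^'n) set" and r R :: real and f :: "complex^'n => complex"
 assumes sub: "vec.subspace V" and vi: "v $ i = 1" and Vi: "!!x. x \<in> V ==> x $ i = 0"
  and So: "ropen V S" and Sc: "convex S" and Sne: "S ~= {}" and r0: "0 < r" and rR: "r < R"
  and fh: "hol {x + w *s v | x w. x \<in> V} {x + w *s v | x w. x \<in> S & cmod w < R} f"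
  and fnz: "!!x w. x \<in> S ==> r <= cmod w ==> cmod w < R ==> f (x + w *s v) ~= 0"
begin

definition W where "W = {x + w *s v | x w. x \<in> V}"
definition cyl where "cyl = {x + w *s v | x w. x \<in> S & cmod w < R}"

lemma SV: "S \<subseteq> V"
 using So ropen_subset by blast

lemma Wsub: "vec.subspace W"
 unfolding vec.subspace_def
proof (intro conjI ballI allI)
 show "0 \<in> W" unfolding W_def using vec.subspace_0[OF sub] by (metis (mono_tags, lifting) add_0 mem_Collect_eq vector_smult_lzero)
 fix a assume "a \<in> W"
 then obtain x w where a: "a = x + w *s v" "x \<in> V" by (auto simp: W_def)
 show "c *s a \<in> W" for c
 proof -
  have "c *s a = c *s x + (c * w) *s v" by (simp add: a vector_add_ldistrib)
  then show ?thesis unfolding W_def using vec.subspace_scale[OF sub a(2)] by blast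
 qed
 fix b assume "b \<in> W"
 then obtain y u where b: "b = y + u *s v" "y \<in> V" by (auto simp: W_def)
 have "a + b = (x + y) + (w + u) *s v" by (simp add: a b vector_sadd_rdistrib)
 then show "a + b \<in> W" unfolding W_def using vec.subspace_add[OF sub a(2) b(2)] by blast
qed

lemma VW: "V \<subseteq> W"
proof
 fix x assume "x \<in> V"
 then have "x = x + 0 *s v & x \<in> V" by simp
 then show "x \<in> W" unfolding W_def by blast
qed

lemma vW: "v \<in> W"
proof -
 have "v = 0 + 1 *s v & 0 \<in> V" using vec.subspace_0[OF sub] by simp
 then show ?thesis unfolding W_def by blast
qed

lemma coord: "x \<in> V ==> (x + w *s v) $ i = w"
 by (simp add: Vi vi)

definition pr where "pr z = z - (z $ i) *s v"

lemma pr_pt: "x \<in> V ==> pr (x + w *s v) = x"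
 by (simp add: pr_def Vi vi)

lemma pr_split: "pr z + (z $ i) *s v = z"
 by (simp add: pr_def)

lemma pr_W: "z \<in> W ==> pr z \<in> V"
 unfolding W_def using pr_pt by auto

lemma pr_line: "pr (z + t *s u) = pr z + t *s pr u"
 by (simp add: pr_def vec_eq_iff algebra_simps)

lemma continuous_pr [continuous_intros]: "continuous_on A g ==> continuous_on A (%x. pr (g x))"
 unfolding pr_def by (intro continuous_intros)

lemma cyl_iff: "z \<in> cyl \<longleftrightarrow> z \<in> W & pr z \<in> S & cmod (z $ i) < R"
proof
 assume "z \<in> cyl"
 then show "z \<in> W & pr z \<in> S & cmod (z $ i) < R"
  unfolding cyl_def W_def using SV coord pr_pt by (auto simp: subset_iff)
next
 assume "z \<in> W & pr z \<in> S & cmod (z $ i) < R"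
 then show "z \<in> cyl" unfolding cyl_def using pr_split[of z] by (metis (mono_tags, lifting) mem_Collect_eq)
qed

lemma cylI: "x \<in> S ==> cmod w < R ==> x + w *s v \<in> cyl"
 unfolding cyl_def by blast

lemma ropen_tube:
 assumes B: "ropen V B" and T: "open T"
 shows "ropen W {z \<in> W. pr z \<in> B & z $ i \<in> T}"
proof -
 obtain O1 where O: "open O1" "B = V \<inter> O1" using B unfolding openin_open by auto
 have "{z \<in> W. pr z \<in> B & z $ i \<in> T} = W \<inter> ((%z. pr z) -` O1 \<inter> (%z. z $ i) -` T)"
  using O pr_W by auto
 moreover have "open ((%z. pr z) -` O1 \<inter> (%z. z $ i) -` T)"
  by (intro open_Int open_vimage O T continuous_intros)
 ultimately show ?thesis by (simp add: openin_open_Int)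
qed

lemma cyl_tube: "cyl = {z \<in> W. pr z \<in> S & z $ i \<in> ball 0 R}"
 using cyl_iff by auto

lemma cyl_open: "ropen W cyl"
 unfolding cyl_tube by (rule ropen_tube[OF So open_ball])

lemma cyl_convex: "convex cyl"
proof -
 have "{z. pr z \<in> S} = pr -` S" by auto
 have "linear pr"
  by (rule linearI) (auto simp: pr_def vec_eq_iff algebra_simps scaleR_conv_of_real[where 'a=complex])
 then have "convex (pr -` S)" using Sc convex_linear_vimage by blast
 moreover have "linear (%z::complex^'n. z $ i)" by (rule linearI) auto
 then have "convex ((%z. z $ i) -` ball (0::complex) R)" using convex_linear_vimage convex_ball by blast
 moreover have "convex W" using Wsub csubspace_subspace subspace_imp_convex by blast
 moreover have "cyl = W \<inter> (pr -` S \<inter> (%z. z $ i) -` ball 0 R)" unfolding cyl_tube by auto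
 ultimately show ?thesis by (simp add: convex_Int)
qed

lemma S_cyl: "S \<subseteq> cyl"
 using cylI[of _ 0] r0 rR by auto

lemma fhc: "hol W cyl f"
 using fh unfolding W_def cyl_def .

lemma slice_holo:
 assumes "hol W cyl g" "x \<in> S"
 shows "(%s. g (x + s *s v)) holomorphic_on ball 0 R"
 by (rule holomorphic_on_subset[OF hol_line[OF Wsub cyl_open assms(1) _ vW]])
  (use assms SV VW cylI in auto)

lemma hol_shift:
 assumes "hol W cyl g" "cmod s < R"
 shows "hol V S (%x. g (x + s *s v))"
 by (rule hol_compose_lin[OF assms(1), where M = "%v. v"])
  (use VW cylI assms(2) in \<open>auto intro!: continuous_intros simp: algebra_simps\<close>)

lemma hol_pr:
 assumes "hol V S g"
 shows "hol W cyl (%z. g (pr z))"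
 by (rule hol_compose_lin[OF assms, where M = pr])
  (use pr_W cyl_iff in \<open>auto intro!: continuous_intros simp: pr_line\<close>)

lemma continuous_slice:
 assumes "hol W cyl g" "T \<subseteq> ball 0 R"
 shows "continuous_on (S \<times> T) (%q. g (fst q + snd q *s v))"
 by (rule continuous_on_compose2[OF hol_continuous[OF assms(1)]])
  (use cylI assms(2) in \<open>auto intro!: continuous_intros\<close>)

definition fd where "fd z = deriv (%t. f (z + t *s v)) 0"

lemma fd_hol: "hol W cyl fd"
 unfolding fd_def by (rule hol_dirderiv[OF Wsub cyl_open fhc vW])

lemma fd_deriv:
 assumes "x \<in> S" "cmod s < R"
 shows "deriv (%t. f (x + t *s v)) s = fd (x + s *s v)"
proof -
 have "((%t. f (x + t *s v)) has_field_derivative deriv (%t. f (x + t *s v)) s) (at s)"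
  by (rule holomorphic_derivI[OF slice_holo[OF fhc assms(1)] open_ball]) (use assms in auto)
 then have "((%t. f (x + t *s v)) has_field_derivative deriv (%t. f (x + t *s v)) s) (at (s + 0))" by simp
 then have "((%t. f (x + (s + t) *s v)) has_field_derivative deriv (%t. f (x + t *s v)) s * 1) (at 0)"
  by (rule DERIV_chain2) (auto intro!: derivative_eq_intros)
 then show ?thesis
  unfolding fd_def by (intro DERIV_imp_deriv[symmetric]) (simp add: vector_sadd_rdistrib add.assoc)
qed

definition zr where "zr x = {w. cmod w < R & f (x + w *s v) = 0}"
definition mu where "mu x w = nat (zorder (%s. f (x + s *s v)) w)"

lemma zr_less: "x \<in> S ==> w \<in> zr x ==> cmod w < r"
 unfolding zr_def using fnz by force

lemma f_pt_nonzero: "x \<in> S ==> \<exists>w\<in>ball 0 R. f (x + w *s v) ~= 0"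
 using fnz[of x "of_real r"] r0 rR by (intro bexI[of _ "of_real r"]) auto

lemma zr_finite:
 assumes "x \<in> S"
 shows "finite (zr x)"
proof (cases "(%s. f (x + s *s v)) constant_on ball 0 R")
 case True
 then have "f (x + w *s v) ~= 0" if "cmod w < R" for w
  using f_pt_nonzero[OF assms] that unfolding constant_on_def by (metis mem_ball_0)
 then have "zr x = {}" unfolding zr_def by auto
 then show ?thesis by simp
next
 case False
 have "finite {w \<in> cball 0 r. f (x + w *s v) = 0}"
  by (rule holomorphic_compact_finite_zeros[OF slice_holo[OF fhc assms] _ _ _ _ False]) (use rR in auto)
 moreover have "zr x \<subseteq> {w \<in> cball 0 r. f (x + w *s v) = 0}"
  using zr_less[OF assms] zr_def by force
 ultimately show ?thesis using finite_subset by blast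
qed

lemma mu_factor:
 assumes "x \<in> S" "w \<in> zr x"
 obtains k e where "mu x w > 0" "e > 0" "cball w e \<subseteq> ball 0 R" "k holomorphic_on cball w e"
  "!!s. s \<in> cball w e ==> f (x + s *s v) = k s * (s - w) ^ mu x w & k s ~= 0"
proof -
 have w: "w \<in> ball 0 R" "f (x + w *s v) = 0" using assms by (auto simp: zr_def)
 show ?thesis
  using zorder_exist_zero[OF slice_holo[OF fhc assms(1)] open_ball _ w(1) f_pt_nonzero[OF assms(1)]] w(2) that
  unfolding mu_def by (auto simp: subset_iff)
qed

lemma mu_pos: "x \<in> S ==> w \<in> zr x ==> mu x w > 0"
 by (erule (1) mu_factor)

text \<open>The argument principle with weight \<open>g\<close>; all zeros lie inside the circle of
  radius \<open>r\<close>, with winding number 1.\<close>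

lemma zero_sum:
 assumes x: "x \<in> S" and g: "g holomorphic_on ball 0 R"
 shows "(\<Sum>w\<in>zr x. of_nat (mu x w) * g w) = cI r (%s. fd (x + s *s v) * g s / f (x + s *s v))"
proof -
 define F where "F = (%s. f (x + s *s v))"
 \<comment> \<open>\<open>argument_principle\<close> sums over zeros and poles; the pole set is
   empty here.\<close>
 have pz: "{w \<in> ball 0 R. F w = 0 | w \<in> {}} = zr x"
  using zr_less[OF x] rR unfolding zr_def F_def by force
 have "contour_integral (circlepath 0 r) (%s. deriv F s * g s / F s) =
   2 * pi * \<i> * (\<Sum>p\<in>{w \<in> ball 0 R. F w = 0 | w \<in> {}}. winding_number (circlepath 0 r) p * g p * zorder F p)"
 proof (rule argument_principle)
  show "F holomorphic_on ball 0 R - {}"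
   using slice_holo[OF fhc x] unfolding F_def by simp
  show "path_image (circlepath 0 r) \<subseteq> ball 0 R - {w \<in> ball 0 R. F w = 0 | w \<in> {}}"
   unfolding pz using zr_less[OF x] r0 rR by force
  show "\<forall>z. z \<notin> ball 0 R --> winding_number (circlepath 0 r) z = 0"
   using rR r0 by (intro allI impI winding_number_zero_outside[where s = "cball 0 r"]) auto
  show "finite {w \<in> ball 0 R. F w = 0 | w \<in> {}}" unfolding pz by (rule zr_finite[OF x])
 qed (use g in auto)
 also have "\<dots> = 2 * pi * \<i> * (\<Sum>w\<in>zr x. of_nat (mu x w) * g w)"
 proof -
  have "winding_number (circlepath 0 r) w * g w * zorder F w = of_nat (mu x w) * g w" if w: "w \<in> zr x" for w
  proof -
   have "winding_number (circlepath 0 r) w = 1"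
    by (rule winding_number_circlepath) (use zr_less[OF x w] in simp)
   moreover have "zorder F w > 0" using mu_pos[OF x w] unfolding mu_def F_def by simp
   ultimately show ?thesis unfolding mu_def F_def by simp
  qed
  then have "(\<Sum>w\<in>zr x. winding_number (circlepath 0 r) w * g w * zorder F w) = (\<Sum>w\<in>zr x. of_nat (mu x w) * g w)"
   by (rule sum.cong[OF refl])
  then show ?thesis unfolding pz by (simp only:)
 qed
 finally have "(\<Sum>w\<in>zr x. of_nat (mu x w) * g w) = cI r (%s. deriv F s * g s / F s)"
  by (simp add: cI_def)
 also have "\<dots> = cI r (%s. fd (x + s *s v) * g s / f (x + s *s v))"
  by (rule cI_cong[OF r0]) (use fd_deriv[OF x] rR in \<open>auto simp: F_def\<close>)
 finally show ?thesis .
qed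

lemma sphere_r: "s \<in> sphere 0 r ==> cmod s < R" "sphere 0 r \<subseteq> ball (0::complex) R"
 using rR by auto

lemma f_sphere: "x \<in> S ==> s \<in> sphere 0 r ==> f (x + s *s v) ~= 0"
 using fnz rR by auto

text \<open>Individual zeros need not depend holomorphically on \<open>x\<close>, but by
  \<open>zero_sum\<close> the weighted sums over them are integrals over a fixed circle, which
  do.\<close>

lemma power_sum_hol:
 assumes g: "hol W cyl g"
 shows "hol V S (%x. \<Sum>w\<in>zr x. of_nat (mu x w) * g (x + w *s v))"
proof (rule hol_cong[OF sub So])
 show "hol V S (%x. cI r (%s. fd (x + s *s v) * g (x + s *s v) / f (x + s *s v)))"
 proof (rule hol_cI[OF sub So r0])
  show "continuous_on (S \<times> sphere 0 r) (%(x, s). fd (x + s *s v) * g (x + s *s v) / f (x + s *s v))"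
   unfolding case_prod_beta
   by (intro continuous_intros continuous_slice[OF _ sphere_r(2)] fd_hol fhc g) (use f_sphere in auto)
  show "hol V S (%x. fd (x + s *s v) * g (x + s *s v) / f (x + s *s v))" if s: "s \<in> sphere 0 r" for s
   by (intro hol_divide hol_mult hol_shift[OF _ sphere_r(1)[OF s]] fd_hol fhc g f_sphere s)
 qed
 show "cI r (%s. fd (x + s *s v) * g (x + s *s v) / f (x + s *s v)) = (\<Sum>w\<in>zr x. of_nat (mu x w) * g (x + w *s v))"
  if "x \<in> S" for x
  by (rule zero_sum[OF that slice_holo[OF g that], symmetric])
qed

definition K where "K = (\<Sum>w\<in>zr (SOME x. x \<in> S). mu (SOME x. x \<in> S) w)"

text \<open>The case \<open>g = 1\<close> of \<open>power_sum_hol\<close>: a continuous function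
  with integer values on a connected set.\<close>

lemma mu_sum:
 assumes "x \<in> S"
 shows "(\<Sum>w\<in>zr x. mu x w) = K"
proof -
 define n where "n = (%x. complex_of_nat (\<Sum>w\<in>zr x. mu x w))"
 have "hol V S (%x. \<Sum>w\<in>zr x. of_nat (mu x w) * (%_. 1) (x + w *s v))"
  by (rule power_sum_hol) simp
 then have "continuous_on S n" unfolding n_def by (simp add: hol_continuous)
 then have "n constant_on S"
 proof (rule continuous_discrete_range_constant[OF convex_connected[OF Sc]])
  fix x assume "x \<in> S"
  have "1 <= norm (n y - n x)" if "n y ~= n x" for y
  proof -
   define a where "a = (\<Sum>w\<in>zr y. mu y w)"
   define b where "b = (\<Sum>w\<in>zr x. mu x w)"
   have ab: "n y = of_nat a" "n x = of_nat b" by (simp_all only: n_def a_def b_def)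
   then have "n y - n x = of_int (int a - int b)" by simp
   moreover have "int a - int b ~= 0" using that ab by auto
   ultimately show ?thesis by (metis norm_of_int of_int_1_le_iff of_int_abs zero_less_abs_iff int_one_le_iff_zero_less)
  qed
  then show "\<exists>e>0. \<forall>y. y \<in> S & n y ~= n x --> e <= norm (n y - n x)" by (intro exI[of _ 1]) auto
 qed
 moreover have "(SOME x. x \<in> S) \<in> S" using Sne by (simp add: some_in_eq)
 ultimately have "n x = n (SOME x. x \<in> S)" using assms unfolding constant_on_def by metis
 then show ?thesis unfolding n_def K_def by (simp only: of_nat_eq_iff)
qed

text \<open>The characteristic polynomial of multiplication by \<open>g\<close> on the functions
  modulo \<open>f\<close> over \<open>x\<close>: its roots are the values of \<open>g\<close> at the
  zeros, with multiplicity. The coordinate along \<open>v\<close> as \<open>g\<close> gives the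
  Weierstrass polynomial \<open>pw\<close>, and the constant term for \<open>- g\<close> gives the
  norm \<open>nrm\<close>.\<close>

definition charp :: "(complex^'n => complex) => complex^'n => complex poly" where
 "charp g x = (\<Prod>w\<in>zr x. [:- g (x + w *s v), 1:] ^ mu x w)"

lemma poly_charp: "poly (charp g x) t = (\<Prod>w\<in>zr x. (t - g (x + w *s v)) ^ mu x w)"
 unfolding charp_def by (simp add: poly_prod poly_power algebra_simps)

lemma charp_degree:
 assumes "x \<in> S"
 shows "degree (charp g x) = K" "coeff (charp g x) K = 1"
proof -
 have "degree (charp g x) = (\<Sum>w\<in>zr x. degree ([:- g (x + w *s v), 1:] ^ mu x w))"
  unfolding charp_def by (rule degree_prod_sum_eq) auto
 also have "\<dots> = (\<Sum>w\<in>zr x. mu x w)" by (simp add: degree_power_eq)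
 finally show "degree (charp g x) = K" using mu_sum[OF assms] by simp
 moreover have "lead_coeff (charp g x) = 1"
  unfolding charp_def by (simp add: lead_coeff_prod lead_coeff_power)
 ultimately show "coeff (charp g x) K = 1" by simp
qed

end

lemma synthetic_coeff:
 fixes p q :: "'a::comm_ring_1 poly"
 assumes p: "p = [:- a, 1:] * q" and K: "degree q < K" and m: "m <= K"
 shows "a * coeff q m = (\<Sum>j\<in>{m<..K}. coeff p j * a ^ (j - m))"
 using m
proof (induction m rule: inc_induct)
 case base
 then show ?case using K by (simp add: coeff_eq_0)
next
 case (step m)
 have "coeff q m = coeff p (Suc m) + a * coeff q (Suc m)" by (simp add: p)
 moreover have "{m<..K} = insert (Suc m) {Suc m<..K}" using step by auto
 moreover have "(\<Sum>j\<in>{Suc m<..K}. coeff p j * a ^ (j - m)) = a * (\<Sum>j\<in>{Suc m<..K}. coeff p j * a ^ (j - Suc m))"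
  unfolding sum_distrib_left by (intro sum.cong refl) (auto simp: Suc_diff_Suc[symmetric] mult_ac)
 ultimately show ?case using step.IH by (simp add: algebra_simps)
qed

text \<open>The derivative of \<open>p\<close> is the sum of \<open>n w\<close> times p / (X -
  \<open>a w\<close>); \<open>synthetic_coeff\<close> expands each quotient, and coefficients are
  compared. Every coefficient is thereby determined by the higher ones and the power sums, since the
  factor \<open>m - K\<close> is nonzero for \<open>m < K\<close>.\<close>

lemma newton_identity:
 fixes a :: "'b => complex" and n :: "'b => nat" and A :: "'b set"
 defines "p \<equiv> \<Prod>w\<in>A. [:- a w, 1:] ^ n w"
 assumes A: "finite A" "!!w. w \<in> A ==> n w > 0" and K: "(\<Sum>w\<in>A. n w) = K" and m: "m <= K"
 shows "(of_nat m - of_nat K) * coeff p m = (\<Sum>j\<in>{m<..K}. coeff p j * (\<Sum>w\<in>A. of_nat (n w) * a w ^ (j - m)))"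
proof -
 define q where "q w = (\<Prod>w\<in>A - {w}. [:- a w, 1:] ^ n w) * [:- a w, 1:] ^ (n w - 1)" for w
 have pq: "p = [:- a w, 1:] * q w" if "w \<in> A" for w
 proof -
  have "[:- a w, 1:] ^ n w = [:- a w, 1:] ^ (n w - 1) * [:- a w, 1:]" using power_minus_mult[OF A(2)[OF that]] by metis
  then show ?thesis unfolding p_def q_def prod.remove[OF A(1) that] by (simp only: mult_ac)
 qed
 have dp: "degree p = K"
  unfolding p_def K[symmetric] by (subst degree_prod_sum_eq) (auto simp: degree_power_eq)
 have dq: "degree (q w) < K" if "w \<in> A" for w
 proof -
  have "q w ~= 0" unfolding q_def using A(1) by auto
  then have "degree p = 1 + degree (q w)" unfolding pq[OF that] by (subst degree_mult_eq) auto
  then show ?thesis using dp by simp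
 qed
 have "pderiv p = (\<Sum>w\<in>A. smult (of_nat (n w)) (q w))"
  unfolding p_def q_def pderiv_prod pderiv_power by (simp add: pderiv_pCons)
 then have "of_nat m * coeff p m = (\<Sum>w\<in>A. of_nat (n w) * coeff (pCons 0 (q w)) m)"
  by (cases m) (simp_all add: coeff_pderiv[symmetric] coeff_sum del: of_nat_Suc)
 also have "\<dots> = (\<Sum>w\<in>A. of_nat (n w) * (coeff p m + a w * coeff (q w) m))"
 proof (intro sum.cong refl)
  fix w assume "w \<in> A"
  then have "coeff p m = coeff (pCons 0 (q w)) m - a w * coeff (q w) m" by (subst pq) auto
  then show "of_nat (n w) * coeff (pCons 0 (q w)) m = of_nat (n w) * (coeff p m + a w * coeff (q w) m)" by simp
 qed
 also have "\<dots> = of_nat K * coeff p m + (\<Sum>w\<in>A. of_nat (n w) * (\<Sum>j\<in>{m<..K}. coeff p j * a w ^ (j - m)))"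
  unfolding K[symmetric] of_nat_sum sum_distrib_right distrib_left sum.distrib
  using synthetic_coeff[OF pq dq m] by (simp add: K)
 also have "(\<Sum>w\<in>A. of_nat (n w) * (\<Sum>j\<in>{m<..K}. coeff p j * a w ^ (j - m)))
   = (\<Sum>j\<in>{m<..K}. coeff p j * (\<Sum>w\<in>A. of_nat (n w) * a w ^ (j - m)))"
  unfolding sum_distrib_left by (subst sum.swap) (simp add: mult_ac)
 finally show ?thesis by (simp add: algebra_simps)
qed

context weierstrass
begin

text \<open>Descending induction on \<open>l\<close> from the leading coefficient 1, by
  \<open>newton_identity\<close> and the holomorphic power sums.\<close>

lemma charp_coeff_hol:
 assumes g: "hol W cyl g"
 shows "hol V S (%x. coeff (charp g x) l)"
proof -
 have top: "hol V S (%x. coeff (charp g x) l)" if "K <= l" for l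
  by (rule hol_cong[OF sub So, of "%_. if l = K then 1 else 0"])
   (use that charp_degree in \<open>auto simp: coeff_eq_0\<close>)
 have "hol V S (%x. coeff (charp g x) l)" if "l <= K" for l
  using that
 proof (induction "K - l" arbitrary: l rule: less_induct)
  case less
  show ?case
  proof (cases "l = K")
   case False
   define p where "p j x = (\<Sum>w\<in>zr x. of_nat (mu x w) * g (x + w *s v) ^ j)" for j x
   have "hol V S (p j)" for j
    unfolding p_def by (intro power_sum_hol hol_power g)
   then have "hol V S (%x. (\<Sum>j\<in>{l<..K}. coeff (charp g x) j * p (j - l) x) / (of_nat l - of_nat K))"
    by (intro hol_divide hol_sum hol_mult hol_const less.hyps) (use False less.prems in auto)
   then show ?thesis
   proof (rule hol_cong[OF sub So])
    fix x assume x: "x \<in> S"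
    have "(of_nat l - of_nat K) * coeff (charp g x) l = (\<Sum>j\<in>{l<..K}. coeff (charp g x) j * p (j - l) x)"
     unfolding charp_def p_def
     by (rule newton_identity[OF zr_finite[OF x] mu_pos[OF x] mu_sum[OF x] less.prems])
    then show "(\<Sum>j\<in>{l<..K}. coeff (charp g x) j * p (j - l) x) / (of_nat l - of_nat K) = coeff (charp g x) l"
     using False by (simp add: field_simps)
   qed
  qed (simp add: top)
 qed
 then show ?thesis using top by (cases "l <= K") auto
qed

text \<open>The norm, or resultant with \<open>f\<close>: it eliminates the coordinate along
  \<open>v\<close>, since it vanishes at \<open>x\<close> exactly if \<open>f\<close> and
  \<open>g\<close> have a common zero over \<open>x\<close>.\<close>

definition nrm :: "(complex^'n => complex) => complex^'n => complex" where
 "nrm g x = (\<Prod>w\<in>zr x. g (x + w *s v) ^ mu x w)"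

lemma nrm_hol:
 assumes "hol W cyl g"
 shows "hol V S (nrm g)"
proof (rule hol_cong[OF sub So])
 have "hol W cyl (%z. - g z)" using assms by (rule hol_uminus)
 then show "hol V S (%x. coeff (charp (%z. - g z) x) 0)" by (rule charp_coeff_hol)
 show "coeff (charp (%z. - g z) x) 0 = nrm g x" for x
  unfolding poly_0_coeff_0[symmetric] poly_charp nrm_def by simp
qed

lemma nrm_zero_iff:
 assumes "x \<in> S"
 shows "nrm g x = 0 \<longleftrightarrow> (\<exists>w. cmod w < R & f (x + w *s v) = 0 & g (x + w *s v) = 0)"
proof -
 have "nrm g x = 0 \<longleftrightarrow> (\<exists>w\<in>zr x. g (x + w *s v) = 0)"
  unfolding nrm_def using zr_finite[OF assms] mu_pos[OF assms] by auto
 then show ?thesis by (auto simp: zr_def)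
qed

definition pw where "pw x = charp (%z. z $ i) x"
definition P where "P z = poly (pw (pr z)) (z $ i)"

lemma pw_coeff_hol: "hol V S (%x. coeff (pw x) l)"
 unfolding pw_def by (rule charp_coeff_hol) (rule hol_component)

lemma poly_pw: "x \<in> S ==> poly (pw x) t = (\<Prod>w\<in>zr x. (t - w) ^ mu x w)"
 unfolding pw_def poly_charp using SV by (intro prod.cong) (auto simp: Vi vi subset_iff)

lemma pw_degree: "x \<in> S ==> degree (pw x) = K" "x \<in> S ==> coeff (pw x) K = 1"
 unfolding pw_def using charp_degree by auto

lemma P_pt: "x \<in> S ==> P (x + w *s v) = poly (pw x) w"
 unfolding P_def using SV by (simp add: pr_pt Vi vi subset_iff)

lemma poly_pw_sum: "x \<in> S ==> poly (pw x) t = (\<Sum>l\<le>K. coeff (pw x) l * t ^ l)"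
 using poly_altdef[of "pw x" t] pw_degree by simp

lemma P_hol: "hol W cyl P"
proof (rule hol_cong[OF Wsub cyl_open])
 show "hol W cyl (%z. \<Sum>l\<le>K. coeff (pw (pr z)) l * (z $ i) ^ l)"
  by (intro hol_sum hol_mult hol_power hol_component hol_pr pw_coeff_hol)
 show "(\<Sum>l\<le>K. coeff (pw (pr z)) l * (z $ i) ^ l) = P z" if "z \<in> cyl" for z
  using that poly_pw_sum cyl_iff unfolding P_def by simp
qed

lemma pw_zero_iff: "x \<in> S ==> poly (pw x) w = 0 \<longleftrightarrow> w \<in> zr x"
 using zr_finite mu_pos by (auto simp: poly_pw)

lemma pw_sphere: "x \<in> S ==> s \<in> sphere 0 r ==> poly (pw x) s ~= 0"
 unfolding pw_zero_iff using zr_less by force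

text \<open>Defines \<open>G / F\<close> across the zeros of \<open>F\<close>: inside radius
  \<open>r\<close> by a Cauchy integral, elsewhere by division. Where \<open>F\<close> is nonzero
  both are the quotient, so the pieces fit together. \<open>k\<close> is separate from
  \<open>G\<close> because division with remainder integrates \<open>g\<close> but divides
  \<open>g\<close> minus its remainder.\<close>

lemma glue_quotient:
 assumes F: "hol W cyl F" and G: "hol W cyl G" and k: "hol W cyl k"
  and nz: "!!x w. x \<in> S ==> r <= cmod w ==> cmod w < R ==> F (x + w *s v) ~= 0"
  and eq: "!!x w. x \<in> S ==> cmod w < r ==>
   G (x + w *s v) = F (x + w *s v) * cI r (%s. k (x + s *s v) / F (x + s *s v) / (s - w))"
 obtains q where "hol W cyl q" "!!z. z \<in> cyl ==> G z = F z * q z"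
proof -
 define c where "c z = cI r (%s. k (pr z + s *s v) / F (pr z + s *s v) / (s - z $ i))" for z
 define q where "q z = (if cmod (z $ i) < r then c z else G z / F z)" for z
 have Fn: "F z ~= 0" if "z \<in> cyl" "~ cmod (z $ i) < r" for z
  using nz[of "pr z" "z $ i"] that pr_split[of z] by (simp add: cyl_iff)
 have q: "G z = F z * q z" if z: "z \<in> cyl" for z
  using eq[of "pr z" "z $ i"] Fn[OF z] z pr_split[of z] by (simp add: q_def c_def cyl_iff)
 define B where "B = {z \<in> W. pr z \<in> S & z $ i \<in> ball 0 r}"
 have B: "ropen W B" unfolding B_def by (rule ropen_tube[OF So open_ball])
 have pts: "pr y + s *s v \<in> cyl" if "y \<in> B" "s \<in> sphere 0 r" for y s
  using that by (intro cylI) (auto simp: B_def rR)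
 have cc: "continuous_on (B \<times> sphere 0 r) (%q. g (pr (fst q) + snd q *s v))" if "hol W cyl g" for g
  by (rule continuous_on_compose2[OF hol_continuous[OF that]])
   (use pts in \<open>auto intro!: continuous_intros\<close>)
 have hh: "hol W B (%y. g (pr y + s *s v))" if "hol W cyl g" "s \<in> sphere 0 r" for g s
  by (rule hol_compose_lin[OF that(1), where M = pr])
   (use that pts pr_W VW in \<open>auto intro!: continuous_intros simp: pr_line algebra_simps B_def\<close>)
 have Fs: "F (pr y + s *s v) ~= 0" "s ~= y $ i" if "y \<in> B" "s \<in> sphere 0 r" for y s
  using that nz[of "pr y" s] rR by (auto simp: B_def)
 have ch: "hol W B c"
  unfolding c_def
 proof (rule hol_cI[OF Wsub B r0])
  show "continuous_on (B \<times> sphere 0 r) (%(y, s). k (pr y + s *s v) / F (pr y + s *s v) / (s - y $ i))"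
   unfolding case_prod_beta by (intro continuous_intros cc F k) (use Fs in auto)
  show "hol W B (%y. k (pr y + s *s v) / F (pr y + s *s v) / (s - y $ i))" if "s \<in> sphere 0 r" for s
   by (intro hol_divide hol_diff hol_const hol_component hh F k) (use Fs that in auto)
 qed
 have "hol W cyl q"
 proof (rule hol_local[OF Wsub])
  show "cyl \<subseteq> W" using cyl_iff by blast
  fix z assume z: "z \<in> cyl"
  show "\<exists>B g. ropen W B & z \<in> B & hol W B g & (\<forall>y\<in>B. g y = q y)"
  proof (cases "cmod (z $ i) < r")
   case True
   then show ?thesis using B z ch by (intro exI[of _ B] exI[of _ c]) (auto simp: q_def B_def cyl_iff)
  next
   case False
   define B' where "B' = cyl \<inter> F -` (- {0})"
   have "ropen cyl B'" unfolding B'_def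
    by (rule continuous_openin_preimage_gen) (use F hol_continuous in auto)
   then have B': "ropen W B'" using cyl_open openin_trans by blast
   have "hol W B' (%y. G y / F y)"
    by (intro hol_divide hol_subset[OF F] hol_subset[OF G]) (auto simp: B'_def)
   moreover have "G y / F y = q y" if "y \<in> B'" for y using that q[of y] by (simp add: B'_def)
   ultimately show ?thesis using B' z Fn[OF z False] by (intro exI[of _ B']) (auto simp: B'_def)
  qed
 qed
 then show ?thesis using that q by blast
qed

text \<open>On each slice \<open>pw x\<close> and \<open>f\<close> have the same zeros with the same
  multiplicities, so their quotient has removable singularities; \<open>glue_quotient\<close> makes
  it holomorphic in \<open>x\<close> too.\<close>

lemma unit_exists:
 obtains U where "hol W cyl U" "!!z. z \<in> cyl ==> P z = f z * U z"
proof -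
 have ex: "\<exists>h. h holomorphic_on ball 0 R & (\<forall>s\<in>ball 0 R. poly (pw x) s = f (x + s *s v) * h s)" if x: "x \<in> S" for x
 proof -
  have "\<exists>h. h holomorphic_on ball 0 R & (\<forall>s\<in>ball 0 R - zr x. h s = poly (pw x) s / f (x + s *s v))"
  proof (rule removable_singularities[OF zr_finite[OF x]])
   show "zr x \<subseteq> interior (ball 0 R)" by (auto simp: zr_def)
   show "(%s. poly (pw x) s / f (x + s *s v)) holomorphic_on ball 0 R - zr x"
    by (intro holomorphic_intros holomorphic_on_subset[OF slice_holo[OF fhc x]]) (auto simp: zr_def)
   fix w assume w: "w \<in> zr x"
   obtain k e where k: "mu x w > 0" "e > 0" "cball w e \<subseteq> ball 0 R" "k holomorphic_on cball w e"
     "!!s. s \<in> cball w e ==> f (x + s *s v) = k s * (s - w) ^ mu x w & k s ~= 0"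
    using mu_factor[OF x w] by metis
   define u where "u = (%s. (\<Prod>w'\<in>zr x - {w}. (s - w') ^ mu x w') / k s)"
   have "continuous_on (cball w e) u"
    unfolding u_def using k by (intro continuous_intros holomorphic_on_imp_continuous_on[OF k(4)]) auto
   then have "isCont u w"
    using k(2) by (intro continuous_on_interior) auto
   then have "u \<in> O[at w](%_. 1)" by (intro continuous_imp_bigo_1) (simp add: continuous_within)
   moreover have "\<forall>\<^sub>F s in at w. u s = poly (pw x) s / f (x + s *s v)"
    unfolding eventually_at
   proof (intro exI[of _ e] conjI ballI impI k)
    fix s assume s: "s ~= w & dist s w < e"
    have "poly (pw x) s = (s - w) ^ mu x w * (\<Prod>w'\<in>zr x - {w}. (s - w') ^ mu x w')"
     unfolding poly_pw[OF x] using zr_finite[OF x] w by (simp add: prod.remove)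
    then show "u s = poly (pw x) s / f (x + s *s v)"
     using k(5)[of s] s by (simp add: u_def dist_commute)
   qed
   ultimately show "(%s. poly (pw x) s / f (x + s *s v)) \<in> O[at w](%_. 1)"
    using landau_o.big.in_cong[of u "%s. poly (pw x) s / f (x + s *s v)" "at w" "%_. 1"] by blast
  qed
  then obtain h where h: "h holomorphic_on ball 0 R" "!!s. s \<in> ball 0 R - zr x ==> h s = poly (pw x) s / f (x + s *s v)"
   by blast
  have "poly (pw x) s = f (x + s *s v) * h s" if "s \<in> ball 0 R" for s
   using h(2)[of s] that pw_zero_iff[OF x, of s] by (cases "s \<in> zr x") (auto simp: zr_def)
  then show ?thesis using h by blast
 qed
 show ?thesis
 proof (rule glue_quotient[OF fhc P_hol P_hol fnz])
  fix x w assume x: "x \<in> S" and w: "cmod w < r"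
  obtain h where h: "h holomorphic_on ball 0 R" "!!s. s \<in> ball 0 R ==> poly (pw x) s = f (x + s *s v) * h s"
   using ex[OF x] by blast
  have "cI r (%s. P (x + s *s v) / f (x + s *s v) / (s - w)) = cI r (%s. h s / (s - w))"
   by (rule cI_cong[OF r0]) (use h(2) f_sphere[OF x] P_pt[OF x] rR in auto)
  also have "\<dots> = h w" by (rule cI_Cauchy[OF r0 h(1) rR w])
  finally show "P (x + w *s v) = f (x + w *s v) * cI r (%s. P (x + s *s v) / f (x + s *s v) / (s - w))"
   using h(2)[of w] P_pt[OF x] w rR by simp
 qed (assumption | rule that)+
qed

text \<open>The coefficient of \<open>w ^ l\<close> in the divided difference (P(s) - P(w)) / (s -
  w) of the Weierstrass polynomial at \<open>x\<close>.\<close>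

definition Bk where "Bk l x s = (\<Sum>j\<in>{l<..K}. coeff (pw x) j * s ^ (j - l - 1))"

lemma Bk_identity:
 assumes "x \<in> S"
 shows "(\<Sum>l<K. Bk l x s * w ^ l) * (s - w) = poly (pw x) s - poly (pw x) w"
proof -
 have "(\<Sum>l<K. Bk l x s * w ^ l) = (\<Sum>l<K. \<Sum>j\<le>K. if l < j then coeff (pw x) j * s ^ (j - l - 1) * w ^ l else 0)"
  unfolding Bk_def sum_distrib_right
  by (intro sum.cong refl sum.mono_neutral_cong_left) auto
 also have "\<dots> = (\<Sum>j\<le>K. \<Sum>l<K. if l < j then coeff (pw x) j * s ^ (j - l - 1) * w ^ l else 0)"
  by (rule sum.swap)
 also have "\<dots> = (\<Sum>j\<le>K. coeff (pw x) j * (\<Sum>l<j. w ^ l * s ^ (j - Suc l)))"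
  unfolding sum_distrib_left
  by (intro sum.cong refl sum.mono_neutral_cong_right) (auto simp: mult_ac)
 finally have "(\<Sum>l<K. Bk l x s * w ^ l) * (s - w) = (\<Sum>j\<le>K. coeff (pw x) j * ((s - w) * (\<Sum>l<j. w ^ l * s ^ (j - Suc l))))"
  by (simp add: sum_distrib_right sum_distrib_left mult_ac)
 also have "\<dots> = (\<Sum>j\<le>K. coeff (pw x) j * (s ^ j - w ^ j))"
 proof (intro sum.cong refl)
  fix j
  define A where "A = (\<Sum>l<j. w ^ l * s ^ (j - Suc l))"
  have "w ^ j - s ^ j = (w - s) * A"
   unfolding A_def power_diff_sumr2 by (simp add: mult.commute)
  then have "(s - w) * A = s ^ j - w ^ j" by (simp add: algebra_simps)
  then have "(s - w) * (\<Sum>l<j. w ^ l * s ^ (j - Suc l)) = s ^ j - w ^ j" by (simp only: A_def)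
  then show "coeff (pw x) j * ((s - w) * (\<Sum>l<j. w ^ l * s ^ (j - Suc l))) = coeff (pw x) j * (s ^ j - w ^ j)" by simp
 qed
 also have "\<dots> = poly (pw x) s - poly (pw x) w"
  unfolding poly_pw_sum[OF assms] by (simp add: right_diff_distrib sum_subtractf)
 finally show ?thesis .
qed

text \<open>The coefficient of \<open>w ^ l\<close> in the remainder of \<open>g\<close> on division
  by the Weierstrass polynomial, as a contour integral; \<open>division\<close> justifies the
  name.\<close>

definition rem where "rem g l x = cI r (%s. g (x + s *s v) / poly (pw x) s * Bk l x s)"

lemma continuous_pw: "continuous_on (S \<times> UNIV) (%q. poly (pw (fst q)) (snd q))"
proof -
 have "continuous_on (S \<times> UNIV) (%q. \<Sum>l\<le>K. coeff (pw (fst q)) l * (snd q) ^ l)"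
  by (intro continuous_intros continuous_on_compose2[OF hol_continuous[OF pw_coeff_hol]]) auto
 then show ?thesis
  by (rule continuous_on_eq) (auto simp: poly_pw_sum)
qed

lemma continuous_Bk: "continuous_on (S \<times> UNIV) (%q. Bk l (fst q) (snd q))"
 unfolding Bk_def
 by (intro continuous_intros continuous_on_compose2[OF hol_continuous[OF pw_coeff_hol]]) auto

lemma continuous_Bk1: "continuous_on A (Bk l x)"
 unfolding Bk_def by (intro continuous_intros)

lemma Bk_hol: "hol V S (%x. Bk l x s)"
 unfolding Bk_def by (intro hol_sum hol_mult pw_coeff_hol hol_const)

lemma pw_hol: "hol V S (%x. poly (pw x) s)"
 by (rule hol_cong[OF sub So, of "%x. \<Sum>l\<le>K. coeff (pw x) l * s ^ l"])
  (auto intro!: hol_sum hol_mult pw_coeff_hol simp: poly_pw_sum)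

lemma rem_hol:
 assumes g: "hol W cyl g"
 shows "hol V S (rem g l)"
 unfolding rem_def
proof (rule hol_cI[OF sub So r0])
 show "continuous_on (S \<times> sphere 0 r) (%(x, s). g (x + s *s v) / poly (pw x) s * Bk l x s)"
  unfolding case_prod_beta
  by (intro continuous_intros continuous_slice[OF g sphere_r(2)] continuous_on_subset[OF continuous_pw]
    continuous_on_subset[OF continuous_Bk]) (use pw_sphere in auto)
 show "hol V S (%x. g (x + s *s v) / poly (pw x) s * Bk l x s)" if "s \<in> sphere 0 r" for s
  by (intro hol_mult hol_divide hol_shift[OF g sphere_r(1)[OF that]] pw_hol Bk_hol pw_sphere that)
qed

lemma rem_continuous:
 assumes "hol W cyl g" "x \<in> S"
 shows "continuous_on (sphere 0 r) (%s. g (x + s *s v) / poly (pw x) s * Bk l x s)"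
 unfolding Bk_def
 by (intro continuous_intros holomorphic_on_imp_continuous_on[OF holomorphic_on_subset[OF slice_holo[OF assms]]])
  (use assms pw_sphere rR in auto)

lemma rem_sum:
 assumes "finite A" "!!a. a \<in> A ==> hol W cyl (g a)" "x \<in> S"
 shows "rem (%z. \<Sum>a\<in>A. g a z) l x = (\<Sum>a\<in>A. rem (g a) l x)"
 unfolding rem_def sum_divide_distrib sum_distrib_right
 by (rule cI_sum[OF r0 assms(1)]) (use rem_continuous assms in auto)

lemma rem_diff:
 assumes "hol W cyl g" "hol W cyl h" "x \<in> S"
 shows "rem (%z. g z - h z) l x = rem g l x - rem h l x"
 unfolding rem_def diff_divide_distrib left_diff_distrib
 by (rule cI_diff[OF r0]) (use rem_continuous assms in auto)

lemma rem_scale: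
 assumes "x \<in> S"
 shows "rem (%z. c (pr z) * g z) l x = c x * rem g l x"
proof -
 have "pr (x + s *s v) = x" for s using assms SV pr_pt by blast
 then show ?thesis unfolding rem_def cI_cmult[symmetric] by (simp add: mult.assoc)
qed

lemma rem_P_mult:
 assumes "hol W cyl h" "x \<in> S"
 shows "rem (%z. P z * h z) l x = 0"
proof -
 have "rem (%z. P z * h z) l x = cI r (%s. h (x + s *s v) * Bk l x s)"
  unfolding rem_def by (rule cI_cong[OF r0]) (use pw_sphere[OF assms(2)] P_pt[OF assms(2)] in simp)
 also have "\<dots> = 0"
  by (rule cI_Cauchy0[OF r0 _ rR])
   (auto intro!: holomorphic_intros slice_holo[OF assms] simp: Bk_def)
 finally show ?thesis .
qed

lemma rem_cong: "x \<in> S ==> (!!z. z \<in> cyl ==> g z = h z) ==> rem g l x = rem h l x"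
 unfolding rem_def by (rule cI_cong[OF r0]) (use cylI rR in auto)

text \<open>By \<open>Bk_identity\<close>, 1 / (s - w) is the sum of P(w) / (P(s) (s - w)) and of
  the terms w^l \<open>Bk l x s\<close> / P(s). Inserted into Cauchy's formula for \<open>g\<close>,
  the first summand yields \<open>P\<close> times a quotient and the others the remainder.\<close>

lemma division:
 assumes g: "hol W cyl g"
 obtains q where "hol W cyl q" "!!z. z \<in> cyl ==> g z = P z * q z + (\<Sum>l<K. rem g l (pr z) * (z $ i) ^ l)"
proof -
 note assms_obt = that
 define D where "D z = g z - (\<Sum>l<K. rem g l (pr z) * (z $ i) ^ l)" for z
 have D: "hol W cyl D"
  unfolding D_def by (intro hol_diff g hol_sum hol_mult hol_power hol_component hol_pr rem_hol)
 have Pn: "P (x + w *s v) ~= 0" if "x \<in> S" "r <= cmod w" for x w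
  using zr_less[OF that(1), of w] pw_zero_iff[OF that(1), of w] P_pt[OF that(1)] that(2) by auto
 show thesis
 proof (rule glue_quotient[OF P_hol D g Pn])
  show thesis if "hol W cyl q" "!!z. z \<in> cyl ==> D z = P z * q z" for q
   by (rule assms_obt[OF that(1)]) (use that(2) in \<open>simp add: D_def diff_eq_eq\<close>)
  fix x w assume x: "x \<in> S" and w: "cmod w < r"
  have pP: "P (x + s *s v) = poly (pw x) s" for s by (rule P_pt[OF x])
  have gc: "continuous_on (sphere 0 r) (%s. g (x + s *s v))"
   by (rule holomorphic_on_imp_continuous_on[OF holomorphic_on_subset[OF slice_holo[OF g x]]]) (use rR in auto)
  have nw: "s - w ~= 0" if "s \<in> sphere 0 r" for s using that w by auto
  have "(\<Sum>l<K. rem g l x * w ^ l) = cI r (%s. \<Sum>l<K. w ^ l * (g (x + s *s v) / poly (pw x) s * Bk l x s))"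
   unfolding cI_sum[OF r0 finite_lessThan continuous_on_mult[OF continuous_on_const rem_continuous[OF g x]]]
    cI_cmult rem_def by (rule sum.cong[OF refl], rule mult.commute)
  then have "poly (pw x) w * cI r (%s. g (x + s *s v) / poly (pw x) s / (s - w)) + (\<Sum>l<K. rem g l x * w ^ l) =
    cI r (%s. poly (pw x) w * (g (x + s *s v) / poly (pw x) s / (s - w))
     + (\<Sum>l<K. w ^ l * (g (x + s *s v) / poly (pw x) s * Bk l x s)))"
   unfolding cI_cmult[symmetric] using pw_sphere[OF x] nw
   by (subst cI_add[OF r0]) (auto intro!: continuous_intros gc continuous_Bk1)
  also have "\<dots> = cI r (%s. g (x + s *s v) / (s - w))"
  proof (rule cI_cong[OF r0])
   fix s :: complex assume s: "s \<in> sphere 0 r"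
   define A where "A = (\<Sum>l<K. Bk l x s * w ^ l)"
   have "A * (s - w) = poly (pw x) s - poly (pw x) w" unfolding A_def by (rule Bk_identity[OF x])
   then have "A = (poly (pw x) s - poly (pw x) w) / (s - w)" using nw[OF s] by (simp add: eq_divide_eq)
   moreover have "(\<Sum>l<K. w ^ l * (g (x + s *s v) / poly (pw x) s * Bk l x s)) = g (x + s *s v) / poly (pw x) s * A"
    unfolding A_def sum_distrib_left by (simp add: mult_ac)
   ultimately show "poly (pw x) w * (g (x + s *s v) / poly (pw x) s / (s - w))
     + (\<Sum>l<K. w ^ l * (g (x + s *s v) / poly (pw x) s * Bk l x s)) = g (x + s *s v) / (s - w)"
    using nw[OF s] pw_sphere[OF x s] by (simp add: field_simps)
  qed
  also have "\<dots> = g (x + w *s v)" by (rule cI_Cauchy[OF r0 slice_holo[OF g x] rR w])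
  finally show "D (x + w *s v) = P (x + w *s v) * cI r (%s. g (x + s *s v) / P (x + s *s v) / (s - w))"
   using x SV by (simp add: D_def pP pr_pt Vi vi subset_iff algebra_simps)
 qed assumption+
qed

end

lemma compact_bound:
 fixes f :: "'a::topological_space => complex"
 assumes "compact K" "continuous_on K f"
 shows "\<exists>B. \<forall>x\<in>K. cmod (f x) <= B"
proof -
 have "bounded (f ` K)" by (intro compact_imp_bounded compact_continuous_image assms)
 then show ?thesis unfolding bounded_iff by auto
qed

lemma compact_bound2:
 fixes f :: "'a::topological_space => 'b::topological_space => complex"
 assumes "compact A" "compact T" "continuous_on (A \<times> T) (%q. f (fst q) (snd q))"
 shows "\<exists>B. \<forall>x\<in>A. \<forall>y\<in>T. cmod (f x y) <= B"
 using compact_bound[OF compact_Times[OF assms(1,2)] assms(3)] by auto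

lemma finite_pos_lower_bound:
 fixes f :: "'a => real"
 assumes "finite A" "!!a. a \<in> A ==> f a > 0"
 obtains e where "e > 0" "!!a. a \<in> A ==> e < f a"
proof -
 have "\<exists>e>0. \<forall>a\<in>A. e < f a"
  using assms
 proof (induction A rule: finite_induct)
  case empty
  then show ?case by (intro exI[of _ 1]) auto
 next
  case (insert a A)
  then obtain e where e: "e > 0" "\<forall>b\<in>A. e < f b" by auto
  have "f a > 0" using insert.prems by auto
  then show ?case using e by (intro exI[of _ "min e (f a / 2)"]) auto
 qed
 then show ?thesis using that by blast
qed

lemma ropen_compact_nbhd:
 fixes V :: "(complex^'n) set"
 assumes "vec.subspace V" "ropen V S" "b \<in> S"
 obtains e where "e > 0" "compact (V \<inter> cball b e)" "V \<inter> cball b e \<subseteq> S"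
proof -
 obtain e where "e > 0" "!!y. y \<in> V ==> dist y b < e ==> y \<in> S" using ropen_ballE[OF assms(2,3)] by metis
 then show ?thesis
  using that[of "e / 2"] closed_Int_compact[OF closed_subspace[OF csubspace_subspace[OF assms(1)]] compact_cball]
  by (force simp: dist_commute)
qed

text \<open>On a single line the bound is differentiability; \<open>vo_from_lines\<close> makes it
  uniform in the direction.\<close>

lemma vo1_hol:
 assumes V: "vec.subspace V" "ropen V S" and f: "hol V S f" and b: "b \<in> S"
 shows "vo V 1 (%z. f z - f b) b"
proof (rule vo_from_lines[OF V hol_diff[OF f hol_const] b zero_less_one, where P = "%_. True"])
 fix v assume "v \<in> V"
 then obtain D where "((%t. f (b + t *s v)) has_field_derivative D) (at 0)"
  using f b unfolding hol_def field_differentiable_def by blast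
 then have "((%t. norm ((f (b + t *s v) - f b) / t)) \<longlongrightarrow> norm D) (at 0)"
  unfolding has_field_derivative_iff by (intro tendsto_norm) simp
 from order_tendstoD(2)[OF this, of "norm D + 1"]
 obtain d where d: "d > 0" "!!t. t ~= 0 ==> cmod t < d ==> norm ((f (b + t *s v) - f b) / t) < norm D + 1"
  unfolding eventually_at by (auto simp: dist_norm)
 have "cmod (f (b + t *s v) - f b) <= (norm D + 1) * cmod t ^ 1" if "cmod t < d" for t
  using d(2)[OF _ that] by (cases "t = 0") (auto simp: norm_divide field_simps less_imp_le)
 then show "\<exists>C d. d > 0 & (\<forall>t. cmod t < d --> cmod (f (b + t *s v) - f b) <= C * cmod t ^ 1)"
  using d(1) by blast
next
 fix y and e :: real assume "y \<in> V" "0 < e"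
 then show "\<exists>v\<in>V. dist v y < e & True" by (intro bexI[of _ y]) auto
qed

context weierstrass
begin

text \<open>Replacing \<open>u\<close> by its remainder changes the product by a multiple of
  \<open>P\<close>, which \<open>rem\<close> kills. So taking remainders turns combinations with
  coefficients on the cylinder into combinations over \<open>S\<close> of the products of
  \<open>G\<close> with powers of the coordinate.\<close>

lemma rem_mult:
 assumes u: "hol W cyl u" and G: "hol W cyl G" and x: "x \<in> S"
 shows "rem (%z. u z * G z) l x = (\<Sum>m<K. rem u m x * rem (%z. (z $ i) ^ m * G z) l x)"
proof -
 obtain q where q: "hol W cyl q" "!!z. z \<in> cyl ==> u z = P z * q z + (\<Sum>l<K. rem u l (pr z) * (z $ i) ^ l)"
  using division[OF u] by blast
 define A where "A = (%m z. rem u m (pr z) * ((z $ i) ^ m * G z))"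
 have Ah: "hol W cyl (A m)" for m
  unfolding A_def by (intro hol_mult hol_pr rem_hol u hol_power hol_component G)
 have "rem (%z. u z * G z) l x = rem (%z. (\<Sum>m<K. A m z) - P z * (- (q z * G z))) l x"
  by (rule rem_cong[OF x]) (simp add: q(2) A_def algebra_simps sum_distrib_left sum_distrib_right)
 also have "\<dots> = rem (%z. \<Sum>m<K. A m z) l x - rem (%z. P z * (- (q z * G z))) l x"
  by (intro rem_diff[OF _ _ x] hol_sum Ah hol_mult P_hol hol_uminus q(1) G)
 also have "\<dots> = rem (%z. \<Sum>m<K. A m z) l x"
  using rem_P_mult[OF hol_uminus[OF hol_mult[OF q(1) G]] x, of l] by simp
 also have "\<dots> = (\<Sum>m<K. rem (A m) l x)"
  by (rule rem_sum[OF finite_lessThan Ah x])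
 also have "\<dots> = (\<Sum>m<K. rem u m x * rem (%z. (z $ i) ^ m * G z) l x)"
  unfolding A_def by (rule sum.cong[OF refl], rule rem_scale[OF x])
 finally show ?thesis .
qed

lemma pw_factor:
 assumes "b \<in> S" "w \<in> zr b"
 obtains q d where "q > 0" "d > 0" "!!s. dist s w < d ==> q * cmod (s - w) ^ mu b w <= cmod (poly (pw b) s)"
proof -
 define o1 where "o1 s = (\<Prod>w'\<in>zr b - {w}. (s - w') ^ mu b w')" for s
 have o1w: "o1 w ~= 0" unfolding o1_def using zr_finite[OF assms(1)] by auto
 have "isCont o1 w" unfolding o1_def by (intro continuous_intros)
 then obtain d where d: "d > 0" "!!s. dist s w < d ==> dist (o1 s) (o1 w) < cmod (o1 w) / 2"
  using o1w unfolding continuous_at_eps_delta by (metis half_gt_zero zero_less_norm_iff)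
 have "cmod (o1 w) / 2 * cmod (s - w) ^ mu b w <= cmod (poly (pw b) s)" if "dist s w < d" for s
 proof -
  have "cmod (o1 w) / 2 <= cmod (o1 s)"
   using d(2)[OF that] norm_triangle_ineq2[of "o1 w" "o1 s"] by (simp add: dist_norm norm_minus_commute)
  then have "cmod (o1 w) / 2 * cmod (s - w) ^ mu b w <= cmod (o1 s) * cmod (s - w) ^ mu b w"
   by (rule mult_right_mono) simp
  also have "\<dots> = cmod (poly (pw b) s)"
   unfolding poly_pw[OF assms(1)] prod.remove[OF zr_finite[OF assms(1)] assms(2)] o1_def
   by (simp add: norm_mult norm_power mult.commute)
  finally show ?thesis .
 qed
 then show ?thesis using that[of "cmod (o1 w) / 2" d] o1w d(1) by simp
qed

lemma pw_diff_bound: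
 assumes b: "b \<in> S"
 obtains A d where "A >= 0" "d > 0"
  "!!x s. x \<in> S ==> dist x b < d ==> cmod s <= R ==> cmod (poly (pw b) s - poly (pw x) s) <= A * norm (x - b)"
proof -
 have "\<forall>l. \<exists>C e. e > 0 & C >= 0 & (\<forall>x\<in>V. dist x b < e --> cmod (coeff (pw x) l - coeff (pw b) l) <= C * norm (x - b))"
 proof
  fix l
  show "\<exists>C e. e > 0 & C >= 0 & (\<forall>x\<in>V. dist x b < e --> cmod (coeff (pw x) l - coeff (pw b) l) <= C * norm (x - b))"
   by (rule voE[OF vo1_hol[OF sub So pw_coeff_hol b, of l]]) auto
 qed
 then obtain C e where Ce: "!!l. e l > (0::real)" "!!l. C l >= (0::real)"
  "!!l x. x \<in> V ==> dist x b < e l ==> cmod (coeff (pw x) l - coeff (pw b) l) <= C l * norm (x - b)" by metis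
 obtain d where d: "d > 0" "!!l. l \<in> {..K} ==> d < e l"
  by (rule finite_pos_lower_bound[of "{..K}" e]) (use Ce(1) in auto)
 have "cmod (poly (pw b) s - poly (pw x) s) <= (\<Sum>l\<le>K. C l * R ^ l) * norm (x - b)"
  if x: "x \<in> S" "dist x b < d" and s: "cmod s <= R" for x s
 proof -
  have "poly (pw b) s - poly (pw x) s = (\<Sum>l\<le>K. (coeff (pw b) l - coeff (pw x) l) * s ^ l)"
   by (simp add: poly_pw_sum[OF b] poly_pw_sum[OF x(1)] sum_subtractf left_diff_distrib)
  also have "cmod \<dots> <= (\<Sum>l\<le>K. C l * R ^ l * norm (x - b))"
  proof (rule sum_norm_le)
   fix l assume "l \<in> {..K}"
   then have "cmod (coeff (pw b) l - coeff (pw x) l) <= C l * norm (x - b)"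
    using Ce(3)[of x l] x d(2)[of l] SV by (auto simp: norm_minus_commute)
   then have "cmod (coeff (pw b) l - coeff (pw x) l) * cmod s ^ l <= C l * norm (x - b) * R ^ l"
    using s Ce(2)[of l] by (intro mult_mono power_mono) auto
   then show "cmod ((coeff (pw b) l - coeff (pw x) l) * s ^ l) <= C l * R ^ l * norm (x - b)"
    by (simp add: norm_mult norm_power mult_ac)
  qed
  finally show ?thesis by (simp add: sum_distrib_right)
 qed
 then show ?thesis using that[of "\<Sum>l\<le>K. C l * R ^ l" d] d(1) Ce(2) r0 rR by (simp add: sum_nonneg)
qed

text \<open>With \<open>Q = P(b, \<cdot>)\<close> and \<open>Q\<^sup>N = P Y + (Q - P)\<^sup>N\<close> the kernel \<open>h / P\<close> splits into \<open>h Y / Q\<^sup>N\<close>, whose poles do not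
 move with \<open>x\<close> and whose residues are estimated on circles of radius \<open>|x - b|\<close>, and an error of order \<open>N\<close>.\<close>

lemma rem_order:
 assumes b: "b \<in> S" and h: "hol W cyl h"
  and van: "!!t. t \<in> zr b ==> vo W ((K + 1) * N) h (b + t *s v)"
 shows "vo V N (rem h l) b"
proof -
 \<comment> \<open>On a circle of radius \<open>a\<close> around a zero \<open>w\<close> over
   \<open>b\<close>, \<open>h\<close> is of size \<open>a ^ M\<close>, while \<open>Q ^ N\<close> is
   at least of size \<open>a ^ (mu b w * N)\<close>, which costs at most \<open>K * N\<close> powers
   of \<open>a\<close>. This exponent leaves \<open>a ^ N\<close>.\<close>
 define M where "M = (K + 1) * N"
 define Q where "Q = poly (pw b)"
 define Y where "Y x s = (\<Sum>a<N. (Q s - poly (pw x) s) ^ (N - Suc a) * Q s ^ a)" for x s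
 define g where "g x s = h (x + s *s v) * (Bk l x s * Y x s) / Q s ^ N" for x s
 define E where "E x s = h (x + s *s v) * Bk l x s / (Q s ^ N * poly (pw x) s)" for x s
 have Qc: "continuous_on T Q" for T unfolding Q_def by (intro continuous_intros)
 have Qn: "Q s ~= 0" if "s \<notin> zr b" for s using pw_zero_iff[OF b] that by (simp add: Q_def)
 have zs: "s \<notin> zr b" if "s \<in> sphere 0 r" for s using zr_less[OF b, of s] that by auto
 obtain eS where eS: "eS > 0" "compact (V \<inter> cball b eS)" "V \<inter> cball b eS \<subseteq> S"
  by (rule ropen_compact_nbhd[OF sub So b])
 define Nb where "Nb = V \<inter> cball b eS"
 have NbS: "Nb \<subseteq> S" and Nbc: "compact Nb" using eS by (auto simp: Nb_def)
 have hc: "continuous_on (Nb \<times> T) (%q. h (fst q + snd q *s v))" if "T \<subseteq> ball 0 R" for T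
  by (rule continuous_on_subset[OF continuous_slice[OF h that]]) (use NbS in auto)
 have pc: "continuous_on (Nb \<times> T) (%q. poly (pw (fst q)) (snd q))" for T
  by (rule continuous_on_subset[OF continuous_pw]) (use NbS in auto)
 have Bc: "continuous_on (Nb \<times> T) (%q. Bk l (fst q) (snd q))" for T
  by (rule continuous_on_subset[OF continuous_Bk]) (use NbS in auto)
 have Qc2: "continuous_on T (%q. Q (snd q))" for T :: "((complex^'n) \<times> complex) set"
  unfolding Q_def by (intro continuous_intros)
 have "continuous_on (Nb \<times> sphere 0 r) (%q. E (fst q) (snd q))"
  unfolding E_def by (intro continuous_intros hc pc Bc Qc2) (use rR Qn zs pw_sphere NbS in auto)
 then obtain BE where BE: "!!x s. x \<in> Nb ==> s \<in> sphere 0 r ==> cmod (E x s) <= BE"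
  using compact_bound2[OF Nbc compact_sphere, where f = E] by blast
 have "continuous_on (Nb \<times> cball 0 r) (%q. Bk l (fst q) (snd q) * Y (fst q) (snd q))"
  unfolding Y_def by (intro continuous_intros pc Bc Qc2)
 then obtain BY where BY: "!!x s. x \<in> Nb ==> s \<in> cball 0 r ==> cmod (Bk l x s * Y x s) <= BY"
  using compact_bound2[OF Nbc compact_cball, where f = "%x s. Bk l x s * Y x s"] by blast
 obtain A dA where A: "A >= 0" "dA > 0"
   "!!x s. x \<in> S ==> dist x b < dA ==> cmod s <= R ==> cmod (Q s - poly (pw x) s) <= A * norm (x - b)"
  using pw_diff_bound[OF b] unfolding Q_def by metis
 have gholo: "g x holomorphic_on ball 0 R - zr b" if x: "x \<in> S" for x
  unfolding g_def Y_def Bk_def Q_def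
  by (intro holomorphic_intros holomorphic_on_subset[OF slice_holo[OF h x]]) (use Qn in \<open>auto simp: Q_def\<close>)
 have split: "rem h l x = (\<Sum>w\<in>zr b. residue (g x) w) + cI r (%s. (Q s - poly (pw x) s) ^ N * E x s)"
  if x: "x \<in> S" for x
 proof -
  have cont: "continuous_on (sphere 0 r) (%s. h (x + s *s v))"
   by (rule holomorphic_on_imp_continuous_on[OF holomorphic_on_subset[OF slice_holo[OF h x]]]) (use rR in auto)
  have "rem h l x = cI r (%s. g x s + (Q s - poly (pw x) s) ^ N * E x s)"
   unfolding rem_def
  proof (rule cI_cong[OF r0])
   fix s :: complex assume s: "s \<in> sphere 0 r"
   have "Q s ^ N - (Q s - poly (pw x) s) ^ N = poly (pw x) s * Y x s"
    using power_diff_sumr2[of "Q s" N "Q s - poly (pw x) s"] by (simp add: Y_def)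
   then have "Q s ^ N = poly (pw x) s * Y x s + (Q s - poly (pw x) s) ^ N" by (simp add: algebra_simps)
   from this[symmetric] have "h (x + s *s v) / poly (pw x) s * Bk l x s
     = h (x + s *s v) * Bk l x s / poly (pw x) s * ((poly (pw x) s * Y x s + (Q s - poly (pw x) s) ^ N) / Q s ^ N)"
    using Qn[OF zs[OF s]] by (simp only:) simp
   then show "h (x + s *s v) / poly (pw x) s * Bk l x s = g x s + (Q s - poly (pw x) s) ^ N * E x s"
    using pw_sphere[OF x s] Qn[OF zs[OF s]] by (simp add: g_def E_def add_divide_distrib distrib_left mult_ac)
  qed
  also have "\<dots> = cI r (g x) + cI r (%s. (Q s - poly (pw x) s) ^ N * E x s)"
   unfolding g_def E_def Y_def
   by (rule cI_add[OF r0]; intro continuous_intros cont Qc continuous_Bk1) (use Qn zs pw_sphere[OF x] in auto)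
  also have "cI r (g x) = (\<Sum>w\<in>zr b. residue (g x) w)"
  proof -
   have "contour_integral (circlepath 0 r) (g x) =
     2 * pi * \<i> * (\<Sum>w\<in>zr b. winding_number (circlepath 0 r) w * residue (g x) w)"
   proof (rule Residue_theorem[OF open_ball connected_ball zr_finite[OF b] gholo[OF x]])
    show "path_image (circlepath 0 r) \<subseteq> ball 0 R - zr b" using r0 rR zr_less[OF b] by force
    show "\<forall>z. z \<notin> ball 0 R --> winding_number (circlepath 0 r) z = 0"
     using rR r0 by (intro allI impI winding_number_zero_outside[where s = "cball 0 r"]) auto
   qed auto
   moreover have "winding_number (circlepath 0 r) w = 1" if "w \<in> zr b" for w
    by (rule winding_number_circlepath) (use zr_less[OF b that] in simp)
   ultimately show ?thesis by (simp add: cI_def)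
  qed
  finally show ?thesis .
 qed
 have "\<exists>C d. d > 0 & (\<forall>a x. 0 < a --> a < d --> x \<in> Nb --> dist x b <= a --> cmod (residue (g x) w) <= C * a ^ N)"
  if w: "w \<in> zr b" for w
 proof -
  obtain Ch dh where Ch: "dh > 0" "Ch >= 0"
    "!!z. z \<in> W ==> dist z (b + w *s v) < dh ==> cmod (h z) <= Ch * norm (z - (b + w *s v)) ^ M"
   using voE[OF van[OF w]] unfolding M_def by metis
  obtain q dq where q: "q > 0" "dq > 0" "!!s. dist s w < dq ==> q * cmod (s - w) ^ mu b w <= cmod (Q s)"
   using pw_factor[OF b w] unfolding Q_def by metis
  have wr: "cmod w < r" by (rule zr_less[OF b w])
  have "open (ball 0 r - (zr b - {w}))" using zr_finite[OF b] by (intro open_Diff finite_imp_closed) auto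
  then obtain di where di: "di > 0" "cball w di \<subseteq> ball 0 r - (zr b - {w})"
   using wr unfolding open_contains_cball by force
  define L where "L = 1 + norm v"
  have L: "L > 0" by (simp add: L_def add_pos_nonneg)
  define d where "d = min (min 1 di) (min dq (dh / L))"
  have d: "d > 0" using di q Ch L by (simp add: d_def)
  have "cmod (residue (g x) w) <= Ch * L ^ M * BY / q ^ N * a ^ N"
   if a: "0 < a" "a < d" and x: "x \<in> Nb" "dist x b <= a" for a x
  proof -
   have a': "a < 1" "a < di" "a < dq" "a * L < dh" using a L by (auto simp: d_def pos_less_divide_eq)
   have "(g x has_contour_integral 2 * pi * \<i> * residue (g x) w) (circlepath w a)"
   proof (rule base_residue)
    show "open (ball 0 R - (zr b - {w}))" using zr_finite[OF b] by (intro open_Diff finite_imp_closed) auto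
    show "g x holomorphic_on ball 0 R - (zr b - {w}) - {w}"
     by (rule holomorphic_on_subset[OF gholo]) (use x NbS in auto)
    show "cball w a \<subseteq> ball 0 R - (zr b - {w})" by (rule order_trans[OF order_trans[OF subset_cball di(2)]]) (use a'(2) rR in auto)
    show "w \<in> ball 0 R - (zr b - {w})" using wr rR by simp
   qed (use a in auto)
   moreover have "cmod (g x s) <= Ch * L ^ M * BY / q ^ N * a ^ N / a" if s: "cmod (s - w) = a" for s
   proof -
    have sw: "dist s w = a" "s \<in> cball w di" using s a' by (auto simp: dist_norm norm_minus_commute)
    then have sr: "s \<in> cball 0 r" "cmod s < R" using di(2) rR by (auto simp: subset_iff)
    have eq: "x + s *s v - (b + w *s v) = (x - b) + (s - w) *s v" by (simp add: vector_sub_rdistrib)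
    have nn: "norm (x + s *s v - (b + w *s v)) <= a * L"
     unfolding eq by (rule order_trans[OF norm_triangle_ineq]) (use x(2) s in \<open>simp only: L_def dist_norm distrib_left norm_smult mult_1_right add_le_cancel_right\<close>)
    have "x + s *s v \<in> W" using cylI[of x s] x NbS sr cyl_iff by blast
    then have "cmod (h (x + s *s v)) <= Ch * norm (x + s *s v - (b + w *s v)) ^ M"
     using nn a'(4) by (intro Ch(3)) (auto simp: dist_norm)
    also have "\<dots> <= Ch * (a * L) ^ M" using nn Ch(2) by (intro mult_left_mono power_mono) auto
    finally have 1: "cmod (h (x + s *s v)) <= Ch * L ^ M * a ^ M" by (simp add: power_mult_distrib mult_ac)
    have 2: "q ^ N * a ^ (mu b w * N) <= cmod (Q s) ^ N"
     using power_mono[OF q(3)[of s], of N] sw a' q(1) a s by (simp add: power_mult_distrib power_mult)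
    have pos: "0 < q ^ N * a ^ (mu b w * N)" using q a by simp
    have BY0: "0 <= BY" using order_trans[OF norm_ge_zero BY[OF x(1) sr(1)]] .
    have "cmod (g x s) <= Ch * L ^ M * a ^ M * BY / (q ^ N * a ^ (mu b w * N))"
     unfolding g_def norm_divide norm_mult[of "h _"] norm_power using 1 2 pos BY[OF x(1) sr(1)] BY0 Ch(2) L a
     by (intro frac_le mult_mono) (auto intro: order_trans[OF norm_ge_zero])
    also have "\<dots> = Ch * L ^ M * BY / q ^ N * (a ^ M / a ^ (mu b w * N))" by simp
    also have "\<dots> <= Ch * L ^ M * BY / q ^ N * (a ^ N / a)"
    proof (rule mult_left_mono)
     have "mu b w <= K"
      unfolding mu_sum[OF b, symmetric] using zr_finite[OF b] w by (intro member_le_sum) auto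
     then have "mu b w * N + N <= M" by (simp add: M_def)
     then have "a ^ M <= a ^ N * a ^ (mu b w * N)"
      unfolding power_add[symmetric] using a a' by (intro power_decreasing) auto
     also have "a ^ N * a ^ (mu b w * N) <= a ^ N * a ^ (mu b w * N) / a"
      using a a' by (simp add: pos_le_divide_eq mult_left_le)
     finally show "a ^ M / a ^ (mu b w * N) <= a ^ N / a" using a by (simp add: divide_simps mult_ac)
     show "0 <= Ch * L ^ M * BY / q ^ N"
      using Ch(2) L q BY0 by simp
    qed
    finally show ?thesis by simp
   qed
   moreover have "0 <= Ch * L ^ M * BY / q ^ N * a ^ N / a"
    using Ch(2) L q a order_trans[OF norm_ge_zero BY[OF x(1), of 0]] r0 by simp
   ultimately have "cmod (2 * pi * \<i> * residue (g x) w) <= Ch * L ^ M * BY / q ^ N * a ^ N / a * (2 * pi * a)"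
    using a(1) by (intro has_contour_integral_bound_circlepath) auto
   then have "(2 * pi) * cmod (residue (g x) w) <= (2 * pi) * (Ch * L ^ M * BY / q ^ N * a ^ N)"
    using a(1) by (simp add: norm_mult mult_ac)
   then show ?thesis by (rule mult_left_le_imp_le) simp
  qed
  then show ?thesis using d by blast
 qed
 then obtain C d where Cd: "!!w. w \<in> zr b ==> d w > 0"
   "!!w a x. w \<in> zr b ==> 0 < a ==> a < d w ==> x \<in> Nb ==> dist x b <= a ==> cmod (residue (g x) w) <= C w * a ^ N"
  by metis
 obtain d0 where d0: "d0 > 0" "!!w. w \<in> zr b ==> d0 < d w"
  by (rule finite_pos_lower_bound[of "zr b" d]) (use zr_finite[OF b] Cd(1) in auto)
 define B where "B = (\<Sum>w\<in>zr b. C w) + A ^ N * BE * r"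
 define d1 where "d1 = min (min d0 dA) eS"
 \<comment> \<open>The radius must be positive even for \<open>x = b\<close>, so the estimate is
   made on circles of radius \<open>a > norm (x - b)\<close> and then passes to the limit.\<close>
 have "cmod (rem h l x) <= B * norm (x - b) ^ N" if x: "x \<in> V" "dist x b < d1" for x
 proof (rule tendsto_lowerbound)
  have xN: "x \<in> Nb" "x \<in> S" using x NbS by (auto simp: Nb_def d1_def dist_commute)
  show "((%a. B * a ^ N) \<longlongrightarrow> B * norm (x - b) ^ N) (at_right (norm (x - b)))" by (intro tendsto_intros)
  have "cmod (rem h l x) <= B * a ^ N" if a: "norm (x - b) < a" "a < d1" for a
  proof -
   have a0: "0 < a" using a(1) by (rule le_less_trans[OF norm_ge_zero])
   have "cmod (\<Sum>w\<in>zr b. residue (g x) w) <= (\<Sum>w\<in>zr b. C w * a ^ N)"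
    by (rule sum_norm_le) (use Cd(2)[OF _ a0 _ xN(1)] a d0(2) in \<open>fastforce simp: dist_norm d1_def\<close>)
   moreover have "cmod (cI r (%s. (Q s - poly (pw x) s) ^ N * E x s)) <= ((A * a) ^ N * BE) * r"
   proof (rule cI_bound[OF r0])
    show "continuous_on (sphere 0 r) (%s. (Q s - poly (pw x) s) ^ N * E x s)"
     unfolding E_def using Qn zs pw_sphere[OF xN(2)] rR
     by (intro continuous_intros Qc continuous_Bk1
       holomorphic_on_imp_continuous_on[OF holomorphic_on_subset[OF slice_holo[OF h xN(2)]]]) auto
    fix s :: complex assume s: "s \<in> sphere 0 r"
    have "cmod (Q s - poly (pw x) s) <= A * norm (x - b)" using A(3)[OF xN(2), of s] x s rR by (simp add: d1_def)
    also have "\<dots> <= A * a" using A(1) a by (simp add: mult_left_mono)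
    finally show "cmod ((Q s - poly (pw x) s) ^ N * E x s) <= (A * a) ^ N * BE"
     unfolding norm_mult norm_power using BE[OF xN(1) s] A(1) a0 by (intro mult_mono power_mono) auto
   qed
   ultimately have "cmod (rem h l x) <= (\<Sum>w\<in>zr b. C w * a ^ N) + (A * a) ^ N * BE * r"
    unfolding split[OF xN(2)] by (rule norm_triangle_mono)
   then show ?thesis by (simp add: B_def sum_distrib_left[symmetric] sum_distrib_right[symmetric] power_mult_distrib algebra_simps)
  qed
  moreover have "norm (x - b) < d1" using x by (simp add: dist_norm)
  ultimately show "\<forall>\<^sub>F a in at_right (norm (x - b)). cmod (rem h l x) <= B * a ^ N"
   unfolding eventually_at_right_field by blast
 qed simp
 moreover have "d1 > 0" using d0 A eS by (simp add: d1_def)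
 ultimately show ?thesis unfolding vo_def by blast
qed

end

section \<open>Finite order membership in submodules\<close>

lemma vo1_entire: "hol UNIV UNIV f ==> f b = 0 ==> vo UNIV 1 f b"
 using vo1_hol[of UNIV UNIV f b] by simp

lemma vo_power:
 assumes "vo V 1 f b"
 shows "vo V N (%z. f z ^ N) b"
proof -
 obtain C e where C: "e > 0" "!!z. z \<in> V ==> dist z b < e ==> cmod (f z) <= C * norm (z - b) ^ 1"
  using voE[OF assms] by metis
 have "cmod (f z ^ N) <= C ^ N * norm (z - b) ^ N" if "z \<in> V" "dist z b < e" for z
  using power_mono[OF C(2)[OF that], of N] by (simp add: norm_power power_mult_distrib)
 then show ?thesis unfolding vo_def using C(1) by blast
qed

lemma vo_subspace: "vo V N f b ==> W \<subseteq> V ==> vo W N f b"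
 unfolding vo_def by (meson subsetD)

text \<open>Holomorphic substitutes for cutoff functions: they merge finitely many local
  approximations of order \<open>N\<close> into one function that keeps the order at each
  point.\<close>

lemma interpolation:
 fixes A :: "(complex^'n) set"
 assumes "finite A"
 obtains e where "!!a. hol UNIV UNIV (e a)" "!!a V. a \<in> A ==> vo V N (%z. e a z - 1) a"
  "!!a b V. a \<in> A ==> b \<in> A ==> a ~= b ==> vo V N (e a) b"
proof -
 have "\<forall>a b. \<exists>k. a ~= b --> (a::complex^'n) $ k ~= b $ k" by (simp add: vec_eq_iff)
 then obtain k where k: "!!a b. a ~= b ==> (a::complex^'n) $ k a b ~= b $ k a b" by metis
 define L where "L = (%a z. \<Prod>b\<in>A - {a}. (z $ k a b - b $ k a b) / (a $ k a b - b $ k a b))"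
 have Lh: "hol UNIV UNIV (L a)" for a
  unfolding L_def divide_inverse by (intro hol_prod hol_mult hol_diff hol_component hol_const)
 have L1: "L a a = 1" for a
  unfolding L_def using k by (intro prod.neutral) (auto)
 have L0: "L a b = 0" if "b \<in> A" "a ~= b" for a b
  unfolding L_def using assms that by (intro prod_zero bexI[of _ b]) auto
 \<comment> \<open>\<open>L a\<close> is 1 at \<open>a\<close> and 0 at the other points. So
   \<open>1 - L a z ^ N\<close> vanishes at \<open>a\<close> and its \<open>N\<close>-th power does
   so to order \<open>N\<close>; and \<open>1 - (1 - X) ^ N\<close> is divisible by X, here
   \<open>L a z ^ N\<close>, which vanishes to order \<open>N\<close> at the other points.\<close>
 define e where "e = (%a z. 1 - (1 - L a z ^ N) ^ N)"
 have eh: "hol UNIV UNIV (e a)" for a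
  unfolding e_def by (intro hol_diff hol_power hol_const Lh)
 have e1: "vo V N (%z. e a z - 1) a" for a V
 proof (cases "N = 0")
  case True
  then show ?thesis by (simp add: e_def vo_def) (intro exI[of _ 1] conjI exI[of _ "1::real"], auto)
 next
  case False
  have "vo UNIV N (%z. (1 - L a z ^ N) ^ N) a"
   by (intro vo_power vo1_entire hol_diff hol_power hol_const Lh) (simp add: L1)
  then have "vo UNIV N (%z. (- 1) * (1 - L a z ^ N) ^ N) a"
   by (rule vo_mult[of _ _ _ _ UNIV]) (auto simp: continuous_on_const)
  moreover have "(%z. (- 1) * (1 - L a z ^ N) ^ N) = (%z. e a z - 1)" by (simp add: e_def fun_eq_iff)
  ultimately have "vo UNIV N (%z. e a z - 1) a" by (simp only:)
  then show ?thesis by (rule vo_subspace) simp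
 qed
 have e0: "vo V N (e a) b" if "a \<in> A" "b \<in> A" "a ~= b" for a b V
 proof -
  have v: "vo UNIV N (%z. L a z ^ N) b"
   by (intro vo_power vo1_entire Lh) (use L0 that in auto)
  have "vo UNIV N (%z. (\<Sum>m<N. (1 - L a z ^ N) ^ m) * L a z ^ N) b"
   by (rule vo_mult[OF v, of UNIV])
    (use hol_continuous[OF Lh[of a]] in \<open>auto intro!: continuous_intros\<close>)
  moreover have "(%z. (\<Sum>m<N. (1 - L a z ^ N) ^ m) * L a z ^ N) = e a"
   using one_diff_power_eq[of "1 - L a z ^ N" N for z] by (simp add: e_def mult.commute fun_eq_iff)
  ultimately have "vo UNIV N (e a) b" by (simp only:)
  then show ?thesis by (rule vo_subspace) simp
 qed
 show ?thesis using that[of e] eh e1 e0 by blast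
qed

text \<open>Fraction-free Gaussian elimination over the holomorphic functions on a convex domain, a
  ring without zero divisors. \<open>C0\<close> is a maximal independent set of columns,
  \<open>U\<close> inverts them up to the factor \<Delta>, and \<open>a\<close> expresses the other
  columns through \<open>C0\<close>, again up to \<Delta>.\<close>

lemma hol_gauss:
 fixes G :: "nat => nat => complex^'n => complex"
 assumes V: "vec.subspace V" "ropen V D" "convex D" "D ~= {}"
  and J: "finite J" and C: "finite C" and G: "\<forall>j\<in>J. \<forall>c\<in>C. hol V D (G j c)"
 shows "\<exists>C0 \<Delta> U a. C0 \<subseteq> C & hol V D \<Delta> & (\<exists>z\<in>D. \<Delta> z ~= 0) &
  (\<forall>c\<in>C0. \<forall>j\<in>J. hol V D (U c j)) & (\<forall>c\<in>C - C0. \<forall>c'\<in>C0. hol V D (a c c')) &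
  (\<forall>c\<in>C0. \<forall>c'\<in>C0. \<forall>z\<in>D. (\<Sum>j\<in>J. U c j z * G j c' z) = (if c = c' then \<Delta> z else 0)) &
  (\<forall>c\<in>C - C0. \<forall>j\<in>J. \<forall>z\<in>D. \<Delta> z * G j c z = (\<Sum>c'\<in>C0. a c c' z * G j c' z))"
 using C G
proof (induction C rule: finite_induct)
 case empty
 then show ?case using V(4) by (intro exI[of _ "{}"] exI[of _ "%_. 1"]) auto
next
 case (insert s C)
 have "\<forall>j\<in>J. \<forall>c\<in>C. hol V D (G j c)" using insert.prems by blast
 from insert.IH[OF this] obtain C0 \<Delta> U a where IH0: "C0 \<subseteq> C" "hol V D \<Delta>" "\<exists>z\<in>D. \<Delta> z ~= 0"
   "\<forall>c\<in>C0. \<forall>j\<in>J. hol V D (U c j)" "\<forall>c\<in>C - C0. \<forall>c'\<in>C0. hol V D (a c c')"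
   "\<forall>c\<in>C0. \<forall>c'\<in>C0. \<forall>z\<in>D. (\<Sum>j\<in>J. U c j z * G j c' z) = (if c = c' then \<Delta> z else 0)"
   "\<forall>c\<in>C - C0. \<forall>j\<in>J. \<forall>z\<in>D. \<Delta> z * G j c z = (\<Sum>c'\<in>C0. a c c' z * G j c' z)"
  by (elim exE conjE) (rule that, assumption+)
 note IH = IH0(1-3) IH0(4-7)[rule_format]
 have C0: "finite C0" "s \<notin> C0" using IH(1) insert finite_subset by auto
 have Gh: "hol V D (G j c)" if "j \<in> J" "c \<in> insert s C0" for j c
  using insert.prems that IH(1) by auto
 define q where "q = (%c z. \<Sum>l\<in>J. U c l z * G l s z)"
 have qh: "hol V D (q c)" if "c \<in> C0" for c
  unfolding q_def using that by (intro hol_sum hol_mult IH Gh) auto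
 \<comment> \<open>\<Delta> times column \<open>s\<close> minus its projection to the span of
   \<open>C0\<close>. If it vanishes identically, \<open>s\<close> is dependent on
   \<open>C0\<close>; otherwise an entry of it becomes the new pivot.\<close>
 define e where "e = (%j z. \<Delta> z * G j s z - (\<Sum>c\<in>C0. q c z * G j c z))"
 have eh: "hol V D (e j)" if "j \<in> J" for j
  unfolding e_def using that by (intro hol_diff hol_sum hol_mult IH Gh qh) auto
 show ?case
 proof (cases "\<forall>j\<in>J. \<forall>z\<in>D. e j z = 0")
  case True
  define a' where "a' = (%c. if c = s then q else a c)"
  show ?thesis
  proof (rule exI[of _ C0], rule exI[of _ \<Delta>], rule exI[of _ U], rule exI[of _ a'], intro conjI ballI)
   show "hol V D (a' c c')" if "c \<in> insert s C - C0" "c' \<in> C0" for c c'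
    using that IH(5) qh by (auto simp: a'_def)
   show "\<Delta> z * G j c z = (\<Sum>c'\<in>C0. a' c c' z * G j c' z)" if "c \<in> insert s C - C0" "j \<in> J" "z \<in> D" for c j z
    using that IH(7)[of c j z] True by (auto simp: a'_def e_def)
  qed (use IH in auto)
 next
  case False
  then obtain j0 z0 where j0: "j0 \<in> J" "z0 \<in> D" "e j0 z0 ~= 0" by blast
  \<comment> \<open>A combination of the rows that annihilates the columns in \<open>C0\<close> and
    takes the value \<open>e j0\<close> on column \<open>s\<close>; it corrects the old inverse
    below.\<close>
  define w where "w = (%l z. (if l = j0 then \<Delta> z else 0) - (\<Sum>c\<in>C0. G j0 c z * U c l z))"
  have wh: "hol V D (w l)" if "l \<in> J" for l
  proof -
   have "hol V D (%z. if l = j0 then \<Delta> z else 0)" using IH(2) by (cases "l = j0") auto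
   then show ?thesis unfolding w_def using that j0 by (intro hol_diff hol_sum hol_mult IH Gh) auto
  qed
  have wsum: "(\<Sum>l\<in>J. w l z * G l c z) = \<Delta> z * G j0 c z - (\<Sum>d\<in>C0. G j0 d z * (\<Sum>l\<in>J. U d l z * G l c z))" for c z
  proof -
   have "(\<Sum>l\<in>J. w l z * G l c z) = (\<Sum>l\<in>J. if l = j0 then \<Delta> z * G j0 c z else 0) - (\<Sum>l\<in>J. \<Sum>d\<in>C0. G j0 d z * (U d l z * G l c z))"
    unfolding sum_subtractf[symmetric] w_def
    by (rule sum.cong[OF refl]) (simp add: left_diff_distrib sum_distrib_right mult.assoc)
   also have "(\<Sum>l\<in>J. \<Sum>d\<in>C0. G j0 d z * (U d l z * G l c z)) = (\<Sum>d\<in>C0. G j0 d z * (\<Sum>l\<in>J. U d l z * G l c z))"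
    unfolding sum_distrib_left by (rule sum.swap)
   finally show ?thesis using J j0 by simp
  qed
  have w0: "(\<Sum>l\<in>J. w l z * G l c z) = 0" if "c \<in> C0" "z \<in> D" for c z
  proof -
   have "(\<Sum>d\<in>C0. G j0 d z * (\<Sum>l\<in>J. U d l z * G l c z)) = (\<Sum>d\<in>C0. if d = c then G j0 c z * \<Delta> z else 0)"
    using that IH(6) by (intro sum.cong refl) auto
   then show ?thesis unfolding wsum using that C0 by simp
  qed
  have ws: "(\<Sum>l\<in>J. w l z * G l s z) = e j0 z" for z
   unfolding wsum e_def q_def by (simp add: mult.commute)
  define U' where "U' = (%c l z. if c = s then \<Delta> z * w l z else e j0 z * U c l z - q c z * w l z)"
  define a' where "a' = (%c c' z. if c' = s then 0 else e j0 z * a c c' z)"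
  define \<Delta>' where "\<Delta>' = (%z. \<Delta> z * e j0 z)"
  show ?thesis
  proof (rule exI[of _ "insert s C0"], rule exI[of _ \<Delta>'], rule exI[of _ U'], rule exI[of _ a'], intro conjI ballI)
   show "insert s C0 \<subseteq> insert s C" using IH(1) by blast
   show "hol V D \<Delta>'" unfolding \<Delta>'_def by (intro hol_mult IH eh j0)
   obtain z1 where z1: "z1 \<in> D" "\<Delta> z1 ~= 0" using IH(3) by blast
   show "\<exists>z\<in>D. \<Delta>' z ~= 0"
    using hol_mult_zero[OF V(1-3) IH(2) eh[OF j0(1)] _ z1 j0(2)] j0(3) unfolding \<Delta>'_def by blast
   show "hol V D (U' c j)" if "c \<in> insert s C0" "j \<in> J" for c j
   proof (cases "c = s")
    case True
    then show ?thesis unfolding U'_def using that by (simp add: hol_mult IH wh)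
   next
    case False
    then show ?thesis unfolding U'_def using that by (simp add: hol_mult hol_diff IH wh eh qh j0)
   qed
   show "hol V D (a' c c')" if "c \<in> insert s C - insert s C0" "c' \<in> insert s C0" for c c'
   proof (cases "c' = s")
    case True
    then show ?thesis unfolding a'_def by simp
   next
    case False
    then show ?thesis unfolding a'_def using that by (simp add: hol_mult IH eh j0)
   qed
   show "(\<Sum>j\<in>J. U' c j z * G j c' z) = (if c = c' then \<Delta>' z else 0)"
    if "c \<in> insert s C0" "c' \<in> insert s C0" "z \<in> D" for c c' z
   proof (cases "c = s")
    case True
    have "(\<Sum>j\<in>J. U' c j z * G j c' z) = \<Delta> z * (\<Sum>j\<in>J. w j z * G j c' z)"
     unfolding U'_def using True by (simp add: sum_distrib_left mult.assoc)
    then show ?thesis using w0[of c' z] ws[of z] that True C0 by (auto simp: \<Delta>'_def)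
   next
    case False
    have "(\<Sum>j\<in>J. U' c j z * G j c' z) = e j0 z * (\<Sum>j\<in>J. U c j z * G j c' z) - q c z * (\<Sum>j\<in>J. w j z * G j c' z)"
     unfolding U'_def using False by (simp add: sum_distrib_left left_diff_distrib sum_subtractf mult.assoc)
    moreover have "c \<in> C0" using that False by simp
    ultimately show ?thesis
     using w0[of c' z] ws[of z] that False C0 IH(6)[of c c' z] by (auto simp: \<Delta>'_def q_def mult.commute)
   qed
   show "\<Delta>' z * G j c z = (\<Sum>c'\<in>insert s C0. a' c c' z * G j c' z)"
    if "c \<in> insert s C - insert s C0" "j \<in> J" "z \<in> D" for c j z
   proof -
    have "(\<Sum>c'\<in>insert s C0. a' c c' z * G j c' z) = (\<Sum>c'\<in>C0. e j0 z * (a c c' z * G j c' z))"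
     using C0 by (auto simp: a'_def mult.assoc intro!: sum.cong)
    also have "\<dots> = e j0 z * (\<Delta> z * G j c z)"
     using IH(7)[of c j z] that by (auto simp: sum_distrib_left)
    finally show ?thesis by (simp add: \<Delta>'_def mult_ac)
   qed
  qed
 qed
qed

text \<open>On a line through 0 on which \<open>f\<close> is not identically zero, 0 is the only
  possible zero in a small disc; on a compact annulus this nonvanishing persists for
  \<open>x\<close> near 0. The last conclusion, about the line itself, later ensures that a single
  point lies over 0. The vector \<open>y0\<close> supplies a line in case \<open>z1\<close> is
  0.\<close>

lemma prepare_direction:
 fixes V :: "(complex^'n) set"
 assumes V: "vec.subspace V" "ropen V \<Omega>" "convex \<Omega>" "0 \<in> \<Omega>"
  and f: "hol V \<Omega> f" "z1 \<in> \<Omega>" "f z1 ~= 0" and y0: "y0 \<in> V" "y0 ~= 0"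
 obtains v i r R S where "v \<in> V" "v $ i = 1" "0 < r" "r < R"
  "ropen {x \<in> V. x $ i = 0} S" "convex S" "0 \<in> S"
  "!!x w. x \<in> S ==> cmod w < R ==> x + w *s v \<in> \<Omega>"
  "!!x w. x \<in> S ==> r <= cmod w ==> cmod w < R ==> f (x + w *s v) ~= 0"
  "!!w. 0 < cmod w ==> cmod w < R ==> f (w *s v) ~= 0"
proof -
 have OV: "\<Omega> \<subseteq> V" using V ropen_subset by blast
 obtain z2 where z2: "z2 \<in> \<Omega>" "f z2 ~= 0" "z2 ~= 0"
 proof (cases "z1 = 0")
  case False
  then show ?thesis using that f by blast
 next
  case True
  obtain e where e: "e > 0" "ball 0 e \<subseteq> {t. 0 + t *s y0 \<in> \<Omega>}"
   using ropen_line_radius[OF V(1,2,4) y0(1)] .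
  have "open {t. 0 + t *s y0 \<in> \<Omega>}" by (rule line_open) (use V y0 OV in auto)
  moreover have c: "connected {t. 0 + t *s y0 \<in> \<Omega>}" by (rule convex_connected[OF convex_line[OF V(3)]])
  ultimately obtain \<rho> where \<rho>: "\<rho> > 0" "ball 0 \<rho> \<subseteq> {t. 0 + t *s y0 \<in> \<Omega>}"
    "!!t. t \<in> ball 0 \<rho> - {0} ==> f (0 + t *s y0) ~= 0"
   using isolated_zero_radius[OF hol_line[OF V(1,2) f(1), of 0 y0], of 0] V f True y0
   by (auto simp: vec.subspace_0)
  define t where "t = complex_of_real (\<rho> / 2)"
  have "t \<in> ball 0 \<rho> - {0}" using \<rho>(1) by (simp add: t_def)
  then show ?thesis using \<rho>(2) \<rho>(3)[of t] that[of "t *s y0"] y0 by auto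
 qed
 obtain i where i: "z2 $ i ~= 0" using z2(3) by (auto simp: vec_eq_iff)
 define v where "v = (1 / z2 $ i) *s z2"
 have v: "v \<in> V" "v $ i = 1" using z2 OV V i by (auto simp: v_def vec.subspace_scale)
 have z2v: "z2 = (z2 $ i) *s v" using i by (simp add: v_def)
 define T where "T = {t. 0 + t *s v \<in> \<Omega>}"
 have T: "open T" "connected T" "0 \<in> T" "z2 $ i \<in> T"
  unfolding T_def using line_open[OF V(1,2) vec.subspace_0[OF V(1)] v(1)] convex_connected[OF convex_line[OF V(3), of 0 v]] V(4) z2 z2v
  by auto
 have fT: "(%t. f (0 + t *s v)) holomorphic_on T"
  unfolding T_def by (rule hol_line[OF V(1,2) f(1) vec.subspace_0[OF V(1)] v(1)])
 have "f (0 + (z2 $ i) *s v) ~= 0" using z2(2) z2v by simp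
 then obtain \<rho> where \<rho>: "\<rho> > 0" "ball 0 \<rho> \<subseteq> T" "!!t. t \<in> ball 0 \<rho> - {0} ==> f (0 + t *s v) ~= 0"
  using isolated_zero_radius[OF fT T] by metis
 obtain e where e: "e > 0" "!!y. y \<in> V ==> dist y 0 < e ==> y \<in> \<Omega>"
  using ropen_ballE[OF V(2,4)] by metis
 have nv: "norm v + 1 > 0" by (simp add: add_nonneg_pos)
 define R where "R = min (\<rho> / 2) (e / 2 / (norm v + 1))"
 have R: "R > 0" "R < \<rho>" "R * (norm v + 1) <= e / 2"
 proof -
  show "R > 0" "R < \<rho>" using \<rho> e nv by (auto simp: R_def)
  show "R * (norm v + 1) <= e / 2"
   unfolding pos_le_divide_eq[OF nv, symmetric] by (simp only: R_def min.cobounded2)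
 qed
 define r where "r = R / 2"
 have r: "0 < r" "r < R" using R by (auto simp: r_def)
 define V' where "V' = {x \<in> V. x $ i = 0}"
 define S0 where "S0 = V' \<inter> ball 0 (e / 2)"
 have S0: "x + w *s v \<in> \<Omega>" if "x \<in> S0" "cmod w <= R" for x w
 proof -
  have "cmod w * norm v <= R * norm v" using that by (intro mult_right_mono) auto
  then have "norm (w *s v) <= e / 2" using R by (simp add: algebra_simps)
  then have "dist (x + w *s v) 0 < e"
   using norm_triangle_ineq[of x "w *s v"] that by (simp add: S0_def)
  moreover have "x + w *s v \<in> V" using that v V by (auto simp: S0_def V'_def vec.subspace_add vec.subspace_scale)
  ultimately show ?thesis using e by blast
 qed
 define A where "A = {w::complex. r <= cmod w & cmod w <= R}"
 have "A = cball 0 R - ball 0 r" by (auto simp: A_def)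
 then have Ac: "compact A" by (simp add: compact_diff)
 have z0: "0 \<in> S0" using e V by (simp add: S0_def V'_def vec.subspace_0)
 have "\<exists>d>0. \<forall>x\<in>S0. \<forall>w\<in>A. dist x 0 < d --> f (x + w *s v) ~= 0"
 proof (rule tube_nonzero[OF _ Ac z0])
  show "continuous_on (S0 \<times> A) (%(x, w). f (x + w *s v))"
   unfolding case_prod_beta
   by (rule continuous_on_compose2[OF hol_continuous[OF f(1)]])
    (use S0 in \<open>auto intro!: continuous_intros simp: A_def\<close>)
  show "f (0 + w *s v) ~= 0" if "w \<in> A" for w
  proof -
   have "w ~= 0" using that r by (auto simp: A_def)
   then show ?thesis using \<rho>(3)[of w] that R by (auto simp: A_def)
  qed
 qed
 then obtain d where d: "d > 0" "!!x w. x \<in> S0 ==> w \<in> A ==> dist x 0 < d ==> f (x + w *s v) ~= 0" by blast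
 define S where "S = V' \<inter> ball 0 (min (e / 2) d)"
 have V's: "vec.subspace V'" using V(1) unfolding V'_def vec.subspace_def by auto
 show ?thesis
 proof
  show "ropen {x \<in> V. x $ i = 0} S" unfolding S_def V'_def by (simp add: openin_open_Int)
  show "convex S" unfolding S_def
   by (intro convex_Int convex_ball subspace_imp_convex csubspace_subspace V's)
  show "0 \<in> S" using z0 d e by (simp add: S_def S0_def)
  show "x + w *s v \<in> \<Omega>" if "x \<in> S" "cmod w < R" for x w
   by (rule S0) (use that in \<open>auto simp: S_def S0_def\<close>)
  show "f (x + w *s v) ~= 0" if "x \<in> S" "r <= cmod w" "cmod w < R" for x w
   by (rule d(2)) (use that in \<open>auto simp: S_def S0_def A_def\<close>)
  show "f (w *s v) ~= 0" if "0 < cmod w" "cmod w < R" for w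
   using \<rho>(3)[of w] that R by auto
 qed (use v r in auto)
qed

lemma ropen_ball_Int:
 fixes V :: "(complex^'n) set"
 assumes "vec.subspace V" "ropen V \<Omega>" "0 \<in> \<Omega>"
 obtains D where "ropen V D" "convex D" "0 \<in> D" "D \<subseteq> \<Omega>"
proof -
 obtain e where e: "e > 0" "!!y. y \<in> V ==> dist y 0 < e ==> y \<in> \<Omega>"
  using ropen_ballE[OF assms(2,3)] by metis
 show ?thesis
 proof
  show "ropen V (V \<inter> ball 0 e)" by (simp add: openin_open_Int)
  show "convex (V \<inter> ball 0 e)"
   by (intro convex_Int convex_ball subspace_imp_convex csubspace_subspace assms)
  show "0 \<in> V \<inter> ball 0 e" using e vec.subspace_0[OF assms(1)] by simp
  show "V \<inter> ball 0 e \<subseteq> \<Omega>" using e by auto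
 qed
qed

text \<open>The submodule generated by the columns \<open>G j\<close> is detected by approximation to a fixed finite order at all
 points: this replaces the coherence and Artin--Rees arguments.\<close>

theorem module_membership:
 fixes V :: "(complex^'n) set" and G :: "nat => nat => complex^'n => complex"
 assumes "vec.subspace V" "ropen V \<Omega>" "0 \<in> \<Omega>" "finite J" "finite C"
  and "\<forall>j\<in>J. \<forall>c\<in>C. hol V \<Omega> (G j c)"
 shows "\<exists>N D. ropen V D & convex D & 0 \<in> D & D \<subseteq> \<Omega> &
  (\<forall>g. (\<forall>c\<in>C. hol V D (g c)) &
   (\<forall>b\<in>D. \<exists>u. (\<forall>j\<in>J. hol V D (u j)) & (\<forall>c\<in>C. vo V N (%z. g c z - (\<Sum>j\<in>J. u j z * G j c z)) b)) -->
   (\<exists>u. (\<forall>j\<in>J. hol V D (u j)) & (\<forall>c\<in>C. \<forall>z\<in>D. g c z = (\<Sum>j\<in>J. u j z * G j c z))))"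
 using assms
proof (induction "dim V" arbitrary: V \<Omega> J C G rule: less_induct)
 case less
 note sub = less.prems(1) and Om = less.prems(2,3) and fin = less.prems(4,5) and Gh = less.prems(6)[rule_format]
 have OV: "\<Omega> \<subseteq> V" using Om ropen_subset by blast
 show ?case
 proof (cases "\<exists>y\<in>V. y ~= 0")
  case False
  then have V0: "V = {0}" using vec.subspace_0[OF sub] by blast
  show ?thesis
  proof (rule exI[of _ 1], rule exI[of _ V], intro conjI allI impI)
   show "ropen V V" by simp
   show "convex V" "0 \<in> V" "V \<subseteq> \<Omega>" using V0 Om by auto
   fix g
   assume g: "(\<forall>c\<in>C. hol V V (g c)) &
    (\<forall>b\<in>V. \<exists>u. (\<forall>j\<in>J. hol V V (u j)) & (\<forall>c\<in>C. vo V 1 (%z. g c z - (\<Sum>j\<in>J. u j z * G j c z)) b))"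
   then obtain u where u: "\<forall>j\<in>J. hol V V (u j)" "!!c. c \<in> C ==> vo V 1 (%z. g c z - (\<Sum>j\<in>J. u j z * G j c z)) 0"
    using V0 by blast
   have "g c z = (\<Sum>j\<in>J. u j z * G j c z)" if "c \<in> C" "z \<in> V" for c z
    using vo_zero_at[OF u(2)[OF that(1)]] that V0 by simp
   then show "\<exists>u. (\<forall>j\<in>J. hol V V (u j)) & (\<forall>c\<in>C. \<forall>z\<in>V. g c z = (\<Sum>j\<in>J. u j z * G j c z))"
    using u(1) by blast
  qed
 next
  case True
  then obtain y0 where y0: "y0 \<in> V" "y0 ~= 0" by blast
  obtain D0 where D0: "ropen V D0" "convex D0" "0 \<in> D0" "D0 \<subseteq> \<Omega>"
   using ropen_ball_Int[OF sub Om] .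
  have Gh0: "hol V D0 (G j c)" if "j \<in> J" "c \<in> C" for j c
   using hol_subset[OF Gh[OF that] D0(4)] .
  have Gall: "\<forall>j\<in>J. \<forall>c\<in>C. hol V D0 (G j c)" using Gh0 by blast
  have D0ne: "D0 ~= {}" using D0(3) by blast
  \<comment> \<open>On the columns \<open>C0\<close> the module contains every vector divisible by
    \<Delta>, since \<open>U\<close> inverts \<open>G\<close> up to \<Delta>. So membership is a
    question modulo \<Delta>, and Weierstrass division by \<Delta> lowers the dimension.\<close>
  from hol_gauss[OF sub D0(1,2) D0ne fin Gall]
  obtain C0 \<Delta> U a where C00: "C0 \<subseteq> C" and \<Delta>h: "hol V D0 \<Delta>" and \<Delta>nz: "\<exists>z\<in>D0. \<Delta> z ~= 0"
   and IU: "\<forall>c\<in>C0. \<forall>j\<in>J. hol V D0 (U c j)" "\<forall>c\<in>C - C0. \<forall>c'\<in>C0. hol V D0 (a c c')"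
   "\<forall>c\<in>C0. \<forall>c'\<in>C0. \<forall>z\<in>D0. (\<Sum>j\<in>J. U c j z * G j c' z) = (if c = c' then \<Delta> z else 0)"
   "\<forall>c\<in>C - C0. \<forall>j\<in>J. \<forall>z\<in>D0. \<Delta> z * G j c z = (\<Sum>c'\<in>C0. a c c' z * G j c' z)"
   by (elim exE conjE) (rule that, assumption+)
  have C0f: "finite C0" using C00 fin finite_subset by blast
  obtain z1 where z1: "z1 \<in> D0" "\<Delta> z1 ~= 0" using \<Delta>nz by blast
  obtain v i r R S where v: "v \<in> V" "v $ i = 1" and rR: "0 < r" "r < R"
   and S: "ropen {x \<in> V. x $ i = 0} S" "convex S" "0 \<in> S"
   and Sin: "!!x w. x \<in> S ==> cmod w < R ==> x + w *s v \<in> D0"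
   and Snz: "!!x w. x \<in> S ==> r <= cmod w ==> cmod w < R ==> \<Delta> (x + w *s v) ~= 0"
   by (rule prepare_direction[OF sub D0(1,2,3) \<Delta>h z1 y0]) blast
  define V' where "V' = {x \<in> V. x $ i = 0}"
  have V's: "vec.subspace V'" using sub unfolding V'_def vec.subspace_def by auto
  have Veq: "{x + w *s v | x w. x \<in> V'} = V"
  proof
   show "{x + w *s v | x w. x \<in> V'} \<subseteq> V"
    using sub v by (auto simp: V'_def vec.subspace_add vec.subspace_scale)
   show "V \<subseteq> {x + w *s v | x w. x \<in> V'}"
   proof
    fix z assume z: "z \<in> V"
    have "z = (z - (z $ i) *s v) + (z $ i) *s v" by simp
    moreover have "z - (z $ i) *s v \<in> V'"
     using z v sub by (simp add: V'_def vec.subspace_diff vec.subspace_scale)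
    ultimately show "z \<in> {x + w *s v | x w. x \<in> V'}" by blast
   qed
  qed
  have dim: "dim V' < dim V"
  proof (rule dim_psubset)
   have "span V' = V'" "span V = V" using V's sub csubspace_subspace span_eq_iff by blast+
   moreover have "V' \<subset> V"
   proof -
    have "v \<notin> V'" "V' \<subseteq> V" using v by (auto simp: V'_def)
    then show ?thesis using v by blast
   qed
   ultimately show "span V' \<subset> span V" by (simp only:)
  qed
  have cylD0: "{x + w *s v | x w. x \<in> S & cmod w < R} \<subseteq> D0" using Sin by blast
  interpret A: weierstrass V' v i S r R \<Delta>
  proof
   show "ropen V' S" using S by (simp add: V'_def)
   show "hol {x + w *s v |x w. x \<in> V'} {x + w *s v |x w. x \<in> S & cmod w < R} \<Delta>"
    unfolding Veq by (rule hol_subset[OF \<Delta>h cylD0])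
  qed (use V's v S rR Snz in \<open>auto simp: V'_def\<close>)
  have AW: "A.W = V" unfolding A.W_def by (rule Veq)
  have Ac: "A.cyl \<subseteq> D0" unfolding A.cyl_def by (rule cylD0)
  \<comment> \<open>Modulo \<Delta> a function on the cylinder is a vector of \<open>A.K\<close>
    remainder coefficients. So each generator yields one generator for every power of the
    coordinate, and each column one column for every coefficient; pairs are encoded to stay with
    indices in \<open>nat\<close>.\<close>
  define J' where "J' = prod_encode ` (J \<times> {..<A.K})"
  define C' where "C' = prod_encode ` (C0 \<times> {..<A.K})"
  define G' where "G' = (%j' c'. A.rem (%z. (z $ i) ^ snd (prod_decode j') * G (fst (prod_decode j')) (fst (prod_decode c')) z) (snd (prod_decode c')))"
  have G'h: "hol V' S (G' j c)" if "j \<in> J'" "c \<in> C'" for j c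
   unfolding G'_def
   by (intro A.rem_hol hol_mult hol_power hol_component, unfold AW, rule hol_subset[OF Gh0 Ac])
    (use that C00 in \<open>auto simp: J'_def C'_def\<close>)
  have J'C': "finite J'" "finite C'" using fin C0f by (auto simp: J'_def C'_def)
  have G'h2: "\<forall>j\<in>J'. \<forall>c\<in>C'. hol V' S (G' j c)" using G'h by blast
  from less.hyps[OF dim V's S(1)[folded V'_def] S(3) J'C' G'h2]
  obtain N' D' where D': "ropen V' D'" "convex D'" "0 \<in> D'" "D' \<subseteq> S"
   and IH0: "\<forall>g. (\<forall>c\<in>C'. hol V' D' (g c)) &
    (\<forall>b\<in>D'. \<exists>u. (\<forall>j\<in>J'. hol V' D' (u j)) & (\<forall>c\<in>C'. vo V' N' (%z. g c z - (\<Sum>j\<in>J'. u j z * G' j c z)) b)) -->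
    (\<exists>u. (\<forall>j\<in>J'. hol V' D' (u j)) & (\<forall>c\<in>C'. \<forall>z\<in>D'. g c z = (\<Sum>j\<in>J'. u j z * G' j c z)))"
   by (elim exE conjE) (rule that, assumption+)
  note IH = IH0[THEN spec, THEN mp, OF conjI]
  \<comment> \<open>The induction returns a smaller base \<open>D'\<close>. Division over
    \<open>D'\<close> has the same degree and the same remainders, so \<open>G'\<close>, computed
    over \<open>S\<close>, stays valid.\<close>
  interpret B: weierstrass V' v i D' r R \<Delta>
  proof
   show "hol {x + w *s v |x w. x \<in> V'} {x + w *s v |x w. x \<in> D' & cmod w < R} \<Delta>"
    unfolding Veq by (rule hol_subset[OF \<Delta>h]) (use D'(4) Sin in blast)
  qed (use V's v D' rR Snz in \<open>auto simp: V'_def\<close>)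
  have BW: "B.W = V" unfolding B.W_def by (rule Veq)
  define D where "D = B.cyl"
  have D: "ropen V D" "convex D" "0 \<in> D" "D \<subseteq> D0"
  proof -
   show "ropen V D" unfolding D_def using B.cyl_open BW by simp
   show "convex D" unfolding D_def by (rule B.cyl_convex)
   show "0 \<in> D" unfolding D_def using B.S_cyl D'(3) by blast
   show "D \<subseteq> D0" unfolding D_def B.cyl_def using D'(4) Sin by blast
  qed
  have KK: "B.K = A.K" using B.mu_sum[OF D'(3)] A.mu_sum[OF S(3)] by simp
  have remeq: "A.rem g l x = B.rem g l x" for g l x
   unfolding A.rem_def B.rem_def A.Bk_def B.Bk_def KK ..
  \<comment> \<open>\<open>rem_order\<close> turns order \<open>(K + 1) * N'\<close> into
    \<open>N'\<close>. The extra 1 makes the approximations exact at their point even if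
    \<open>N' = 0\<close>, as the columns outside \<open>C0\<close> require.\<close>
  define N where "N = (A.K + 1) * N' + 1"
  show ?thesis
  proof (intro exI[of _ N] exI[of _ D] conjI allI impI)
   show "ropen V D" "convex D" "0 \<in> D" "D \<subseteq> \<Omega>" using D D0 by auto
   fix g
   assume "(\<forall>c\<in>C. hol V D (g c)) &
    (\<forall>b\<in>D. \<exists>u. (\<forall>j\<in>J. hol V D (u j)) & (\<forall>c\<in>C. vo V N (%z. g c z - (\<Sum>j\<in>J. u j z * G j c z)) b))"
   then have gh: "!!c. c \<in> C ==> hol V D (g c)"
    and gv: "!!b. b \<in> D ==> \<exists>u. (\<forall>j\<in>J. hol V D (u j)) & (\<forall>c\<in>C. vo V N (%z. g c z - (\<Sum>j\<in>J. u j z * G j c z)) b)"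
    by blast+
   have GhD: "hol V D (G j c)" if "j \<in> J" "c \<in> C" for j c
    using hol_subset[OF Gh0[OF that] D(4)] .
   have gW: "hol B.W B.cyl (g c)" if "c \<in> C0" for c
    using gh that C00 unfolding BW D_def by blast
   have GW: "hol B.W B.cyl (G j c)" if "j \<in> J" "c \<in> C0" for j c
    using GhD[OF that(1)] that C00 unfolding BW D_def by blast
   define g' where "g' = (%c'. B.rem (g (fst (prod_decode c'))) (snd (prod_decode c')))"
   have sumJ: "(\<Sum>j'\<in>J'. F (fst (prod_decode j')) (snd (prod_decode j'))) = (\<Sum>j\<in>J. \<Sum>m<A.K. F j m)" for F :: "nat => nat => complex"
    unfolding J'_def by (subst sum.reindex) (auto simp: inj_prod_encode sum.cartesian_product intro!: sum.cong)
   have "\<exists>u. (\<forall>j\<in>J'. hol V' D' (u j)) & (\<forall>c\<in>C'. \<forall>z\<in>D'. g' c z = (\<Sum>j\<in>J'. u j z * G' j c z))"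
   proof (rule IH)
    show "\<forall>c\<in>C'. hol V' D' (g' c)"
     unfolding g'_def C'_def by (auto intro!: B.rem_hol gW)
    show "\<forall>b\<in>D'. \<exists>u. (\<forall>j\<in>J'. hol V' D' (u j)) & (\<forall>c\<in>C'. vo V' N' (%z. g' c z - (\<Sum>j\<in>J'. u j z * G' j c z)) b)"
    proof
     fix b assume b: "b \<in> D'"
     \<comment> \<open>The remainder at \<open>b\<close> depends on all zeros of \<Delta> over
       \<open>b\<close>, so the approximations given at these finitely many points are merged into
       one by interpolation.\<close>
     define pts where "pts = (%t. b + t *s v) ` B.zr b"
     have ptsD: "pts \<subseteq> D" unfolding pts_def D_def B.zr_def using b B.cylI by auto
     have ptsf: "finite pts" unfolding pts_def using B.zr_finite[OF b] by simp
     have "\<forall>p. \<exists>u. p \<in> pts --> (\<forall>j\<in>J. hol V D (u j)) & (\<forall>c\<in>C. vo V N (%z. g c z - (\<Sum>j\<in>J. u j z * G j c z)) p)"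
      using gv ptsD by blast
     from choice[OF this] obtain u where u0: "\<forall>p. p \<in> pts -->
      (\<forall>j\<in>J. hol V D (u p j)) & (\<forall>c\<in>C. vo V N (%z. g c z - (\<Sum>j\<in>J. u p j z * G j c z)) p)" ..
     obtain e where e: "!!p. hol UNIV UNIV (e p)" "!!p V. p \<in> pts ==> vo V N (%z. e p z - 1) p"
      "!!p q V. p \<in> pts ==> q \<in> pts ==> p ~= q ==> vo V N (e p) q"
      using interpolation[OF ptsf, of N thesis] by blast
     have eD: "hol V D (e p)" for p
      by (rule hol_subset[OF hol_subspace[OF e(1)]]) auto
     define y where "y = (%j z. \<Sum>p\<in>pts. e p z * u p j z)"
     have yh: "hol V D (y j)" if "j \<in> J" for j
      unfolding y_def using that u0 by (intro hol_sum hol_mult eD) auto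
     have vo_h: "vo V N (%z. g c z - (\<Sum>j\<in>J. y j z * G j c z)) p" if c: "c \<in> C0" and p: "p \<in> pts" for c p
     proof -
      have cC: "c \<in> C" using c C00 by blast
      have pD: "p \<in> D" using p ptsD by blast
      define w where "w = (%q z. \<Sum>j\<in>J. u q j z * G j c z)"
      have wh: "hol V D (w q)" if "q \<in> pts" for q
       unfolding w_def using that cC u0 by (intro hol_sum hol_mult GhD) auto
      have 1: "vo V N (%z. g c z - w p z) p" unfolding w_def using u0 p cC by blast
      have 2: "vo V N (%z. (- w p z) * (e p z - 1)) p"
       by (rule vo_mult[OF e(2)[OF p] _ D(1) pD]) (rule hol_continuous[OF hol_uminus[OF wh[OF p]]])
      have 3: "vo V N (%z. \<Sum>q\<in>pts - {p}. (- w q z) * e q z) p"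
      proof (rule vo_sum)
       fix q assume q: "q \<in> pts - {p}"
       show "vo V N (%z. (- w q z) * e q z) p"
        by (rule vo_mult[OF e(3) _ D(1) pD]) (use q p hol_continuous[OF hol_uminus[OF wh]] in auto)
      qed
      have eq: "g c z - (\<Sum>j\<in>J. y j z * G j c z) =
       (g c z - w p z) + (- w p z) * (e p z - 1) + (\<Sum>q\<in>pts - {p}. (- w q z) * e q z)" for z
      proof -
       have "(\<Sum>j\<in>J. y j z * G j c z) = (\<Sum>j\<in>J. \<Sum>q\<in>pts. e q z * (u q j z * G j c z))"
        unfolding y_def sum_distrib_right by (simp add: mult.assoc)
       also have "\<dots> = (\<Sum>q\<in>pts. e q z * w q z)"
        unfolding w_def sum_distrib_left by (rule sum.swap)
       also have "\<dots> = e p z * w p z + (\<Sum>q\<in>pts - {p}. e q z * w q z)"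
        using ptsf p by (simp add: sum.remove)
       finally show ?thesis by (simp add: algebra_simps sum_negf)
      qed
      show ?thesis unfolding eq by (rule vo_add[OF vo_add[OF 1 2] 3])
     qed
     define u' where "u' = (%j'. B.rem (y (fst (prod_decode j'))) (snd (prod_decode j')))"
     have yW: "hol B.W B.cyl (y j)" if "j \<in> J" for j using yh[OF that] unfolding BW D_def .
     have u'h: "\<forall>j\<in>J'. hol V' D' (u' j)"
      unfolding u'_def J'_def by (auto intro!: B.rem_hol yW)
     moreover have "vo V' N' (%z. g' c' z - (\<Sum>j\<in>J'. u' j z * G' j c' z)) b" if c': "c' \<in> C'" for c'
     proof -
      obtain c l where cl: "c \<in> C0" "l < A.K" "c' = prod_encode (c, l)" using c' by (auto simp: C'_def)
      define h where "h = (%z. g c z - (\<Sum>j\<in>J. y j z * G j c z))"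
      have hW: "hol B.W B.cyl h"
       unfolding h_def by (intro hol_diff hol_sum hol_mult gW yW GW cl)
      have "vo V' N' (B.rem h l) b"
      proof (rule B.rem_order[OF b hW])
       fix t assume "t \<in> B.zr b"
       then have p: "b + t *s v \<in> pts" by (auto simp: pts_def)
       obtain Ch d where Ch: "d > 0" "Ch >= 0" "!!z. z \<in> V ==> dist z (b + t *s v) < d ==> cmod (h z) <= Ch * norm (z - (b + t *s v)) ^ N"
        using vo_h[OF cl(1) p, folded h_def] by (elim voE) blast
       have "cmod (h z) <= Ch * norm (z - (b + t *s v)) ^ ((B.K + 1) * N')"
        if z: "z \<in> V" "dist z (b + t *s v) < min d 1" for z
       proof -
        have "norm (z - (b + t *s v)) ^ N <= norm (z - (b + t *s v)) ^ ((B.K + 1) * N')"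
         by (rule power_decreasing) (use z KK in \<open>auto simp: N_def dist_norm\<close>)
        then show ?thesis using Ch(3)[of z] z Ch(2) by (meson min_less_iff_conj mult_left_mono order_trans)
       qed
       then show "vo B.W ((B.K + 1) * N') h (b + t *s v)"
        unfolding vo_def BW using Ch(1) by (intro exI[of _ Ch] exI[of _ "min d 1"]) auto
      qed
      moreover have "B.rem h l x = g' c' x - (\<Sum>j\<in>J'. u' j x * G' j c' x)" if x: "x \<in> D'" for x
      proof -
       have "B.rem h l x = B.rem (g c) l x - B.rem (%z. \<Sum>j\<in>J. y j z * G j c z) l x"
        unfolding h_def by (intro B.rem_diff hol_sum hol_mult gW yW GW cl x)
       also have "B.rem (%z. \<Sum>j\<in>J. y j z * G j c z) l x = (\<Sum>j\<in>J. B.rem (%z. y j z * G j c z) l x)"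
        by (intro B.rem_sum fin hol_mult yW GW cl x)
       also have "\<dots> = (\<Sum>j\<in>J. \<Sum>m<A.K. B.rem (y j) m x * B.rem (%z. (z $ i) ^ m * G j c z) l x)"
        unfolding KK[symmetric] by (intro sum.cong refl B.rem_mult yW GW cl x)
       also have "\<dots> = (\<Sum>j\<in>J'. u' j x * G' j c' x)"
        unfolding u'_def G'_def sumJ[symmetric] by (simp add: cl(3) remeq)
       finally show ?thesis by (simp add: g'_def cl(3))
      qed
      ultimately show ?thesis by (rule vo_cong[OF _ D'(1) b])
     qed
     ultimately show "\<exists>u. (\<forall>j\<in>J'. hol V' D' (u j)) & (\<forall>c\<in>C'. vo V' N' (%z. g' c z - (\<Sum>j\<in>J'. u j z * G' j c z)) b)"
      by blast
    qed
   qed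
   then obtain y where y: "!!j. j \<in> J' ==> hol V' D' (y j)"
    "!!c z. c \<in> C' ==> z \<in> D' ==> g' c z = (\<Sum>j\<in>J'. y j z * G' j c z)" by blast
   \<comment> \<open>The solution over the base, read as polynomials in the coordinate along
     \<open>v\<close>. What it leaves has remainder 0, that is, it is a multiple of
     \<Delta>.\<close>
   define Y where "Y = (%j z. \<Sum>m<A.K. y (prod_encode (j, m)) (B.pr z) * (z $ i) ^ m)"
   have YW: "hol B.W B.cyl (Y j)" if "j \<in> J" for j
    unfolding Y_def using that
    by (intro hol_sum hol_mult hol_power hol_component B.hol_pr y) (auto simp: J'_def)
   define h where "h = (%c z. g c z - (\<Sum>j\<in>J. Y j z * G j c z))"
   have hW: "hol B.W B.cyl (h c)" if "c \<in> C0" for c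
    unfolding h_def using that by (intro hol_diff hol_sum hol_mult gW YW GW)
   have rem0: "B.rem (h c) l x = 0" if cl: "c \<in> C0" "l < A.K" and x: "x \<in> D'" for c l x
   proof -
    have trm: "B.rem (%z. Y j z * G j c z) l x = (\<Sum>m<A.K. y (prod_encode (j, m)) x * B.rem (%z. (z $ i) ^ m * G j c z) l x)"
     if j: "j \<in> J" for j
    proof -
     have "B.rem (%z. Y j z * G j c z) l x = B.rem (%z. \<Sum>m<A.K. y (prod_encode (j, m)) (B.pr z) * ((z $ i) ^ m * G j c z)) l x"
      by (simp add: Y_def sum_distrib_right mult.assoc)
     also have "\<dots> = (\<Sum>m<A.K. B.rem (%z. y (prod_encode (j, m)) (B.pr z) * ((z $ i) ^ m * G j c z)) l x)"
      by (rule B.rem_sum[OF finite_lessThan _ x])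
       (use j cl in \<open>auto simp: J'_def intro!: hol_mult hol_power hol_component B.hol_pr y GW\<close>)
     also have "\<dots> = (\<Sum>m<A.K. y (prod_encode (j, m)) x * B.rem (%z. (z $ i) ^ m * G j c z) l x)"
      by (rule sum.cong[OF refl], rule B.rem_scale[OF x])
     finally show ?thesis .
    qed
    have "B.rem (h c) l x = B.rem (g c) l x - B.rem (%z. \<Sum>j\<in>J. Y j z * G j c z) l x"
     unfolding h_def by (intro B.rem_diff hol_sum hol_mult gW YW GW cl x)
    also have "B.rem (%z. \<Sum>j\<in>J. Y j z * G j c z) l x = (\<Sum>j\<in>J. B.rem (%z. Y j z * G j c z) l x)"
     by (intro B.rem_sum fin hol_mult YW GW cl x)
    also have "\<dots> = (\<Sum>j\<in>J. \<Sum>m<A.K. y (prod_encode (j, m)) x * B.rem (%z. (z $ i) ^ m * G j c z) l x)"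
     by (intro sum.cong refl trm)
    also have "\<dots> = (\<Sum>j\<in>J'. y j x * G' j (prod_encode (c, l)) x)"
     unfolding G'_def sumJ[symmetric] by (simp add: remeq)
    also have "\<dots> = g' (prod_encode (c, l)) x"
     by (rule y(2)[symmetric]) (use cl x in \<open>auto simp: C'_def\<close>)
    finally show ?thesis by (simp add: g'_def)
   qed
   obtain Ut where Ut: "hol B.W B.cyl Ut" "!!z. z \<in> B.cyl ==> B.P z = \<Delta> z * Ut z"
    using B.unit_exists by blast
   have "\<forall>c. \<exists>q. c \<in> C0 --> hol V D q & (\<forall>z\<in>D. h c z = \<Delta> z * q z)"
   proof (intro allI impI)
    fix c
    show "\<exists>q. c \<in> C0 --> hol V D q & (\<forall>z\<in>D. h c z = \<Delta> z * q z)"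
    proof (cases "c \<in> C0")
     case True
     obtain q where q: "hol B.W B.cyl q" "!!z. z \<in> B.cyl ==> h c z = B.P z * q z + (\<Sum>l<B.K. B.rem (h c) l (B.pr z) * (z $ i) ^ l)"
      using B.division[OF hW[OF True]] by blast
     have "h c z = \<Delta> z * (Ut z * q z)" if "z \<in> B.cyl" for z
      using q(2)[OF that] Ut(2)[OF that] rem0[OF True] B.cyl_iff that KK by (simp add: mult.assoc)
     moreover have "hol V D (%z. Ut z * q z)"
      using hol_mult[OF Ut(1) q(1)] unfolding BW D_def .
     ultimately show ?thesis unfolding D_def by blast
    qed simp
   qed
   then obtain q where q: "!!c. c \<in> C0 ==> hol V D (q c)" "!!c z. c \<in> C0 ==> z \<in> D ==> h c z = \<Delta> z * q c z"
    by metis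
   \<comment> \<open>The leftover \<open>\<Delta> z * q c z\<close> in the columns of
     \<open>C0\<close> is the combination with coefficients \<open>q c z * U c j z\<close>.\<close>
   define x where "x = (%j z. Y j z + (\<Sum>c\<in>C0. q c z * U c j z))"
   have xh: "hol V D (x j)" if "j \<in> J" for j
    unfolding x_def using YW[OF that] IU(1) that D(4)
    by (intro hol_add hol_sum hol_mult q) (auto simp: BW D_def intro: hol_subset)
   have xC0: "g c z = (\<Sum>j\<in>J. x j z * G j c z)" if c: "c \<in> C0" and z: "z \<in> D" for c z
   proof -
    have "(\<Sum>j\<in>J. x j z * G j c z) = (\<Sum>j\<in>J. Y j z * G j c z) + (\<Sum>j\<in>J. \<Sum>d\<in>C0. q d z * (U d j z * G j c z))"
     unfolding x_def by (simp add: distrib_right sum.distrib sum_distrib_right mult.assoc)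
    also have "(\<Sum>j\<in>J. \<Sum>d\<in>C0. q d z * (U d j z * G j c z)) = (\<Sum>d\<in>C0. q d z * (\<Sum>j\<in>J. U d j z * G j c z))"
     unfolding sum_distrib_left by (rule sum.swap)
    also have "\<dots> = (\<Sum>d\<in>C0. if d = c then q c z * \<Delta> z else 0)"
     using IU(3) c z D(4) by (intro sum.cong refl) auto
    also have "\<dots> = q c z * \<Delta> z" using c C0f by simp
    finally show ?thesis using q(2)[OF c z] by (simp add: h_def algebra_simps)
   qed
   \<comment> \<open>The relation between the columns holds for \<open>g\<close> at every point
     because the approximations are exact at their points; then \<Delta> cancels by
     \<open>hol_mult_zero\<close>.\<close>
   have xC: "g c z = (\<Sum>j\<in>J. x j z * G j c z)" if c: "c \<in> C - C0" and z: "z \<in> D" for c z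
   proof -
    have cC: "c \<in> C" using c by blast
    have rel: "\<Delta> z * (\<Sum>j\<in>J. u j z * G j c z) = (\<Sum>d\<in>C0. a c d z * (\<Sum>j\<in>J. u j z * G j d z))" if z: "z \<in> D" for z u
    proof -
     have "\<Delta> z * (\<Sum>j\<in>J. u j z * G j c z) = (\<Sum>j\<in>J. u j z * (\<Delta> z * G j c z))"
      by (simp add: sum_distrib_left mult_ac)
     also have "\<dots> = (\<Sum>j\<in>J. \<Sum>d\<in>C0. a c d z * (u j z * G j d z))"
     proof (rule sum.cong[OF refl])
      fix j assume "j \<in> J"
      then have "\<Delta> z * G j c z = (\<Sum>d\<in>C0. a c d z * G j d z)" using IU(4) c z D(4) by blast
      then show "u j z * (\<Delta> z * G j c z) = (\<Sum>d\<in>C0. a c d z * (u j z * G j d z))"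
       by (simp add: sum_distrib_left mult_ac)
     qed
     also have "\<dots> = (\<Sum>d\<in>C0. a c d z * (\<Sum>j\<in>J. u j z * G j d z))"
      unfolding sum_distrib_left by (rule sum.swap)
     finally show ?thesis .
    qed
    have 1: "\<Delta> b * g c b = (\<Sum>d\<in>C0. a c d b * g d b)" if b: "b \<in> D" for b
    proof -
     obtain u where u: "!!c. c \<in> C ==> vo V N (%z. g c z - (\<Sum>j\<in>J. u j z * G j c z)) b"
      using gv[OF b] by blast
     have bV: "b \<in> V" using b D(1) ropen_subset by blast
     have "g c b = (\<Sum>j\<in>J. u j b * G j c b)" if "c \<in> C" for c
      using vo_zero_at[OF u[OF that] _ bV] by (simp add: N_def)
     then show ?thesis using rel[OF b, of u] C00 cC by (auto intro!: sum.cong)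
    qed
    have 2: "\<Delta> y * (g c y - (\<Sum>j\<in>J. x j y * G j c y)) = 0" if y: "y \<in> D" for y
     using 1[OF y] rel[OF y, of x] xC0[OF _ y] by (simp add: right_diff_distrib)
    have "hol V D (%y. g c y - (\<Sum>j\<in>J. x j y * G j c y))"
     by (intro hol_diff hol_sum hol_mult gh xh GhD cC)
    moreover have "\<exists>y\<in>D. \<Delta> y ~= 0"
     using D'(3) B.f_pt_nonzero[OF D'(3)] B.cylI[OF D'(3)] unfolding D_def by auto
    ultimately have "g c z - (\<Sum>j\<in>J. x j z * G j c z) = 0"
     using hol_mult_zero[OF sub D(1,2) hol_subset[OF \<Delta>h D(4)] _ 2 _ _ z] by blast
    then show ?thesis by simp
   qed
   show "\<exists>u. (\<forall>j\<in>J. hol V D (u j)) & (\<forall>c\<in>C. \<forall>z\<in>D. g c z = (\<Sum>j\<in>J. u j z * G j c z))"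
    using xh xC0 xC by blast
  qed
 qed
qed

section \<open>Branched covers by elimination\<close>

definition EI :: "'n set => (complex^'n) set" where
 "EI I = {y. \<forall>j. j \<notin> I --> y $ j = 0}"

definition pI :: "'n set => complex^'n => complex^'n" where
 "pI I y = (\<chi> j. if j \<in> I then y $ j else 0)"

abbreviation ax :: "'n => complex^'n" where "ax j \<equiv> axis j 1"

lemma pI_nth [simp]: "pI I y $ j = (if j \<in> I then y $ j else 0)"
 by (simp add: pI_def)

lemma ax_nth [simp]: "ax j $ k = (if k = j then 1 else 0)"
 by (simp add: axis_def)

lemma pI_EI [simp]: "pI I y \<in> EI I"
 by (simp add: EI_def)

lemma EI_subspace [simp]: "vec.subspace (EI I)"
 by (auto simp: vec.subspace_def EI_def)

lemma pI_id: "x \<in> EI I ==> pI I x = x"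
 by (auto simp: EI_def vec_eq_iff)

lemma EI_mono: "I \<subseteq> J ==> EI I \<subseteq> EI J"
 by (auto simp: EI_def)

lemma EI_UNIV [simp]: "EI UNIV = UNIV"
 by (simp add: EI_def)

lemma pI_line: "pI I (z + t *s u) = pI I z + t *s pI I u"
 by (simp add: vec_eq_iff)

lemma continuous_pI [continuous_intros]:
 "continuous_on S f ==> continuous_on S (%x. pI I (f x))"
proof -
 assume f: "continuous_on S f"
 have "continuous_on S (%x. if j \<in> I then f x $ j else 0)" for j
  using f by (cases "j \<in> I") (auto intro!: continuous_intros)
 then show ?thesis unfolding pI_def by (intro continuous_on_vec_lambda)
qed

definition Om :: "'n set => (complex^'n) set => ('n => real) => (complex^'n) set" where
 "Om I D r = {y. pI I y \<in> D & (\<forall>j. j \<notin> I --> cmod (y $ j) < r j)}"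

definition Tb :: "'n => (complex^'n) set => real => (complex^'n) set" where
 "Tb j D \<rho> = {x + w *s ax j | x w. x \<in> D & cmod w < \<rho>}"

lemma EI_insert: "j \<notin> I ==> {x + w *s ax j | x w. x \<in> EI I} = EI (insert j I)"
proof
 assume j: "j \<notin> I"
 show "{x + w *s ax j | x w. x \<in> EI I} \<subseteq> EI (insert j I)" by (auto simp: EI_def)
 show "EI (insert j I) \<subseteq> {x + w *s ax j | x w. x \<in> EI I}"
 proof
  fix z assume z: "z \<in> EI (insert j I)"
  then have "z = pI I z + (z $ j) *s ax j" using j by (auto simp: vec_eq_iff EI_def)
  then show "z \<in> {x + w *s ax j | x w. x \<in> EI I}" using pI_EI by blast
 qed
qed

text \<open>A tower presents \<open>X\<close> near \<open>0\<close> as a set finite over the zero set of \<open>F\<close> in the coordinate space \<open>EI I\<close>: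
 each remaining coordinate is a root of an equation \<open>Q j\<close> over \<open>EI I\<close>. The functions \<open>H\<close> define \<open>X\<close>.\<close>

definition tower ::
 "(complex^'n) set => 'n set => (complex^'n) set => ('n => real) => ('n => real) =>
  ('n => complex^'n => complex) => (complex^'n => complex) set => (complex^'n => complex) set => bool" where
 "tower X I D s r Q H F \<longleftrightarrow>
  ropen (EI I) D & convex D & 0 \<in> D & 0 \<in> X & finite H & finite F &
  (\<forall>h\<in>H. hol UNIV (Om I D r) h) & X \<inter> Om I D r = {y \<in> Om I D r. \<forall>h\<in>H. h y = 0} &
  (\<forall>f\<in>F. hol (EI I) D f) & pI I ` (X \<inter> Om I D r) = {x \<in> D. \<forall>f\<in>F. f x = 0} &
  (\<forall>j. j \<notin> I --> 0 < s j & s j < r j & hol (EI (insert j I)) (Tb j D (r j)) (Q j) &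
   (\<forall>x\<in>D. \<forall>w. s j <= cmod w & cmod w < r j --> Q j (x + w *s ax j) ~= 0) &
   (\<forall>w. 0 < cmod w & cmod w < r j --> Q j (w *s ax j) ~= 0) &
   (\<forall>y\<in>X \<inter> Om I D r. Q j (pI I y + (y $ j) *s ax j) = 0))"

lemma towerD:
 assumes "tower X I D s r Q H F"
 shows "ropen (EI I) D" "convex D" "0 \<in> D" "0 \<in> X" "finite H" "finite F"
  "\<forall>h\<in>H. hol UNIV (Om I D r) h" "X \<inter> Om I D r = {y \<in> Om I D r. \<forall>h\<in>H. h y = 0}"
  "\<forall>f\<in>F. hol (EI I) D f" "pI I ` (X \<inter> Om I D r) = {x \<in> D. \<forall>f\<in>F. f x = 0}"
  "\<forall>j. j \<notin> I --> 0 < s j & s j < r j & hol (EI (insert j I)) (Tb j D (r j)) (Q j) &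
   (\<forall>x\<in>D. \<forall>w. s j <= cmod w & cmod w < r j --> Q j (x + w *s ax j) ~= 0) &
   (\<forall>w. 0 < cmod w & cmod w < r j --> Q j (w *s ax j) ~= 0) &
   (\<forall>y\<in>X \<inter> Om I D r. Q j (pI I y + (y $ j) *s ax j) = 0)"
 using assms unfolding tower_def by - (elim conjE, assumption)+

lemma towerQ:
 assumes T: "tower X I D s r Q H F" and j: "j \<notin> I"
 shows "0 < s j" "s j < r j" "hol (EI (insert j I)) (Tb j D (r j)) (Q j)"
  "!!x w. x \<in> D ==> s j <= cmod w ==> cmod w < r j ==> Q j (x + w *s ax j) ~= 0"
  "!!w. 0 < cmod w ==> cmod w < r j ==> Q j (w *s ax j) ~= 0"
  "!!y. y \<in> X \<inter> Om I D r ==> Q j (pI I y + (y $ j) *s ax j) = 0"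
 using towerD(11)[OF T, rule_format, OF j] by metis+

text \<open>A complex linear change of coordinates together with its inverse; the elimination
  composes such changes.\<close>

definition ciso :: "(complex^'n => complex^'n) => (complex^'n => complex^'n) => bool" where
 "ciso A B \<longleftrightarrow> (\<forall>x y c. A (x + c *s y) = A x + c *s A y) & (\<forall>x y c. B (x + c *s y) = B x + c *s B y) &
   (\<forall>x. A (B x) = x) & (\<forall>x. B (A x) = x)"

lemma ciso_sym: "ciso A B ==> ciso B A"
 unfolding ciso_def by blast

lemma ciso_id: "ciso (%x. x) (%x. x)"
 unfolding ciso_def by simp

lemma ciso_compose: "ciso A B ==> ciso A' B' ==> ciso (%x. A (A' x)) (%x. B' (B x))"
 unfolding ciso_def by simp

lemma ciso_zero:
 assumes "ciso A B"
 shows "A 0 = 0"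
proof -
 have "A (0 + 1 *s 0) = A 0 + 1 *s A 0" using assms unfolding ciso_def by blast
 then show ?thesis by simp
qed

lemma ciso_linear:
 assumes "ciso A B"
 shows "linear A"
proof (rule linearI)
 have *: "A (x + c *s y) = A x + c *s A y" for x y c using assms by (simp add: ciso_def)
 show "A (x + y) = A x + A y" for x y using *[of x 1 y] by simp
 show "A (r *\<^sub>R x) = r *\<^sub>R A x" for r x
  using *[of 0 "of_real r" x] ciso_zero[OF assms] by (simp add: smult_of_real)
qed

lemma ciso_continuous: "ciso A B ==> continuous_on S A"
 using ciso_linear linear_continuous_on linear_conv_bounded_linear by blast

lemma dim_EI_ropen_tube:
 assumes "ropen (EI I) D" "j \<notin> I"
 shows "ropen (EI (insert j I)) (Tb j D \<rho>)"
proof -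
 obtain O1 where O: "open O1" "D = EI I \<inter> O1" using assms unfolding openin_open by auto
 have "Tb j D \<rho> = EI (insert j I) \<inter> ((%z. pI I z) -` O1 \<inter> (%z. z $ j) -` ball 0 \<rho>)"
 proof
  show "Tb j D \<rho> \<subseteq> EI (insert j I) \<inter> ((%z. pI I z) -` O1 \<inter> (%z. z $ j) -` ball 0 \<rho>)"
  proof
   fix z assume "z \<in> Tb j D \<rho>"
   then obtain x w where z: "z = x + w *s ax j" "x \<in> EI I" "x \<in> O1" "cmod w < \<rho>"
    unfolding Tb_def O by blast
   have "pI I z = x" "z $ j = w" using z assms(2) by (auto simp: vec_eq_iff EI_def)
   then show "z \<in> EI (insert j I) \<inter> ((%z. pI I z) -` O1 \<inter> (%z. z $ j) -` ball 0 \<rho>)"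
    using z by (auto simp: EI_def)
  qed
  show "EI (insert j I) \<inter> ((%z. pI I z) -` O1 \<inter> (%z. z $ j) -` ball 0 \<rho>) \<subseteq> Tb j D \<rho>"
  proof
   fix z assume z: "z \<in> EI (insert j I) \<inter> ((%z. pI I z) -` O1 \<inter> (%z. z $ j) -` ball 0 \<rho>)"
   then have "z = pI I z + (z $ j) *s ax j" using assms(2) by (auto simp: vec_eq_iff EI_def)
   moreover have "pI I z \<in> D" "cmod (z $ j) < \<rho>" using z O by auto
   ultimately show "z \<in> Tb j D \<rho>" unfolding Tb_def by blast
  qed
 qed
 moreover have "open ((%z. pI I z) -` O1 \<inter> (%z. z $ j) -` ball 0 \<rho>)"
  by (intro open_Int open_vimage O continuous_intros open_ball)
 ultimately show ?thesis by (simp add: openin_open_Int)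
qed

lemma Tb_convex:
 fixes D :: "(complex^'n) set"
 assumes "convex D"
 shows "convex (Tb j D \<rho>)"
proof (rule convexI)
 fix a b and p q :: real
 assume ab: "a \<in> Tb j D \<rho>" "b \<in> Tb j D \<rho>" and pq: "0 <= p" "0 <= q" "p + q = 1"
 obtain x w y u where xw: "a = x + w *s ax j" "x \<in> D" "cmod w < \<rho>" "b = y + u *s ax j" "y \<in> D" "cmod u < \<rho>"
  using ab unfolding Tb_def by blast
 have "p *\<^sub>R a + q *\<^sub>R b = (p *\<^sub>R x + q *\<^sub>R y) + (p *\<^sub>R w + q *\<^sub>R u) *s ax j"
  unfolding xw by (simp add: vec_eq_iff algebra_simps)
 moreover have "p *\<^sub>R x + q *\<^sub>R y \<in> D" using assms xw pq by (simp add: convexD)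
 moreover have "p *\<^sub>R w + q *\<^sub>R u \<in> ball 0 \<rho>"
  using convexD[OF convex_ball[of "0::complex" \<rho>], of w u p q] xw pq by simp
 ultimately show "p *\<^sub>R a + q *\<^sub>R b \<in> Tb j D \<rho>"
  unfolding Tb_def mem_Collect_eq mem_ball_0 by blast
qed

text \<open>Of the combinations with coefficients 1, l, l^2, ... more than \<open>q\<close> vanish
  at one common point \<open>w\<close>; there the polynomial with coefficients \<open>f k w\<close>
  has degree at most \<open>q\<close> and too many roots. Norms of single combinations can therefore
  detect common zeros.\<close>

lemma pigeonhole_common_zero:
 fixes f :: "nat => 'a => complex"
 assumes Z: "finite Z" "card Z <= K"
  and z: "!!l. l < K * q + 1 ==> \<exists>w\<in>Z. (\<Sum>k<q. of_nat l ^ k * f k w) = 0"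
 shows "\<exists>w\<in>Z. \<forall>k<q. f k w = 0"
proof -
 define T where "T w = {l \<in> {..<K * q + 1}. (\<Sum>k<q. of_nat l ^ k * f k w) = 0}" for w
 have "\<exists>w\<in>Z. q < card (T w)"
 proof (rule ccontr)
  assume "~ ?thesis"
  then have le: "card (T w) <= q" if "w \<in> Z" for w using that not_less by blast
  have "{..<K * q + 1} \<subseteq> (\<Union>w\<in>Z. T w)" using z by (auto simp: T_def)
  then have "card {..<K * q + 1} <= card (\<Union>w\<in>Z. T w)"
   by (intro card_mono finite_UN_I Z) (auto simp: T_def)
  also have "\<dots> <= (\<Sum>w\<in>Z. card (T w))" by (rule card_UN_le[OF Z(1)])
  also have "\<dots> <= card Z * q" using sum_bounded_above[of Z "%w. card (T w)" q] le by simp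
  also have "\<dots> <= K * q" using Z by simp
  finally show False by simp
 qed
 then obtain w where w: "w \<in> Z" "q < card (T w)" by blast
 define p where "p = (\<Sum>k<q. monom (f k w) k)"
 have pe: "poly p t = (\<Sum>k<q. t ^ k * f k w)" for t
  by (simp add: p_def poly_sum poly_monom mult.commute)
 have coeffp: "coeff p k = f k w" if "k < q" for k
  using that by (simp add: p_def coeff_sum)
 have "p = 0"
 proof (rule ccontr)
  assume p: "p ~= 0"
  have "degree p <= q"
   unfolding p_def by (intro degree_sum_le) (auto intro: order_trans[OF degree_monom_le])
  moreover have "card (T w) <= card {t. poly p t = 0}"
  proof (rule card_inj_on_le[of complex_of_nat])
   show "complex_of_nat ` T w \<subseteq> {t. poly p t = 0}" by (auto simp: T_def pe)
   show "finite {t. poly p t = 0}" by (rule poly_roots_finite[OF p])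
  qed (simp add: inj_on_def)
  moreover have "card {t. poly p t = 0} <= degree p" by (rule card_poly_roots_bound[OF p])
  ultimately show False using w by simp
 qed
 then show ?thesis using coeffp w(1) by (metis coeff_0)
qed

text \<open>One coordinate \<open>i\<close> in \<open>I\<close> is eliminated through
  \<open>f0\<close>: after a shear making \<open>v\<close> the \<open>i\<close>-th axis,
  \<open>f0\<close> itself becomes the equation for the coordinate \<open>i\<close>, and everything
  else that lived over \<open>D\<close>, both the functions in \<open>F\<close> and the equations
  \<open>Q j\<close>, is replaced by norms along the zeros of \<open>f0\<close>.\<close>

lemma elimination_step:
 fixes X :: "(complex^'n) set"
 assumes tow: "tower X I D s r Q H F" and f0: "f0 \<in> F" "x1 \<in> D" "f0 x1 ~= 0"
 obtains A B i D' s' r' Q' H' F' where "ciso A B" "i \<in> I" "tower (A -` X) (I - {i}) D' s' r' Q' H' F'"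
proof -
 note D = towerD(1-3)[OF tow] and X0 = towerD(4)[OF tow] and fin = towerD(5,6)[OF tow]
  and Hh = towerD(7)[OF tow, rule_format] and XH = towerD(8)[OF tow]
  and Fh = towerD(9)[OF tow, rule_format] and XF = towerD(10)[OF tow]
 have sr: "0 < s j & s j < r j" if "j \<notin> I" for j using towerQ(1,2)[OF tow that] by blast
 note Qh = towerQ(3)[OF tow] and Qnz = towerQ(4)[OF tow] and Q0 = towerQ(5)[OF tow] and QX = towerQ(6)[OF tow]
 have pI0: "pI I 0 = (0 :: complex^'n)" by (simp add: vec_eq_iff)
 have "0 \<in> Om I D r" using D(3) sr by (force simp: Om_def pI0)
 then have "f0 0 = 0" using XF X0 f0(1) pI0 by force
 then have x1: "x1 ~= 0" "x1 \<in> EI I" using f0 D ropen_subset by blast+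
 obtain v i r1 R1 S where v: "v \<in> EI I" "v $ i = 1" and rR: "0 < r1" "r1 < R1"
  and S: "ropen {x \<in> EI I. x $ i = 0} S" "convex S" "0 \<in> S"
  and Sin: "!!x w. x \<in> S ==> cmod w < R1 ==> x + w *s v \<in> D"
  and Snz: "!!x w. x \<in> S ==> r1 <= cmod w ==> cmod w < R1 ==> f0 (x + w *s v) ~= 0"
  and S0: "!!w. 0 < cmod w ==> cmod w < R1 ==> f0 (w *s v) ~= 0"
  by (rule prepare_direction[OF EI_subspace D Fh[OF f0(1)] f0(2,3) x1(2,1)]) blast
 have iI: "i \<in> I" using v by (auto simp: EI_def)
 define I' where "I' = I - {i}"
 have V'eq: "{x \<in> EI I. x $ i = 0} = EI I'" using iI by (auto simp: EI_def I'_def)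
 have So: "ropen (EI I') S" using S(1) unfolding V'eq .
 have SE: "S \<subseteq> EI I'" using So ropen_subset by blast
 have vj: "v $ j = 0" if "j \<notin> I" for j using v that by (auto simp: EI_def)
 have ij: "j ~= i" if "j \<notin> I" for j using that iI by blast
 \<comment> \<open>The shear sending \<open>ax i\<close> to \<open>v\<close> and fixing the
   hyperplane where the coordinate \<open>i\<close> is 0.\<close>
 define A where "A = (%y::complex^'n. y + (y $ i) *s (v - ax i))"
 define B where "B = (%y::complex^'n. y - (y $ i) *s (v - ax i))"
 have AB: "ciso A B"
  unfolding ciso_def A_def B_def using v(2) by (simp add: vec_eq_iff algebra_simps)
 have pA: "pI I (A y) = pI I' y + (y $ i) *s v" for y
  using iI v(2) vj by (auto simp: vec_eq_iff A_def I'_def algebra_simps)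
 have Aj: "A y $ j = y $ j" if "j \<notin> I" for y j
  using vj[OF that] ij[OF that] by (simp add: A_def)
 define r' where "r' = (%j. if j = i then R1 else r j)"
 define s' where "s' = (%j. if j = i then r1 else s j)"
 have OmA: "A y \<in> Om I D r" if "y \<in> Om I' S r'" for y
 proof -
  have "pI I' y \<in> S" "cmod (y $ i) < R1" using that by (auto simp: Om_def I'_def r'_def)
  then have "pI I (A y) \<in> D" unfolding pA by (rule Sin)
  moreover have "cmod (A y $ j) < r j" if j: "j \<notin> I" for j
   using \<open>y \<in> Om I' S r'\<close> ij[OF j] j unfolding Aj[OF j] by (auto simp: Om_def I'_def r'_def split: if_splits)
  ultimately show ?thesis by (simp add: Om_def)
 qed
 have Wspace: "{x + w *s v |x w. x \<in> EI I'} = EI I"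
 proof
  show "{x + w *s v |x w. x \<in> EI I'} \<subseteq> EI I" using vj by (auto simp: EI_def I'_def)
  show "EI I \<subseteq> {x + w *s v |x w. x \<in> EI I'}"
  proof
   fix z assume z: "z \<in> EI I"
   have "z = (z - (z $ i) *s v) + (z $ i) *s v" by simp
   moreover have "z - (z $ i) *s v \<in> EI I'" using z v vj by (auto simp: EI_def I'_def)
   ultimately show "z \<in> {x + w *s v |x w. x \<in> EI I'}" by blast
  qed
 qed
 interpret N: weierstrass "EI I'" v i S r1 R1 f0
 proof
  show "hol {x + w *s v |x w. x \<in> EI I'} {x + w *s v |x w. x \<in> S & cmod w < R1} f0"
   unfolding Wspace by (rule hol_subset[OF Fh[OF f0(1)]]) (use Sin in blast)
  show "vec.subspace (EI I')" "ropen (EI I') S" by (simp_all add: So)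
  show "!!x. x \<in> EI I' ==> x $ i = 0" by (simp add: EI_def I'_def)
 qed (use v S rR Snz in auto)
 have NW: "N.W = EI I" unfolding N.W_def by (rule Wspace)
 have NcD: "N.cyl \<subseteq> D" unfolding N.cyl_def using Sin by blast
 \<comment> \<open>The norm of \<open>Q j\<close> along the zeros of \<open>f0\<close>, spelled out
   because the Weierstrass setting in which it is a norm depends on \<open>j\<close> and is
   interpreted only below.\<close>
 define Qj where "Qj = (%j z. \<Prod>w\<in>{w. cmod w < R1 & f0 (pI I z + w *s v) = 0}. Q j (z + w *s v) ^ nat (zorder (%u. f0 (pI I z + u *s v)) w))"
 define Q' where "Q' = (%j. if j = i then (%z. f0 (pI I' z + (z $ i) *s v)) else Qj j)"
 have Qj_props: "hol (EI (insert j I')) (Tb j S (r j)) (Qj j) &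
   (\<forall>x\<in>S. \<forall>w. cmod w < r j --> (Qj j (x + w *s ax j) = 0 \<longleftrightarrow>
     (\<exists>u. cmod u < R1 & f0 (x + u *s v) = 0 & Q j (x + u *s v + w *s ax j) = 0)))" if j: "j \<notin> I" for j
 proof -
  have jI': "j \<notin> I'" using j by (simp add: I'_def)
  have pIz: "pI I (x + w *s ax j + u *s v) = x + u *s v" if "x \<in> EI I'" for x w u
   using that j vj iI by (auto simp: vec_eq_iff EI_def I'_def)
  have Tb_form: "{y + u *s v |y u. y \<in> Tb j S (r j) & cmod u < R1} \<subseteq> Tb j D (r j)"
  proof
   fix z assume "z \<in> {y + u *s v |y u. y \<in> Tb j S (r j) & cmod u < R1}"
   then obtain x w u where z: "z = x + w *s ax j + u *s v" "x \<in> S" "cmod w < r j" "cmod u < R1"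
    unfolding Tb_def by blast
   then have "z = (x + u *s v) + w *s ax j" "x + u *s v \<in> D" using Sin by (auto simp: algebra_simps)
   then show "z \<in> Tb j D (r j)" using z(3) unfolding Tb_def by blast
  qed
  have Wj: "{y + u *s v |y u. y \<in> EI (insert j I')} = EI (insert j I)"
  proof
   show "{y + u *s v |y u. y \<in> EI (insert j I')} \<subseteq> EI (insert j I)" using vj by (auto simp: EI_def I'_def)
   show "EI (insert j I) \<subseteq> {y + u *s v |y u. y \<in> EI (insert j I')}"
   proof
    fix z assume z: "z \<in> EI (insert j I)"
    have "z = (z - (z $ i) *s v) + (z $ i) *s v" by simp
    moreover have "z - (z $ i) *s v \<in> EI (insert j I')" using z v vj by (auto simp: EI_def I'_def)
    ultimately show "z \<in> {y + u *s v |y u. y \<in> EI (insert j I')}" by blast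
   qed
  qed
  \<comment> \<open>\<open>f0\<close> does not involve the coordinate \<open>j\<close>; it is
    regarded as a function over the product of \<open>S\<close> with the disc of that coordinate,
    with the same zeros in direction \<open>v\<close>.\<close>
  interpret M: weierstrass "EI (insert j I')" v i "Tb j S (r j)" r1 R1 "%z. f0 (pI I z)"
  proof
   show "ropen (EI (insert j I')) (Tb j S (r j))" by (rule dim_EI_ropen_tube[OF So jI'])
   show "convex (Tb j S (r j))" by (rule Tb_convex[OF S(2)])
   have "0 + 0 *s ax j \<in> Tb j S (r j)" unfolding Tb_def using S(3) sr[OF j] by force
   then show "Tb j S (r j) ~= {}" by blast
   show "hol {x + w *s v |x w. x \<in> EI (insert j I')} {x + w *s v |x w. x \<in> Tb j S (r j) & cmod w < R1} (%z. f0 (pI I z))"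
   proof (rule hol_compose_lin[OF Fh[OF f0(1)], where M = "pI I"])
    fix z assume "z \<in> {x + w *s v |x w. x \<in> Tb j S (r j) & cmod w < R1}"
    then obtain x w u where z: "z = x + w *s ax j + u *s v" "x \<in> S" "cmod u < R1"
     unfolding Tb_def by blast
    then show "pI I z \<in> D" using pIz SE Sin by auto
   qed (auto intro!: continuous_intros simp: pI_line)
   show "f0 (pI I (x + w *s v)) ~= 0" if x: "x \<in> Tb j S (r j)" and w: "r1 <= cmod w" "cmod w < R1" for x w
   proof -
    obtain y u where y: "x = y + u *s ax j" "y \<in> S" using x unfolding Tb_def by blast
    then have "pI I (x + w *s v) = y + w *s v" using pIz SE by blast
    then show ?thesis using Snz[OF y(2) w] by simp
   qed
   show "vec.subspace (EI (insert j I'))" by simp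
   show "!!x. x \<in> EI (insert j I') ==> x $ i = 0" using ij[OF j] by (simp add: EI_def I'_def)
  qed (use v rR in auto)
  have MW: "M.W = EI (insert j I)" unfolding M.W_def by (rule Wj)
  have Mc: "M.cyl \<subseteq> Tb j D (r j)" unfolding M.cyl_def by (rule Tb_form)
  have key: "pI I (z + w *s v) = pI I z + w *s v" for z w
   using pI_id[OF v(1)] by (simp add: pI_line)
  have Qeq: "Qj j = M.nrm (Q j)"
   unfolding Qj_def M.nrm_def M.zr_def M.mu_def key ..
  have "hol (EI (insert j I')) (Tb j S (r j)) (Qj j)"
   unfolding Qeq by (rule M.nrm_hol) (use hol_subset[OF Qh[OF j] Mc] in \<open>simp add: MW\<close>)
  moreover have "Qj j (x + w *s ax j) = 0 \<longleftrightarrow> (\<exists>u. cmod u < R1 & f0 (x + u *s v) = 0 & Q j (x + u *s v + w *s ax j) = 0)"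
   if x: "x \<in> S" "cmod w < r j" for x w
  proof -
   have mem: "x + w *s ax j \<in> Tb j S (r j)" using x unfolding Tb_def by blast
   have xE: "x \<in> EI I'" using x SE by blast
   have comm: "x + w *s ax j + u *s v = x + u *s v + w *s ax j" for u by (simp add: algebra_simps)
   show ?thesis unfolding Qeq M.nrm_zero_iff[OF mem, of "Q j"] unfolding pIz[OF xE] unfolding comm ..
  qed
  ultimately show ?thesis by blast
 qed
 obtain fs where fs: "set fs = F" using finite_list[OF fin(2)] by blast
 define q where "q = length fs"
 \<comment> \<open>The norm of one function only tells whether it shares a zero with
   \<open>f0\<close>. Common zeros of all of \<open>F\<close> over \<open>x\<close> are detected by
   the norms of \<open>N.K * q + 1\<close> combinations, by
   \<open>pigeonhole_common_zero\<close>.\<close>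
 define g where "g = (%l z. \<Sum>k<q. of_nat l ^ k * (fs ! k) z)"
 have gh: "hol (EI I) D (g l)" for l :: nat
  unfolding g_def by (intro hol_sum hol_mult hol_const Fh) (use fs q_def in auto)
 define F' where "F' = (%l. N.nrm (g l)) ` {..<N.K * q + 1}"
 have F'z: "(\<forall>f\<in>F'. f x = 0) \<longleftrightarrow> (\<exists>u. cmod u < R1 & (\<forall>f\<in>F. f (x + u *s v) = 0))" if x: "x \<in> S" for x
 proof
  assume all: "\<forall>f\<in>F'. f x = 0"
  have "\<exists>w\<in>N.zr x. \<forall>k<q. (fs ! k) (x + w *s v) = 0"
  proof (rule pigeonhole_common_zero[OF N.zr_finite[OF x]])
   have "card (N.zr x) = (\<Sum>w\<in>N.zr x. 1)" by simp
   also have "\<dots> <= (\<Sum>w\<in>N.zr x. N.mu x w)" by (intro sum_mono) (use N.mu_pos[OF x] in force)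
   finally show "card (N.zr x) <= N.K" using N.mu_sum[OF x] by simp
   fix l assume "l < N.K * q + 1"
   then have "N.nrm (g l) x = 0" using all by (auto simp: F'_def)
   then show "\<exists>w\<in>N.zr x. (\<Sum>k<q. of_nat l ^ k * (fs ! k) (x + w *s v)) = 0"
    unfolding N.nrm_zero_iff[OF x] g_def N.zr_def by blast
  qed
  then obtain w where w: "w \<in> N.zr x" "!!k. k < q ==> (fs ! k) (x + w *s v) = 0" by blast
  then have "\<forall>f\<in>F. f (x + w *s v) = 0" using fs unfolding q_def by (metis in_set_conv_nth)
  then show "\<exists>u. cmod u < R1 & (\<forall>f\<in>F. f (x + u *s v) = 0)" using w(1) by (auto simp: N.zr_def)
 next
  assume "\<exists>u. cmod u < R1 & (\<forall>f\<in>F. f (x + u *s v) = 0)"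
  then obtain u where u: "cmod u < R1" "\<forall>f\<in>F. f (x + u *s v) = 0" by blast
  have "g l (x + u *s v) = 0" for l
   unfolding g_def using u fs by (intro sum.neutral) (auto simp: q_def)
  then have "N.nrm (g l) x = 0" for l
   unfolding N.nrm_zero_iff[OF x] using u f0 by blast
  then show "\<forall>f\<in>F'. f x = 0" by (auto simp: F'_def)
 qed
 define H' where "H' = (%h y. h (A y)) ` H"
 have Acont: "continuous_on T A" for T using ciso_continuous[OF AB] .
 have "tower (A -` X) I' S s' r' Q' H' F'"
  unfolding tower_def
 proof (intro conjI allI impI ballI)
  show "ropen (EI I') S" "convex S" "0 \<in> S" "0 \<in> A -` X"
   using So S X0 ciso_zero[OF AB] by auto
  show "finite H'" "finite F'" using fin by (auto simp: H'_def F'_def)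
  show "hol UNIV (Om I' S r') h" if h: "h \<in> H'" for h
  proof -
   obtain h0 where h0: "h0 \<in> H" "h = (%y. h0 (A y))" using h by (auto simp: H'_def)
   show ?thesis unfolding h0(2)
    by (rule hol_compose_lin[OF Hh[OF h0(1)] Acont OmA, where M = A])
     (use AB in \<open>auto simp: ciso_def\<close>)
  qed
  show "A -` X \<inter> Om I' S r' = {y \<in> Om I' S r'. \<forall>h\<in>H'. h y = 0}"
   using XH OmA by (auto simp: H'_def)
  show "hol (EI I') S f" if "f \<in> F'" for f
  proof -
   obtain l where "f = N.nrm (g l)" using \<open>f \<in> F'\<close> by (auto simp: F'_def)
   then show ?thesis using N.nrm_hol[of "g l"] hol_subset[OF gh NcD] unfolding NW by simp
  qed
  show "pI I' ` (A -` X \<inter> Om I' S r') = {x \<in> S. \<forall>f\<in>F'. f x = 0}"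
  proof (intro set_eqI iffI)
   fix x assume "x \<in> pI I' ` (A -` X \<inter> Om I' S r')"
   then obtain y where y: "x = pI I' y" "A y \<in> X" "y \<in> Om I' S r'" by auto
   have "pI I (A y) \<in> {x \<in> D. \<forall>f\<in>F. f x = 0}" unfolding XF[symmetric] using y OmA by blast
   then have "\<forall>f\<in>F. f (x + (y $ i) *s v) = 0" unfolding pA y(1) by blast
   moreover have "x \<in> S" "cmod (y $ i) < R1" using y by (auto simp: Om_def I'_def r'_def)
   ultimately show "x \<in> {x \<in> S. \<forall>f\<in>F'. f x = 0}" using F'z by blast
  next
   fix x assume "x \<in> {x \<in> S. \<forall>f\<in>F'. f x = 0}"
   then obtain u where u: "x \<in> S" "cmod u < R1" "\<forall>f\<in>F. f (x + u *s v) = 0" using F'z by blast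
   then have "x + u *s v \<in> pI I ` (X \<inter> Om I D r)" unfolding XF using Sin by blast
   then obtain y0 where y0: "x + u *s v = pI I y0" "y0 \<in> X" "y0 \<in> Om I D r" by blast
   define y where "y = B y0"
   have Ay: "A y = y0" using AB by (simp add: y_def ciso_def)
   have eq: "pI I' y + (y $ i) *s v = x + u *s v" using pA[of y] Ay y0 by simp
   have "(pI I' y + (y $ i) *s v) $ i = y $ i" "(x + u *s v) $ i = u"
    using v(2) u(1) SE by (auto simp: I'_def EI_def)
   then have yu: "y $ i = u" using eq by simp
   then have px: "pI I' y = x" using eq by simp
   have "cmod (y $ j) < r' j" if "j \<notin> I'" for j
   proof (cases "j = i")
    case True
    then show ?thesis using yu u by (simp add: r'_def)
   next
    case False
    then have j: "j \<notin> I" using that by (simp add: I'_def)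
    moreover have "cmod (y0 $ j) < r j" using y0(3) j unfolding Om_def by blast
    ultimately show ?thesis using Aj[OF j, of y] Ay False by (simp add: r'_def)
   qed
   then have "y \<in> A -` X \<inter> Om I' S r'" using px u(1) Ay y0 by (simp add: Om_def)
   then show "x \<in> pI I' ` (A -` X \<inter> Om I' S r')" using px by blast
  qed
  fix j assume jI': "j \<notin> I'"
  show "0 < s' j" "s' j < r' j" using sr rR jI' by (auto simp: s'_def r'_def I'_def)
  have L: "pI I' (x + w *s ax i) + ((x + w *s ax i) $ i) *s v = x + w *s v" if "x \<in> EI I'" for x w
   using that by (auto simp: vec_eq_iff EI_def I'_def)
  show "hol (EI (insert j I')) (Tb j S (r' j)) (Q' j)"
  proof (cases "j = i")
   case True
   have "hol (EI (insert i I')) (Tb i S R1) (%z. f0 (pI I' z + (z $ i) *s v))"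
   proof (rule hol_compose_lin[OF Fh[OF f0(1)], where M = "%z. pI I' z + (z $ i) *s v"])
    fix z assume "z \<in> Tb i S R1"
    then obtain x w where "z = x + w *s ax i" "x \<in> S" "cmod w < R1" unfolding Tb_def by blast
    then show "pI I' z + (z $ i) *s v \<in> D" using L SE Sin by (metis subsetD)
   next
    fix z u :: "complex^'n" and t :: complex
    show "pI I' u + (u $ i) *s v \<in> EI I & pI I' (z + t *s u) + (z + t *s u) $ i *s v = pI I' z + z $ i *s v + t *s (pI I' u + u $ i *s v)"
     using vj by (auto simp: EI_def I'_def vec_eq_iff algebra_simps)
   qed (intro continuous_intros)
   then show ?thesis using True by (simp add: Q'_def r'_def)
  next
   case False
   then show ?thesis using Qj_props[of j] jI' by (simp add: Q'_def r'_def I'_def)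
  qed
  have Q'i: "Q' i (x + w *s ax i) = f0 (x + w *s v)" if "x \<in> S" for x w
  proof -
   have "x \<in> EI I'" using that SE by blast
   then show ?thesis unfolding Q'_def using L[of x w] by (simp only: if_True simp_thms)
  qed
  show "Q' j (x + w *s ax j) ~= 0" if x: "x \<in> S" and w: "s' j <= cmod w & cmod w < r' j" for x w
  proof (cases "j = i")
   case True
   then show ?thesis using Q'i[OF x] Snz[OF x] w by (simp add: s'_def r'_def)
  next
   case False
   then have j: "j \<notin> I" using jI' by (simp add: I'_def)
   have "Q j (x + u *s v + w *s ax j) ~= 0" if "cmod u < R1" for u
    using Qnz[OF j Sin[OF x that], of w] w False by (simp add: s'_def r'_def)
   then show ?thesis using Qj_props[OF j] x w False by (auto simp: Q'_def r'_def)
  qed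
  show "Q' j (w *s ax j) ~= 0" if w: "0 < cmod w & cmod w < r' j" for w
  proof (cases "j = i")
   case True
   then show ?thesis using Q'i[OF S(3), of w] S0[of w] w by (simp add: r'_def)
  next
   case False
   then have j: "j \<notin> I" using jI' by (simp add: I'_def)
   have "Q j (0 + u *s v + w *s ax j) ~= 0" if u: "cmod u < R1" "f0 (0 + u *s v) = 0" for u
   proof -
    have "u = 0" using S0[of u] u by force
    then show ?thesis using Q0[OF j, of w] w False by (simp add: r'_def)
   qed
   moreover have "cmod w < r j" using w False by (simp add: r'_def)
   ultimately have "Qj j (0 + w *s ax j) ~= 0" using Qj_props[OF j] S(3) by blast
   then show ?thesis using False by (simp add: Q'_def)
  qed
  show "Q' j (pI I' y + (y $ j) *s ax j) = 0" if y: "y \<in> A -` X \<inter> Om I' S r'" for y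
  proof -
   have yS: "pI I' y \<in> S" "cmod (y $ i) < R1" using y by (auto simp: Om_def I'_def r'_def)
   have Ay: "A y \<in> X \<inter> Om I D r" using y OmA by auto
   have "pI I (A y) \<in> {x \<in> D. \<forall>f\<in>F. f x = 0}" unfolding XF[symmetric] using Ay by blast
   then have f00: "f0 (pI I' y + (y $ i) *s v) = 0" unfolding pA using f0 by blast
   show ?thesis
   proof (cases "j = i")
    case True
    then show ?thesis using Q'i[OF yS(1)] f00 by simp
   next
    case False
    then have j: "j \<notin> I" using jI' by (simp add: I'_def)
    have "Q j (pI I' y + (y $ i) *s v + (y $ j) *s ax j) = 0"
     using QX[OF j Ay] unfolding pA Aj[OF j] .
    moreover have "cmod (y $ j) < r j" using y j jI' False by (auto simp: Om_def r'_def)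
    ultimately show ?thesis using Qj_props[OF j] yS f00 False by (auto simp: Q'_def)
   qed
  qed
 qed
 then show ?thesis using that AB iI unfolding I'_def by blast
qed

text \<open>The elimination is repeated until all functions in \<open>F\<close> vanish identically;
  the projection of \<open>X\<close> is then all of \<open>D\<close>. The strict decrease of
  \<open>I\<close> recorded at the end becomes the drop of dimension at the branch locus.\<close>

lemma elimination:
 fixes X :: "(complex^'n) set"
 assumes "tower X I D s r Q H F"
 shows "\<exists>A B I' D' s' r' Q' H'. ciso A B & tower (A -` X) I' D' s' r' Q' H' {} & I' \<subseteq> I &
  ((\<exists>f\<in>F. \<exists>x\<in>D. f x ~= 0) --> I' ~= I)"
 using assms
proof (induction "card I" arbitrary: X I D s r Q H F rule: less_induct)
 case less
 show ?case
 proof (cases "\<exists>f\<in>F. \<exists>x\<in>D. f x ~= 0")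
  case False
  have "{x \<in> D. \<forall>f\<in>F. f x = 0} = {x \<in> D. \<forall>f\<in>{}. f x = 0}" using False by blast
  then have "tower X I D s r Q H {}"
   using less.prems unfolding tower_def by (elim conjE, intro conjI) (assumption | simp only: | simp)+
  then have "tower ((%x. x) -` X) I D s r Q H {}" by simp
  then show ?thesis using False ciso_id by blast
 next
  case True
  then obtain f0 x1 where f0: "f0 \<in> F" "x1 \<in> D" "f0 x1 ~= 0" by blast
  obtain A B i D' s' r' Q' H' F' where 1: "ciso A B" "i \<in> I" "tower (A -` X) (I - {i}) D' s' r' Q' H' F'"
   using elimination_step[OF less.prems f0] .
  have "card (I - {i}) < card I" using 1(2) by (intro psubset_card_mono) auto
  from less.hyps[OF this 1(3)] obtain A2 B2 I2 D2 s2 r2 Q2 H2 where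
   2: "ciso A2 B2" "tower (A2 -` (A -` X)) I2 D2 s2 r2 Q2 H2 {}" "I2 \<subseteq> I - {i}" by blast
  have "A2 -` (A -` X) = (%x. A (A2 x)) -` X" by auto
  then have "tower ((%x. A (A2 x)) -` X) I2 D2 s2 r2 Q2 H2 {}" using 2(2) by simp
  moreover have "I2 \<subseteq> I" "I2 ~= I" using 2(3) 1(2) by auto
  ultimately show ?thesis using ciso_compose[OF 1(1) 2(1)] by blast
 qed
qed

section \<open>Discriminants and local branches of roots\<close>

inductive mpol :: "nat => ((nat => complex) => complex) => bool" for n where
 mono: "mpol n (%w. c * (\<Prod>k<n. w k ^ e k))"
| add: "mpol n f ==> mpol n g ==> mpol n (%w. f w + g w)"

lemma mpol_mult:
 assumes "mpol n f" "mpol n g"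
 shows "mpol n (%w. f w * g w)"
 using assms(1)
proof induction
 case (mono c e)
 show ?case
  using assms(2)
 proof induction
  case (mono c' e')
  have "(%w. c * (\<Prod>k<n. w k ^ e k) * (c' * (\<Prod>k<n. w k ^ e' k))) = (%w. (c * c') * (\<Prod>k<n. w k ^ (e k + e' k)))"
   by (simp add: power_add prod.distrib mult_ac)
  then show ?case using mpol.mono[of n "c * c'" "%k. e k + e' k"] by simp
 next
  case (add f g)
  then show ?case using mpol.add[OF add.IH] by (simp add: distrib_left)
 qed
next
 case (add f1 f2)
 then show ?case using mpol.add[OF add.IH] by (simp add: distrib_right)
qed

lemma mpol_one: "mpol n (%w. 1)"
 using mpol.mono[of n 1 "%_. 0"] by simp

lemma mpol_diff:
 assumes "a < n" "b < n"
 shows "mpol n (%w. w a - w b)"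
proof -
 have *: "(\<Prod>k<n. w k ^ (if k = a then 1 else 0)) = w a" if "a < n" for a and w :: "nat => complex"
 proof -
  have "(\<Prod>k<n. w k ^ (if k = a then 1 else 0)) = (\<Prod>k<n. if k = a then w a else 1)"
   by (rule prod.cong) auto
  then show ?thesis using that by simp
 qed
 show ?thesis
  using mpol.add[OF mpol.mono[of n 1 "%k. if k = a then 1 else 0"] mpol.mono[of n "-1" "%k. if k = b then 1 else 0"]]
   *[OF assms(1)] *[OF assms(2)] by simp
qed

lemma mpol_prod: "finite A ==> (!!a. a \<in> A ==> mpol n (f a)) ==> mpol n (%w. \<Prod>a\<in>A. f a w)"
 by (induction A rule: finite_induct) (auto intro: mpol_one mpol_mult)

context weierstrass
begin

lemma card_zr_le: "x \<in> S ==> card (zr x) <= K"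
proof -
 assume x: "x \<in> S"
 have "card (zr x) = (\<Sum>w\<in>zr x. 1)" by simp
 also have "\<dots> <= (\<Sum>w\<in>zr x. mu x w)" by (intro sum_mono) (use mu_pos[OF x] in force)
 finally show ?thesis using mu_sum[OF x] by simp
qed

text \<open>For a monomial the sum over tuples factors into a product of power sums of the zeros,
  which are holomorphic.\<close>

lemma mpol_sum_hol:
 assumes "mpol n h"
 shows "hol V S (%x. \<Sum>a\<in>PiE {..<n} (%_. zr x). (\<Prod>k<n. of_nat (mu x (a k))) * h a)"
 using assms
proof induction
 case (mono c e)
 have "hol V S (%x. c * (\<Prod>k<n. \<Sum>w\<in>zr x. of_nat (mu x w) * (%z. (z $ i) ^ e k) (x + w *s v)))"
  by (intro hol_mult hol_const hol_prod power_sum_hol hol_power hol_component)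
 then show ?case
 proof (rule hol_cong[OF sub So])
  fix x assume x: "x \<in> S"
  have "(\<Prod>k<n. \<Sum>w\<in>zr x. of_nat (mu x w) * (%z. (z $ i) ^ e k) (x + w *s v)) = (\<Prod>k<n. \<Sum>w\<in>zr x. of_nat (mu x w) * w ^ e k)"
   using x SV by (auto simp: Vi vi subset_iff)
  also have "\<dots> = (\<Sum>a\<in>PiE {..<n} (%_. zr x). \<Prod>k<n. of_nat (mu x (a k)) * a k ^ e k)"
   by (rule prod_sum_PiE) (use zr_finite[OF x] in auto)
  finally show "c * (\<Prod>k<n. \<Sum>w\<in>zr x. of_nat (mu x w) * (%z. (z $ i) ^ e k) (x + w *s v)) =
   (\<Sum>a\<in>PiE {..<n} (%_. zr x). (\<Prod>k<n. of_nat (mu x (a k))) * (c * (\<Prod>k<n. a k ^ e k)))"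
   by (simp add: sum_distrib_left prod.distrib mult_ac)
 qed
next
 case (add f g)
 then show ?case using hol_add[OF add.IH] by (simp add: distrib_left sum.distrib)
qed

text \<open>A subdiscriminant: summing over all tuples of zeros, those with a repetition contribute \<open>0\<close>.\<close>

lemma discriminant:
 "\<exists>n \<delta>. hol V S \<delta> & (\<forall>x\<in>S. card (zr x) <= n) & (\<exists>x\<in>S. card (zr x) = n) &
  (\<forall>x\<in>S. \<delta> x ~= 0 \<longleftrightarrow> card (zr x) = n)"
proof -
 define T where "T = (%x. card (zr x)) ` S"
 have Tf: "finite T" using card_zr_le by (intro finite_subset[of T "{..K}"]) (auto simp: T_def)
 have Tne: "T ~= {}" using Sne by (simp add: T_def)
 define n where "n = Max T"
 have le: "card (zr x) <= n" if "x \<in> S" for x using Tf that by (auto simp: n_def T_def)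
 have "n \<in> T" unfolding n_def using Tf Tne by (rule Max_in)
 then have ex: "\<exists>x\<in>S. card (zr x) = n" by (auto simp: T_def)
 \<comment> \<open>The product runs over ordered pairs and is therefore invariant under
   permutations, so all enumerations of the zeros contribute the same value.\<close>
 define h where "h = (%w::nat => complex. \<Prod>a<n. \<Prod>b\<in>{..<n} - {a}. (w a - w b))"
 have hm: "mpol n h" unfolding h_def by (intro mpol_prod mpol_diff) auto
 define \<delta> where "\<delta> = (%x. \<Sum>a\<in>PiE {..<n} (%_. zr x). (\<Prod>k<n. of_nat (mu x (a k))) * h a)"
 have \<delta>h: "hol V S \<delta>" unfolding \<delta>_def by (rule mpol_sum_hol[OF hm])
 have h0: "h a = 0" if ninj: "~ inj_on a {..<n}" for a
 proof -
  obtain p q where pq: "p < n" "q < n" "p ~= q" "a p = a q" using ninj by (auto simp: inj_on_def)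
  have "q \<in> {..<n} - {p}" "a p - a q = 0" using pq by simp_all
  then have "(\<Prod>b\<in>{..<n} - {p}. (a p - a b)) = 0" by (intro prod_zero) blast+
  then have "\<exists>p\<in>{..<n}. (\<Prod>b\<in>{..<n} - {p}. (a p - a b)) = 0" using pq(1) by blast
  then show ?thesis unfolding h_def by (rule prod_zero[OF finite_lessThan])
 qed
 have iff: "\<delta> x ~= 0 \<longleftrightarrow> card (zr x) = n" if x: "x \<in> S" for x
 proof (cases "card (zr x) = n")
  case False
  have "h a = 0" if a: "a \<in> PiE {..<n} (%_. zr x)" for a
  proof (rule h0)
   show "~ inj_on a {..<n}"
   proof
    assume "inj_on a {..<n}"
    then have "card {..<n} <= card (zr x)"
     by (rule card_inj_on_le) (use a zr_finite[OF x] in auto)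
    then show False using le[OF x] False by simp
   qed
  qed
  then have "\<delta> x = 0" unfolding \<delta>_def by (intro sum.neutral) auto
  then show ?thesis using False by simp
 next
  case True
  define C where "C = (\<Prod>w\<in>zr x. of_nat (mu x w)) * (\<Prod>w\<in>zr x. \<Prod>w'\<in>zr x - {w}. (w - w'))"
  define I where "I = {a \<in> PiE {..<n} (%_. zr x). inj_on a {..<n}}"
  have fin: "finite (PiE {..<n} (%_. zr x))" using zr_finite[OF x] by (intro finite_PiE) auto
  have val: "(\<Prod>k<n. of_nat (mu x (a k))) * h a = C" if a: "a \<in> I" for a
  proof -
   have img: "a ` {..<n} = zr x"
    by (rule card_subset_eq[OF zr_finite[OF x]]) (use a True in \<open>auto simp: I_def card_image\<close>)
   have inj: "inj_on a {..<n}" using a by (simp add: I_def)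
   then have bij: "bij_betw a {..<n} (zr x)" using img by (simp add: bij_betw_def)
   have 1: "(\<Prod>k<n. of_nat (mu x (a k))) = (\<Prod>w\<in>zr x. of_nat (mu x w) :: complex)"
    by (rule prod.reindex_bij_betw[OF bij])
   have "h a = (\<Prod>p<n. \<Prod>w'\<in>zr x - {a p}. (a p - w'))"
    unfolding h_def
   proof (rule prod.cong[OF refl])
    fix p assume "p \<in> {..<n}"
    moreover from this have "a p \<in> zr x" using img by blast
    ultimately have "bij_betw a ({..<n} - {p}) (zr x - {a p})"
     using bij_betw_DiffI[OF bij, of "{p}" "{a p}"] by (simp add: bij_betw_def)
    then show "(\<Prod>b\<in>{..<n} - {p}. (a p - a b)) = (\<Prod>w'\<in>zr x - {a p}. (a p - w'))"
     by (rule prod.reindex_bij_betw)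
   qed
   also have "\<dots> = (\<Prod>w\<in>zr x. \<Prod>w'\<in>zr x - {w}. (w - w'))"
    by (rule prod.reindex_bij_betw[OF bij])
   finally show ?thesis using 1 by (simp add: C_def)
  qed
  have "\<delta> x = (\<Sum>a\<in>I. (\<Prod>k<n. of_nat (mu x (a k))) * h a)"
   unfolding \<delta>_def by (rule sum.mono_neutral_right[OF fin]) (auto simp: I_def h0)
  also have "\<dots> = of_nat (card I) * C" using val by simp
  finally have eq: "\<delta> x = of_nat (card I) * C" .
  obtain b where b: "bij_betw b {0..<card (zr x)} (zr x)" using ex_bij_betw_nat_finite[OF zr_finite[OF x]] by blast
  have "restrict b {..<n} \<in> I"
   using b True by (auto simp: I_def bij_betw_def atLeast0LessThan inj_on_def)
  moreover have "finite I" using fin by (simp add: I_def)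
  ultimately have "card I ~= 0" by auto
  moreover have "C ~= 0"
   unfolding C_def using zr_finite[OF x] mu_pos[OF x] by auto
  ultimately show ?thesis using eq True by simp
 qed
 show ?thesis by (intro exI[of _ n] exI[of _ \<delta>] conjI ballI \<delta>h le ex iff)
qed

text \<open>Around each of the distinct zeros over \<open>x0\<close> a small disc keeps its number
  of zeros, at least one, for \<open>x\<close> near \<open>x0\<close>. Maximality leaves exactly one
  distinct zero in each disc, and its position is the mean of the zeros counted with multiplicity,
  hence holomorphic.\<close>

lemma local_roots:
 assumes x0: "x0 \<in> S" and max: "!!x. x \<in> S ==> card (zr x) <= card (zr x0)"
 shows "\<exists>B \<omega>. ropen V B & x0 \<in> B & B \<subseteq> S & (\<forall>l<card (zr x0). hol V B (\<omega> l)) &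
  (\<forall>x\<in>B. bij_betw (%l. \<omega> l x) {..<card (zr x0)} (zr x))"
proof -
 define Z where "Z = zr x0"
 have Zf: "finite Z" unfolding Z_def by (rule zr_finite[OF x0])
 \<comment> \<open>Diagonal pairs measure the distance of a zero to the boundary circle, the others
   the distance between two zeros; one \<eta> below all these values keeps the discs inside and
   apart.\<close>
 define \<phi> where "\<phi> = (%(w, w'). if w = w' then (R - cmod w) / 4 else dist w w' / 8)"
 obtain \<eta> where \<eta>: "\<eta> > 0" "!!p. p \<in> Z \<times> Z ==> \<eta> < \<phi> p"
  by (rule finite_pos_lower_bound[of "Z \<times> Z" \<phi>]) (use Zf in \<open>auto simp: \<phi>_def Z_def zr_def\<close>)
 have \<eta>R: "cmod w + 4 * \<eta> < R" if "w \<in> Z" for w using \<eta>(2)[of "(w, w)"] that by (simp add: \<phi>_def)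
 have \<eta>d: "8 * \<eta> < dist w w'" if "w \<in> Z" "w' \<in> Z" "w ~= w'" for w w' using \<eta>(2)[of "(w, w')"] that by (simp add: \<phi>_def)
 define A where "A = {s::complex. \<eta> <= cmod s & cmod s <= 2 * \<eta>}"
 have "A = cball 0 (2 * \<eta>) - ball 0 \<eta>" by (auto simp: A_def)
 then have Ac: "compact A" by (simp add: compact_diff)
 have sR: "cmod (w + s) < R" if "w \<in> Z" "cmod s <= 2 * \<eta>" for w s
  using \<eta>R[OF that(1)] that(2) norm_triangle_ineq[of w s] \<eta>(1) by simp
 have "\<exists>e>0. \<forall>x\<in>S. \<forall>s\<in>A. dist x x0 < e --> f (x + (w + s) *s v) ~= 0" if w: "w \<in> Z" for w
 proof (rule tube_nonzero[OF _ Ac x0])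
  show "continuous_on (S \<times> A) (%(x, s). f (x + (w + s) *s v))"
   unfolding case_prod_beta
  proof (rule continuous_on_compose2[OF hol_continuous[OF fhc]])
   show "(%q. fst q + (w + snd q) *s v) ` (S \<times> A) \<subseteq> cyl"
   proof (rule image_subsetI)
    fix q assume "q \<in> S \<times> A"
    then show "fst q + (w + snd q) *s v \<in> cyl" by (intro cylI sR[OF w]) (auto simp: A_def)
   qed
  qed (intro continuous_intros)
  show "f (x0 + (w + s) *s v) ~= 0" if "s \<in> A" for s
  proof
   assume "f (x0 + (w + s) *s v) = 0"
   then have "w + s \<in> Z" using sR[OF w] that by (simp add: Z_def zr_def A_def)
   moreover have "w ~= w + s" using that \<eta>(1) by (auto simp: A_def)
   ultimately have "8 * \<eta> < dist w (w + s)" using \<eta>d[OF w] by blast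
   then show False using that \<eta>(1) by (simp add: A_def dist_norm)
  qed
 qed
 then obtain e where e: "!!w. w \<in> Z ==> e w > 0"
  "!!w x s. w \<in> Z ==> x \<in> S ==> s \<in> A ==> dist x x0 < e w ==> f (x + (w + s) *s v) ~= 0" by metis
 obtain d where d: "d > 0" "!!w. w \<in> Z ==> d < e w" by (rule finite_pos_lower_bound[OF Zf, of e]) (use e(1) in auto)
 define B where "B = S \<inter> ball x0 d"
 have B: "ropen V B" "x0 \<in> B" "B \<subseteq> S" "convex B"
  unfolding B_def using So x0 d(1) Sc by (auto simp: openin_Int_open convex_Int)
 define Tw where "Tw = (%w x. {s. cmod s < 2 * \<eta> & f (x + s *s v + w *s v) = 0})"
 have each: "\<exists>\<sigma>. hol V B \<sigma> & (\<forall>x\<in>B. Tw w x ~= {} & (\<forall>s. Tw w x = {s} --> \<sigma> x = w + s))" if w: "w \<in> Z" for w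
 proof -
  interpret L: weierstrass V v i B \<eta> "2 * \<eta>" "%z. f (z + w *s v)"
  proof
   show "hol {x + w *s v |x w. x \<in> V} {x + w *s v |x w. x \<in> B & cmod w < 2 * \<eta>} (%z. f (z + w *s v))"
   proof (rule hol_compose_lin[OF fh, where M = "%v. v"])
    fix z assume "z \<in> {x + w *s v |x w. x \<in> B & cmod w < 2 * \<eta>}"
    then obtain x s where z: "z = x + s *s v" "x \<in> B" "cmod s < 2 * \<eta>" by blast
    then have "z + w *s v = x + (w + s) *s v" by (simp add: vector_sadd_rdistrib)
    moreover have "cmod (w + s) < R" using sR[OF w] z by simp
    ultimately show "z + w *s v \<in> {x + w *s v |x w. x \<in> S & cmod w < R}" using z B by blast
   qed (auto intro!: continuous_intros simp: algebra_simps)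
   show "f (x + s *s v + w *s v) ~= 0" if "x \<in> B" "\<eta> <= cmod s" "cmod s < 2 * \<eta>" for x s
   proof -
    have "dist x x0 < e w" using that d(2)[OF w] by (simp add: B_def dist_commute)
    then have "f (x + (w + s) *s v) ~= 0" using e(2)[OF w _ _ , of x s] that B by (auto simp: A_def)
    then show ?thesis by (simp add: vector_sadd_rdistrib algebra_simps)
   qed
  qed (use sub vi Vi B \<eta>(1) in auto)
  have Tz: "Tw w x = L.zr x" for x unfolding Tw_def L.zr_def ..
  have "0 \<in> L.zr x0" using w \<eta>(1) by (simp add: L.zr_def Z_def zr_def)
  then have "L.mu x0 0 > 0" "finite (L.zr x0)" using L.mu_pos[OF B(2)] L.zr_finite[OF B(2)] by auto
  then have K1: "L.K > 0"
   using member_le_sum[of 0 "L.zr x0" "L.mu x0"] \<open>0 \<in> L.zr x0\<close> unfolding L.mu_sum[OF B(2)] by simp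
  define \<sigma> where "\<sigma> = (%x. w + (\<Sum>s\<in>L.zr x. of_nat (L.mu x s) * (x + s *s v) $ i) / of_nat L.K)"
  have "hol V B \<sigma>" unfolding \<sigma>_def
   by (intro hol_add hol_const hol_divide L.power_sum_hol hol_component) (use K1 in auto)
  moreover have "Tw w x ~= {}" if x: "x \<in> B" for x
   using L.mu_sum[OF x] K1 unfolding Tz by auto
  moreover have "\<sigma> x = w + s" if x: "x \<in> B" "Tw w x = {s}" for x s
  proof -
   have zz: "L.zr x = {s}" using x Tz by simp
   then have "L.mu x s = L.K" using L.mu_sum[OF x(1)] by simp
   moreover have "(x + s *s v) $ i = s" using x B SV coord by blast
   ultimately show ?thesis unfolding \<sigma>_def zz using K1 by simp
  qed
  ultimately show ?thesis by blast
 qed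
 then obtain \<sigma> where \<sigma>: "!!w. w \<in> Z ==> hol V B (\<sigma> w)" "!!w x. w \<in> Z ==> x \<in> B ==> Tw w x ~= {}"
  "!!w x s. w \<in> Z ==> x \<in> B ==> Tw w x = {s} ==> \<sigma> w x = w + s" by metis
 have main: "bij_betw (%w. \<sigma> w x) Z (zr x)" if x: "x \<in> B" for x
 proof -
  have xS: "x \<in> S" using x B by blast
  have "\<forall>w. \<exists>s. w \<in> Z --> s \<in> Tw w x" using \<sigma>(2) x by blast
  then obtain s where s: "!!w. w \<in> Z ==> s w \<in> Tw w x" by metis
  have mem: "w + t \<in> zr x" if "w \<in> Z" "t \<in> Tw w x" for w t
  proof -
   have "x + t *s v + w *s v = x + (w + t) *s v" by (simp add: vector_sadd_rdistrib)
   then have "f (x + (w + t) *s v) = 0" using that(2) unfolding Tw_def by (metis (mono_tags, lifting) mem_Collect_eq)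
   then show ?thesis using that sR[OF that(1), of t] unfolding Tw_def zr_def by simp
  qed
  have sep: "w = w'" if "w \<in> Z" "w' \<in> Z" "t \<in> Tw w x" "t' \<in> Tw w' x" "w + t = w' + t'" for w w' t t'
  proof (rule ccontr)
   assume "w ~= w'"
   then have "8 * \<eta> < dist w w'" using \<eta>d that by blast
   moreover have "w - w' = t' - t" using that(5) by (simp add: algebra_simps)
   then have "dist w w' <= cmod t' + cmod t" by (simp add: dist_norm norm_triangle_ineq4)
   ultimately show False using that(3,4) \<eta>(1) by (simp add: Tw_def)
  qed
  have inj: "inj_on (%w. w + s w) Z" using sep s by (intro inj_onI) blast
  have img: "(%w. w + s w) ` Z = zr x"
  proof (rule card_subset_eq[OF zr_finite[OF xS]])
   show sub1: "(%w. w + s w) ` Z \<subseteq> zr x" using mem s by blast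
   have "card ((%w. w + s w) ` Z) = card (zr x0)" using card_image[OF inj] by (simp add: Z_def)
   then show "card ((%w. w + s w) ` Z) = card (zr x)"
    using max[OF xS] card_mono[OF zr_finite[OF xS] sub1] by simp
  qed
  have sing: "Tw w x = {s w}" if w: "w \<in> Z" for w
  proof -
   have "t = s w" if t: "t \<in> Tw w x" for t
   proof -
    have "w + t \<in> (%w. w + s w) ` Z" using mem[OF w t] img by simp
    then obtain w' where w': "w' \<in> Z" "w + t = w' + s w'" by blast
    have "w = w'" by (rule sep[OF w w'(1) t s[OF w'(1)] w'(2)])
    then show ?thesis using w' by simp
   qed
   then show ?thesis using s[OF w] by blast
  qed
  have "\<sigma> w x = w + s w" if "w \<in> Z" for w using \<sigma>(3)[OF that x sing[OF that]] .
  then have "bij_betw (%w. \<sigma> w x) Z (zr x) \<longleftrightarrow> bij_betw (%w. w + s w) Z (zr x)"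
   by (intro bij_betw_cong)
  then show ?thesis using inj img by (simp add: bij_betw_def)
 qed
 obtain b where b: "bij_betw b {0..<card Z} Z" using ex_bij_betw_nat_finite[OF Zf] by blast
 show ?thesis
 proof (intro exI[of _ B] exI[of _ "%l. \<sigma> (b l)"] conjI ballI allI impI B)
  show "hol V B (\<sigma> (b l))" if "l < card (zr x0)" for l
  proof -
   have "b l \<in> Z" using bij_betwE[OF b] that by (simp add: Z_def)
   then show ?thesis by (rule \<sigma>(1))
  qed
  show "bij_betw (%l. \<sigma> (b l) x) {..<card (zr x0)} (zr x)" if "x \<in> B" for x
   using bij_betw_trans[OF b main[OF that]] by (simp add: o_def Z_def atLeast0LessThan)
 qed
qed

end

section \<open>Branched covers: sheets and properness\<close>

lemma holE_imp_continuous: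
 assumes "!!k. continuous_on S (%x. \<sigma> x $ k)"
 shows "continuous_on S (\<sigma> :: _ => complex^'n)"
 using continuous_on_vec_lambda[of S "%k x. \<sigma> x $ k"] assms by simp

lemma norm_ax [simp]: "norm (ax j :: complex^'n) = 1"
proof -
 have "norm (ax j :: complex^'n) = L2_set (%i. if i = j then 1 else 0) UNIV"
  by (simp add: norm_vec_def if_distrib cong: if_cong)
 then show ?thesis by (simp add: L2_set_def if_distrib[of "%x. x\<^sup>2"] cong: if_cong)
qed

text \<open>A tower with no functions left in \<open>F\<close>: \<open>X\<close> projects onto all
  of \<open>D\<close>, with finite fibres controlled by the roots of the \<open>Q j\<close>.\<close>

locale cover =
 fixes X :: "(complex^'n) set" and I :: "'n set" and D :: "(complex^'n) set" and s r :: "'n => real"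
  and Q :: "'n => complex^'n => complex" and H :: "(complex^'n => complex) set"
 assumes tow: "tower X I D s r Q H {}"
begin

abbreviation "V \<equiv> EI I"
abbreviation "Om' \<equiv> Om I D r"

lemmas D = towerD(1-3)[OF tow]
lemmas X0 = towerD(4)[OF tow]
lemmas Hf = towerD(5)[OF tow]
lemmas Hh = towerD(7)[OF tow, rule_format]
lemmas XH = towerD(8)[OF tow]

lemma XD: "pI I ` (X \<inter> Om') = D"
 using towerD(10)[OF tow] by simp

lemma DV: "D \<subseteq> V"
 using D ropen_subset by blast

lemma pI_D: "y \<in> Om' ==> pI I y \<in> D"
 by (simp add: Om_def)

lemma weier: "j \<notin> I ==> weierstrass V (ax j) j D (s j) (r j) (Q j)"
proof
 assume j: "j \<notin> I"
 show "vec.subspace V" "ropen V D" "convex D" using D by auto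
 show "ax j $ j = (1::complex)" by simp
 show "!!x. x \<in> V ==> x $ j = 0" using j by (simp add: EI_def)
 show "D ~= {}" using D by blast
 show "0 < s j" "s j < r j" using towerQ[OF tow j] by auto
 show "hol {x + w *s ax j |x w. x \<in> V} {x + w *s ax j |x w. x \<in> D & cmod w < r j} (Q j)"
  using towerQ(3)[OF tow j] unfolding EI_insert[OF j] Tb_def .
 show "!!x w. x \<in> D ==> s j <= cmod w ==> cmod w < r j ==> Q j (x + w *s ax j) ~= 0"
  using towerQ(4)[OF tow j] .
qed

definition Zr :: "'n => complex^'n => complex set" where
 "Zr j x = {w. cmod w < r j & Q j (x + w *s ax j) = 0}"

lemma Zr_eq: "j \<notin> I ==> weierstrass.zr (ax j) (r j) (Q j) x = Zr j x"
 unfolding Zr_def using weierstrass.zr_def[OF weier] by simp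

lemma X_Zr: "y \<in> X \<inter> Om' ==> j \<notin> I ==> y $ j \<in> Zr j (pI I y)"
 using towerQ(6)[OF tow] by (auto simp: Zr_def Om_def)

lemma X_less: "y \<in> X \<inter> Om' ==> j \<notin> I ==> cmod (y $ j) < s j"
 using weierstrass.zr_less[OF weier, of j "pI I y" "y $ j"] X_Zr Zr_eq pI_D by auto

lemma Zr_0: "j \<notin> I ==> Zr j 0 \<subseteq> {0}"
 using towerQ(5)[OF tow] by (force simp: Zr_def)

lemma Om_open: "open Om'"
proof -
 obtain O1 where O: "open O1" "D = V \<inter> O1" using D(1) unfolding openin_open by auto
 have "Om' = (%y. pI I y) -` O1 \<inter> (\<Inter>j\<in>-I. (%y. y $ j) -` ball 0 (r j))"
  using O by (auto simp: Om_def)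
 moreover have "open ((%y. pI I y) -` O1 \<inter> (\<Inter>j\<in>-I. (%y::complex^'n. y $ j) -` ball 0 (r j)))"
  by (intro open_Int open_INT open_vimage O continuous_intros ballI finite open_ball)
 ultimately show ?thesis by simp
qed

text \<open>Sections through tuples of roots of the equations \<open>Q j\<close>. They cover
  \<open>X\<close> over \<open>B\<close> but need not lie on \<open>X\<close>;
  \<open>fsheets\<close> adds that. By means of \<eta> a point of \<open>X\<close> is assigned to a
  sheet through its distance to the point of the sheet over \<open>x0\<close>.\<close>

definition sheets ::
 "complex^'n => (complex^'n) set => ('n => nat) set => (('n => nat) => complex^'n => complex^'n) => real => bool" where
 "sheets x0 B L \<sigma> \<eta> \<longleftrightarrow> ropen V B & convex B & x0 \<in> B & B \<subseteq> D & finite L & \<eta> > 0 &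
  (\<forall>l\<in>L. \<forall>k. hol V B (%x. \<sigma> l x $ k)) &
  (\<forall>l\<in>L. \<forall>x\<in>B. pI I (\<sigma> l x) = x & \<sigma> l x \<in> Om' & dist (\<sigma> l x) (\<sigma> l x0) < \<eta>) &
  (\<forall>l\<in>L. \<forall>l'\<in>L. l ~= l' --> 2 * \<eta> <= dist (\<sigma> l x0) (\<sigma> l' x0)) &
  (\<forall>y\<in>X \<inter> Om'. pI I y \<in> B --> (\<exists>l\<in>L. y = \<sigma> l (pI I y)))"

lemma sheetsD0:
 assumes "sheets x0 B L \<sigma> \<eta>"
 shows "ropen V B" "convex B" "x0 \<in> B" "B \<subseteq> D" "finite L" "\<eta> > 0"
  "\<forall>l\<in>L. \<forall>k. hol V B (%x. \<sigma> l x $ k)"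
  "\<forall>l\<in>L. \<forall>x\<in>B. pI I (\<sigma> l x) = x & \<sigma> l x \<in> Om' & dist (\<sigma> l x) (\<sigma> l x0) < \<eta>"
  "\<forall>l\<in>L. \<forall>l'\<in>L. l ~= l' --> 2 * \<eta> <= dist (\<sigma> l x0) (\<sigma> l' x0)"
  "\<forall>y\<in>X \<inter> Om'. pI I y \<in> B --> (\<exists>l\<in>L. y = \<sigma> l (pI I y))"
 using assms unfolding sheets_def by - (elim conjE, assumption)+

lemma sheetsD:
 assumes "sheets x0 B L \<sigma> \<eta>"
 shows "ropen V B" "convex B" "x0 \<in> B" "B \<subseteq> D" "finite L" "\<eta> > 0"
  "!!l k. l \<in> L ==> hol V B (%x. \<sigma> l x $ k)"
  "!!l x. l \<in> L ==> x \<in> B ==> pI I (\<sigma> l x) = x" "!!l x. l \<in> L ==> x \<in> B ==> \<sigma> l x \<in> Om'"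
  "!!l x. l \<in> L ==> x \<in> B ==> dist (\<sigma> l x) (\<sigma> l x0) < \<eta>"
  "!!l l'. l \<in> L ==> l' \<in> L ==> l ~= l' ==> 2 * \<eta> <= dist (\<sigma> l x0) (\<sigma> l' x0)"
  "!!y. y \<in> X \<inter> Om' ==> pI I y \<in> B ==> \<exists>l\<in>L. y = \<sigma> l (pI I y)"
 using sheetsD0[OF assms] by simp_all

lemma sheets_continuous:
 assumes "sheets x0 B L \<sigma> \<eta>" "l \<in> L"
 shows "continuous_on B (\<sigma> l)"
 by (rule holE_imp_continuous) (rule hol_continuous[OF sheetsD(7)[OF assms]])

lemma sheet_near:
 assumes sh: "sheets x0 B L \<sigma> \<eta>" and l: "l \<in> L" and y: "y \<in> X \<inter> Om'" "pI I y \<in> B" "dist y (\<sigma> l x0) < \<eta>"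
 shows "y = \<sigma> l (pI I y)"
proof -
 obtain l' where l': "l' \<in> L" "y = \<sigma> l' (pI I y)" using sheetsD(12)[OF sh y(1,2)] by blast
 have "l' = l"
 proof (rule ccontr)
  assume "l' ~= l"
  then have "2 * \<eta> <= dist (\<sigma> l' x0) (\<sigma> l x0)" using sheetsD(11)[OF sh l'(1) l] by blast
  also have "\<dots> <= dist (\<sigma> l' x0) y + dist y (\<sigma> l x0)" by (rule dist_triangle)
  also have "\<dots> < \<eta> + \<eta>"
   using sheetsD(10)[OF sh l'(1) y(2)] l'(2) y(3) by (simp add: dist_commute)
  finally show False by simp
 qed
 then show ?thesis using l' by simp
qed

text \<open>\<delta> is the product of the discriminants of all the equations: where it is nonzero,
  every \<open>Q j\<close> has its maximal number of distinct roots and \<open>local_roots\<close>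
  applies in each coordinate. \<open>M\<close> is the number of tuples and does not depend on
  \<open>x0\<close>.\<close>

lemma branching:
 obtains \<delta> M where "hol V D \<delta>" "\<exists>x\<in>D. \<delta> x ~= 0"
  "!!x0. x0 \<in> D ==> \<delta> x0 ~= 0 ==> \<exists>B L \<sigma> \<eta>. sheets x0 B L \<sigma> \<eta> & card L <= M"
proof -
 define pd where "pd = (%j n \<delta>. j \<notin> I --> hol V D \<delta> & (\<forall>x\<in>D. card (Zr j x) <= n) &
   (\<exists>x\<in>D. card (Zr j x) = n) & (\<forall>x\<in>D. \<delta> x ~= 0 \<longleftrightarrow> card (Zr j x) = n))"
 have "\<exists>n \<delta>. pd j n \<delta>" for j
 proof (cases "j \<in> I")
  case True
  then show ?thesis by (simp add: pd_def)
 next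
  case False
  show ?thesis unfolding pd_def
   using weierstrass.discriminant[OF weier[OF False], unfolded Zr_eq[OF False]] False by simp
 qed
 then obtain n \<delta> where pd: "!!j. pd j (n j) (\<delta> j)" by metis
 have nd: "j \<notin> I ==> hol V D (\<delta> j)" "j \<notin> I ==> x \<in> D ==> card (Zr j x) <= n j"
  "j \<notin> I ==> \<exists>x\<in>D. card (Zr j x) = n j" "j \<notin> I ==> x \<in> D ==> \<delta> j x ~= 0 \<longleftrightarrow> card (Zr j x) = n j" for j x
  using pd[of j] unfolding pd_def by simp_all
 define \<Delta> where "\<Delta> = (%x. \<Prod>j\<in>-I. \<delta> j x)"
 have \<Delta>h: "hol V D \<Delta>" unfolding \<Delta>_def by (intro hol_prod nd) auto
 have \<Delta>nz: "\<exists>x\<in>D. \<Delta> x ~= 0"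
  unfolding \<Delta>_def by (rule hol_prod_nonzero[OF EI_subspace D(1,2)]) (use D nd in auto)
 define L where "L = PiE (-I) (%j. {..<n j})"
 have Lf: "finite L" unfolding L_def by (intro finite_PiE) auto
 have ex: "\<exists>B L \<sigma> \<eta>. sheets x0 B L \<sigma> \<eta> & card L <= card (PiE (-I) (%j. {..<n j}))" if x0: "x0 \<in> D" "\<Delta> x0 ~= 0" for x0
 proof -
  have card0: "card (Zr j x0) = n j" if j: "j \<notin> I" for j
   using x0 nd(4)[OF j x0(1)] j unfolding \<Delta>_def by auto
  define pr where "pr = (%j B \<omega>. j \<notin> I --> ropen V B & x0 \<in> B & B \<subseteq> D & (\<forall>l<n j. hol V B (\<omega> l)) &
    (\<forall>x\<in>B. bij_betw (%l. \<omega> l x) {..<n j} (Zr j x)))"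
  have "\<exists>B \<omega>. pr j B \<omega>" for j
  proof (cases "j \<in> I")
   case True
   then show ?thesis by (simp add: pr_def)
  next
   case False
   have "card (Zr j x) <= card (Zr j x0)" if "x \<in> D" for x using nd(2)[OF False that] card0[OF False] by simp
   then show ?thesis unfolding pr_def
    using weierstrass.local_roots[OF weier[OF False] x0(1), unfolded Zr_eq[OF False]] card0[OF False] by simp
  qed
  then obtain B1 \<omega> where pr: "!!j. pr j (B1 j) (\<omega> j)" by metis
  have B1: "j \<notin> I ==> ropen V (B1 j)" "j \<notin> I ==> x0 \<in> B1 j" "j \<notin> I ==> B1 j \<subseteq> D"
   and \<omega>: "j \<notin> I ==> l < n j ==> hol V (B1 j) (\<omega> j l)"
    "j \<notin> I ==> x \<in> B1 j ==> bij_betw (%l. \<omega> j l x) {..<n j} (Zr j x)" for j l x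
   using pr[of j] unfolding pr_def by simp_all
  define B2 where "B2 = D \<inter> (\<Inter>j\<in>-I. B1 j)"
  have B2: "ropen V B2" "x0 \<in> B2" "B2 \<subseteq> D"
  proof -
   show "ropen V B2"
   proof (cases "-I = {}")
    case True
    then show ?thesis using D by (simp add: B2_def)
   next
    case False
    then show ?thesis unfolding B2_def by (intro openin_Int D openin_INT2 B1) auto
   qed
  qed (use x0 B1 in \<open>auto simp: B2_def\<close>)
  define \<sigma> where "\<sigma> = (%(l::'n => nat) x. (\<chi> j. if j \<in> I then x $ j else \<omega> j (l j) x))"
  have \<sigma>h: "hol V B2 (%x. \<sigma> l x $ k)" if "l \<in> L" for l k
  proof (cases "k \<in> I")
   case True
   then show ?thesis by (simp add: \<sigma>_def hol_component)
  next
   case False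
   then have "hol V (B1 k) (\<omega> k (l k))" using that by (intro \<omega>) (auto simp: L_def)
   then have "hol V B2 (\<omega> k (l k))" by (rule hol_subset) (use False in \<open>auto simp: B2_def\<close>)
   then show ?thesis using False by (simp add: \<sigma>_def)
  qed
  have \<sigma>p: "pI I (\<sigma> l x) = x" if "x \<in> B2" for l x
  proof -
   have "x \<in> V" using that B2 DV by blast
   then show ?thesis by (auto simp: vec_eq_iff \<sigma>_def EI_def)
  qed
  have \<omega>Z: "\<omega> j (l j) x \<in> Zr j x" if "l \<in> L" "x \<in> B2" "j \<notin> I" for l x j
   using bij_betwE[OF \<omega>(2)[OF that(3), of x]] that by (auto simp: L_def B2_def)
  have \<sigma>O: "\<sigma> l x \<in> Om'" if "l \<in> L" "x \<in> B2" for l x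
   using \<omega>Z[OF that] \<sigma>p[OF that(2)] that B2 by (auto simp: Om_def \<sigma>_def Zr_def)
  have \<sigma>c: "continuous_on B2 (\<sigma> l)" if "l \<in> L" for l
   by (rule holE_imp_continuous) (rule hol_continuous[OF \<sigma>h[OF that]])
  have \<sigma>inj: "l = l'" if "l \<in> L" "l' \<in> L" "\<sigma> l x0 = \<sigma> l' x0" for l l'
  proof (rule PiE_ext[OF that(1,2)[unfolded L_def]])
   fix j assume j: "j \<in> - I"
   then have "\<omega> j (l j) x0 = \<omega> j (l' j) x0" using that(3) by (auto simp: \<sigma>_def vec_eq_iff split: if_splits)
   moreover have "inj_on (%l. \<omega> j l x0) {..<n j}" using \<omega>(2)[of j x0] j B1(2) by (simp add: bij_betw_def)
   ultimately show "l j = l' j" using that j by (auto simp: L_def inj_on_def)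
  qed
  obtain \<eta> where \<eta>: "\<eta> > 0" "!!p. p \<in> {p \<in> L \<times> L. fst p ~= snd p} ==> \<eta> < dist (\<sigma> (fst p) x0) (\<sigma> (snd p) x0) / 2"
   by (rule finite_pos_lower_bound[of "{p \<in> L \<times> L. fst p ~= snd p}" "%p. dist (\<sigma> (fst p) x0) (\<sigma> (snd p) x0) / 2"])
    (use Lf \<sigma>inj in auto)
  have "\<exists>e>0. \<forall>x\<in>B2. dist x x0 < e --> dist (\<sigma> l x) (\<sigma> l x0) < \<eta>" if "l \<in> L" for l
   using \<sigma>c[OF that] B2(2) \<eta>(1) unfolding continuous_on_iff by blast
  then obtain e where e: "!!l. l \<in> L ==> e l > 0" "!!l x. l \<in> L ==> x \<in> B2 ==> dist x x0 < e l ==> dist (\<sigma> l x) (\<sigma> l x0) < \<eta>"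
   by metis
  obtain d where d: "d > 0" "!!l. l \<in> L ==> d < e l" by (rule finite_pos_lower_bound[OF Lf, of e]) (use e(1) in auto)
  obtain d2 where d2: "d2 > 0" "!!y. y \<in> V ==> dist y x0 < d2 ==> y \<in> B2" using ropen_ballE[OF B2(1,2)] by metis
  define B where "B = V \<inter> ball x0 (min d d2)"
  have BB2: "B \<subseteq> B2" using d2 by (auto simp: B_def dist_commute)
  have "sheets x0 B L \<sigma> \<eta>"
   unfolding sheets_def
  proof (intro conjI ballI allI impI)
   show "ropen V B" unfolding B_def by (simp add: openin_open_Int)
   show "convex B" unfolding B_def
    by (intro convex_Int convex_ball subspace_imp_convex csubspace_subspace EI_subspace)
   show "x0 \<in> B" using x0 DV d d2 by (auto simp: B_def)
   show "B \<subseteq> D" using BB2 B2 by blast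
   show "hol V B (%x. \<sigma> l x $ k)" if "l \<in> L" for l k by (rule hol_subset[OF \<sigma>h[OF that] BB2])
   show "pI I (\<sigma> l x) = x" "\<sigma> l x \<in> Om'" if "l \<in> L" "x \<in> B" for l x using that \<sigma>p \<sigma>O BB2 by blast+
   show "dist (\<sigma> l x) (\<sigma> l x0) < \<eta>" if "l \<in> L" "x \<in> B" for l x
    using that e(2)[of l x] d(2)[of l] BB2 by (auto simp: B_def dist_commute)
   show "2 * \<eta> <= dist (\<sigma> l x0) (\<sigma> l' x0)" if "l \<in> L" "l' \<in> L" "l ~= l'" for l l'
    using \<eta>(2)[of "(l, l')"] that by simp
   fix y assume y: "y \<in> X \<inter> Om'" "pI I y \<in> B"
   have "\<forall>j. \<exists>m. j \<notin> I --> m < n j & \<omega> j m (pI I y) = y $ j"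
   proof (intro allI)
    fix j
    show "\<exists>m. j \<notin> I --> m < n j & \<omega> j m (pI I y) = y $ j"
    proof (cases "j \<in> I")
     case False
     have "pI I y \<in> B1 j" using y(2) BB2 False by (auto simp: B2_def)
     then have "(%l. \<omega> j l (pI I y)) ` {..<n j} = Zr j (pI I y)"
      using \<omega>(2)[OF False] by (auto simp: bij_betw_def)
     then have "y $ j \<in> (%l. \<omega> j l (pI I y)) ` {..<n j}" using X_Zr[OF y(1) False] by simp
     then show ?thesis by auto
    qed blast
   qed
   then obtain m where m: "!!j. j \<notin> I ==> m j < n j & \<omega> j (m j) (pI I y) = y $ j" by metis
   define l where "l = restrict m (-I)"
   have "l \<in> L" unfolding l_def L_def using m by auto
   moreover have "y = \<sigma> l (pI I y)" using m by (auto simp: vec_eq_iff \<sigma>_def l_def)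
   ultimately show "\<exists>l\<in>L. y = \<sigma> l (pI I y)" by blast
  qed (use Lf \<eta> in auto)
  then show ?thesis unfolding L_def by blast
 qed
 show ?thesis by (rule that[OF \<Delta>h \<Delta>nz ex])
qed

text \<open>The projection is proper: the roots of \<open>Q j\<close> satisfy
  \<open>cmod w < s j\<close> with \<open>s j < r j\<close>, so \<open>X\<close> stays away from the
  lateral boundary of \<open>Om'\<close>.\<close>

lemma X_closed_compact:
 assumes K: "compact K" "K \<subseteq> D"
 shows "compact {y \<in> X \<inter> Om'. pI I y \<in> K}"
proof -
 define C where "C = {y. pI I y \<in> K & (\<forall>j. j \<notin> I --> cmod (y $ j) <= s j)}"
 have CO: "C \<subseteq> Om'" using K towerQ(2)[OF tow] by (force simp: C_def Om_def)
 have "closed C"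
 proof -
  have "C = (%y. pI I y) -` K \<inter> (\<Inter>j\<in>-I. (%y. y $ j) -` cball 0 (s j))" by (auto simp: C_def)
  moreover have "closed ((%y. pI I y) -` K \<inter> (\<Inter>j\<in>-I. (%y::complex^'n. y $ j) -` cball 0 (s j)))"
   by (intro closed_Int closed_INT ballI continuous_closed_vimage compact_imp_closed[OF K(1)] continuous_intros closed_cball)
    (auto intro!: continuous_intros simp: continuous_on_eq_continuous_at[symmetric])
  ultimately show ?thesis by simp
 qed
 moreover have "bounded C"
 proof -
  obtain B where B: "!!x. x \<in> K ==> norm x <= B" using compact_imp_bounded[OF K(1)] unfolding bounded_iff by blast
  have "norm y <= B + (\<Sum>j\<in>-I. s j)" if y: "y \<in> C" for y
  proof -
   have "norm y = norm (pI I y + (\<Sum>j\<in>-I. (y $ j) *s ax j))"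
    by (rule arg_cong[of _ _ norm]) (auto simp: vec_eq_iff if_distrib[of "%x. _ * x"] cong: if_cong)
   also have "\<dots> <= norm (pI I y) + (\<Sum>j\<in>-I. norm ((y $ j) *s ax j))"
    by (intro norm_triangle_mono order_refl norm_sum)
   also have "\<dots> <= B + (\<Sum>j\<in>-I. s j)"
    by (intro add_mono B sum_mono) (use y in \<open>auto simp: C_def\<close>)
   finally show ?thesis .
  qed
  then show ?thesis unfolding bounded_iff by blast
 qed
 ultimately have "compact C" using compact_eq_bounded_closed by blast
 moreover have "{y \<in> X \<inter> Om'. pI I y \<in> K} = {y \<in> C. \<forall>h\<in>H. h y = 0}"
 proof (intro set_eqI iffI)
  fix y assume y: "y \<in> {y \<in> X \<inter> Om'. pI I y \<in> K}"
  then have "y \<in> C" using X_less[of y] by (auto simp: C_def less_imp_le)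
  moreover have "\<forall>h\<in>H. h y = 0" using y XH by blast
  ultimately show "y \<in> {y \<in> C. \<forall>h\<in>H. h y = 0}" by blast
 next
  fix y assume "y \<in> {y \<in> C. \<forall>h\<in>H. h y = 0}"
  then show "y \<in> {y \<in> X \<inter> Om'. pI I y \<in> K}" using CO XH by (auto simp: C_def)
 qed
 moreover have "closed {y \<in> C. \<forall>h\<in>H. h y = 0}"
 proof -
  have eq: "{y \<in> C. \<forall>h\<in>H. h y = 0} = C \<inter> (\<Inter>h\<in>H. {y \<in> C. h y = 0})" by blast
  have "closed {y \<in> C. h y = 0}" if "h \<in> H" for h
   by (rule continuous_closed_preimage_constant[OF continuous_on_subset[OF hol_continuous[OF Hh[OF that]] CO] \<open>closed C\<close>])
  then show ?thesis unfolding eq by (intro closed_Int \<open>closed C\<close> closed_INT ballI)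
 qed
 ultimately show ?thesis
  using compact_Int_closed[of C "{y \<in> C. \<forall>h\<in>H. h y = 0}"] by (simp add: Int_absorb1 Collect_mono)
qed

lemma X_near_fibre:
 assumes b: "b \<in> D" and G: "open G" "{y \<in> X \<inter> Om'. pI I y = b} \<subseteq> G"
 obtains d where "d > 0" "\<forall>y\<in>X \<inter> Om'. dist (pI I y) b < d --> y \<in> G"
proof -
 obtain e where e: "e > 0" "compact (V \<inter> cball b e)" "V \<inter> cball b e \<subseteq> D"
  by (rule ropen_compact_nbhd[OF EI_subspace D(1) b])
 define C where "C = {y \<in> X \<inter> Om'. pI I y \<in> V \<inter> cball b e} - G"
 have Cc: "compact C" unfolding C_def by (intro compact_diff X_closed_compact[OF e(2,3)] G)
 have inC: "y \<in> C" if "y \<in> X \<inter> Om'" "dist (pI I y) b < e" "y \<notin> G" for y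
  using that by (auto simp: C_def dist_commute)
 show ?thesis
 proof (cases "C = {}")
  case True
  then show ?thesis using that[of e] inC e(1) by blast
 next
  case False
  obtain y1 where y1: "y1 \<in> C" "!!y. y \<in> C ==> dist (pI I y1) b <= dist (pI I y) b"
   using continuous_attains_inf[OF Cc False, OF continuous_on_dist[OF continuous_pI[OF continuous_on_id] continuous_on_const], of I b] by blast
  have "dist (pI I y1) b > 0" using y1(1) G(2) by (auto simp: C_def)
  then show ?thesis
   using that[of "min e (dist (pI I y1) b)"] inC y1(2) e(1) by (metis min_less_iff_conj not_le)
 qed
qed

text \<open>Over 0 each \<open>Q j\<close> has at most the root 0, so the fibre is a single point;
  the rest is properness.\<close>

lemma X_small:
 assumes "\<epsilon> > 0"
 obtains d where "d > 0" "!!y. y \<in> X \<inter> Om' ==> norm (pI I y) < d ==> norm y < \<epsilon>"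
proof -
 have "y = 0" if y: "y \<in> X \<inter> Om'" "pI I y = 0" for y
 proof -
  have "y $ j = 0" if j: "j \<notin> I" for j using X_Zr[OF y(1) j] Zr_0[OF j] y(2) by auto
  then show ?thesis using y(2) by (auto simp: vec_eq_iff) (metis pI_nth zero_index)
 qed
 then have "{y \<in> X \<inter> Om'. pI I y = 0} \<subseteq> {0}" by blast
 then have "{y \<in> X \<inter> Om'. pI I y = 0} \<subseteq> ball 0 \<epsilon>" by (rule order_trans) (use assms in simp)
 then obtain d where "d > 0" "\<forall>y\<in>X \<inter> Om'. dist (pI I y) 0 < d --> y \<in> ball 0 \<epsilon>"
  by (rule X_near_fibre[OF D(3) open_ball])
 then show ?thesis using that[of d] by simp
qed

end

section \<open>Dimension and purity\<close>

lemma dim_EI: "dim (EI I :: (complex^'n) set) = 2 * card I"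
proof -
 define d where "d = (%(j, u). axis j u :: complex^'n) ` (I \<times> {1, \<i>})"
 have dB: "d \<subseteq> Basis" by (auto simp: d_def Basis_vec_def Basis_complex_def)
 have "EI I = {x::complex^'n. \<forall>i\<in>Basis. i \<notin> d --> x \<bullet> i = 0}"
 proof (intro set_eqI iffI)
  fix x :: "complex^'n" assume x: "x \<in> EI I"
  have "x \<bullet> i = 0" if i: "i \<in> Basis" "i \<notin> d" for i
  proof -
   obtain j u where ju: "i = axis j u" "u \<in> {1, \<i>}" using i by (auto simp: Basis_vec_def Basis_complex_def)
   then have "j \<notin> I" using i(2) by (auto simp: d_def)
   then show ?thesis using x ju(1) by (simp add: inner_axis EI_def)
  qed
  then show "x \<in> {x. \<forall>i\<in>Basis. i \<notin> d --> x \<bullet> i = 0}" by blast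
 next
  fix x :: "complex^'n" assume x: "x \<in> {x. \<forall>i\<in>Basis. i \<notin> d --> x \<bullet> i = 0}"
  have "x $ j = 0" if j: "j \<notin> I" for j
  proof -
   have "axis j u \<in> Basis & axis j u \<notin> d" if "u \<in> {1, \<i>}" for u
    using that j by (auto simp: d_def Basis_vec_def Basis_complex_def axis_eq_axis)
   then have "x \<bullet> axis j 1 = 0" "x \<bullet> axis j \<i> = 0" using x by blast+
   then show ?thesis by (simp add: inner_axis complex_eq_iff inner_complex_def)
  qed
  then show "x \<in> EI I" by (simp add: EI_def)
 qed
 moreover have "card d = card (I \<times> {1::complex, \<i>})"
  unfolding d_def by (rule card_image) (auto simp: inj_on_def axis_eq_axis complex_eq_iff)
 moreover have "card {1, \<i>} = 2" by (simp add: complex_eq_iff)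
 ultimately show ?thesis using dim_substandard[OF dB] by (simp add: card_cartesian_product)
qed

text \<open>Real topological dimension below \<open>k\<close>. This form lets invariance of domain
  compare charts of the regular part with sheets of a cover.\<close>

definition thin :: "nat => (complex^'n) set => bool" where
 "thin k Y \<longleftrightarrow> (\<forall>T S. \<forall>j :: complex^'n => complex^'n. subspace T & k <= dim T & ropen T S & S ~= {} & continuous_on S j & inj_on j S -->
   ~ j ` S \<subseteq> Y)"

lemma thinD:
 fixes j :: "complex^'n => complex^'n"
 assumes "thin k Y" "subspace T" "k <= dim T" "ropen T S" "S ~= {}" "continuous_on S j" "inj_on j S" "j ` S \<subseteq> Y"
 shows False
 using assms unfolding thin_def by blast

lemma thin_empty: "thin k {}"
 unfolding thin_def by blast

lemma thin_vimage:
 fixes A :: "complex^'n => complex^'n"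
 assumes Y: "thin k Y" and A: "continuous_on UNIV A" "inj A" and Y': "!!y. y \<in> Y' ==> A y \<in> Y" and k: "k <= k'"
 shows "thin k' Y'"
 unfolding thin_def
proof (intro allI impI notI, elim conjE)
 fix T S :: "(complex^'n) set" and j :: "complex^'n => complex^'n"
 assume h: "subspace T" "k' <= dim T" "ropen T S" "S ~= {}" "continuous_on S j" "inj_on j S" "j ` S \<subseteq> Y'"
 show False
 proof (rule thinD[OF Y h(1) _ h(3,4), of "A \<circ> j"])
  show "continuous_on S (A \<circ> j)" by (rule continuous_on_compose[OF h(5) continuous_on_subset[OF A(1)]]) simp
  show "inj_on (A \<circ> j) S" using h(6) A(2) by (auto simp: inj_on_def)
  show "(A \<circ> j) ` S \<subseteq> Y" using h(7) Y' by auto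
 qed (use h k in auto)
qed

lemma ciso_inj: "ciso A B ==> inj A"
 by (rule inj_on_inverseI[of _ B]) (simp add: ciso_def)

context cover
begin

text \<open>Near \<open>b\<close> the embedded piece stays on one sheet, from which it is recovered
  by its projection; so the projection to the base is still injective.\<close>

lemma sheet_projection:
 fixes j :: "complex^'n => complex^'n"
 assumes T: "subspace T" "ropen T S" and j: "continuous_on S j" "inj_on j S" "j ` S \<subseteq> X \<inter> Om'"
  and b: "b \<in> S" and sh: "sheets x0 B L \<sigma> \<eta>" and l: "l \<in> L" and jb: "pI I (j b) \<in> B" "dist (j b) (\<sigma> l x0) < \<eta>"
 obtains S' where "ropen T S'" "b \<in> S'" "S' \<subseteq> S" "inj_on (%c. pI I (j c)) S'"
  "!!c. c \<in> S' ==> pI I (j c) \<in> B & j c = \<sigma> l (pI I (j c))" "continuous_on S' (%c. pI I (j c))"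
proof -
 obtain O1 where O: "open O1" "B = V \<inter> O1" using sheetsD(1)[OF sh] unfolding openin_open by auto
 define S' where "S' = S \<inter> j -` (pI I -` O1 \<inter> ball (\<sigma> l x0) \<eta>)"
 have op: "open (pI I -` O1 \<inter> ball (\<sigma> l x0) \<eta>)"
  by (intro open_Int open_vimage O continuous_pI continuous_on_id open_ball)
 have "ropen S S'" unfolding S'_def using continuous_openin_preimage_gen[OF j(1) op] .
 then have S'o: "ropen T S'" by (rule openin_trans[OF _ T(2)])
 have eq: "pI I (j c) \<in> B & j c = \<sigma> l (pI I (j c))" if c: "c \<in> S'" for c
 proof -
  have "pI I (j c) \<in> B" using c by (simp add: S'_def O)
  then show ?thesis using sheet_near[OF sh l, of "j c"] c j(3) by (auto simp: S'_def dist_commute)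
 qed
 show ?thesis
 proof (rule that[OF S'o _ _ _ eq])
  show "b \<in> S'" using b jb by (auto simp: S'_def O dist_commute)
  show "S' \<subseteq> S" by (auto simp: S'_def)
  then show "continuous_on S' (%c. pI I (j c))" by (intro continuous_intros continuous_on_subset[OF j(1)])
  show "inj_on (%c. pI I (j c)) S'"
  proof (rule inj_onI)
   fix c d assume cd: "c \<in> S'" "d \<in> S'" "pI I (j c) = pI I (j d)"
   then have "j c = j d" using eq by metis
   then show "c = d" using j(2) cd by (auto simp: S'_def inj_on_def)
  qed
 qed
qed

lemma sheet_dim:
 fixes j :: "complex^'n => complex^'n"
 assumes T: "subspace T" "ropen T S" and j: "continuous_on S j" "inj_on j S" "j ` S \<subseteq> X \<inter> Om'"
  and b: "b \<in> S" and sh: "sheets (pI I (j b)) B L \<sigma> \<eta>"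
 shows "dim T <= dim V"
proof -
 have "j b \<in> X \<inter> Om'" using j b by blast
 then obtain l where l: "l \<in> L" "j b = \<sigma> l (pI I (j b))" using sheetsD(12)[OF sh _ sheetsD(3)[OF sh]] by blast
 have "dist (j b) (\<sigma> l (pI I (j b))) < \<eta>" using l(2) sheetsD(6)[OF sh] by simp
 then obtain S' where S': "ropen T S'" "b \<in> S'" "inj_on (%c. pI I (j c)) S'" "continuous_on S' (%c. pI I (j c))"
  using sheet_projection[OF T j b sh l(1) sheetsD(3)[OF sh]] by metis
 show ?thesis
  by (rule invariance_of_dimension_subspaces[OF S'(1) T(1) csubspace_subspace[OF EI_subspace] S'(4) _ S'(3)])
   (use S'(2) in auto)
qed

lemma pI_zero [simp]: "pI J 0 = 0"
 by (simp add: vec_eq_iff)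

lemma Om_0: "0 \<in> Om'"
 using D(3) towerQ(1,2)[OF tow] by (force simp: Om_def)

lemma hol_pI: "hol V D f ==> hol UNIV Om' (%y. f (pI I y))"
 by (rule hol_compose_lin[where M = "pI I"]) (auto intro!: continuous_intros pI_D simp: pI_line)

text \<open>The branch locus is a tower over the same base with \<delta> as the one remaining
  function; as \<delta> is not identically zero, its elimination uses up a coordinate.\<close>

lemma branch_tower:
 assumes \<delta>: "hol V D \<delta>" "x1 \<in> D" "\<delta> x1 ~= 0" "\<delta> 0 = 0"
 shows "\<exists>A B I' D' s' r' Q' H'. ciso A B & tower (A -` (X \<inter> {y. \<delta> (pI I y) = 0})) I' D' s' r' Q' H' {} & I' \<subset> I"
proof -
 have "tower (X \<inter> {y. \<delta> (pI I y) = 0}) I D s r Q (insert (%y. \<delta> (pI I y)) H) {\<delta>}"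
  unfolding tower_def
 proof (intro conjI)
  show "ropen V D" "convex D" "0 \<in> D" using D by auto
  show "0 \<in> X \<inter> {y. \<delta> (pI I y) = 0}" using X0 \<delta> by simp
  show "\<forall>h\<in>insert (%y. \<delta> (pI I y)) H. hol UNIV Om' h" using Hh hol_pI[OF \<delta>(1)] by auto
  show "X \<inter> {y. \<delta> (pI I y) = 0} \<inter> Om' = {y \<in> Om'. \<forall>h\<in>insert (%y. \<delta> (pI I y)) H. h y = 0}"
   using XH by auto
  show "pI I ` (X \<inter> {y. \<delta> (pI I y) = 0} \<inter> Om') = {x \<in> D. \<forall>f\<in>{\<delta>}. f x = 0}"
   using XD by auto
  show "\<forall>j. j \<notin> I --> 0 < s j & s j < r j & hol (EI (insert j I)) (Tb j D (r j)) (Q j) &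
   (\<forall>x\<in>D. \<forall>w. s j <= cmod w & cmod w < r j --> Q j (x + w *s ax j) ~= 0) &
   (\<forall>w. 0 < cmod w & cmod w < r j --> Q j (w *s ax j) ~= 0) &
   (\<forall>y\<in>X \<inter> {y. \<delta> (pI I y) = 0} \<inter> Om'. Q j (pI I y + (y $ j) *s ax j) = 0)"
   using towerD(11)[OF tow] by blast
 qed (use Hf \<delta> in auto)
 from elimination[OF this] \<delta>(2,3) show ?thesis by blast
qed

end

lemma nonbranch_open:
 assumes "cover X I D s r Q H" and \<delta>: "hol (EI I) D \<delta>" "\<delta> 0 ~= 0"
 shows "\<exists>U. open U & 0 \<in> U & U \<subseteq> Om I D r & (\<forall>y\<in>U. \<delta> (pI I y) ~= 0)"
proof -
 interpret cover X I D s r Q H by fact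
 have "open (Om' \<inter> (%y. \<delta> (pI I y)) -` (- {0}))"
  by (rule continuous_open_preimage[OF hol_continuous[OF hol_pI[OF \<delta>(1)]] Om_open]) (simp add: open_Compl)
 then show ?thesis using Om_0 \<delta> by (intro exI[of _ "Om' \<inter> (%y. \<delta> (pI I y)) -` (- {0})"]) auto
qed

lemma (in cover) thin_branch:
 assumes \<delta>: "hol V D \<delta>" "x1 \<in> D" "\<delta> x1 ~= 0"
  and IH: "!!(X :: (complex^'n) set) I' D s r Q H. I' \<subset> I ==> tower X I' D s r Q H {} ==>
   \<exists>U. open U & 0 \<in> U & thin (Suc (dim (EI I'))) (X \<inter> U)"
 shows "\<exists>U. open U & 0 \<in> U & thin (dim V) (X \<inter> {y. \<delta> (pI I y) = 0} \<inter> U)"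
proof (cases "\<delta> 0 = 0")
 case False
 obtain U where U: "open U" "0 \<in> U" "U \<subseteq> Om'" "\<forall>y\<in>U. \<delta> (pI I y) ~= 0"
  using nonbranch_open[OF cover_axioms \<delta>(1) False] by blast
 have "X \<inter> {y. \<delta> (pI I y) = 0} \<inter> U = {}" using U(4) by blast
 then show ?thesis using U(1,2) thin_empty by (intro exI[of _ U]) simp
next
 case True
 obtain A B I' D' s' r' Q' H' where A: "ciso A B"
  "tower (A -` (X \<inter> {y. \<delta> (pI I y) = 0})) I' D' s' r' Q' H' {}" "I' \<subset> I"
  using branch_tower[OF \<delta>(1) _ _ True] \<delta>(2,3) by blast
 obtain U where U: "open U" "0 \<in> U" "thin (Suc (dim (EI I'))) (A -` (X \<inter> {y. \<delta> (pI I y) = 0}) \<inter> U)"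
  using IH[OF A(3,2)] by blast
 have "card I' < card I" using A(3) by (intro psubset_card_mono) auto
 then have le: "Suc (dim (EI I' :: (complex^'n) set)) <= dim V" by (simp add: dim_EI)
 have BA: "A (B y) = y" for y using A(1) by (simp add: ciso_def)
 have Bc: "continuous_on UNIV B" "inj B" using ciso_continuous[OF ciso_sym[OF A(1)]] ciso_inj[OF ciso_sym[OF A(1)]] .
 have "thin (dim V) (X \<inter> {y. \<delta> (pI I y) = 0} \<inter> B -` U)"
  by (rule thin_vimage[OF U(3) Bc _ le]) (simp add: BA)
 moreover have "open (B -` U)" using U(1) Bc by (intro open_vimage)
 moreover have "0 \<in> B -` U" using U(2) ciso_zero[OF ciso_sym[OF A(1)]] by simp
 ultimately show ?thesis by blast
qed

text \<open>Induction on \<open>card I\<close>. By invariance of domain a piece of dimension above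
  \<open>dim V\<close> cannot meet the part of \<open>X\<close> over which there are sheets, so it
  lies in the branch locus, whose dimension is smaller by \<open>branch_tower\<close>.\<close>

lemma dim_bound:
 fixes X :: "(complex^'n) set"
 assumes "tower X I D s r Q H {}"
 shows "\<exists>U. open U & 0 \<in> U & thin (Suc (dim (EI I))) (X \<inter> U)"
 using assms
proof (induction "card I" arbitrary: X I D s r Q H rule: less_induct)
 case less
 interpret cover X I D s r Q H by unfold_locales (rule less.prems)
 obtain \<delta> M where \<delta>: "hol V D \<delta>" "\<exists>x\<in>D. \<delta> x ~= 0"
  "!!x0. x0 \<in> D ==> \<delta> x0 ~= 0 ==> \<exists>B L \<sigma> \<eta>. sheets x0 B L \<sigma> \<eta> & card L <= M"
 proof (rule branching)
  fix \<delta> M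
  assume a: "hol V D \<delta>" "\<exists>x\<in>D. \<delta> x ~= 0"
   "!!x0. x0 \<in> D ==> \<delta> x0 ~= 0 ==> \<exists>B L \<sigma> \<eta>. sheets x0 B L \<sigma> \<eta> & card L <= M"
  show thesis by (rule that[OF a])
 qed
 have main: "False" if T: "subspace T" "dim V < dim T" "ropen T S" "b \<in> S" and j: "continuous_on S j" "inj_on j S" "j ` S \<subseteq> X \<inter> Om'"
  and nz: "\<delta> (pI I (j b)) ~= 0" for T S :: "(complex^'n) set" and j :: "complex^'n => complex^'n" and b
 proof -
  have "pI I (j b) \<in> D" using j(3) T(4) pI_D by blast
  then obtain B L \<sigma> \<eta> where "sheets (pI I (j b)) B L \<sigma> \<eta>" using \<delta>(3) nz by blast
  then show False using sheet_dim[OF T(1,3) j T(4)] T(2) by fastforce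
 qed
 have IH: "\<exists>U. open U & 0 \<in> U & thin (Suc (dim (EI I'))) (X' \<inter> U)"
  if "I' \<subset> I" "tower X' I' D' s' r' Q' H' {}" for X' :: "(complex^'n) set" and I' D' s' r' Q' H'
  by (rule less.hyps[OF psubset_card_mono[OF _ that(1)] that(2)]) simp
 obtain x1 where x1: "x1 \<in> D" "\<delta> x1 ~= 0" using \<delta>(2) by blast
 have "\<exists>U. open U & 0 \<in> U & thin (dim V) (X \<inter> {y. \<delta> (pI I y) = 0} \<inter> U)"
  by (rule thin_branch[OF \<delta>(1) x1]) (rule IH)
 then obtain U where U: "open U" "0 \<in> U" "thin (dim V) (X \<inter> {y. \<delta> (pI I y) = 0} \<inter> U)" by blast
 have "thin (Suc (dim V)) (X \<inter> (Om' \<inter> U))"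
  unfolding thin_def
 proof (intro allI impI notI, elim conjE)
  fix T S :: "(complex^'n) set" and j :: "complex^'n => complex^'n"
  assume h: "subspace T" "Suc (dim V) <= dim T" "ropen T S" "S ~= {}" "continuous_on S j" "inj_on j S" "j ` S \<subseteq> X \<inter> (Om' \<inter> U)"
  have jX: "j ` S \<subseteq> X \<inter> Om'" using h(7) by blast
  have "\<delta> (pI I (j b)) = 0" if "b \<in> S" for b using main[OF h(1) Suc_le_lessD[OF h(2)] h(3) that h(5,6) jX] by blast
  then have "j ` S \<subseteq> X \<inter> {y. \<delta> (pI I y) = 0} \<inter> U" using h(7) by blast
  then show False by (rule thinD[OF U(3) h(1) Suc_leD[OF h(2)] h(3-6)])
 qed
 then show ?case using U(1,2) Om_open Om_0 by (intro exI[of _ "Om' \<inter> U"]) auto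
qed

lemma (in cover) dim_bound_branch:
 assumes "hol V D \<delta>" "x1 \<in> D" "\<delta> x1 ~= 0"
 shows "\<exists>U. open U & 0 \<in> U & thin (dim V) (X \<inter> {y. \<delta> (pI I y) = 0} \<inter> U)"
 by (rule thin_branch[OF assms]) (rule dim_bound)

text \<open>A nonlinear inner map does not carry lines to lines; the outer function is therefore
  differentiated in the Frechet sense, by \<open>hol_imp_holo_on\<close>, and the chain rule
  applies.\<close>

lemma hol_compose_map:
 fixes \<sigma> :: "complex^'n => complex^'n"
 assumes V: "vec.subspace V" "ropen V B" and O1: "open O1" and f: "hol UNIV O1 f"
  and \<sigma>: "!!k. hol V B (%x. \<sigma> x $ k)" "!!x. x \<in> B ==> \<sigma> x \<in> O1"
 shows "hol V B (%x. f (\<sigma> x))"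
 unfolding hol_def
proof (intro conjI ballI)
 have "continuous_on B \<sigma>" by (rule holE_imp_continuous) (rule hol_continuous[OF \<sigma>(1)])
 then show "continuous_on B (%x. f (\<sigma> x))"
  by (rule continuous_on_compose2[OF hol_continuous[OF f]]) (use \<sigma>(2) in auto)
 fix z v assume zv: "z \<in> B" "v \<in> V"
 have "\<exists>d. ((%t. \<sigma> (z + t *s v) $ k) has_field_derivative d) (at 0)" for k
  using \<sigma>(1)[of k] zv unfolding hol_def field_differentiable_def by blast
 then obtain d where d: "!!k. ((%t. \<sigma> (z + t *s v) $ k) has_field_derivative d k) (at 0)" by metis
 have bl: "bounded_linear (%c::complex. c *s (ax k :: complex^'n))" for k
  by (rule linear_conv_bounded_linear[THEN iffD1], rule linearI) (auto simp: vec_eq_iff algebra_simps)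
 have "((%t. \<Sum>k\<in>UNIV. (\<sigma> (z + t *s v) $ k) *s ax k) has_derivative (%t. \<Sum>k\<in>UNIV. (d k * t) *s ax k)) (at 0)"
  by (intro has_derivative_sum bounded_linear.has_derivative[OF bl] d[unfolded has_field_derivative_def])
 moreover have "(\<Sum>k\<in>UNIV. (x $ k) *s ax k) = x" for x :: "complex^'n"
  by (simp add: vec_eq_iff if_distrib[of "%x. _ * x"] cong: if_cong)
 moreover have "(\<Sum>k\<in>UNIV. (d k * t) *s ax k) = t *s (\<Sum>k\<in>UNIV. d k *s (ax k :: complex^'n))" for t
  by (simp add: vec_eq_iff sum_distrib_left mult_ac)
 ultimately have 1: "((%t. \<sigma> (z + t *s v)) has_derivative (%t. t *s (\<Sum>k\<in>UNIV. d k *s ax k))) (at 0)" by simp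
 obtain L where L: "Vector_Spaces.linear (*s) (*) L" "(f has_derivative L) (at (\<sigma> z) within O1)"
  using hol_imp_holo_on[OF O1 f] \<sigma>(2)[OF zv(1)] unfolding holo_on_def by blast
 have "(f has_derivative L) (at (\<sigma> (z + 0 *s v)))"
  using L(2) at_within_open[OF \<sigma>(2)[OF zv(1)] O1] by simp
 from diff_chain_at[OF 1 this] have "((%t. f (\<sigma> (z + t *s v))) has_derivative (%t. L (t *s (\<Sum>k\<in>UNIV. d k *s ax k)))) (at 0)"
  by (simp add: o_def)
 moreover have "L (t *s w) = L w * t" for t w
  using L(1) by (simp add: Vector_Spaces.linear_iff mult.commute)
 ultimately show "(%t. f (\<sigma> (z + t *s v))) field_differentiable (at 0)"
  unfolding field_differentiable_def has_field_derivative_def by auto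
qed

lemma Om_mono: "D' \<subseteq> D ==> Om I D' r \<subseteq> Om I D r"
 by (auto simp: Om_def)

lemma tower_restrict:
 fixes X :: "(complex^'n) set"
 assumes tow: "tower X I D s r Q H {}" and D': "ropen (EI I) D'" "convex D'" "0 \<in> D'" "D' \<subseteq> D"
 shows "tower X I D' s r Q H {}"
 unfolding tower_def
proof (intro conjI allI impI)
 note OO = Om_mono[OF D'(4)]
 show "ropen (EI I) D'" "convex D'" "0 \<in> D'" by fact+
 show "0 \<in> X" "finite H" "finite ({} :: (complex^'n => complex) set)" using towerD(4,5)[OF tow] by auto
 show "\<forall>h\<in>H. hol UNIV (Om I D' r) h" using towerD(7)[OF tow] hol_subset[OF _ OO] by blast
 show "X \<inter> Om I D' r = {y \<in> Om I D' r. \<forall>h\<in>H. h y = 0}" using towerD(8)[OF tow] OO by blast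
 show "pI I ` (X \<inter> Om I D' r) = {x \<in> D'. \<forall>f\<in>{}. f x = 0}"
 proof
  show "{x \<in> D'. \<forall>f\<in>{}. f x = 0} \<subseteq> pI I ` (X \<inter> Om I D' r)"
  proof
   fix x :: "complex^'n" assume "x \<in> {x \<in> D'. \<forall>f\<in>{}. f x = 0}"
   then have x: "x \<in> D'" by simp
   then have "x \<in> pI I ` (X \<inter> Om I D r)" using towerD(10)[OF tow] D'(4) by auto
   then obtain y where "y \<in> X \<inter> Om I D r" "x = pI I y" by blast
   then show "x \<in> pI I ` (X \<inter> Om I D' r)" using x by (auto simp: Om_def)
  qed
 qed (auto simp: Om_def)
 fix j assume j: "j \<notin> I"
 show "0 < s j" "s j < r j" using towerQ(1,2)[OF tow j] .
 show "hol (EI (insert j I)) (Tb j D' (r j)) (Q j)"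
  by (rule hol_subset[OF towerQ(3)[OF tow j]]) (use D'(4) in \<open>auto simp: Tb_def\<close>)
 show "\<forall>x\<in>D'. \<forall>w. s j <= cmod w & cmod w < r j --> Q j (x + w *s ax j) ~= 0" using towerQ(4)[OF tow j] D'(4) by blast
 show "!!w. 0 < cmod w & cmod w < r j ==> Q j (w *s ax j) ~= 0" using towerQ(5)[OF tow j] by blast
 show "\<forall>y\<in>X \<inter> Om I D' r. Q j (pI I y + (y $ j) *s ax j) = 0" using towerQ(6)[OF tow j] OO by blast
qed auto

section \<open>Purity, sheets inside the variety, density of unbranched points\<close>

definition (in cover) fsheets where
 "fsheets x0 B L \<sigma> \<eta> \<longleftrightarrow> sheets x0 B L \<sigma> \<eta> & (\<forall>l\<in>L. \<forall>x\<in>B. \<sigma> l x \<in> X)"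

text \<open>Purity in topological form: everywhere on \<open>X\<close> there are arbitrarily small
  embedded pieces of the full real dimension of the base.\<close>

definition (in cover) pure :: bool where
 "pure \<longleftrightarrow> (\<forall>y\<in>X \<inter> Om'. \<forall>W. open W & y \<in> W --> (\<exists>T S j. subspace T & dim T = dim V & ropen T S & S ~= {} &
   continuous_on S j & inj_on j S & (j :: complex^'n => complex^'n) ` S \<subseteq> X \<inter> W))"

lemma (in cover) pureE:
 assumes "pure" "y \<in> X \<inter> Om'" "open W" "y \<in> W"
 obtains T S :: "(complex^'n) set" and j :: "complex^'n => complex^'n"
 where "subspace T" "dim T = dim V" "ropen T S" "S ~= {}" "continuous_on S j" "inj_on j S" "j ` S \<subseteq> X \<inter> W"
proof -
 have "\<exists>T S j. subspace T & dim T = dim V & ropen T S & S ~= {} &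
   continuous_on S j & inj_on j S & (j :: complex^'n => complex^'n) ` S \<subseteq> X \<inter> W"
  using assms unfolding pure_def by (elim ballE allE impE) auto
 then show ?thesis by (elim exE conjE) (rule that)
qed

locale bcover = cover X I D s r Q H for X :: "(complex^'n) set" and I D s r Q H +
 fixes \<delta> :: "complex^'n => complex" and M :: nat
 assumes \<delta>h: "hol V D \<delta>" and \<delta>nz: "\<exists>x\<in>D. \<delta> x ~= 0"
  and fsh: "x0 \<in> D ==> \<delta> x0 ~= 0 ==> \<exists>B L \<sigma> \<eta>. fsheets x0 B L \<sigma> \<eta> & card L <= M"

text \<open>By purity a piece of dimension \<open>dim V\<close> lies on the sheet near the given
  point. Its projection is open by invariance of domain; the equations of \<open>X\<close> hold on
  the sheet over this open set and hence, by the identity theorem, over all of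
  \<open>B\<close>.\<close>

lemma (in cover) sheet_all_or_nothing:
 assumes pure: pure and sh: "sheets x0 B L \<sigma> \<eta>" and l: "l \<in> L" and x1: "x1 \<in> B" "\<sigma> l x1 \<in> X" and x: "x \<in> B"
 shows "\<sigma> l x \<in> X"
proof -
 obtain O1 where O: "open O1" "B = V \<inter> O1" using sheetsD(1)[OF sh] unfolding openin_open by auto
 define W where "W = Om' \<inter> (pI I -` O1 \<inter> ball (\<sigma> l x0) \<eta>)"
 have Wo: "open W" unfolding W_def
  by (intro open_Int Om_open open_vimage O continuous_pI continuous_on_id open_ball)
 have y: "\<sigma> l x1 \<in> X \<inter> Om'" "\<sigma> l x1 \<in> W"
  using x1 sheetsD(8-10)[OF sh l x1(1)] O by (auto simp: W_def dist_commute)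
 obtain T S :: "(complex^'n) set" and j :: "complex^'n => complex^'n"
  where T: "subspace T" "dim T = dim V" "ropen T S" "S ~= {}" and j: "continuous_on S j" "inj_on j S" "j ` S \<subseteq> X \<inter> W"
  by (rule pureE[OF pure y(1) Wo y(2)])
 obtain b where b: "b \<in> S" using T(4) by blast
 have jX: "j ` S \<subseteq> X \<inter> Om'" using j(3) by (auto simp: W_def)
 have jb: "pI I (j b) \<in> B" "dist (j b) (\<sigma> l x0) < \<eta>" using j(3) b O by (auto simp: W_def dist_commute)
 obtain S' where S': "ropen T S'" "b \<in> S'" "S' \<subseteq> S" "inj_on (%c. pI I (j c)) S'"
  "!!c. c \<in> S' ==> pI I (j c) \<in> B & j c = \<sigma> l (pI I (j c))" "continuous_on S' (%c. pI I (j c))"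
  using sheet_projection[OF T(1,3) j(1,2) jX b sh l jb] by metis
 have "ropen V ((%c. pI I (j c)) ` S')"
  by (rule invariance_of_domain_subspaces[OF S'(1) T(1) csubspace_subspace[OF EI_subspace] _ S'(6) _ S'(4)])
   (use T(2) in auto)
 then obtain e where e: "e > 0" "!!y. y \<in> V ==> dist y (pI I (j b)) < e ==> y \<in> (%c. pI I (j c)) ` S'"
  using ropen_ballE S'(2) by (metis imageI)
 have "h (\<sigma> l x) = 0" if h: "h \<in> H" for h
 proof (rule hol_identity[OF EI_subspace sheetsD(1,2)[OF sh] _ jb(1) e(1) _ x, where f = "%x. h (\<sigma> l x)"])
  show "hol V B (%x. h (\<sigma> l x))"
   by (rule hol_compose_map[OF EI_subspace sheetsD(1)[OF sh] Om_open Hh[OF h] sheetsD(7)[OF sh l] sheetsD(9)[OF sh l]])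
  fix y assume y: "y \<in> B" "dist y (pI I (j b)) < e"
  then have "y \<in> (%c. pI I (j c)) ` S'" using e(2) sheetsD(4)[OF sh] DV by blast
  then obtain c where c: "c \<in> S'" "y = pI I (j c)" by blast
  then have "\<sigma> l y \<in> X \<inter> Om'" using S'(3) S'(5)[OF c(1)] jX by auto
  then show "h (\<sigma> l y) = 0" using XH h by blast
 qed
 then show ?thesis using XH sheetsD(9)[OF sh l x] by blast
qed

lemma (in cover) fsheets_exist:
 assumes pure: pure and sh: "sheets x0 B L \<sigma> \<eta>"
 shows "\<exists>L'. fsheets x0 B L' \<sigma> \<eta> & card L' <= card L"
proof -
 define L' where "L' = {l \<in> L. \<exists>x\<in>B. \<sigma> l x \<in> X}"
 have "\<exists>l\<in>L'. y = \<sigma> l (pI I y)" if y: "y \<in> X \<inter> Om'" "pI I y \<in> B" for y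
 proof -
  obtain l where l: "l \<in> L" "y = \<sigma> l (pI I y)" using sheetsD(12)[OF sh y] by blast
  then have "\<sigma> l (pI I y) \<in> X" using y(1) by simp
  then show ?thesis using l y(2) unfolding L'_def by blast
 qed
 then have "sheets x0 B L' \<sigma> \<eta>"
  using sh unfolding sheets_def by (elim conjE, intro conjI) (assumption | force simp: L'_def)+
 moreover have "\<forall>l\<in>L'. \<forall>x\<in>B. \<sigma> l x \<in> X" using sheet_all_or_nothing[OF pure sh] by (auto simp: L'_def)
 moreover have "card L' <= card L" using sheetsD(5)[OF sh] by (auto simp: L'_def intro: card_mono)
 ultimately show ?thesis unfolding fsheets_def by blast
qed

lemma (in cover) pure_bcover:
 assumes pure: pure
 shows "\<exists>\<delta> M. bcover X I D s r Q H \<delta> M"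
proof (rule branching)
 fix \<delta> M
 assume a: "hol V D \<delta>" "\<exists>x\<in>D. \<delta> x ~= 0"
   "!!x0. x0 \<in> D ==> \<delta> x0 ~= 0 ==> \<exists>B L \<sigma> \<eta>. sheets x0 B L \<sigma> \<eta> & card L <= M"
 have "bcover X I D s r Q H \<delta> M"
 proof
  fix x0 assume x0: "x0 \<in> D" "\<delta> x0 ~= 0"
  obtain B L \<sigma> \<eta> where sh: "sheets x0 B L \<sigma> \<eta>" "card L <= M" using a(3)[OF x0] by blast
  obtain L' where "fsheets x0 B L' \<sigma> \<eta>" "card L' <= card L" using fsheets_exist[OF pure sh(1)] by blast
  then show "\<exists>B L \<sigma> \<eta>. fsheets x0 B L \<sigma> \<eta> & card L <= M" using sh(2) le_trans by blast
 qed (use a in auto)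
 then show ?thesis by blast
qed

lemma (in bcover) bcover_restrict:
 assumes D': "ropen V D'" "convex D'" "0 \<in> D'" "D' \<subseteq> D"
 shows "bcover X I D' s r Q H \<delta> M"
proof -
 interpret C: cover X I D' s r Q H by unfold_locales (rule tower_restrict[OF tow D'])
 show ?thesis
 proof
  show "hol V D' \<delta>" by (rule hol_subset[OF \<delta>h D'(4)])
  obtain x1 where x1: "x1 \<in> D" "\<delta> x1 ~= 0" using \<delta>nz by blast
  obtain e where e: "e > 0" "!!y. y \<in> V ==> dist y 0 < e ==> y \<in> D'" using ropen_ballE[OF D'(1,3)] by metis
  obtain y where "y \<in> D" "dist y 0 < e" "\<delta> y ~= 0"
   by (rule hol_nonzero_dense[OF EI_subspace D(1,2) \<delta>h x1 D(3) e(1)])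
  then show "\<exists>x\<in>D'. \<delta> x ~= 0" using e(2) DV by blast
  fix x0 assume x0: "x0 \<in> D'" "\<delta> x0 ~= 0"
  then obtain B L \<sigma> \<eta> where sh: "fsheets x0 B L \<sigma> \<eta>" "card L <= M" using fsh D'(4) by blast
  note S = sh(1)[unfolded fsheets_def, THEN conjunct1]
  have O: "Om I D' r \<subseteq> Om'" by (rule Om_mono[OF D'(4)])
  have "C.sheets x0 (B \<inter> D') L \<sigma> \<eta>"
   unfolding C.sheets_def
  proof (intro conjI ballI allI impI)
   show "ropen V (B \<inter> D')" using sheetsD(1)[OF S] D' by (intro openin_Int)
   show "convex (B \<inter> D')" using sheetsD(2)[OF S] D' by (intro convex_Int)
   show "hol V (B \<inter> D') (%x. \<sigma> l x $ k)" if "l \<in> L" for l k by (rule hol_subset[OF sheetsD(7)[OF S that]]) simp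
   show "\<sigma> l x \<in> Om I D' r" if "l \<in> L" "x \<in> B \<inter> D'" for l x
    using sheetsD(8,9)[OF S that(1), of x] that(2) by (simp add: Om_def)
   show "\<exists>l\<in>L. y = \<sigma> l (pI I y)" if "y \<in> X \<inter> Om I D' r" "pI I y \<in> B \<inter> D'" for y
    using sheetsD(12)[OF S] that O by blast
  qed (use sheetsD[OF S] x0 in auto)
  moreover have "\<forall>l\<in>L. \<forall>x\<in>B \<inter> D'. \<sigma> l x \<in> X" using sh(1) by (auto simp: fsheets_def)
  ultimately show "\<exists>B L \<sigma> \<eta>. C.fsheets x0 B L \<sigma> \<eta> & card L <= M" using sh(2) unfolding C.fsheets_def by blast
 qed
qed

locale pcover = bcover X I D s r Q H \<delta> M for X :: "(complex^'n) set" and I D s r Q H \<delta> M +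
 assumes dense: "y \<in> X \<inter> Om' ==> open W ==> y \<in> W ==> \<exists>y'\<in>X \<inter> Om' \<inter> W. \<delta> (pI I y') ~= 0"

lemma (in pcover) pcover_restrict:
 assumes D': "ropen V D'" "convex D'" "0 \<in> D'" "D' \<subseteq> D"
 shows "pcover X I D' s r Q H \<delta> M"
proof -
 interpret C: bcover X I D' s r Q H \<delta> M by (rule bcover_restrict[OF D'])
 show ?thesis
 proof
  fix y W assume y: "y \<in> X \<inter> Om I D' r" "open W" "y \<in> W"
  have "y \<in> X \<inter> Om'" using y(1) Om_mono[OF D'(4)] by blast
  then obtain y' where "y' \<in> X \<inter> Om' \<inter> (W \<inter> Om I D' r)" "\<delta> (pI I y') ~= 0"
   using dense[of y "W \<inter> Om I D' r"] y C.Om_open by blast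
  then show "\<exists>y'\<in>X \<inter> Om I D' r \<inter> W. \<delta> (pI I y') ~= 0" by blast
 qed
qed

text \<open>The branch locus is thin near 0, so no piece of full dimension fits into it; shrinking
  \<open>D\<close> confines all of \<open>X\<close> over it to that neighbourhood of 0.\<close>

lemma (in cover) pure_pcover:
 assumes pure: pure
 shows "\<exists>D' \<delta> M. ropen V D' & convex D' & 0 \<in> D' & D' \<subseteq> D & pcover X I D' s r Q H \<delta> M"
proof -
 obtain \<delta> M where b: "bcover X I D s r Q H \<delta> M" using pure_bcover[OF pure] by blast
 interpret b: bcover X I D s r Q H \<delta> M by (rule b)
 obtain x1 where x1: "x1 \<in> D" "\<delta> x1 ~= 0" using b.\<delta>nz by blast
 obtain U where U: "open U" "0 \<in> U" "thin (dim V) (X \<inter> {y. \<delta> (pI I y) = 0} \<inter> U)"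
  using dim_bound_branch[OF b.\<delta>h x1] by blast
 obtain e where e: "e > 0" "ball 0 e \<subseteq> U" using U open_contains_ball by blast
 obtain d where d: "d > 0" "!!y. y \<in> X \<inter> Om' ==> norm (pI I y) < d ==> norm y < e" using X_small[OF e(1)] by metis
 define D' where "D' = D \<inter> ball 0 d"
 have D': "ropen V D'" "convex D'" "0 \<in> D'" "D' \<subseteq> D"
  using D d(1) by (auto simp: D'_def intro: convex_Int openin_Int_open)
 interpret C: bcover X I D' s r Q H \<delta> M by (rule b.bcover_restrict[OF D'])
 have "pcover X I D' s r Q H \<delta> M"
 proof
  fix y W assume y: "y \<in> X \<inter> Om I D' r" "open W" "y \<in> W"
  have O: "Om I D' r \<subseteq> Om'" by (rule Om_mono[OF D'(4)])
  have "y \<in> X \<inter> Om'" "open (W \<inter> Om I D' r)" "y \<in> W \<inter> Om I D' r" using y O C.Om_open by auto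
  then obtain T S :: "(complex^'n) set" and j :: "complex^'n => complex^'n"
   where T: "subspace T" "dim T = dim V" "ropen T S" "S ~= {}" and j: "continuous_on S j" "inj_on j S" "j ` S \<subseteq> X \<inter> (W \<inter> Om I D' r)"
   by (rule pureE[OF pure])
  have "X \<inter> (W \<inter> Om I D' r) \<subseteq> U"
  proof
   fix y assume "y \<in> X \<inter> (W \<inter> Om I D' r)"
   then have "y \<in> X \<inter> Om'" "norm (pI I y) < d" using O by (auto simp: Om_def D'_def)
   then show "y \<in> U" using d(2) e(2) by auto
  qed
  moreover have "~ j ` S \<subseteq> X \<inter> {y. \<delta> (pI I y) = 0} \<inter> U"
   using thinD[OF U(3) T(1) _ T(3,4) j(1,2)] T(2) by auto
  ultimately show "\<exists>y'\<in>X \<inter> Om I D' r \<inter> W. \<delta> (pI I y') ~= 0" using j(3) by blast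
 qed
 then show ?thesis using D' by blast
qed

section \<open>Traces and their order of vanishing\<close>

definition (in cover) fib where "fib x = {y \<in> X \<inter> Om'. pI I y = x}"

lemma (in cover) fib_finite:
 assumes "x \<in> D"
 shows "finite (fib x)"
proof -
 have "inj_on (%y. \<lambda>j\<in>-I. y $ j) (fib x)"
 proof (rule inj_onI)
  fix y y' assume y: "y \<in> fib x" "y' \<in> fib x" "(\<lambda>j\<in>-I. y $ j) = (\<lambda>j\<in>-I. y' $ j)"
  have "y $ j = y' $ j" for j
  proof (cases "j \<in> I")
   case True
   have "pI I y $ j = pI I y' $ j" using y by (simp only: fib_def mem_Collect_eq)
   then show ?thesis using True by simp
  next
   case False
   then show ?thesis using fun_cong[OF y(3), of j] by simp
  qed
  then show "y = y'" by (simp add: vec_eq_iff)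
 qed
 moreover have "(%y. \<lambda>j\<in>-I. y $ j) ` fib x \<subseteq> PiE (-I) (%j. Zr j x)"
  using X_Zr by (auto simp: fib_def)
 moreover have "finite (PiE (-I) (%j. Zr j x))"
 proof (rule finite_PiE)
  fix j assume "j \<in> - I"
  then show "finite (Zr j x)" using weierstrass.zr_finite[OF weier, of j x] assms Zr_eq by simp
 qed simp
 ultimately show ?thesis using inj_on_finite by blast
qed

context bcover
begin

lemma fsheetsD:
 assumes "fsheets x0 B L \<sigma> \<eta>"
 shows "sheets x0 B L \<sigma> \<eta>" "!!l x. l \<in> L ==> x \<in> B ==> \<sigma> l x \<in> X"
 using assms by (auto simp: fsheets_def)

lemma sheet_sep:
 assumes sh: "sheets x0 B L \<sigma> \<eta>" and "l \<in> L" "l' \<in> L" "x \<in> B" "x' \<in> B" "\<sigma> l x = \<sigma> l' x'"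
 shows "l = l'"
proof (rule ccontr)
 assume "l ~= l'"
 then have "2 * \<eta> <= dist (\<sigma> l x0) (\<sigma> l' x0)" using sheetsD(11)[OF sh] assms by blast
 also have "\<dots> <= dist (\<sigma> l x0) (\<sigma> l x) + dist (\<sigma> l x) (\<sigma> l' x0)" by (rule dist_triangle)
 also have "\<dots> < \<eta> + \<eta>"
  using sheetsD(10)[OF sh, of l x] sheetsD(10)[OF sh, of l' x'] assms by (simp add: dist_commute)
 finally show False by simp
qed

lemma fib_sheet:
 assumes sh: "fsheets x0 B L \<sigma> \<eta>" and x: "x \<in> B"
 shows "bij_betw (%l. \<sigma> l x) L (fib x)"
 unfolding bij_betw_def
proof
 note S = fsheetsD(1)[OF sh]
 show "inj_on (%l. \<sigma> l x) L" using sheet_sep[OF S _ _ x x] by (auto intro!: inj_onI)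
 show "(%l. \<sigma> l x) ` L = fib x"
 proof
  show "(%l. \<sigma> l x) ` L \<subseteq> fib x" using sheetsD(8,9)[OF S _ x] fsheetsD(2)[OF sh _ x] by (auto simp: fib_def)
  show "fib x \<subseteq> (%l. \<sigma> l x) ` L" using sheetsD(12)[OF S] x by (auto simp: fib_def)
 qed
qed

lemma card_fib: "x \<in> D ==> \<delta> x ~= 0 ==> card (fib x) <= M"
 using fsh fib_sheet bij_betw_same_card sheetsD(3) fsheetsD(1) by metis

definition Tr :: "(complex^'n => complex) => complex^'n => complex" where
 "Tr \<psi> x = (\<Sum>y\<in>fib x. \<psi> y)"

text \<open>The weakly holomorphic functions, tested on the sheets that lie on \<open>X\<close>;
  nothing is demanded over the branch locus.\<close>

definition wh :: "(complex^'n => complex) => bool" where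
 "wh \<psi> \<longleftrightarrow> (\<forall>x0 B L \<sigma> \<eta>. fsheets x0 B L \<sigma> \<eta> --> (\<forall>l\<in>L. hol V B (%x. \<psi> (\<sigma> l x))))"

lemma whD: "wh \<psi> ==> fsheets x0 B L \<sigma> \<eta> ==> l \<in> L ==> hol V B (%x. \<psi> (\<sigma> l x))"
 unfolding wh_def by blast

lemma wh_mult: "wh \<psi> ==> wh \<xi> ==> wh (%y. \<psi> y * \<xi> y)"
 by (subst wh_def) (intro allI impI ballI hol_mult; erule (2) whD)

lemma wh_hol:
 assumes "hol UNIV Om' p"
 shows "wh p"
 unfolding wh_def
proof (intro allI impI ballI)
 fix x0 B L \<sigma> \<eta> l assume sh: "fsheets x0 B L \<sigma> \<eta>" and l: "l \<in> (L :: ('n => nat) set)"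
 note S = fsheetsD(1)[OF sh]
 show "hol V B (%x. p (\<sigma> l x))"
  by (rule hol_compose_map[OF EI_subspace sheetsD(1)[OF S] Om_open assms sheetsD(7)[OF S l] sheetsD(9)[OF S l]])
qed

text \<open>Over compact sets \<psi> is bounded on \<open>X\<close> by properness, and unbranched
  fibres have at most \<open>M\<close> points; so the trace is bounded near the branch locus and
  Riemann's theorem extends it.\<close>

lemma trace_extension:
 assumes w: "wh \<psi>" and c: "continuous_on (X \<inter> Om') \<psi>"
 shows "\<exists>F. hol V D F & (\<forall>x\<in>D. \<delta> x ~= 0 --> F x = Tr \<psi> x)"
proof -
 obtain x1 where x1: "x1 \<in> D" "\<delta> x1 ~= 0" using \<delta>nz by blast
 have h: "hol V (D \<inter> {z. \<delta> z ~= 0}) (Tr \<psi>)"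
 proof (rule hol_local[OF EI_subspace])
  fix z assume "z \<in> D \<inter> {z. \<delta> z ~= 0}"
  then obtain B L \<sigma> \<eta> where sh: "fsheets z B L \<sigma> \<eta>" using fsh by blast
  note S = fsheetsD(1)[OF sh]
  have "hol V B (%x. \<Sum>l\<in>L. \<psi> (\<sigma> l x))" by (intro hol_sum whD[OF w sh])
  moreover have "(\<Sum>l\<in>L. \<psi> (\<sigma> l y)) = Tr \<psi> y" if "y \<in> B" for y
   unfolding Tr_def by (rule sum.reindex_bij_betw[OF fib_sheet[OF sh that]])
  ultimately show "\<exists>B g. ropen V B & z \<in> B & hol V B g & (\<forall>y\<in>B. g y = Tr \<psi> y)"
   using sheetsD(1,3)[OF S] by blast
 qed (use DV in blast)
 have bd: "\<exists>e>0. \<exists>C. \<forall>z\<in>D. dist z b < e & \<delta> z ~= 0 --> cmod (Tr \<psi> z) <= C" if b: "b \<in> D" for b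
 proof -
  obtain e where e: "e > 0" "compact (V \<inter> cball b e)" "V \<inter> cball b e \<subseteq> D"
   by (rule ropen_compact_nbhd[OF EI_subspace D(1) b])
  obtain C where C: "\<forall>y\<in>{y \<in> X \<inter> Om'. pI I y \<in> V \<inter> cball b e}. cmod (\<psi> y) <= C"
   using compact_bound[OF X_closed_compact[OF e(2,3)] continuous_on_subset[OF c]] by blast
  have "cmod (Tr \<psi> z) <= real M * \<bar>C\<bar>" if z: "z \<in> D" "dist z b < e" "\<delta> z ~= 0" for z
  proof -
   have zK: "z \<in> V \<inter> cball b e" using z DV by (auto simp: dist_commute)
   have "cmod (Tr \<psi> z) <= (\<Sum>y\<in>fib z. cmod (\<psi> y))" unfolding Tr_def by (rule norm_sum)
   also have "\<dots> <= (\<Sum>y\<in>fib z. \<bar>C\<bar>)" by (rule sum_mono) (use C zK in \<open>force simp: fib_def\<close>)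
   also have "\<dots> <= real M * \<bar>C\<bar>" using card_fib[OF z(1,3)] by (simp add: mult_right_mono)
   finally show ?thesis .
  qed
  then show ?thesis using e(1) by blast
 qed
 show ?thesis
  by (rule hol_riemann_extension[OF EI_subspace D(1,2) \<delta>h x1 h bd]) blast+
qed

text \<open>Any holomorphic extension of the trace; since \<delta> is nonzero on a dense set, its
  values on \<open>D\<close> do not depend on the choice.\<close>

definition TX :: "(complex^'n => complex) => complex^'n => complex" where
 "TX \<psi> = (SOME F. hol V D F & (\<forall>x\<in>D. \<delta> x ~= 0 --> F x = Tr \<psi> x))"

lemma TX:
 assumes "wh \<psi>" "continuous_on (X \<inter> Om') \<psi>"
 shows "hol V D (TX \<psi>)" "!!x. x \<in> D ==> \<delta> x ~= 0 ==> TX \<psi> x = Tr \<psi> x"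
 using someI_ex[OF trace_extension[OF assms], folded TX_def] by auto

text \<open>The sheets trivialise the projection off the branch locus; this gives access to lifting
  over simply connected domains.\<close>

lemma cov: "covering_space {y \<in> X \<inter> Om'. \<delta> (pI I y) ~= 0} (pI I) {x \<in> D. \<delta> x ~= 0}"
 (is "covering_space ?C _ ?S")
 unfolding covering_space_def
proof (intro conjI ballI)
 show "continuous_on ?C (pI I)" by (intro continuous_pI continuous_on_id)
 show "pI I ` ?C = ?S"
 proof
  show "?S \<subseteq> pI I ` ?C"
  proof
   fix x assume x: "x \<in> ?S"
   then have "x \<in> pI I ` (X \<inter> Om')" using XD by blast
   then show "x \<in> pI I ` ?C" using x by auto
  qed
 qed (use pI_D in auto)
 fix x0 assume x0: "x0 \<in> ?S"
 then obtain B L \<sigma> \<eta> where sh: "fsheets x0 B L \<sigma> \<eta>" using fsh by blast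
 note S = fsheetsD(1)[OF sh]
 obtain O1 where O: "open O1" "B = V \<inter> O1" using sheetsD(1)[OF S] unfolding openin_open by auto
 define T where "T = ?S \<inter> O1"
 have TB: "T \<subseteq> B" "T \<subseteq> ?S" using O DV by (auto simp: T_def)
 have To: "openin (top_of_set ?S) T" unfolding T_def by (rule openin_open_Int[OF O(1)])
 have img: "\<sigma> l ` T = ?C \<inter> (pI I -` O1 \<inter> ball (\<sigma> l x0) \<eta>)" if l: "l \<in> L" for l
 proof (intro set_eqI iffI)
  fix y assume "y \<in> \<sigma> l ` T"
  then obtain x where x: "x \<in> T" "y = \<sigma> l x" by blast
  then have xB: "x \<in> B" using TB by blast
  show "y \<in> ?C \<inter> (pI I -` O1 \<inter> ball (\<sigma> l x0) \<eta>)"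
   using sheetsD(8-10)[OF S l xB] fsheetsD(2)[OF sh l xB] x TB by (auto simp: T_def dist_commute)
 next
  fix y assume y: "y \<in> ?C \<inter> (pI I -` O1 \<inter> ball (\<sigma> l x0) \<eta>)"
  then have "pI I y \<in> T" using pI_D by (auto simp: T_def)
  moreover have "y = \<sigma> l (pI I y)"
   using sheet_near[OF S l, of y] y \<open>pI I y \<in> T\<close> TB by (auto simp: dist_commute)
  ultimately show "y \<in> \<sigma> l ` T" by blast
 qed
 show "\<exists>T. x0 \<in> T & openin (top_of_set ?S) T & (\<exists>v. \<Union>v = ?C \<inter> pI I -` T &
    (\<forall>u\<in>v. openin (top_of_set ?C) u) & pairwise disjnt v & (\<forall>u\<in>v. \<exists>q. homeomorphism u T (pI I) q))"
 proof (rule exI[of _ T], intro conjI exI[of _ "(%l. \<sigma> l ` T) ` L"] To)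
  show "x0 \<in> T" using x0 sheetsD(3)[OF S] O by (simp add: T_def)
  show "\<Union>((%l. \<sigma> l ` T) ` L) = ?C \<inter> pI I -` T"
  proof
   show "\<Union>((%l. \<sigma> l ` T) ` L) \<subseteq> ?C \<inter> pI I -` T"
   proof
    fix y assume "y \<in> \<Union>((%l. \<sigma> l ` T) ` L)"
    then obtain l x where l: "l \<in> L" "x \<in> T" "y = \<sigma> l x" by blast
    then have "y \<in> ?C" using img[OF l(1)] by blast
    moreover have "pI I y = x" using sheetsD(8)[OF S l(1)] l TB by blast
    ultimately show "y \<in> ?C \<inter> pI I -` T" using l by simp
   qed
   show "?C \<inter> pI I -` T \<subseteq> \<Union>((%l. \<sigma> l ` T) ` L)"
    using sheetsD(12)[OF S] TB by blast
  qed
  show "\<forall>u\<in>(%l. \<sigma> l ` T) ` L. openin (top_of_set ?C) u"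
  proof
   fix u assume "u \<in> (%l. \<sigma> l ` T) ` L"
   then obtain l where l: "l \<in> L" "u = \<sigma> l ` T" by blast
   have "open (pI I -` O1 \<inter> ball (\<sigma> l x0) \<eta>)"
    by (intro open_Int open_vimage O continuous_pI continuous_on_id open_ball)
   then show "openin (top_of_set ?C) u" unfolding l(2) img[OF l(1)] by (rule openin_open_Int)
  qed
  show "pairwise disjnt ((%l. \<sigma> l ` T) ` L)"
   unfolding pairwise_def disjnt_def using sheet_sep[OF S] TB by blast
  show "\<forall>u\<in>(%l. \<sigma> l ` T) ` L. \<exists>q. homeomorphism u T (pI I) q"
  proof
   fix u assume "u \<in> (%l. \<sigma> l ` T) ` L"
   then obtain l where l: "l \<in> L" "u = \<sigma> l ` T" by blast
   have p: "pI I (\<sigma> l x) = x" if "x \<in> T" for x using sheetsD(8)[OF S l(1)] that TB by blast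
   have "homeomorphism (\<sigma> l ` T) T (pI I) (\<sigma> l)"
    by (rule homeomorphismI)
     (use p continuous_on_subset[OF sheets_continuous[OF S l(1)] TB(1)] in \<open>auto intro!: continuous_pI continuous_on_id\<close>)
   then show "\<exists>q. homeomorphism u T (pI I) q" unfolding l(2) by blast
  qed
 qed
qed

text \<open>The punctured disc around \<open>b\<close> on the line is unwound by
  \<open>b + exp \<zeta> *s u\<close> with \<open>\<zeta>\<close> in a half plane, which is simply
  connected: every sheet continues to a lift \<open>Y l\<close> on all of it. Going once around
  \<open>b\<close>, that is adding 2 pi i to \<open>\<zeta>\<close>, permutes the lifts by
  \<open>\<pi>\<close>.\<close>

lemma line_lifts:
 assumes b: "b \<in> D" and u: "u \<in> V" and R: "R > 0"
  and line: "\<forall>t. 0 < cmod t & cmod t < R --> b + t *s u \<in> D & \<delta> (b + t *s u) ~= 0"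
 shows "\<exists>(\<Lambda> :: (complex^'n) set) Y \<pi>. finite \<Lambda> & bij_betw \<pi> \<Lambda> \<Lambda> &
  (\<forall>l\<in>\<Lambda>. continuous_on {\<zeta>. Re \<zeta> < ln R} (Y l)) &
  (\<forall>\<zeta>\<in>{\<zeta>. Re \<zeta> < ln R}. bij_betw (%l. Y l \<zeta>) \<Lambda> (fib (b + exp \<zeta> *s u))) &
  (\<forall>l\<in>\<Lambda>. \<forall>\<psi>. wh \<psi> --> (%\<zeta>. \<psi> (Y l \<zeta>)) holomorphic_on {\<zeta>. Re \<zeta> < ln R}) &
  (\<forall>l\<in>\<Lambda>. \<forall>\<zeta>\<in>{\<zeta>. Re \<zeta> < ln R}. Y l (\<zeta> + 2 * of_real pi * \<i>) = (Y (\<pi> l) \<zeta> :: complex^'n))"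
proof -
 define Hp where "Hp = {\<zeta>. Re \<zeta> < ln R}"
 define f where "f = (%\<zeta>. b + exp \<zeta> *s u)"
 define \<zeta>0 where "\<zeta>0 = complex_of_real (ln R - 1)"
 have \<zeta>0: "\<zeta>0 \<in> Hp" by (simp add: Hp_def \<zeta>0_def)
 define C where "C = {y \<in> X \<inter> Om'. \<delta> (pI I y) ~= 0}"
 define S where "S = {x \<in> D. \<delta> x ~= 0}"
 have cov': "covering_space C (pI I) S" unfolding C_def S_def by (rule cov)
 have Hpo: "open Hp" unfolding Hp_def by (rule open_halfspace_Re_lt)
 have Hpc: "convex Hp" unfolding Hp_def by (rule convex_halfspace_Re_lt)
 have fS: "f \<zeta> \<in> S" if "\<zeta> \<in> Hp" for \<zeta>
 proof -
  have "exp (Re \<zeta>) < R" using that R by (metis Hp_def exp_less_mono exp_ln mem_Collect_eq)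
  then show ?thesis using line[rule_format, of "exp \<zeta>"] by (simp add: f_def S_def)
 qed
 have fc: "continuous_on A f" for A unfolding f_def by (intro continuous_intros)
 have fibC: "y \<in> fib x \<longleftrightarrow> y \<in> C & pI I y = x" if "x \<in> S" for x y
  using that by (auto simp: fib_def C_def S_def)
 have lift: "\<exists>g. continuous_on Hp g & (\<forall>\<zeta>\<in>Hp. g \<zeta> \<in> fib (f \<zeta>)) & g \<zeta> = y" if \<zeta>: "\<zeta> \<in> Hp" and y: "y \<in> fib (f \<zeta>)" for \<zeta> y
 proof -
  have y': "y \<in> C" "f \<zeta> = pI I y" using y fibC[OF fS[OF \<zeta>]] by auto
  obtain g where g: "continuous_on Hp g" "g \<in> Hp \<rightarrow> C" "g \<zeta> = y" "!!x. x \<in> Hp ==> pI I (g x) = f x"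
   by (rule covering_space_lift_strong[OF cov' y'(1) \<zeta> convex_imp_simply_connected[OF Hpc]
      convex_imp_locally_path_connected[OF Hpc] fc _ y'(2)]) (use fS in auto)
  then show ?thesis using fibC fS by (intro exI[of _ g]) auto
 qed
 have uniq: "g \<zeta>' = h \<zeta>'" if g: "continuous_on Hp g" "!!\<zeta>. \<zeta> \<in> Hp ==> g \<zeta> \<in> fib (f \<zeta>)"
  and h: "continuous_on Hp h" "!!\<zeta>. \<zeta> \<in> Hp ==> h \<zeta> \<in> fib (f \<zeta>)" and eq: "\<zeta> \<in> Hp" "g \<zeta> = h \<zeta>" "\<zeta>' \<in> Hp" for g h \<zeta> \<zeta>'
 proof -
  have a: "g \<in> Hp \<rightarrow> C" "h \<in> Hp \<rightarrow> C" "!!x. x \<in> Hp ==> f x = pI I (g x)" "!!x. x \<in> Hp ==> f x = pI I (h x)"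
   using g(2) h(2) fibC fS by fastforce+
  show ?thesis
   by (rule covering_space_lift_unique[OF cov' eq(2) fc _ g(1) a(1,3) h(1) a(2,4) convex_connected[OF Hpc] eq(1,3)])
    (use fS in auto)
 qed
 define \<Lambda> where "\<Lambda> = fib (f \<zeta>0)"
 have \<Lambda>: "finite \<Lambda>" unfolding \<Lambda>_def by (rule fib_finite) (use fS[OF \<zeta>0] S_def in auto)
 have "\<forall>l. \<exists>g. l \<in> \<Lambda> --> continuous_on Hp g & (\<forall>\<zeta>\<in>Hp. g \<zeta> \<in> fib (f \<zeta>)) & g \<zeta>0 = l"
  using lift[OF \<zeta>0] unfolding \<Lambda>_def by blast
 then obtain Y where Y0: "!!l. l \<in> \<Lambda> --> continuous_on Hp (Y l) & (\<forall>\<zeta>\<in>Hp. Y l \<zeta> \<in> fib (f \<zeta>)) & Y l \<zeta>0 = l"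
  by metis
 have Y: "l \<in> \<Lambda> ==> continuous_on Hp (Y l)" "l \<in> \<Lambda> ==> \<zeta> \<in> Hp ==> Y l \<zeta> \<in> fib (f \<zeta>)" "l \<in> \<Lambda> ==> Y l \<zeta>0 = l" for l \<zeta>
  using Y0[of l] by auto
 have bij: "bij_betw (%l. Y l \<zeta>) \<Lambda> (fib (f \<zeta>))" if \<zeta>: "\<zeta> \<in> Hp" for \<zeta>
  unfolding bij_betw_def
 proof (intro conjI inj_onI set_eqI iffI)
  fix l l' assume l: "l \<in> \<Lambda>" "l' \<in> \<Lambda>" "Y l \<zeta> = Y l' \<zeta>"
  have "Y l \<zeta>0 = Y l' \<zeta>0" by (rule uniq[OF Y(1,2)[OF l(1)] Y(1,2)[OF l(2)] \<zeta> l(3) \<zeta>0])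
  then show "l = l'" using Y(3) l by simp
 next
  fix y assume y: "y \<in> fib (f \<zeta>)"
  obtain g where g: "continuous_on Hp g" "!!\<zeta>. \<zeta> \<in> Hp ==> g \<zeta> \<in> fib (f \<zeta>)" "g \<zeta> = y" using lift[OF \<zeta> y] by blast
  have l: "g \<zeta>0 \<in> \<Lambda>" unfolding \<Lambda>_def by (rule g(2)[OF \<zeta>0])
  have "Y (g \<zeta>0) \<zeta> = g \<zeta>" by (rule uniq[OF Y(1,2)[OF l] g(1,2) \<zeta>0 Y(3)[OF l] \<zeta>])
  show "y \<in> (%l. Y l \<zeta>) ` \<Lambda>" by (rule image_eqI[OF _ l]) (use g(3) \<open>Y (g \<zeta>0) \<zeta> = g \<zeta>\<close> in simp)
 qed (use Y(2) \<zeta> in auto)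
 define \<tau> where "\<tau> = 2 * complex_of_real pi * \<i>"
 have \<tau>: "\<zeta> + \<tau> \<in> Hp" "f (\<zeta> + \<tau>) = f \<zeta>" if "\<zeta> \<in> Hp" for \<zeta>
  using that by (auto simp: Hp_def f_def \<tau>_def exp_add)
 define \<pi> where "\<pi> = (%l. Y l (\<zeta>0 + \<tau>))"
 have \<pi>b: "bij_betw \<pi> \<Lambda> \<Lambda>" using bij[OF \<tau>(1)[OF \<zeta>0]] unfolding \<tau>(2)[OF \<zeta>0] \<pi>_def \<Lambda>_def .
 have per: "Y l (\<zeta> + \<tau>) = Y (\<pi> l) \<zeta>" if l: "l \<in> \<Lambda>" and \<zeta>: "\<zeta> \<in> Hp" for l \<zeta>
 proof -
  have \<pi>l: "\<pi> l \<in> \<Lambda>" using bij_betwE[OF \<pi>b] l by blast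
  have 1: "continuous_on Hp (%\<zeta>. Y l (\<zeta> + \<tau>))"
   by (rule continuous_on_compose2[OF Y(1)[OF l]]) (use \<tau>(1) in \<open>auto intro!: continuous_intros\<close>)
  have 2: "Y l (\<zeta> + \<tau>) \<in> fib (f \<zeta>)" if "\<zeta> \<in> Hp" for \<zeta> using Y(2)[OF l \<tau>(1)[OF that]] \<tau>(2)[OF that] by simp
  show ?thesis
   by (rule uniq[OF 1 2 Y(1,2)[OF \<pi>l] \<zeta>0 _ \<zeta>]) (simp_all add: Y(3)[OF \<pi>l], simp add: \<pi>_def)
 qed
 have hY: "(%\<zeta>. \<psi> (Y l \<zeta>)) holomorphic_on Hp" if l: "l \<in> \<Lambda>" and w: "wh \<psi>" for l \<psi>
 proof -
  have "(%\<zeta>. \<psi> (Y l \<zeta>)) field_differentiable (at \<zeta>1)" if \<zeta>1: "\<zeta>1 \<in> Hp" for \<zeta>1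
  proof -
   have "f \<zeta>1 \<in> D" "\<delta> (f \<zeta>1) ~= 0" using fS[OF \<zeta>1] by (auto simp: S_def)
   then obtain B L \<sigma> \<eta> where sh: "fsheets (f \<zeta>1) B L \<sigma> \<eta>" using fsh by blast
   note Sh = fsheetsD(1)[OF sh]
   have Yx: "Y l \<zeta> \<in> X \<inter> Om'" "pI I (Y l \<zeta>) = f \<zeta>" if "\<zeta> \<in> Hp" for \<zeta> using Y(2)[OF l that] by (auto simp: fib_def)
   have "Y l \<zeta>1 \<in> (%l. \<sigma> l (f \<zeta>1)) ` L"
    using fib_sheet[OF sh sheetsD(3)[OF Sh]] Y(2)[OF l \<zeta>1] by (simp add: bij_betw_def)
   then obtain k where k: "k \<in> L" "Y l \<zeta>1 = \<sigma> k (f \<zeta>1)" by blast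
   have lo: "open {t. b + t *s u \<in> B}" "{t. b + t *s u \<in> B} ~= {}"
    using line_open[OF EI_subspace sheetsD(1)[OF Sh], of b u] u b DV sheetsD(3)[OF Sh] by (auto simp: f_def)
   have "exp \<zeta>1 \<in> {t. b + t *s u \<in> B}" using sheetsD(3)[OF Sh] by (simp add: f_def)
   define A where "A = Hp \<inter> Y l -` ball (\<sigma> k (f \<zeta>1)) \<eta> \<inter> exp -` {t. b + t *s u \<in> B}"
   have Ao: "open A" unfolding A_def
    by (intro open_Int continuous_open_preimage[OF Y(1)[OF l] Hpo] open_ball open_vimage lo continuous_intros)
   have A1: "\<zeta>1 \<in> A" using \<zeta>1 k sheetsD(3,6)[OF Sh] by (simp add: A_def f_def)
   have Ae: "\<psi> (Y l \<zeta>) = \<psi> (\<sigma> k (b + exp \<zeta> *s u))" if "\<zeta> \<in> A" for \<zeta>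
   proof -
    have "\<zeta> \<in> Hp" using that by (simp add: A_def)
    then have "Y l \<zeta> = \<sigma> k (pI I (Y l \<zeta>))"
     using sheet_near[OF Sh k(1) Yx(1)] Yx(2) that by (auto simp: A_def f_def dist_commute)
    then show ?thesis using Yx(2)[OF \<open>\<zeta> \<in> Hp\<close>] by (simp add: f_def)
   qed
   have "b \<in> V" using b DV by blast
   have "(%t. \<psi> (\<sigma> k (b + t *s u))) holomorphic_on {t. b + t *s u \<in> B}"
    by (rule hol_line[OF EI_subspace sheetsD(1)[OF Sh] whD[OF w sh k(1)] \<open>b \<in> V\<close> u])
   then have "((%t. \<psi> (\<sigma> k (b + t *s u))) \<circ> exp) holomorphic_on A"
    by (intro holomorphic_on_compose_gen[of exp A _ "{t. b + t *s u \<in> B}"] holomorphic_intros) (auto simp: A_def)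
   then have "(%\<zeta>. \<psi> (Y l \<zeta>)) holomorphic_on A"
    by (rule holomorphic_transform) (simp add: Ae)
   then show ?thesis using Ao A1 holomorphic_on_imp_differentiable_at by blast
  qed
  then show ?thesis using Hpo holomorphic_on_open field_differentiable_def by metis
 qed
 show ?thesis
  unfolding Hp_def[symmetric]
  by (rule exI[of _ \<Lambda>], rule exI[of _ Y], rule exI[of _ \<pi>], intro conjI ballI allI impI)
   (use \<Lambda> \<pi>b Y bij per hY in \<open>simp_all add: f_def \<tau>_def\<close>)
qed

end

section \<open>Order of a trace along a line through a branch point\<close>

lemma reflected_holomorphic:
 fixes c :: real
 assumes w: "w holomorphic_on S" "open S" and T: "open T" "!!\<zeta>. \<zeta> \<in> T ==> 2 * of_real c - cnj \<zeta> \<in> S"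
 shows "(%\<zeta>. cnj (w (2 * of_real c - cnj \<zeta>))) holomorphic_on T"
proof -
 have "(%\<zeta>. cnj (w (2 * of_real c - cnj \<zeta>))) field_differentiable (at \<zeta>)" if z: "\<zeta> \<in> T" for \<zeta>
 proof -
  obtain d where "(w has_field_derivative d) (at (2 * of_real c - cnj \<zeta>))"
   using w T(2)[OF z] holomorphic_on_imp_differentiable_at field_differentiable_def by blast
  then have "(w has_derivative (*) d) (at (2 * of_real c - cnj \<zeta>))" by (simp add: has_field_derivative_def)
  moreover have "((%\<zeta>. 2 * of_real c - cnj \<zeta>) has_derivative (%h. - cnj h)) (at \<zeta>)"
   by (auto intro!: derivative_eq_intros)
  ultimately have "(w \<circ> (%\<zeta>. 2 * of_real c - cnj \<zeta>) has_derivative (*) d \<circ> (%h. - cnj h)) (at \<zeta>)"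
   by (rule diff_chain_at[rotated])
  from bounded_linear.has_derivative[OF bounded_linear_cnj this]
  have "((%\<zeta>. cnj (w (2 * of_real c - cnj \<zeta>))) has_derivative (%h. (- cnj d) * h)) (at \<zeta>)"
   by (simp add: o_def)
  then show ?thesis unfolding field_differentiable_def has_field_derivative_def by blast
 qed
 then show ?thesis using T(1) holomorphic_on_open field_differentiable_def by metis
qed

lemma order_cases:
 assumes h: "h holomorphic_on ball 0 R" and R: "R > 0"
 shows "(\<exists>g. g holomorphic_on ball 0 R & (\<forall>t\<in>ball 0 R. h t = t ^ N * g t)) |
  (\<exists>k<N. \<exists>g. g holomorphic_on ball 0 R & (\<forall>t\<in>ball 0 R. h t = t ^ k * g t) & g 0 ~= 0)"
proof (induction N)
 case 0
 then show ?case using h by auto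
next
 case (Suc N)
 show ?case
 proof (cases "\<exists>g. g holomorphic_on ball 0 R & (\<forall>t\<in>ball 0 R. h t = t ^ N * g t) & g 0 = 0")
  case False
  then show ?thesis using Suc less_SucI lessI by metis
 next
  case True
  then obtain g where g: "g holomorphic_on ball 0 R" "!!t. t \<in> ball 0 R ==> h t = t ^ N * g t" "g 0 = 0" by blast
  define G where "G = (%z. if z = 0 then deriv g 0 else (g z - g 0) / (z - 0))"
  have "G holomorphic_on ball 0 R" unfolding G_def by (rule pole_lemma[OF g(1)]) (use R in simp)
  moreover have "h t = t ^ Suc N * G t" if "t \<in> ball 0 R" for t
   using g(2)[OF that] g(3) by (auto simp: G_def)
  ultimately show ?thesis by blast
 qed
qed

text \<open>The difference between a primitive and its translate by the period is constant, so the
  integral over a period segment is the same on every vertical line of the strip.\<close>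

lemma periodic_segment_integral:
 fixes J :: "complex => complex" and p q :: real
 assumes J: "J holomorphic_on {\<zeta>. p < Re \<zeta> & Re \<zeta> < q}"
  and per: "!!\<zeta>. p < Re \<zeta> ==> Re \<zeta> < q ==> J (\<zeta> + 2 * of_real pi * \<i>) = J \<zeta>"
 shows "\<exists>P. \<forall>c. p < c & c < q --> (J has_contour_integral P) (linepath (of_real c) (of_real c + 2 * of_real pi * \<i>))"
proof (cases "p < q")
 case True
 define S where "S = {\<zeta>. p < Re \<zeta> & Re \<zeta> < q}"
 have S: "convex S" "open S"
 proof -
  have "S = {\<zeta>. Re \<zeta> > p} \<inter> {\<zeta>. Re \<zeta> < q}" by (auto simp: S_def)
  then show "convex S" "open S"
   by (auto intro!: convex_Int convex_halfspace_Re_gt convex_halfspace_Re_lt open_Int open_halfspace_Re_gt open_halfspace_Re_lt)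
 qed
 define \<tau> where "\<tau> = 2 * complex_of_real pi * \<i>"
 have \<tau>S: "\<zeta> + \<tau> \<in> S \<longleftrightarrow> \<zeta> \<in> S" for \<zeta> by (simp add: S_def \<tau>_def)
 obtain g where g0: "!!x. x \<in> S ==> (g has_field_derivative J x) (at x within S)"
  using holomorphic_convex_primitive'[OF S J[folded S_def]] by metis
 have g: "(g has_field_derivative J x) (at x)" if "x \<in> S" for x
  using g0[OF that] at_within_open[OF that S(2)] by simp
 have "((%x. g (x + \<tau>) - g x) has_field_derivative 0) (at x within S)" if x: "x \<in> S" for x
 proof -
  have "((%x. g (x + \<tau>) - g x) has_field_derivative (J (x + \<tau>) - J x)) (at x)"
   using g[of "x + \<tau>"] g[OF x] x \<tau>S by (intro DERIV_diff) (auto simp: DERIV_shift)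
  then show ?thesis using per[of x] x by (simp add: S_def \<tau>_def has_field_derivative_at_within)
 qed
 from has_field_derivative_zero_constant[OF S(1) this]
 obtain P where P: "!!x. x \<in> S ==> g (x + \<tau>) - g x = P" by blast
 have "(J has_contour_integral P) (linepath (of_real c) (of_real c + \<tau>))" if c: "p < c" "c < q" for c
 proof -
  have cS: "of_real c \<in> S" using c by (simp add: S_def)
  have "closed_segment (of_real c) (of_real c + \<tau>) \<subseteq> S"
   by (rule closed_segment_subset[OF cS _ S(1)]) (simp add: \<tau>S cS)
  from contour_integral_primitive[OF g0 valid_path_linepath, of "of_real c" "of_real c + \<tau>"] this
  show ?thesis using P[OF cS] by simp
 qed
 then show ?thesis unfolding \<tau>_def by blast
qed auto

lemma power_factor_bound:
 fixes g h :: "complex => complex"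
 assumes g: "g holomorphic_on ball 0 R" and R: "R > 0" and h: "!!t. t \<in> ball 0 R ==> h t = t ^ N * g t"
 shows "\<exists>C d. d > 0 & (\<forall>t. cmod t < d --> cmod (h t) <= C * cmod t ^ N)"
proof -
 have "continuous_on (cball 0 (R / 2)) g"
  by (rule continuous_on_subset[OF holomorphic_on_imp_continuous_on[OF g]]) (use R in auto)
 then obtain B where B: "\<forall>t\<in>cball 0 (R / 2). cmod (g t) <= B" using compact_bound[OF compact_cball] by blast
 have "cmod (h t) <= B * cmod t ^ N" if "cmod t < R / 2" for t
 proof -
  have "cmod (h t) = cmod t ^ N * cmod (g t)" using h[of t] that R by (simp add: norm_mult norm_power)
  also have "\<dots> <= cmod t ^ N * B" using B that by (intro mult_left_mono) auto
  finally show ?thesis by (simp add: mult.commute)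
 qed
 then show ?thesis using R by (intro exI[of _ B] exI[of _ "R / 2"]) auto
qed

text \<open>The function \<open>h\<close> is a trace of terms \<open>a * cnj w\<close>. Replacing \<open>cnj w\<close> by its reflection in the line
 \<open>Re \<zeta> = c\<close> makes the trace holomorphic and periodic on a strip, so its leading coefficient can be computed
 on a fixed line, where the reflected factor tends to \<open>0\<close> as \<open>c\<close> tends to \<open>-\<infinity>\<close>.\<close>

lemma strip_order:
 fixes a w :: "'j => complex => complex"
 assumes h: "h holomorphic_on ball 0 R" and R: "R > 0" and fin: "finite A"
  and aw: "!!j. j \<in> A ==> a j holomorphic_on {\<zeta>. Re \<zeta> < ln R}" "!!j. j \<in> A ==> w j holomorphic_on {\<zeta>. Re \<zeta> < ln R}"
  and per: "!!\<zeta> \<xi>. Re \<zeta> < ln R ==> Re \<xi> < ln R ==>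
   (\<Sum>j\<in>A. a j (\<zeta> + 2 * of_real pi * \<i>) * cnj (w j (\<xi> + 2 * of_real pi * \<i>))) = (\<Sum>j\<in>A. a j \<zeta> * cnj (w j \<xi>))"
  and decay: "!!\<epsilon>. \<epsilon> > 0 ==> \<exists>c. \<forall>j\<in>A. \<forall>\<zeta>. Re \<zeta> < ln R & Re \<zeta> < c --> cmod (w j \<zeta>) <= \<epsilon>"
  and app: "!!\<zeta>. Re \<zeta> < ln R ==> cmod (h (exp \<zeta>) - (\<Sum>j\<in>A. a j \<zeta> * cnj (w j \<zeta>))) <= C * cmod (exp \<zeta>) ^ N"
 shows "\<exists>C d. d > 0 & (\<forall>t. cmod t < d --> cmod (h t) <= C * cmod t ^ N)"
proof -
 \<comment> \<open>Either the order is at least \<open>N\<close>, which gives the claim, or it is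
   some \<open>k < N\<close> with leading coefficient \<open>g 0\<close>, which is refuted.\<close>
 consider g where "g holomorphic_on ball 0 R" "!!t. t \<in> ball 0 R ==> h t = t ^ N * g t"
  | k g where "k < N" "g holomorphic_on ball 0 R" "!!t. t \<in> ball 0 R ==> h t = t ^ k * g t" "g 0 ~= 0"
  using order_cases[OF h R, of N] by metis
 then show ?thesis
 proof cases
  case 1
  show ?thesis by (rule power_factor_bound[OF 1(1) R 1(2)])
 next
  case 2
  define \<tau> where "\<tau> = 2 * complex_of_real pi * \<i>"
  have \<tau>: "cmod \<tau> = 2 * pi" "exp \<tau> = 1" "Re \<tau> = 0" by (auto simp: \<tau>_def norm_mult)
  \<comment> \<open>Three errors of size \<epsilon> will occur, so a quarter of the leading
    coefficient leaves a contradiction.\<close>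
  define \<epsilon> where "\<epsilon> = cmod (g 0) / 4"
  have \<epsilon>: "\<epsilon> > 0" using 2(4) by (simp add: \<epsilon>_def)
  define c0 where "c0 = ln R - 1"
  let ?seg = "%c::real. closed_segment (of_real c) (of_real c + \<tau>)"
  have segRe: "Re \<zeta> = c" if "\<zeta> \<in> ?seg c" for \<zeta> c
   using that \<tau>(3) by (auto simp: closed_segment_def algebra_simps)
  have sub: "?seg c0 \<subseteq> {\<zeta>. Re \<zeta> < ln R}"
  proof
   fix \<zeta> assume "\<zeta> \<in> ?seg c0"
   then have "Re \<zeta> = c0" by (rule segRe)
   then show "\<zeta> \<in> {\<zeta>. Re \<zeta> < ln R}" by (simp add: c0_def)
  qed
  have "\<exists>B. \<forall>j\<in>A. \<forall>\<zeta>\<in>?seg c0. cmod (a j \<zeta>) <= B"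
  proof -
   have "\<forall>j. \<exists>B. j \<in> A --> (\<forall>\<zeta>\<in>?seg c0. cmod (a j \<zeta>) <= B)"
    using compact_bound[OF compact_segment continuous_on_subset[OF holomorphic_on_imp_continuous_on[OF aw(1)] sub]] by blast
   then obtain B where B: "!!j \<zeta>. j \<in> A ==> \<zeta> \<in> ?seg c0 ==> cmod (a j \<zeta>) <= B j" by metis
   have "cmod (a j \<zeta>) <= (\<Sum>j\<in>A. \<bar>B j\<bar>)" if j: "j \<in> A" "\<zeta> \<in> ?seg c0" for j \<zeta>
   proof -
    have "cmod (a j \<zeta>) <= \<bar>B j\<bar>" using B[OF j] by simp
    also have "\<dots> <= (\<Sum>j\<in>A. \<bar>B j\<bar>)" by (rule member_le_sum[OF j(1) _ fin]) simp
    finally show ?thesis .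
   qed
   then show ?thesis by blast
  qed
  then obtain B0 where B0: "\<forall>j\<in>A. \<forall>\<zeta>\<in>?seg c0. cmod (a j \<zeta>) <= B0" by blast
  define B where "B = \<bar>B0\<bar> + 1"
  have B: "B > 0" "!!j \<zeta>. j \<in> A ==> \<zeta> \<in> ?seg c0 ==> cmod (a j \<zeta>) <= B" using B0 by (fastforce simp: B_def)+
  define E where "E = cmod (exp (- (of_nat k * complex_of_real c0)))"
  have E: "E > 0" by (simp add: E_def)
  define \<eta> where "\<eta> = \<epsilon> / (B * E * (real (card A) + 1))"
  have \<eta>: "\<eta> > 0" using \<epsilon> B E by (simp add: \<eta>_def)
  obtain c1 where c1: "!!j \<zeta>. j \<in> A ==> Re \<zeta> < ln R ==> Re \<zeta> < c1 ==> cmod (w j \<zeta>) <= \<eta>" using decay[OF \<eta>] by blast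
  have "continuous_on (ball 0 R) g" using 2(2) by (rule holomorphic_on_imp_continuous_on)
  then obtain d where d: "d > 0" "!!t. t \<in> ball 0 R ==> dist t 0 < d ==> dist (g t) (g 0) < \<epsilon>"
   unfolding continuous_on_iff using \<epsilon> R by (metis centre_in_ball)
  \<comment> \<open>Far enough to the left for all estimates: the reflection
    \<open>2 * c - c0\<close> of the line at \<open>c0\<close> lies where the factors
    \<open>w j\<close> are at most \<eta>, and \<open>exp c\<close> is at most 1 and small enough
    for \<open>g\<close> to be near \<open>g 0\<close> and for the error of order
    \<open>N - k\<close>, which is at least 1.\<close>
  define c where "c = Min {c0 - 1, (c1 + c0) / 2 - 1, ln d - 1, ln (\<epsilon> / (\<bar>C\<bar> + 1)), 0}"
  have "c <= c0 - 1" "c <= (c1 + c0) / 2 - 1" "c <= ln d - 1" "c <= ln (\<epsilon> / (\<bar>C\<bar> + 1))" "c <= 0"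
   unfolding c_def by (rule Min_le; simp)+
  then have c: "c < c0" "2 * c - c0 < c1" "c < ln d" "c <= ln (\<epsilon> / (\<bar>C\<bar> + 1))" "c <= 0"
   by (auto simp: field_simps)
  define S where "S = {\<zeta>. 2 * c - ln R < Re \<zeta> & Re \<zeta> < ln R}"
  \<comment> \<open>On the line \<open>Re \<zeta> = c\<close> the reflection is the identity, so
    \<open>J\<close> is the original sum divided by \<open>exp \<zeta> ^ k\<close> and close to
    \<open>g 0\<close>. On the line \<open>Re \<zeta> = c0\<close> the reflected factors are tiny.
    The two period integrals agree.\<close>
  define J where "J = (%\<zeta>. (\<Sum>j\<in>A. a j \<zeta> * cnj (w j (2 * of_real c - cnj \<zeta>))) * exp (- (of_nat k * \<zeta>)))"
  have So: "open S"
  proof -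
   have "S = {\<zeta>. Re \<zeta> > 2 * c - ln R} \<inter> {\<zeta>. Re \<zeta> < ln R}" by (auto simp: S_def)
   then show ?thesis by (auto intro!: open_Int open_halfspace_Re_gt open_halfspace_Re_lt)
  qed
  have "J holomorphic_on S"
   unfolding J_def
  proof (intro holomorphic_intros)
   fix j assume j: "j \<in> A"
   show "a j holomorphic_on S" by (rule holomorphic_on_subset[OF aw(1)[OF j]]) (auto simp: S_def)
   show "(%\<zeta>. cnj (w j (2 * of_real c - cnj \<zeta>))) holomorphic_on S"
    by (rule reflected_holomorphic[OF aw(2)[OF j] open_halfspace_Re_lt So]) (auto simp: S_def)
  qed
  moreover have "J (\<zeta> + 2 * of_real pi * \<i>) = J \<zeta>" if "2 * c - ln R < Re \<zeta>" "Re \<zeta> < ln R" for \<zeta>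
  proof -
   have e: "exp (- (of_nat k * (\<zeta> + \<tau>))) = exp (- (of_nat k * \<zeta>))"
   proof -
    have "exp (- (of_nat k * (\<zeta> + \<tau>))) = exp (- (of_nat k * \<zeta>)) * inverse (exp (of_nat k * \<tau>))"
     by (simp add: exp_minus[symmetric] exp_add[symmetric] ring_distribs)
    then show ?thesis by (simp add: exp_of_nat_mult \<tau>)
   qed
   have r: "2 * of_real c - cnj (\<zeta> + \<tau>) = 2 * of_real c - cnj \<zeta> + \<tau>" by (simp add: \<tau>_def)
   have "Re (2 * of_real c - cnj \<zeta>) < ln R" using that by simp
   from per[OF that(2) this] show ?thesis unfolding J_def \<tau>_def[symmetric] e r by simp
  qed
  ultimately obtain P where P: "!!c'. 2 * c - ln R < c' ==> c' < ln R ==>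
    (J has_contour_integral P) (linepath (of_real c') (of_real c' + \<tau>))"
   using periodic_segment_integral[of J "2 * c - ln R" "ln R"] unfolding S_def \<tau>_def by blast
  have c0R: "c0 < ln R" "2 * c - ln R < c0" "2 * c - ln R < c" "c < ln R" using c(1) by (auto simp: c0_def)
  have "cmod P <= \<epsilon> * cmod (of_real c0 + \<tau> - of_real c0)"
  proof (rule has_contour_integral_bound_linepath[OF P[OF c0R(2,1)]])
   fix \<zeta> assume z: "\<zeta> \<in> ?seg c0"
   note Rez = segRe[OF z]
   have "cmod (J \<zeta>) = cmod (\<Sum>j\<in>A. a j \<zeta> * cnj (w j (2 * of_real c - cnj \<zeta>))) * E"
    by (simp add: J_def norm_mult E_def Rez)
   also have "\<dots> <= (\<Sum>j\<in>A. B * \<eta>) * E"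
   proof (intro mult_right_mono sum_norm_le)
    fix j assume j: "j \<in> A"
    have "cmod (w j (2 * of_real c - cnj \<zeta>)) <= \<eta>" by (rule c1[OF j]) (use Rez c c0R in auto)
    then show "cmod (a j \<zeta> * cnj (w j (2 * of_real c - cnj \<zeta>))) <= B * \<eta>"
     unfolding norm_mult complex_mod_cnj by (intro mult_mono B(2)[OF j z]) (use B in auto)
   qed (use E in simp)
   also have "\<dots> = real (card A) * (B * \<eta> * E)" by simp
   also have "\<dots> <= (real (card A) + 1) * (B * \<eta> * E)" using B E \<eta> by (intro mult_right_mono) auto
   also have "\<dots> = \<eta> * (B * E * (real (card A) + 1))" by (simp add: mult_ac)
   also have "\<dots> = \<epsilon>"
   proof -
    have "real (card A) + 1 ~= 0" by linarith
    then have "B * E * (real (card A) + 1) ~= 0" using B(1) E by simp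
    then show ?thesis unfolding \<eta>_def by (rule nonzero_eq_divide_eq[THEN iffD1]) (rule refl)
   qed
   finally show "cmod (J \<zeta>) <= \<epsilon>" .
  qed (use \<epsilon> in simp)
  moreover have "cmod (P - g 0 * (of_real c + \<tau> - of_real c)) <= (\<epsilon> + \<epsilon>) * cmod (of_real c + \<tau> - of_real c)"
  proof (rule has_contour_integral_bound_linepath[OF has_contour_integral_diff[OF P[OF c0R(3,4)] has_contour_integral_const_linepath]])
   fix \<zeta> assume z: "\<zeta> \<in> ?seg c"
   note Rez = segRe[OF z]
   have refl: "2 * of_real c - cnj \<zeta> = \<zeta>" using Rez by (simp add: complex_eq_iff)
   let ?t = "exp \<zeta>"
   have ct: "cmod ?t = exp c" by (simp add: Rez)
   have tR: "?t \<in> ball 0 R" using ct c0R R by (metis exp_less_mono exp_ln dist_0_norm mem_ball)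
   have ek: "exp (- (of_nat k * \<zeta>)) = inverse (?t ^ k)" by (simp add: exp_minus exp_of_nat_mult)
   have gt: "g ?t = h ?t * inverse (?t ^ k)" using 2(3)[OF tR] by simp
   have "exp c < d" using c(3) d(1) by (metis exp_less_mono exp_ln)
   then have 1: "cmod (g ?t - g 0) <= \<epsilon>" using d(2)[OF tR] ct by (simp add: dist_norm less_imp_le)
   have "cmod (J \<zeta> - g ?t) = cmod (h ?t - (\<Sum>j\<in>A. a j \<zeta> * cnj (w j \<zeta>))) * cmod (inverse (?t ^ k))"
    unfolding J_def refl ek gt left_diff_distrib[symmetric] norm_mult by (simp add: norm_minus_commute)
   also have "\<dots> <= (C * exp c ^ N) * inverse (exp c ^ k)"
   proof (intro mult_mono)
    show le: "cmod (h ?t - (\<Sum>j\<in>A. a j \<zeta> * cnj (w j \<zeta>))) <= C * exp c ^ N"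
     using app[of \<zeta>] Rez c0R ct by simp
    show "0 <= C * exp c ^ N" by (rule order_trans[OF norm_ge_zero le])
   qed (simp_all add: norm_inverse norm_power Rez)
   also have "\<dots> <= (\<bar>C\<bar> + 1) * (exp c ^ N * inverse (exp c ^ k))"
    unfolding mult.assoc by (intro mult_right_mono) auto
   also have "\<dots> <= (\<bar>C\<bar> + 1) * (\<epsilon> / (\<bar>C\<bar> + 1))"
   proof (intro mult_left_mono)
    have "exp c ^ N * inverse (exp c ^ k) = exp c ^ Suc (N - k - 1)"
    proof -
     have "exp c ^ N = exp c ^ Suc (N - k - 1) * exp c ^ k" using 2(1) by (simp flip: power_add power_Suc)
     then show ?thesis by simp
    qed
    also have "\<dots> <= exp c" using c(5) by (simp add: mult_left_le power_le_one)
    also have "\<dots> <= exp (ln (\<epsilon> / (\<bar>C\<bar> + 1)))" using c(4) by simp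
    also have "\<dots> = \<epsilon> / (\<bar>C\<bar> + 1)" by (rule exp_ln) (use \<epsilon> in \<open>simp add: add_nonneg_pos\<close>)
    finally show "exp c ^ N * inverse (exp c ^ k) <= \<epsilon> / (\<bar>C\<bar> + 1)" .
   qed simp
   also have "\<dots> = \<epsilon>"
   proof -
    have "\<bar>C\<bar> + 1 ~= 0" by linarith
    then show ?thesis by simp
   qed
   finally have 2: "cmod (J \<zeta> - g ?t) <= \<epsilon>" .
   have "cmod (J \<zeta> - g 0) = cmod ((J \<zeta> - g ?t) + (g ?t - g 0))" by simp
   also have "\<dots> <= \<epsilon> + \<epsilon>" using norm_triangle_ineq 1 2 by (meson add_mono order_trans)
   finally show "cmod (J \<zeta> - g 0) <= \<epsilon> + \<epsilon>" .
  qed (use \<epsilon> in simp)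
  ultimately have "cmod P <= \<epsilon> * (2 * pi)" "cmod (P - g 0 * \<tau>) <= (\<epsilon> + \<epsilon>) * (2 * pi)" by (auto simp: \<tau>)
  then have "cmod (g 0 * \<tau>) <= 3 * \<epsilon> * (2 * pi)"
   using norm_triangle_sub[of "g 0 * \<tau>" P] by (simp add: norm_minus_commute algebra_simps)
  then have "cmod (g 0) * (2 * pi) <= (3 / 4 * cmod (g 0)) * (2 * pi)" by (simp add: norm_mult \<tau> \<epsilon>_def)
  then have "cmod (g 0) <= 3 / 4 * cmod (g 0)" by (simp only: mult_le_cancel_right_pos pi_gt_zero mult_pos_pos zero_less_numeral)
  then show ?thesis using 2(4) by simp
 qed
qed

text \<open>A root \<open>w\<close> over \<open>x\<close> satisfies |P(b,w)| = |P(b,w) - P(x,w)| =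
  O(|x - b|), while |P(b,w)| is at least a multiple of the power \<open>mu b c\<close> of |w - c|.
  As these distances are below 1, the exponent may be raised to \<open>K\<close>, the same for all
  \<open>b\<close>.\<close>

lemma (in weierstrass) root_hoelder:
 assumes b: "b \<in> S" and c: "c \<in> zr b"
 shows "\<exists>C d. d > 0 & C >= 0 & (\<forall>x\<in>S. \<forall>w\<in>zr x. dist x b < d & dist w c < d --> cmod (w - c) ^ K <= C * norm (x - b))"
proof -
 obtain A e0 where A: "A >= 0" "e0 > 0" "!!x s. x \<in> S ==> dist x b < e0 ==> cmod s <= R ==>
   cmod (poly (pw b) s - poly (pw x) s) <= A * norm (x - b)"
  using pw_diff_bound[OF b] by metis
 obtain q d1 where q: "q > 0" "d1 > 0" "!!s. dist s c < d1 ==> q * cmod (s - c) ^ mu b c <= cmod (poly (pw b) s)"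
  using pw_factor[OF b c] by metis
 have mu: "mu b c <= K" unfolding mu_sum[OF b, symmetric] by (rule member_le_sum[OF c _ zr_finite[OF b]]) simp
 have "cmod (w - c) ^ K <= (A / q) * norm (x - b)"
  if x: "x \<in> S" and w: "w \<in> zr x" and d: "dist x b < min e0 (min d1 1)" "dist w c < min e0 (min d1 1)" for x w
 proof -
  have "cmod (w - c) ^ K <= cmod (w - c) ^ mu b c"
   by (rule power_decreasing[OF mu]) (use d(2) in \<open>auto simp: dist_norm\<close>)
  then have "q * cmod (w - c) ^ K <= q * cmod (w - c) ^ mu b c" using q(1) by simp
  also have "\<dots> <= cmod (poly (pw b) w - poly (pw x) w)" using q(3)[of w] d pw_zero_iff[OF x, of w] w by simp
  also have "\<dots> <= A * norm (x - b)" using A(3)[OF x, of w] d w by (simp add: zr_def)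
  finally show ?thesis using q(1) by (simp add: field_simps)
 qed
 then show ?thesis using A q
  by (intro exI[of _ "A / q"] exI[of _ "min e0 (min d1 1)"]) auto
qed

context cover
begin

lemma fib_near:
 assumes b: "b \<in> D" and \<epsilon>: "\<epsilon> > 0"
 obtains d where "d > 0" "!!y. y \<in> X \<inter> Om' ==> dist (pI I y) b < d ==> \<exists>y0\<in>fib b. dist y y0 < \<epsilon>"
proof -
 obtain d where "d > 0" "\<forall>y\<in>X \<inter> Om'. dist (pI I y) b < d --> y \<in> (\<Union>y0\<in>fib b. ball y0 \<epsilon>)"
  by (rule X_near_fibre[OF b, of "\<Union>y0\<in>fib b. ball y0 \<epsilon>"]) (use \<epsilon> in \<open>auto simp: fib_def\<close>)
 then show ?thesis using that[of d] by (auto simp: dist_commute)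
qed

text \<open>This converts orders on the variety into orders on the base: an error of order
  \<open>K * N\<close> at \<open>y0\<close> has order \<open>N\<close> in the distance of the
  projections. The exponent comes from \<open>root_hoelder\<close> in every coordinate and is
  uniform in \<open>b\<close>; the constants may vary.\<close>

lemma fib_hoelder:
 "\<exists>K. \<forall>b\<in>D. \<forall>y0\<in>fib b. \<exists>C d. d > 0 & (\<forall>y\<in>X \<inter> Om'. dist y y0 < d --> norm (y - y0) ^ K <= C * norm (pI I y - b))"
proof -
 define Kj where "Kj j = weierstrass.K (ax j) D (r j) (Q j)" for j
 \<comment> \<open>The successor makes the exponent at least 1, as the coordinates in
   \<open>I\<close> require.\<close>
 define K where "K = Suc (\<Sum>j\<in>-I. Kj j)"
 have KK: "Kj j <= K" if "j \<notin> I" for j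
 proof -
  have "Kj j <= (\<Sum>j\<in>-I. Kj j)" by (rule member_le_sum) (use that in auto)
  then show ?thesis by (simp add: K_def)
 qed
 have "\<exists>C d. d > 0 & (\<forall>y\<in>X \<inter> Om'. dist y y0 < d --> norm (y - y0) ^ K <= C * norm (pI I y - b))"
  if b: "b \<in> D" and y0: "y0 \<in> fib b" for b y0
 proof -
  have y0': "y0 \<in> X \<inter> Om'" "pI I y0 = b" using y0 by (auto simp: fib_def)
  have le1: "u ^ K <= u ^ k" if "0 <= u" "u <= 1" "k <= K" for u :: real and k using that by (intro power_decreasing)
  have "\<forall>j. \<exists>C d. d > 0 & C >= 0 & (\<forall>y\<in>X \<inter> Om'. dist y y0 < d --> cmod ((y - y0) $ j) ^ K <= C * norm (pI I y - b))"
  proof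
   fix j
   show "\<exists>C d. d > 0 & C >= 0 & (\<forall>y\<in>X \<inter> Om'. dist y y0 < d --> cmod ((y - y0) $ j) ^ K <= C * norm (pI I y - b))"
   proof (cases "j \<in> I")
    case True
    have "cmod ((y - y0) $ j) ^ K <= 1 * norm (pI I y - b)" if "dist y y0 < 1" for y
    proof -
     have "cmod ((y - y0) $ j) <= 1" using Finite_Cartesian_Product.norm_nth_le[of "y - y0" j] that by (simp add: dist_norm)
     then have "cmod ((y - y0) $ j) ^ K <= cmod ((y - y0) $ j) ^ 1" by (intro le1) (auto simp: K_def)
     also have "\<dots> = cmod ((pI I y - pI I y0) $ j)" using True by simp
     also have "\<dots> <= norm (pI I y - b)" unfolding y0'(2) by (rule Finite_Cartesian_Product.norm_nth_le)
     finally show ?thesis by simp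
    qed
    then show ?thesis by (intro exI[of _ 1]) auto
   next
    case False
    have c: "y0 $ j \<in> weierstrass.zr (ax j) (r j) (Q j) b" using X_Zr[OF y0'(1) False] y0'(2) Zr_eq[OF False] by simp
    obtain C d where Cd: "d > 0" "C >= 0" "\<forall>x\<in>D. \<forall>w\<in>Zr j x. dist x b < d & dist w (y0 $ j) < d --> cmod (w - y0 $ j) ^ Kj j <= C * norm (x - b)"
     using weierstrass.root_hoelder[OF weier[OF False] b c] unfolding Zr_eq[OF False] Kj_def by blast
    have "cmod ((y - y0) $ j) ^ K <= C * norm (pI I y - b)" if y: "y \<in> X \<inter> Om'" "dist y y0 < min d 1" for y
    proof -
     have nj: "cmod ((y - y0) $ j) <= dist y y0" using Finite_Cartesian_Product.norm_nth_le[of "y - y0" j] by (simp add: dist_norm)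
     have "norm (pI I y - pI I y0) <= norm (y - y0)"
      by (rule norm_le_componentwise_cart) simp
     then have "dist (pI I y) b < d" using y(2) y0'(2) by (simp add: dist_norm)
     moreover have "dist (y $ j) (y0 $ j) < d" using nj y(2) by (simp add: dist_norm)
     ultimately have "cmod (y $ j - y0 $ j) ^ Kj j <= C * norm (pI I y - b)"
      using Cd(3) X_Zr[OF y(1) False] pI_D y(1) by blast
     moreover have "cmod ((y - y0) $ j) ^ K <= cmod ((y - y0) $ j) ^ Kj j"
      by (rule le1) (use nj y(2) KK[OF False] in auto)
     ultimately show ?thesis by simp
    qed
    then show ?thesis using Cd by (intro exI[of _ C] exI[of _ "min d 1"]) auto
   qed
  qed
  then obtain C d where Cd: "!!j. d j > (0::real)" "!!j. C j >= (0::real)"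
   "!!j y. y \<in> X \<inter> Om' ==> dist y y0 < d j ==> cmod ((y - y0) $ j) ^ K <= C j * norm (pI I y - b)" by metis
  obtain d0 where d0: "d0 > 0" "!!j. j \<in> UNIV ==> d0 < d j" by (rule finite_pos_lower_bound[of UNIV d]) (use Cd(1) in auto)
  have "norm (y - y0) ^ K <= (real CARD('n) ^ K * (\<Sum>j\<in>UNIV. C j)) * norm (pI I y - b)"
   if y: "y \<in> X \<inter> Om'" "dist y y0 < d0" for y
  proof -
   define m where "m = Max (range (%j. cmod ((y - y0) $ j)))"
   have "m \<in> range (%j. cmod ((y - y0) $ j))" unfolding m_def by (rule Max_in) auto
   then obtain j where j: "m = cmod ((y - y0) $ j)" by blast
   have "norm (y - y0) <= (\<Sum>j\<in>UNIV. cmod ((y - y0) $ j))"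
    unfolding norm_vec_def by (rule L2_set_le_sum) simp
   also have "\<dots> <= (\<Sum>j\<in>(UNIV::'n set). m)" by (intro sum_mono) (auto simp: m_def)
   finally have "norm (y - y0) ^ K <= (real CARD('n) * m) ^ K" by (intro power_mono) auto
   also have "\<dots> = real CARD('n) ^ K * cmod ((y - y0) $ j) ^ K" by (simp add: power_mult_distrib j)
   also have "\<dots> <= real CARD('n) ^ K * (C j * norm (pI I y - b))"
    by (intro mult_left_mono Cd(3)[OF y(1)]) (use d0(2)[of j] y(2) in auto)
   also have "\<dots> <= real CARD('n) ^ K * ((\<Sum>j\<in>UNIV. C j) * norm (pI I y - b))"
    by (intro mult_left_mono mult_right_mono member_le_sum) (use Cd(2) in auto)
   finally show ?thesis by (simp add: mult.assoc)
  qed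
  then show ?thesis using d0(1) by blast
 qed
 then show ?thesis by blast
qed

text \<open>What is left of \<xi> near \<open>y0\<close> once its holomorphic part is subtracted: up
  to an error of order \<open>N\<close> measured on the base, every term carries an antiholomorphic
  factor vanishing at \<open>y0\<close>.\<close>

definition mixed :: "(complex^'n => complex) => complex^'n => nat => complex^'n => bool" where
 "mixed \<xi> b N y0 \<longleftrightarrow> (\<exists>e C q A B. e > (0::real) & (\<forall>\<nu><q::nat. hol UNIV UNIV (A \<nu>) & hol UNIV UNIV (B \<nu>) & B \<nu> y0 = 0) &
   (\<forall>y\<in>X \<inter> Om'. dist y y0 < e --> cmod (\<xi> y - (\<Sum>\<nu><q. A \<nu> y * cnj (B \<nu> y))) <= C * norm (pI I y - b) ^ N))"

end

context bcover
begin

text \<open>On the punctured line the trace is a sum over the lifts \<open>Y l\<close>, and each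
  lift tends to a point \<open>i l\<close> of the fibre over \<open>b\<close>. Inserting the mixed
  expansions at these points gives the sum of products to which \<open>strip_order\<close>
  applies.\<close>

lemma order_line:
 assumes F: "hol V D F" "!!x. x \<in> D ==> \<delta> x ~= 0 ==> F x = Tr \<xi> x"
  and b: "b \<in> D" and u: "u \<in> V" and R: "R > 0"
  and line: "!!t. 0 < cmod t ==> cmod t < R ==> b + t *s u \<in> D & \<delta> (b + t *s u) ~= 0"
  and mx: "!!y0. y0 \<in> fib b ==> mixed \<xi> b N y0"
 shows "\<exists>C d. d > 0 & (\<forall>t. cmod t < d --> cmod (F (b + t *s u)) <= C * cmod t ^ N)"
proof -
 define P where "P = (%y0 e C q A B. e > (0::real) & (\<forall>\<nu><q::nat. hol UNIV UNIV (A \<nu>) & hol UNIV UNIV (B \<nu>) & B \<nu> y0 = 0) &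
   (\<forall>y\<in>X \<inter> Om'. dist y y0 < e --> cmod (\<xi> y - (\<Sum>\<nu><q. A \<nu> y * cnj (B \<nu> y))) <= C * norm (pI I y - b) ^ N))"
 have "\<forall>y0. \<exists>e C q A B. y0 \<in> fib b --> P y0 e C q A B" using mx unfolding mixed_def P_def by blast
 then obtain e C q A B where "!!y0. y0 \<in> fib b ==> P y0 (e y0) (C y0) (q y0) (A y0) (B y0)" by metis
 then have e: "!!y0. y0 \<in> fib b ==> e y0 > 0"
  and AB: "!!y0 \<nu>. y0 \<in> fib b ==> \<nu> < q y0 ==> hol UNIV UNIV (A y0 \<nu>) & hol UNIV UNIV (B y0 \<nu>) & B y0 \<nu> y0 = 0"
  and ap: "!!y0 y. y0 \<in> fib b ==> y \<in> X \<inter> Om' ==> dist y y0 < e y0 ==>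
   cmod (\<xi> y - (\<Sum>\<nu><q y0. A y0 \<nu> y * cnj (B y0 \<nu> y))) <= C y0 * norm (pI I y - b) ^ N"
  unfolding P_def by blast+
 note ff = fib_finite[OF b]
 obtain ea where ea: "ea > 0" "!!y0. y0 \<in> fib b ==> ea < e y0" by (rule finite_pos_lower_bound[OF ff, of e]) (use e in auto)
 obtain eb where eb: "eb > 0" "!!p. p \<in> {p \<in> fib b \<times> fib b. fst p ~= snd p} ==> eb < dist (fst p) (snd p) / 2"
  by (rule finite_pos_lower_bound[of "{p \<in> fib b \<times> fib b. fst p ~= snd p}" "%p. dist (fst p) (snd p) / 2"]) (use ff in auto)
 define e1 where "e1 = min ea eb"
 have e1: "e1 > 0" using ea eb by (simp add: e1_def)
 have close: "y0 = y1" if "y0 \<in> fib b" "y1 \<in> fib b" "dist y y0 < e1" "dist y y1 < e1" for y y0 y1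
 proof (rule ccontr)
  assume "y0 ~= y1"
  then have "2 * eb < dist y0 y1" using eb(2)[of "(y0, y1)"] that by simp
  moreover have "dist y0 y1 <= dist y y0 + dist y y1" by (rule dist_triangle3)
  ultimately show False using that by (simp add: e1_def)
 qed
 obtain d1 where d1: "d1 > 0" "!!y. y \<in> X \<inter> Om' ==> dist (pI I y) b < d1 ==> \<exists>y0\<in>fib b. dist y y0 < e1"
  using fib_near[OF b e1] by metis
 define R0 where "R0 = min R (d1 / (norm u + 1))"
 have nu: "norm u + 1 > 0" using norm_ge_zero[of u] by linarith
 have R0: "R0 > 0" "R0 <= R" using R d1 nu by (auto simp: R0_def)
 define Hp where "Hp = {\<zeta>. Re \<zeta> < ln R0}"
 have ex: "cmod (exp \<zeta>) < R0" if "\<zeta> \<in> Hp" for \<zeta>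
  using that R0(1) unfolding Hp_def norm_exp_eq_Re by (metis exp_less_mono exp_ln mem_Collect_eq)
 have line1: "\<forall>t. 0 < cmod t & cmod t < R0 --> b + t *s u \<in> D & \<delta> (b + t *s u) ~= 0" using line R0(2) by simp
 note line0 = line1[rule_format, OF conjI]
 have near0: "cmod t * norm u < d1" if "cmod t < R0" for t
 proof -
  have "cmod t * norm u <= cmod t * (norm u + 1)" by (simp add: algebra_simps)
  also have "\<dots> < R0 * (norm u + 1)" using that nu by simp
  also have "\<dots> <= (d1 / (norm u + 1)) * (norm u + 1)" using nu by (intro mult_right_mono) (auto simp: R0_def)
  also have "\<dots> = d1" using nu by simp
  finally show ?thesis .
 qed
 obtain \<Lambda> :: "(complex^'n) set" and Y \<pi> where L: "finite \<Lambda>" "bij_betw \<pi> \<Lambda> \<Lambda>" "\<forall>l\<in>\<Lambda>. continuous_on Hp (Y l)"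
  "\<forall>\<zeta>\<in>Hp. bij_betw (%l. Y l \<zeta>) \<Lambda> (fib (b + exp \<zeta> *s u))"
  "\<forall>l\<in>\<Lambda>. \<forall>\<psi>. wh \<psi> --> (%\<zeta>. \<psi> (Y l \<zeta>)) holomorphic_on Hp"
  "\<forall>l\<in>\<Lambda>. \<forall>\<zeta>\<in>Hp. Y l (\<zeta> + 2 * of_real pi * \<i>) = Y (\<pi> l) \<zeta>"
  using line_lifts[OF b u R0(1) line1] unfolding Hp_def[symmetric] by (elim exE conjE) (rule that, assumption+)
 have Yf: "Y l \<zeta> \<in> X \<inter> Om'" "pI I (Y l \<zeta>) = b + exp \<zeta> *s u" if "l \<in> \<Lambda>" "\<zeta> \<in> Hp" for l \<zeta>
  using bij_betwE[OF L(4)[rule_format, OF that(2)]] that(1) by (auto simp: fib_def)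
 have Ynear: "\<exists>y0\<in>fib b. dist (Y l \<zeta>) y0 < e1" if "l \<in> \<Lambda>" "\<zeta> \<in> Hp" for l \<zeta>
  by (rule d1(2)[OF Yf(1)[OF that]]) (use Yf(2)[OF that] near0[OF ex[OF that(2)]] in \<open>simp add: dist_norm\<close>)
 \<comment> \<open>The half plane is connected and the balls of radius \<open>e1\<close> around the
   points of the fibre are disjoint, so a lift stays in one ball.\<close>
 have "\<exists>y0\<in>fib b. \<forall>\<zeta>\<in>Hp. dist (Y l \<zeta>) y0 < e1" if l: "l \<in> \<Lambda>" for l
 proof -
  define \<zeta>0 where "\<zeta>0 = complex_of_real (ln R0 - 1)"
  have \<zeta>0: "\<zeta>0 \<in> Hp" by (simp add: Hp_def \<zeta>0_def)
  obtain y0 where y0: "y0 \<in> fib b" "dist (Y l \<zeta>0) y0 < e1" using Ynear[OF l \<zeta>0] by blast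
  define W where "W = (\<Union>y\<in>fib b - {y0}. ball y e1)"
  have "connected (Y l ` Hp)"
   using L(3) l unfolding Hp_def by (intro connected_continuous_image convex_connected convex_halfspace_Re_lt) auto
  then have "ball y0 e1 \<inter> Y l ` Hp = {} | W \<inter> Y l ` Hp = {}"
  proof (rule connectedD)
   show "open W" unfolding W_def by (intro open_UN ballI open_ball)
   show "ball y0 e1 \<inter> W \<inter> Y l ` Hp = {}" using close[OF y0(1)] by (force simp: W_def dist_commute)
   show "Y l ` Hp \<subseteq> ball y0 e1 \<union> W" using Ynear[OF l] by (force simp: W_def dist_commute)
  qed simp
  then have "W \<inter> Y l ` Hp = {}" using y0(2) \<zeta>0 by (auto simp: dist_commute)
  then have "dist (Y l \<zeta>) y0 < e1" if "\<zeta> \<in> Hp" for \<zeta> using Ynear[OF l that] that by (force simp: W_def dist_commute)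
  then show ?thesis using y0(1) by blast
 qed
 then obtain i where i: "!!l. l \<in> \<Lambda> ==> i l \<in> fib b" "!!l \<zeta>. l \<in> \<Lambda> ==> \<zeta> \<in> Hp ==> dist (Y l \<zeta>) (i l) < e1" by metis
 have \<pi>L: "\<pi> l \<in> \<Lambda>" if "l \<in> \<Lambda>" for l using bij_betwE[OF L(2)] that by blast
 have \<tau>Hp: "\<zeta> + 2 * of_real pi * \<i> \<in> Hp" if "\<zeta> \<in> Hp" for \<zeta> using that by (simp add: Hp_def)
 \<comment> \<open>The lifts \<open>l\<close> and \<open>\<pi> l\<close> pass through the same
   points one period apart, hence belong to the same point of the fibre. So the permutation respects
   \<open>q\<close>, \<open>A\<close> and \<open>B\<close>, which vary with that point.\<close>
 have i\<pi>: "i (\<pi> l) = i l" if l: "l \<in> \<Lambda>" for l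
 proof -
  have z: "complex_of_real (ln R0 - 1) \<in> Hp" by (simp add: Hp_def)
  have "dist (Y (\<pi> l) (of_real (ln R0 - 1))) (i l) < e1"
   using i(2)[OF l \<tau>Hp[OF z]] L(6)[rule_format, OF l z] by simp
  then show ?thesis using close[OF i(1)[OF \<pi>L[OF l]] i(1)[OF l] i(2)[OF \<pi>L[OF l] z]] by simp
 qed
 define SA where "SA = Sigma \<Lambda> (%l. {..<q (i l)})"
 define a where "a = (%j \<zeta>. A (i (fst j)) (snd j) (Y (fst j) \<zeta>))"
 define w where "w = (%j \<zeta>. B (i (fst j)) (snd j) (Y (fst j) \<zeta>))"
 have SAsum: "(\<Sum>j\<in>SA. g (fst j) (snd j)) = (\<Sum>l\<in>\<Lambda>. \<Sum>\<nu><q (i l). g l \<nu>)" for g :: "complex^'n => nat => complex"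
  unfolding SA_def using sum.Sigma[OF L(1), of "%l. {..<q (i l)}" g] by (simp add: case_prod_beta)
 have entire: "(%\<zeta>. G (Y l \<zeta>)) holomorphic_on Hp" if "l \<in> \<Lambda>" "hol UNIV UNIV G" for l G
  using L(5) that wh_hol[OF hol_subset[OF that(2)]] by blast
 define h where "h = (%t. F (b + t *s u))"
 have hh: "h holomorphic_on ball 0 R0"
 proof -
  have "ball 0 R0 \<subseteq> {t. b + t *s u \<in> D}"
  proof
   fix t :: complex assume "t \<in> ball 0 R0"
   then show "t \<in> {t. b + t *s u \<in> D}" using line0[of t] b by (cases "t = 0") auto
  qed
  moreover have "b \<in> V" using b DV by blast
  ultimately show ?thesis unfolding h_def
   using holomorphic_on_subset[OF hol_line[OF EI_subspace D(1) F(1) _ u]] by blast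
 qed
 have "\<exists>C d. d > 0 & (\<forall>t. cmod t < d --> cmod (h t) <= C * cmod t ^ N)"
 proof (rule strip_order[OF hh R0(1)])
  show "finite SA" unfolding SA_def by (intro finite_SigmaI L) auto
  fix j assume "j \<in> SA"
  then show "a j holomorphic_on {\<zeta>. Re \<zeta> < ln R0}" "w j holomorphic_on {\<zeta>. Re \<zeta> < ln R0}"
   unfolding a_def w_def Hp_def[symmetric] using AB[OF i(1)] by (auto intro!: entire simp: SA_def)
 next
  \<comment> \<open>The two arguments are independent because the reflection separates them; the
    permutation of the lifts moves both factors alike.\<close>
  fix \<zeta> \<xi>' assume z: "Re \<zeta> < ln R0" "Re \<xi>' < ln R0"
  then have zH: "\<zeta> \<in> Hp" "\<xi>' \<in> Hp" by (auto simp: Hp_def)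
  have "(\<Sum>j\<in>SA. a j (\<zeta> + 2 * of_real pi * \<i>) * cnj (w j (\<xi>' + 2 * of_real pi * \<i>))) =
   (\<Sum>l\<in>\<Lambda>. \<Sum>\<nu><q (i l). A (i l) \<nu> (Y l (\<zeta> + 2 * of_real pi * \<i>)) * cnj (B (i l) \<nu> (Y l (\<xi>' + 2 * of_real pi * \<i>))))"
   unfolding a_def w_def by (rule SAsum)
  also have "\<dots> = (\<Sum>l\<in>\<Lambda>. \<Sum>\<nu><q (i (\<pi> l)). A (i (\<pi> l)) \<nu> (Y (\<pi> l) \<zeta>) * cnj (B (i (\<pi> l)) \<nu> (Y (\<pi> l) \<xi>')))"
   by (intro sum.cong refl) (use L(6) zH i\<pi> in auto)
  also have "\<dots> = (\<Sum>l\<in>\<Lambda>. \<Sum>\<nu><q (i l). A (i l) \<nu> (Y l \<zeta>) * cnj (B (i l) \<nu> (Y l \<xi>')))"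
   by (rule sum.reindex_bij_betw[OF L(2)])
  also have "\<dots> = (\<Sum>j\<in>SA. a j \<zeta> * cnj (w j \<xi>'))" unfolding a_def w_def by (rule SAsum[symmetric])
  finally show "(\<Sum>j\<in>SA. a j (\<zeta> + 2 * of_real pi * \<i>) * cnj (w j (\<xi>' + 2 * of_real pi * \<i>))) = (\<Sum>j\<in>SA. a j \<zeta> * cnj (w j \<xi>'))" .
 next
  fix \<epsilon> :: real assume \<epsilon>: "\<epsilon> > 0"
  have "\<forall>j\<in>SA. \<exists>d>0. \<forall>y. dist y (i (fst j)) < d --> cmod (B (i (fst j)) (snd j) y) <= \<epsilon>"
  proof
   fix j assume "j \<in> SA"
   then have "i (fst j) \<in> fib b" "snd j < q (i (fst j))" using i(1) by (auto simp: SA_def)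
   then have "continuous_on UNIV (B (i (fst j)) (snd j))" "B (i (fst j)) (snd j) (i (fst j)) = 0"
    using AB hol_continuous by blast+
   then show "\<exists>d>0. \<forall>y. dist y (i (fst j)) < d --> cmod (B (i (fst j)) (snd j) y) <= \<epsilon>"
    using \<epsilon> unfolding continuous_on_iff by (metis UNIV_I dist_0_norm dist_commute less_imp_le)
  qed
  then obtain d where d: "!!j. j \<in> SA ==> d j > 0" "!!j y. j \<in> SA ==> dist y (i (fst j)) < d j ==> cmod (B (i (fst j)) (snd j) y) <= \<epsilon>"
   by metis
  have SAf: "finite SA" unfolding SA_def by (intro finite_SigmaI L) auto
  obtain d0 where d0: "d0 > 0" "!!j. j \<in> SA ==> d0 < d j" by (rule finite_pos_lower_bound[OF SAf, of d]) (use d(1) in auto)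
  have "min d0 e1 > 0" using d0 e1 by simp
  then obtain d2 where d2: "d2 > 0" "!!y. y \<in> X \<inter> Om' ==> dist (pI I y) b < d2 ==> \<exists>y0\<in>fib b. dist y y0 < min d0 e1"
   using fib_near[OF b] by metis
  have "cmod (w j \<zeta>) <= \<epsilon>" if j: "j \<in> SA" and z: "Re \<zeta> < ln R0" "Re \<zeta> < ln (d2 / (norm u + 1))" for j \<zeta>
  proof -
   have zH: "\<zeta> \<in> Hp" using z by (simp add: Hp_def)
   have l: "fst j \<in> \<Lambda>" using j by (auto simp: SA_def)
   have "cmod (exp \<zeta>) < d2 / (norm u + 1)"
    unfolding norm_exp_eq_Re using z(2) d2(1) nu by (metis divide_pos_pos exp_less_mono exp_ln)
   then have "cmod (exp \<zeta>) * (norm u + 1) < d2" using nu by (simp add: pos_less_divide_eq)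
   moreover have "cmod (exp \<zeta>) * norm u <= cmod (exp \<zeta>) * (norm u + 1)" by (simp add: algebra_simps)
   ultimately have "cmod (exp \<zeta>) * norm u < d2" by linarith
   then obtain y0 where y0: "y0 \<in> fib b" "dist (Y (fst j) \<zeta>) y0 < min d0 e1"
    using d2(2)[OF Yf(1)[OF l zH]] Yf(2)[OF l zH] by (auto simp: dist_norm)
   then have "y0 = i (fst j)" using close[OF y0(1) i(1)[OF l] _ i(2)[OF l zH]] by simp
   then show ?thesis unfolding w_def using d(2)[OF j] y0(2) d0(2)[OF j] by simp
  qed
  then show "\<exists>c. \<forall>j\<in>SA. \<forall>\<zeta>. Re \<zeta> < ln R0 & Re \<zeta> < c --> cmod (w j \<zeta>) <= \<epsilon>" by blast
 next
  fix \<zeta> assume "Re \<zeta> < ln R0"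
  then have zH: "\<zeta> \<in> Hp" by (simp add: Hp_def)
  have "h (exp \<zeta>) = Tr \<xi> (b + exp \<zeta> *s u)" unfolding h_def
   by (rule F(2)) (use line0[of "exp \<zeta>"] ex[OF zH] in auto)
  also have "\<dots> = (\<Sum>l\<in>\<Lambda>. \<xi> (Y l \<zeta>))"
   unfolding Tr_def by (rule sum.reindex_bij_betw[OF L(4)[rule_format, OF zH], symmetric])
  finally have "h (exp \<zeta>) - (\<Sum>j\<in>SA. a j \<zeta> * cnj (w j \<zeta>)) =
    (\<Sum>l\<in>\<Lambda>. \<xi> (Y l \<zeta>) - (\<Sum>\<nu><q (i l). A (i l) \<nu> (Y l \<zeta>) * cnj (B (i l) \<nu> (Y l \<zeta>))))"
   unfolding a_def w_def SAsum[of "%l \<nu>. A (i l) \<nu> (Y l \<zeta>) * cnj (B (i l) \<nu> (Y l \<zeta>))"] by (simp add: sum_subtractf)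
  also have "cmod \<dots> <= (\<Sum>l\<in>\<Lambda>. C (i l) * (cmod (exp \<zeta>) * norm u) ^ N)"
  proof (rule sum_norm_le)
   fix l assume l: "l \<in> \<Lambda>"
   have "dist (Y l \<zeta>) (i l) < e (i l)" using i(2)[OF l zH] ea(2)[OF i(1)[OF l]] by (simp add: e1_def)
   from ap[OF i(1)[OF l] Yf(1)[OF l zH] this]
   show "cmod (\<xi> (Y l \<zeta>) - (\<Sum>\<nu><q (i l). A (i l) \<nu> (Y l \<zeta>) * cnj (B (i l) \<nu> (Y l \<zeta>)))) <= C (i l) * (cmod (exp \<zeta>) * norm u) ^ N"
    unfolding Yf(2)[OF l zH] by simp
  qed
  also have "\<dots> = ((\<Sum>l\<in>\<Lambda>. C (i l)) * norm u ^ N) * cmod (exp \<zeta>) ^ N"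
   unfolding sum_distrib_right by (intro sum.cong refl) (simp add: power_mult_distrib mult_ac)
  finally show "cmod (h (exp \<zeta>) - (\<Sum>j\<in>SA. a j \<zeta> * cnj (w j \<zeta>))) <= ((\<Sum>l\<in>\<Lambda>. C (i l)) * norm u ^ N) * cmod (exp \<zeta>) ^ N" .
 qed
 then show ?thesis unfolding h_def .
qed

text \<open>The directions \<open>v\<close> with \<delta> nonzero at \<open>b + v\<close> are dense,
  and on such a line \<delta> has at most an isolated zero at \<open>b\<close>; this is what
  \<open>order_line\<close> and \<open>vo_from_lines\<close> ask for.\<close>

lemma order_trace:
 assumes F: "hol V D F" "!!x. x \<in> D ==> \<delta> x ~= 0 ==> F x = Tr \<xi> x"
  and b: "b \<in> D" and mx: "!!y0. y0 \<in> fib b ==> mixed \<xi> b N y0"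
 shows "vo V N F b"
proof -
 have bV: "b \<in> V" using b DV by blast
 obtain e0 where e0: "e0 > 0" "!!y. y \<in> V ==> dist y b < e0 ==> y \<in> D" using ropen_ballE[OF D(1) b] by metis
 obtain x1 where x1: "x1 \<in> D" "\<delta> x1 ~= 0" using \<delta>nz by blast
 show ?thesis
 proof (rule vo_from_lines[OF EI_subspace D(1) F(1) b e0(1), where P = "%v. b + v \<in> D & \<delta> (b + v) ~= 0"])
  fix y e assume y: "y \<in> V" "norm y < e0" and e: "(e::real) > 0"
  have "b + y \<in> V" by (rule vec.subspace_add[OF EI_subspace bV y(1)])
  then have "b + y \<in> D" using e0(2) y(2) by (simp add: dist_norm)
  obtain z where z: "z \<in> D" "dist z (b + y) < e" "\<delta> z ~= 0"
   by (rule hol_nonzero_dense[OF EI_subspace D(1,2) \<delta>h x1 \<open>b + y \<in> D\<close> e])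
  have "z \<in> V" using z(1) DV by blast
  show "\<exists>v\<in>V. dist v y < e & b + v \<in> D & \<delta> (b + v) ~= 0"
   by (rule bexI[of _ "z - b"]) (use z vec.subspace_diff[OF EI_subspace \<open>z \<in> V\<close> bV] in \<open>auto simp: dist_norm algebra_simps\<close>)
 next
  fix v assume v: "v \<in> V" "b + v \<in> D & \<delta> (b + v) ~= 0"
  define T where "T = {t. b + t *s v \<in> D}"
  have 1: "(%t. \<delta> (b + t *s v)) holomorphic_on T" unfolding T_def by (rule hol_line[OF EI_subspace D(1) \<delta>h bV v(1)])
  have 2: "open T" unfolding T_def by (rule line_open[OF EI_subspace D(1) bV v(1)])
  have 3: "connected T" unfolding T_def by (intro convex_connected convex_line D(2))
  obtain R where R: "R > 0" "ball 0 R \<subseteq> T" "!!z. z \<in> ball 0 R - {0} ==> \<delta> (b + z *s v) ~= 0"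
   by (rule isolated_zero_radius[OF 1 2 3, of 1]) (use b v(2) in \<open>auto simp: T_def\<close>)
  show "\<exists>C d. d > 0 & (\<forall>t. cmod t < d --> cmod (F (b + t *s v)) <= C * cmod t ^ N)"
   by (rule order_line[OF F b v(1) R(1) _ mx]) (use R in \<open>auto simp: T_def subset_eq\<close>)
 qed
qed

end

section \<open>Taylor expansion\<close>

definition hmg :: "nat => (complex^'n => complex) => bool" where
 "hmg i A \<longleftrightarrow> hol UNIV UNIV A & (\<forall>s h. A (s *s h) = s ^ i * A h)"

text \<open>Polynomials in the coordinates and their conjugates, as sums of products of a
  holomorphic and an antiholomorphic homogeneous factor. Homogeneity serves to integrate along rays,
  and the factorisation isolates the holomorphic part.\<close>

inductive hpoly :: "(complex^'n => complex) => bool" where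
 hpoly_term: "hmg i A ==> hmg j B ==> hpoly (%h. A h * cnj (B h))"
| hpoly_zero: "hpoly (%_. 0)"
| hpoly_add: "hpoly f ==> hpoly g ==> hpoly (%h. f h + g h)"

lemma hmg_const: "hmg 0 (%_. c)"
 by (simp add: hmg_def)

lemma hmg_mult_component: "hmg i A ==> hmg (Suc i) (%h. c * (h $ k) * A h)"
 unfolding hmg_def by (auto intro!: hol_mult hol_component)

lemma hpoly_const: "hpoly (%_. c)"
 using hpoly_term[OF hmg_const[of c] hmg_const[of 1]] by simp

lemma hpoly_sum: "finite S ==> (!!i. i \<in> S ==> hpoly (f i)) ==> hpoly (%h. \<Sum>i\<in>S. f i h)"
 by (induction S rule: finite_induct) (auto intro: hpoly_zero hpoly_add)

text \<open>A term has degree \<open>i + j\<close> along real rays, so multiplication by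
  \<open>(h \<bullet> e) / (i + j + 1)\<close> integrates it. The real coordinate
  \<open>h \<bullet> e\<close> is the real part of \<open>cnj u * h $ k\<close>, a sum of one
  holomorphic and one antiholomorphic term, so the result is again of this kind.\<close>

lemma hpoly_antiderivative:
 fixes f :: "complex^'n => complex"
 assumes "hpoly f" "e \<in> Basis"
 shows "\<exists>T. hpoly T & T 0 = 0 & (\<forall>h s. ((%s. T (s *\<^sub>R h)) has_vector_derivative (h \<bullet> e) *\<^sub>R f (s *\<^sub>R h)) (at s))"
 using assms
proof (induction rule: hpoly.induct)
 case (hpoly_term i A j B)
 obtain k u where e: "e = axis k u" "u = 1 | u = \<i>" using hpoly_term(3) by (auto simp: Basis_vec_def Basis_complex_def)
 define a where "a = cnj u / 2 / of_nat (i + j + 1)"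
 have inner: "complex_of_real (h \<bullet> e) = (cnj u * h $ k + u * cnj (h $ k)) / 2" for h :: "complex^'n"
  using e(2) by (auto simp: e(1) inner_axis complex_eq_iff inner_complex_def)
 define T where "T = (%h. (a * (h $ k) * A h) * cnj (B h) + A h * cnj (a * (h $ k) * B h))"
 have Teq: "T h = of_real (h \<bullet> e) * (A h * cnj (B h)) / of_nat (i + j + 1)" for h
  unfolding inner T_def a_def by (simp add: add_divide_distrib algebra_simps)
 have "hpoly T" unfolding T_def
  by (intro hpoly.hpoly_add hpoly.hpoly_term[OF hmg_mult_component[OF hpoly_term(1)] hpoly_term(2)]
    hpoly.hpoly_term[OF hpoly_term(1) hmg_mult_component[OF hpoly_term(2)]])
 moreover have "T 0 = 0" by (simp add: Teq)
 moreover have "((%s. T (s *\<^sub>R h)) has_vector_derivative (h \<bullet> e) *\<^sub>R (A (s *\<^sub>R h) * cnj (B (s *\<^sub>R h)))) (at s)" for h s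
 proof -
  have AB: "A (s *\<^sub>R h) * cnj (B (s *\<^sub>R h)) = of_real s ^ (i + j) * (A h * cnj (B h))" for s
   using hpoly_term(1,2) unfolding hmg_def smult_of_real[symmetric] by (simp add: power_add)
  have Ts: "T (s *\<^sub>R h) = of_real (s ^ (i + j + 1)) * T h" for s
   unfolding Teq AB by simp
  have "((%s. s ^ (i + j + 1)) has_real_derivative real (i + j + 1) * s ^ (i + j)) (at s)"
   using DERIV_pow[of "i + j + 1" s] by simp
  then have "((%s. of_real (s ^ (i + j + 1)) * T h) has_vector_derivative of_real (real (i + j + 1) * s ^ (i + j)) * T h) (at s)"
   by (intro has_vector_derivative_mult_left has_vector_derivative_of_real) (simp add: has_real_derivative_iff_has_vector_derivative)
  moreover have "of_real (real (i + j + 1) * s ^ (i + j)) * T h = (h \<bullet> e) *\<^sub>R (A (s *\<^sub>R h) * cnj (B (s *\<^sub>R h)))"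
  proof -
   have "(of_nat (i + j + 1) :: complex) ~= 0" by (metis of_nat_eq_0_iff Suc_eq_plus1 nat.distinct(1))
   then show ?thesis unfolding AB Teq unfolding scaleR_conv_of_real by (simp add: field_simps)
  qed
  ultimately show ?thesis unfolding Ts by simp
 qed
 ultimately show ?case by blast
next
 case hpoly_zero
 show ?case by (rule exI[of _ "%_. 0"]) (auto intro: hpoly.hpoly_zero)
next
 case (hpoly_add f g)
 then obtain S T where ST: "hpoly S" "S 0 = 0" "!!h s. ((%s. S (s *\<^sub>R h)) has_vector_derivative (h \<bullet> e) *\<^sub>R f (s *\<^sub>R h)) (at s)"
  "hpoly T" "T 0 = 0" "!!h s. ((%s. T (s *\<^sub>R h)) has_vector_derivative (h \<bullet> e) *\<^sub>R g (s *\<^sub>R h)) (at s)"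
  by blast
 show ?case
  by (rule exI[of _ "%h. S h + T h"])
   (use ST in \<open>auto intro!: hpoly.hpoly_add has_vector_derivative_add simp: scaleR_add_right\<close>)
qed

text \<open>Terms with \<open>j = 0\<close> are holomorphic since \<open>B\<close> is then constant;
  for \<open>j > 0\<close> homogeneity gives \<open>B 0 = 0\<close>.\<close>

lemma hpoly_split:
 assumes "hpoly f"
 shows "\<exists>p q A B. hol UNIV UNIV p & (\<forall>\<nu><q::nat. hol UNIV UNIV (A \<nu>) & hol UNIV UNIV (B \<nu>) & B \<nu> 0 = 0) &
  f = (%h. p h + (\<Sum>\<nu><q. A \<nu> h * cnj (B \<nu> h)))"
 using assms
proof (induction rule: hpoly.induct)
 case (hpoly_term i A j B)
 have hAB: "hol UNIV UNIV A" "hol UNIV UNIV B" and B: "B (s *s h) = s ^ j * B h" for s h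
  using hpoly_term by (auto simp: hmg_def)
 show ?case
 proof (cases "j = 0")
  case True
  have "B h = B 0" for h using B[of 0 h] True by simp
  then have "(%h. A h * cnj (B h)) = (%h. A h * cnj (B 0) + (\<Sum>\<nu><(0::nat). A h * cnj (B h)))" by (intro ext) simp
  then show ?thesis using hAB
   by (intro exI[of _ "%h. A h * cnj (B 0)"] exI[of _ "0::nat"]) (rule exI[of _ "%_. A"], rule exI[of _ "%_. B"], auto intro!: hol_mult)
 next
  case False
  then have "B 0 = 0" using B[of 0 0] by (simp add: power_0_left)
  then show ?thesis using hAB
   by (intro exI[of _ "%_. 0"] exI[of _ "1::nat"]) (rule exI[of _ "%_. A"], rule exI[of _ "%_. B"], auto)
 qed
next
 case hpoly_zero
 show ?case by (intro exI[of _ "%_. 0"] exI[of _ "0::nat"]) auto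
next
 case (hpoly_add f g)
 obtain p q A B where f: "hol UNIV UNIV p" "\<forall>\<nu><q::nat. hol UNIV UNIV (A \<nu>) & hol UNIV UNIV (B \<nu>) & B \<nu> 0 = 0"
  "f = (%h. p h + (\<Sum>\<nu><q. A \<nu> h * cnj (B \<nu> h)))" using hpoly_add.IH(1) by (elim exE conjE) (rule that, assumption+)
 obtain p' q' A' B' where g: "hol UNIV UNIV p'" "\<forall>\<nu><q'::nat. hol UNIV UNIV (A' \<nu>) & hol UNIV UNIV (B' \<nu>) & B' \<nu> 0 = 0"
  "g = (%h. p' h + (\<Sum>\<nu><q'. A' \<nu> h * cnj (B' \<nu> h)))" using hpoly_add.IH(2) by (elim exE conjE) (rule that, assumption+)
 define A2 where "A2 \<nu> = (if \<nu> < q then A \<nu> else A' (\<nu> - q))" for \<nu>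
 define B2 where "B2 \<nu> = (if \<nu> < q then B \<nu> else B' (\<nu> - q))" for \<nu>
 have "(\<Sum>\<nu><q + q'. A2 \<nu> h * cnj (B2 \<nu> h)) = (\<Sum>\<nu><q. A \<nu> h * cnj (B \<nu> h)) + (\<Sum>\<nu><q'. A' \<nu> h * cnj (B' \<nu> h))" for h
  by (induction q') (simp_all add: A2_def B2_def)
 then have "(%h. f h + g h) = (%h. (p h + p' h) + (\<Sum>\<nu><q + q'. A2 \<nu> h * cnj (B2 \<nu> h)))"
  unfolding f(3) g(3) by (simp add: algebra_simps)
 moreover have "hol UNIV UNIV (%h. p h + p' h)" by (intro hol_add f g)
 moreover have "\<forall>\<nu><q + q'. hol UNIV UNIV (A2 \<nu>) & hol UNIV UNIV (B2 \<nu>) & B2 \<nu> 0 = 0"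
  using f(2) g(2) by (auto simp: A2_def B2_def)
 ultimately show ?case by (intro exI conjI) assumption+
qed

text \<open>Induction on \<open>m\<close>: the derivatives along a basis are expanded to order
  \<open>m\<close> and integrated along the rays from \<open>a\<close>, which gains one order. At
  the bottom, continuity gives a bounded error with the zero polynomial.\<close>

lemma taylor_hpoly:
 fixes g :: "complex^'n => complex"
 assumes "Ck_on m g W" "open W" "a \<in> W"
 shows "\<exists>f e C. hpoly f & e > 0 & (\<forall>h. norm h < e --> cmod (g (a + h) - f h) <= C * norm h ^ m)"
 using assms
proof (induction m arbitrary: g)
 case 0
 then have "continuous_on W g" by simp
 then obtain e where e: "e > 0" "!!y. y \<in> W ==> dist y a < e ==> dist (g y) (g a) < 1"
  unfolding continuous_on_iff using 0(3) by (metis zero_less_one)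
 obtain e' where e': "e' > 0" "ball a e' \<subseteq> W" using 0(2,3) open_contains_ball by blast
 have "cmod (g (a + h) - 0) <= (cmod (g a) + 1) * norm h ^ 0" if "norm h < min e e'" for h
 proof -
  have "a + h \<in> W" using that e'(2) by (auto simp: dist_norm subset_eq)
  then have "dist (g (a + h)) (g a) < 1" using e(2) that by (simp add: dist_norm)
  then show ?thesis using norm_triangle_sub[of "g (a + h)" "g a"] by (simp add: dist_norm)
 qed
 then have "\<forall>h. norm h < min e e' --> cmod (g (a + h) - 0) <= (cmod (g a) + 1) * norm h ^ 0" by blast
 moreover have "min e e' > 0" using e e' by simp
 ultimately show ?case using hpoly_zero by blast
next
 case (Suc m)
 define g' where "g' = (%v x. frechet_derivative g (at x) v)"
 have gd: "(g has_derivative (%v. g' v x)) (at x)" if "x \<in> W" for x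
  using Suc.prems(1) that by (simp add: g'_def frechet_derivative_works)
 have "\<forall>v. \<exists>f e C. hpoly f & e > 0 & (\<forall>h. norm h < e --> cmod (g' v (a + h) - f h) <= C * norm h ^ m)"
 proof
  fix v
  have "Ck_on m (g' v) W" using Suc.prems(1) by (simp add: g'_def)
  then show "\<exists>f e C. hpoly f & e > 0 & (\<forall>h. norm h < e --> cmod (g' v (a + h) - f h) <= C * norm h ^ m)"
   by (rule Suc.IH[OF _ Suc.prems(2,3)])
 qed
 then obtain f e C where f: "!!v. hpoly (f v)" "!!v. e v > (0::real)"
  "!!v h. norm h < e v ==> cmod (g' v (a + h) - f v h) <= C v * norm h ^ m" by metis
 have "\<forall>v. \<exists>T. v \<in> Basis --> hpoly T & T 0 = 0 & (\<forall>h s. ((%s. T (s *\<^sub>R h)) has_vector_derivative (h \<bullet> v) *\<^sub>R f v (s *\<^sub>R h)) (at s))"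
  using hpoly_antiderivative[OF f(1)] by blast
 then obtain T where T: "!!v. v \<in> Basis ==> hpoly (T v)" "!!v. v \<in> Basis ==> T v 0 = 0"
  "!!v h s. v \<in> Basis ==> ((%s. T v (s *\<^sub>R h)) has_vector_derivative (h \<bullet> v) *\<^sub>R f v (s *\<^sub>R h)) (at s)" by metis
 obtain e0 where e0: "e0 > 0" "!!v::complex^'n. v \<in> Basis ==> e0 < e v"
  by (rule finite_pos_lower_bound[OF finite_Basis, of e]) (use f(2) in auto)
 obtain e' where e': "e' > 0" "ball a e' \<subseteq> W" using Suc.prems(2,3) open_contains_ball by blast
 define Ts where "Ts h = g a + (\<Sum>v\<in>Basis. T v h)" for h :: "complex^'n"
 have "hpoly Ts" unfolding Ts_def by (intro hpoly_add hpoly_const hpoly_sum T(1)) auto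
 have "cmod (g (a + h) - Ts h) <= (\<Sum>v\<in>Basis. \<bar>C v\<bar>) * norm h ^ Suc m" if h: "norm h < min e0 e'" for h
 proof -
  define F where "F = (%s. g (a + s *\<^sub>R h) - Ts (s *\<^sub>R h))"
  define F' where "F' = (%s. \<Sum>v\<in>Basis. (h \<bullet> v) *\<^sub>R (g' v (a + s *\<^sub>R h) - f v (s *\<^sub>R h)))"
  have sh: "norm (s *\<^sub>R h) <= norm h" if "s \<in> {0..1}" for s using that by (simp add: mult_left_le_one_le)
  have dF: "(F has_vector_derivative F' s) (at s within {0..1})" if s: "s \<in> {0..1}" for s
  proof -
   have "a + s *\<^sub>R h \<in> W" using sh[OF s] h e'(2) by (auto simp: dist_norm subset_eq)
   note gd[OF this]
   moreover have "((%s. a + s *\<^sub>R h) has_derivative (%t. t *\<^sub>R h)) (at s)" by (auto intro!: derivative_eq_intros)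
   ultimately have "(g \<circ> (%s. a + s *\<^sub>R h) has_derivative (%v. g' v (a + s *\<^sub>R h)) \<circ> (%t. t *\<^sub>R h)) (at s)"
    by (rule diff_chain_at[rotated])
   moreover have lin: "linear (%v. g' v (a + s *\<^sub>R h))" using has_derivative_linear[OF gd[OF \<open>a + s *\<^sub>R h \<in> W\<close>]] .
   have "g' (t *\<^sub>R h) (a + s *\<^sub>R h) = t *\<^sub>R g' h (a + s *\<^sub>R h)" for t using linear_scale[OF lin] by blast
   ultimately have 1: "((%s. g (a + s *\<^sub>R h)) has_vector_derivative g' h (a + s *\<^sub>R h)) (at s)"
    unfolding has_vector_derivative_def by (simp add: o_def)
   have "g' h (a + s *\<^sub>R h) = g' (\<Sum>v\<in>Basis. (h \<bullet> v) *\<^sub>R v) (a + s *\<^sub>R h)" by (simp add: euclidean_representation)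
   also have "\<dots> = (\<Sum>v\<in>Basis. (h \<bullet> v) *\<^sub>R g' v (a + s *\<^sub>R h))" by (simp add: linear_sum[OF lin] linear_scale[OF lin])
   finally have 2: "g' h (a + s *\<^sub>R h) = \<dots>" .
   have "((%s. Ts (s *\<^sub>R h)) has_vector_derivative (\<Sum>v\<in>Basis. (h \<bullet> v) *\<^sub>R f v (s *\<^sub>R h))) (at s)"
    unfolding Ts_def by (auto intro!: derivative_eq_intros has_vector_derivative_sum T(3))
   from has_vector_derivative_diff[OF 1 this] have "(F has_vector_derivative F' s) (at s)"
    unfolding F_def F'_def 2 by (simp add: sum_subtractf scaleR_diff_right)
   then show ?thesis by (rule has_vector_derivative_at_within)
  qed
  have bF: "norm (F' s) <= (\<Sum>v\<in>Basis. \<bar>C v\<bar>) * norm h ^ Suc m" if s: "s \<in> {0..1}" for s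
  proof -
   have "norm (F' s) <= (\<Sum>v\<in>Basis. \<bar>C v\<bar> * norm h ^ Suc m)"
    unfolding F'_def
   proof (rule sum_norm_le)
    fix v :: "complex^'n" assume v: "v \<in> Basis"
    have "norm (s *\<^sub>R h) < e v" using sh[OF s] h e0(2)[OF v] by linarith
    then have "cmod (g' v (a + s *\<^sub>R h) - f v (s *\<^sub>R h)) <= C v * norm (s *\<^sub>R h) ^ m" by (rule f(3))
    also have "\<dots> <= \<bar>C v\<bar> * norm h ^ m" by (intro mult_mono power_mono sh[OF s]) auto
    finally have "\<bar>h \<bullet> v\<bar> * cmod (g' v (a + s *\<^sub>R h) - f v (s *\<^sub>R h)) <= norm h * (\<bar>C v\<bar> * norm h ^ m)"
     by (intro mult_mono Basis_le_norm[OF v]) auto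
    then show "norm ((h \<bullet> v) *\<^sub>R (g' v (a + s *\<^sub>R h) - f v (s *\<^sub>R h))) <= \<bar>C v\<bar> * norm h ^ Suc m" by (simp add: mult_ac)
   qed
   then show ?thesis by (simp add: sum_distrib_right)
  qed
  have "norm (F 1 - F 0) <= ((\<Sum>v\<in>Basis. \<bar>C v\<bar>) * norm h ^ Suc m) * norm (1 - (0::real))"
  proof (rule differentiable_bound[of "{0..1}" F "%s t. t *\<^sub>R F' s"])
   show "onorm (%t. t *\<^sub>R F' s) <= (\<Sum>v\<in>Basis. \<bar>C v\<bar>) * norm h ^ Suc m" if s: "s \<in> {0..1}" for s
    by (rule onorm_le) (use mult_right_mono[OF bF[OF s] abs_ge_zero] in \<open>simp add: mult.commute\<close>)
  qed (use dF in \<open>auto simp: has_vector_derivative_def\<close>)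
  moreover have "F 0 = 0" using T(2) by (simp add: F_def Ts_def)
  ultimately show ?thesis by (simp add: F_def)
 qed
 then have "\<forall>h. norm h < min e0 e' --> cmod (g (a + h) - Ts h) <= (\<Sum>v\<in>Basis. \<bar>C v\<bar>) * norm h ^ Suc m" by blast
 moreover have "min e0 e' > 0" using e0(1) e'(1) by simp
 ultimately show ?case using \<open>hpoly Ts\<close> by blast
qed

section \<open>Finite generation over the base by iterated division\<close>

definition deg0 :: "('n => real) => ('n => complex^'n => complex) => 'n => nat" where
 "deg0 r Q j = (\<Sum>w\<in>weierstrass.zr (ax j) (r j) (Q j) 0. weierstrass.mu (ax j) (Q j) 0 w)"

context cover
begin

text \<open>The intermediate stages, with only the coordinates in \<open>J\<close> adjoined to
  \<open>I\<close>: division starts from all coordinates and ends over \<open>D\<close>.\<close>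

definition OmJ where "OmJ J = {y \<in> EI (I \<union> J). pI I y \<in> D & (\<forall>j\<in>J. cmod (y $ j) < r j)}"

lemma OmJ_insert:
 assumes j: "j \<notin> I" "j \<notin> J"
 shows "{x + w *s ax j | x w. x \<in> OmJ J & cmod w < r j} = OmJ (insert j J)"
proof (intro set_eqI iffI)
 fix z assume "z \<in> {x + w *s ax j | x w. x \<in> OmJ J & cmod w < r j}"
 then obtain x w where z: "z = x + w *s ax j" "x \<in> OmJ J" "cmod w < r j" by blast
 have "pI I z = pI I x" using j z(1) by (auto simp: vec_eq_iff)
 moreover have "x $ j = 0" using z(2) j by (simp add: OmJ_def EI_def)
 ultimately show "z \<in> OmJ (insert j J)" using z j by (auto simp: OmJ_def EI_def)
next
 fix z assume z: "z \<in> OmJ (insert j J)"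
 define x where "x = z - (z $ j) *s ax j"
 have "pI I x = pI I z" using j by (auto simp: vec_eq_iff x_def)
 then have "x \<in> OmJ J" using z j by (auto simp: OmJ_def EI_def x_def)
 moreover have "z = x + (z $ j) *s ax j" "cmod (z $ j) < r j" using z by (auto simp: x_def OmJ_def)
 ultimately show "z \<in> {x + w *s ax j | x w. x \<in> OmJ J & cmod w < r j}" by blast
qed

lemma OmJ_ropen: "J \<subseteq> - I ==> ropen (EI (I \<union> J)) (OmJ J)"
proof -
 obtain O1 where O: "open O1" "D = V \<inter> O1" using D(1) unfolding openin_open by auto
 have "OmJ J = EI (I \<union> J) \<inter> ((%y. pI I y) -` O1 \<inter> (\<Inter>j\<in>J. (%y. y $ j) -` ball 0 (r j)))"
  unfolding OmJ_def using O(2) by auto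
 moreover have "open ((%y. pI I y) -` O1 \<inter> (\<Inter>j\<in>J. (%y::complex^'n. y $ j) -` ball 0 (r j)))"
  by (intro open_Int open_INT open_vimage O continuous_intros ballI finite open_ball)
 ultimately show ?thesis by (simp add: openin_open_Int)
qed

lemma OmJ_convex: "convex (OmJ J)"
proof (rule convexI)
 fix x y and p q :: real
 assume xy: "x \<in> OmJ J" "y \<in> OmJ J" and pq: "0 <= p" "0 <= q" "p + q = 1"
 have "pI I (p *\<^sub>R x + q *\<^sub>R y) = p *\<^sub>R pI I x + q *\<^sub>R pI I y" by (simp add: vec_eq_iff)
 then have "pI I (p *\<^sub>R x + q *\<^sub>R y) \<in> D" using D(2) xy pq by (simp add: OmJ_def convexD)
 moreover have "p *\<^sub>R x $ j + q *\<^sub>R y $ j \<in> ball 0 (r j)" if "j \<in> J" for j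
  using convexD[OF convex_ball[of "0::complex" "r j"], of "x $ j" "y $ j" p q] xy pq that by (simp add: OmJ_def)
 ultimately show "p *\<^sub>R x + q *\<^sub>R y \<in> OmJ J" using xy by (auto simp: OmJ_def EI_def)
qed

text \<open>On the common zeros of the equations \<open>Q j\<close> the multiple of the Weierstrass
  polynomial vanishes and division leaves only the remainder; its coefficients live over one
  coordinate less and are treated by induction.\<close>

lemma iterated_division:
 assumes "finite J" "J \<subseteq> - I" "hol (EI (I \<union> J)) (OmJ J) p"
 shows "\<exists>c. (\<forall>\<kappa>. hol V D (c \<kappa>)) & (\<forall>y\<in>OmJ J. (\<forall>j\<in>J. Q j (pI I y + (y $ j) *s ax j) = 0) -->
  p y = (\<Sum>\<kappa>\<in>PiE J (%j. {..<deg0 r Q j}). c \<kappa> (pI I y) * (\<Prod>j\<in>J. (y $ j) ^ \<kappa> j)))"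
 using assms
proof (induction J arbitrary: p rule: finite_induct)
 case empty
 have O: "OmJ {} = D"
 proof (intro set_eqI)
  fix x show "x \<in> OmJ {} \<longleftrightarrow> x \<in> D" using DV pI_id[of x I] by (auto simp: OmJ_def)
 qed
 have "hol V D p" using empty unfolding O by simp
 moreover have "p y = p (pI I y)" if "y \<in> D" for y using that DV pI_id by force
 ultimately show ?case unfolding O by (intro exI[of _ "%_. p"]) auto
next
 case (insert j J)
 have jI: "j \<notin> I" and J: "J \<subseteq> - I" using insert.prems by auto
 have ins: "insert j (I \<union> J) = I \<union> insert j J" by blast
 have jU: "j \<notin> I \<union> J" using jI insert.hyps by blast
 let ?f = "%y. Q j (pI I y + (y $ j) *s ax j)"
 have xj: "x $ j = 0" if "x \<in> EI (I \<union> J)" for x using that jU by (simp add: EI_def)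
 have fpt: "?f (x + w *s ax j) = Q j (pI I x + w *s ax j)" if "x \<in> EI (I \<union> J)" for x w
 proof -
  have "pI I (x + w *s ax j) = pI I x" using jI by (auto simp: vec_eq_iff)
  moreover have "(x + w *s ax j) $ j = w" using xj[OF that] by simp
  ultimately show ?thesis by simp
 qed
 have O0: "0 \<in> OmJ J" using D(3) J towerQ(1,2)[OF tow] by (force simp: OmJ_def EI_def)
 interpret W: weierstrass "EI (I \<union> J)" "ax j" j "OmJ J" "s j" "r j" ?f
 proof
  show "ropen (EI (I \<union> J)) (OmJ J)" by (rule OmJ_ropen[OF J])
  show "OmJ J ~= {}" using O0 by blast
  show "0 < s j" "s j < r j" using towerQ(1,2)[OF tow jI] .
  show "hol {x + w *s ax j |x w. x \<in> EI (I \<union> J)} {x + w *s ax j |x w. x \<in> OmJ J & cmod w < r j} ?f"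
  proof (rule hol_compose_lin[OF towerQ(3)[OF tow jI], where M = "%z. pI I z + (z $ j) *s ax j"])
   show "continuous_on {x + w *s ax j |x w. x \<in> OmJ J & cmod w < r j} (%z. pI I z + (z $ j) *s ax j)"
    by (intro continuous_intros)
   fix z assume "z \<in> {x + w *s ax j |x w. x \<in> OmJ J & cmod w < r j}"
   then have "pI I z \<in> D" "cmod (z $ j) < r j" unfolding OmJ_insert[OF jI insert.hyps(2)] by (auto simp: OmJ_def)
   then show "pI I z + (z $ j) *s ax j \<in> Tb j D (r j)" unfolding Tb_def by blast
  next
   fix z v :: "complex^'n" and t :: complex
   show "pI I v + (v $ j) *s ax j \<in> EI (insert j I) &
    pI I (z + t *s v) + (z + t *s v) $ j *s ax j = pI I z + z $ j *s ax j + t *s (pI I v + v $ j *s ax j)"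
    by (auto simp: EI_def vec_eq_iff algebra_simps)
  qed
  show "?f (x + w *s ax j) ~= 0" if "x \<in> OmJ J" "s j <= cmod w" "cmod w < r j" for x w
   unfolding fpt[OF OmJ_def[of J, THEN equalityD1, THEN subsetD, OF that(1), THEN CollectD, THEN conjunct1]]
   by (rule towerQ(4)[OF tow jI]) (use that in \<open>auto simp: OmJ_def\<close>)
 qed (use xj OmJ_convex in auto)
 have WW: "W.W = EI (I \<union> insert j J)" unfolding W.W_def EI_insert[OF jU] ins ..
 have Wc: "W.cyl = OmJ (insert j J)" unfolding W.cyl_def by (rule OmJ_insert[OF jI insert.hyps(2)])
 \<comment> \<open>The number of zeros is constant over the base and may be counted over 0, so
   neither adjoining coordinates nor shrinking \<open>D\<close> changes the degree.\<close>
 have WK: "W.K = deg0 r Q j"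
 proof -
  interpret q: weierstrass V "ax j" j D "s j" "r j" "Q j" by (rule weier[OF jI])
  have f0: "?f (0 + w *s ax j) = Q j (0 + w *s ax j)" for w using fpt[of 0 w] by (simp add: EI_def)
  have zr: "W.zr 0 = q.zr 0" unfolding W.zr_def q.zr_def f0 ..
  have mu: "W.mu 0 w = q.mu 0 w" for w unfolding W.mu_def q.mu_def f0 ..
  show ?thesis unfolding W.mu_sum[OF O0, symmetric] deg0_def zr mu ..
 qed
 have ph: "hol W.W W.cyl p" using insert.prems(2) unfolding WW Wc .
 obtain q where q: "hol W.W W.cyl q" "!!z. z \<in> W.cyl ==> p z = W.P z * q z + (\<Sum>l<W.K. W.rem p l (W.pr z) * (z $ j) ^ l)"
 proof (rule W.division[OF ph])
  fix q assume a: "hol W.W W.cyl q" "!!z. z \<in> W.cyl ==> p z = W.P z * q z + (\<Sum>l<W.K. W.rem p l (W.pr z) * (z $ j) ^ l)"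
  show thesis by (rule that[OF a])
 qed
 have "\<forall>l. \<exists>c. (\<forall>\<kappa>. hol V D (c \<kappa>)) & (\<forall>y\<in>OmJ J. (\<forall>j\<in>J. Q j (pI I y + (y $ j) *s ax j) = 0) -->
  W.rem p l y = (\<Sum>\<kappa>\<in>PiE J (%j. {..<deg0 r Q j}). c \<kappa> (pI I y) * (\<Prod>j\<in>J. (y $ j) ^ \<kappa> j)))"
  using insert.IH[OF J W.rem_hol[OF ph]] by blast
 from choice[OF this] obtain c where c: "!!l \<kappa>. hol V D (c l \<kappa>)"
  "!!l y. y \<in> OmJ J ==> (\<forall>j\<in>J. Q j (pI I y + (y $ j) *s ax j) = 0) ==>
   W.rem p l y = (\<Sum>\<kappa>\<in>PiE J (%j. {..<deg0 r Q j}). c l \<kappa> (pI I y) * (\<Prod>j\<in>J. (y $ j) ^ \<kappa> j))"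
  by blast
 \<comment> \<open>The exponent of the new coordinate selects the coefficient; resetting
   \<open>\<kappa> j\<close> to \<open>undefined\<close> returns an element of the extensional
   function space over \<open>J\<close>.\<close>
 define c' where "c' \<kappa> = c (\<kappa> j) (\<kappa>(j := undefined))" for \<kappa>
 have "p y = (\<Sum>\<kappa>\<in>PiE (insert j J) (%j. {..<deg0 r Q j}). c' \<kappa> (pI I y) * (\<Prod>j\<in>insert j J. (y $ j) ^ \<kappa> j))"
  if y: "y \<in> OmJ (insert j J)" and yQ: "\<forall>j\<in>insert j J. Q j (pI I y + (y $ j) *s ax j) = 0" for y
 proof -
  have yc: "y \<in> W.cyl" using y Wc by simp
  have prO: "W.pr y \<in> OmJ J" "cmod (y $ j) < r j" using yc W.cyl_iff by auto
  have prI: "pI I (W.pr y) = pI I y" using jI by (auto simp: vec_eq_iff W.pr_def)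
  have prJ: "W.pr y $ k = y $ k" if "k \<in> J" for k using that insert.hyps(2) by (auto simp: W.pr_def)
  have ys: "W.pr y + (y $ j) *s ax j = y" by (rule W.pr_split)
  have "?f (W.pr y + (y $ j) *s ax j) = 0" unfolding ys using yQ by simp
  then have "y $ j \<in> W.zr (W.pr y)" using prO(2) by (simp add: W.zr_def)
  then have "W.P (W.pr y + (y $ j) *s ax j) = 0" unfolding W.P_pt[OF prO(1)] W.pw_zero_iff[OF prO(1)] .
  then have "p y = (\<Sum>l<deg0 r Q j. W.rem p l (W.pr y) * (y $ j) ^ l)" using q(2)[OF yc] unfolding ys WK by simp
  also have "\<dots> = (\<Sum>l<deg0 r Q j. \<Sum>\<kappa>\<in>PiE J (%j. {..<deg0 r Q j}). (c l \<kappa> (pI I y) * (\<Prod>j\<in>J. (y $ j) ^ \<kappa> j)) * (y $ j) ^ l)"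
  proof (intro sum.cong refl)
   fix l
   have "W.rem p l (W.pr y) = (\<Sum>\<kappa>\<in>PiE J (%j. {..<deg0 r Q j}). c l \<kappa> (pI I y) * (\<Prod>j\<in>J. (W.pr y $ j) ^ \<kappa> j))"
    using c(2)[OF prO(1), unfolded prI] yQ prJ by simp
   then show "W.rem p l (W.pr y) * (y $ j) ^ l = (\<Sum>\<kappa>\<in>PiE J (%j. {..<deg0 r Q j}). (c l \<kappa> (pI I y) * (\<Prod>j\<in>J. (y $ j) ^ \<kappa> j)) * (y $ j) ^ l)"
    using prJ by (simp add: sum_distrib_right cong: prod.cong)
  qed
  also have "\<dots> = (\<Sum>(l, \<kappa>)\<in>{..<deg0 r Q j} \<times> PiE J (%j. {..<deg0 r Q j}). (c l \<kappa> (pI I y) * (\<Prod>j\<in>J. (y $ j) ^ \<kappa> j)) * (y $ j) ^ l)"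
   by (simp add: sum.cartesian_product)
  also have "\<dots> = (\<Sum>\<kappa>\<in>PiE (insert j J) (%j. {..<deg0 r Q j}). c' \<kappa> (pI I y) * (\<Prod>j\<in>insert j J. (y $ j) ^ \<kappa> j))"
   unfolding PiE_insert_eq
  proof (subst sum.reindex)
   show "inj_on (%(y, g). g(j := y)) ({..<deg0 r Q j} \<times> PiE J (%j. {..<deg0 r Q j}))" by (rule inj_combinator[OF insert.hyps(2)])
   show "(\<Sum>(l, \<kappa>)\<in>{..<deg0 r Q j} \<times> PiE J (%j. {..<deg0 r Q j}). (c l \<kappa> (pI I y) * (\<Prod>j\<in>J. (y $ j) ^ \<kappa> j)) * (y $ j) ^ l) =
    sum ((%\<kappa>. c' \<kappa> (pI I y) * (\<Prod>j\<in>insert j J. (y $ j) ^ \<kappa> j)) \<circ> (%(y, g). g(j := y))) ({..<deg0 r Q j} \<times> PiE J (%j. {..<deg0 r Q j}))"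
   proof (intro sum.cong refl, clarify)
    fix l \<kappa> assume k: "\<kappa> \<in> PiE J (%j. {..<deg0 r Q j})"
    have "\<kappa>(j := undefined) = \<kappa>" using k insert.hyps(2) by (auto simp: PiE_def extensional_def)
    then have c1: "c' (\<kappa>(j := l)) = c l \<kappa>" by (simp add: c'_def)
    have "(\<Prod>k\<in>insert j J. (y $ k) ^ (\<kappa>(j := l)) k) = (y $ j) ^ l * (\<Prod>k\<in>J. (y $ k) ^ \<kappa> k)"
    proof -
     have "(\<Prod>k\<in>J. (y $ k) ^ (\<kappa>(j := l)) k) = (\<Prod>k\<in>J. (y $ k) ^ \<kappa> k)"
      by (intro prod.cong refl) (use insert.hyps(2) in auto)
     then show ?thesis using insert.hyps by simp
    qed
    then show "(c l \<kappa> (pI I y) * (\<Prod>j\<in>J. (y $ j) ^ \<kappa> j)) * (y $ j) ^ l =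
     ((%\<kappa>. c' \<kappa> (pI I y) * (\<Prod>j\<in>insert j J. (y $ j) ^ \<kappa> j)) \<circ> (%(y, g). g(j := y))) (l, \<kappa>)"
     unfolding o_def case_prod_conv c1 by (simp add: mult_ac)
   qed
  qed
  finally show ?thesis .
 qed
 then show ?case using c(1) by (intro exI[of _ c']) (auto simp: c'_def)
qed

end

text \<open>The order of quantifiers matters: the monomials are fixed before \<open>D1\<close>,
  because \<open>module_membership\<close>, applied to the matrix built from them, shrinks the
  base.\<close>

lemma (in cover) monomials:
 "\<exists>q m. (\<forall>k<q::nat. hol UNIV UNIV (m k)) &
  (\<forall>D1. ropen V D1 & convex D1 & 0 \<in> D1 & D1 \<subseteq> D --> (\<forall>p. hol UNIV (Om I D1 r) p -->
   (\<exists>c. (\<forall>k<q. hol V D1 (c k)) & (\<forall>y\<in>X \<inter> Om I D1 r. p y = (\<Sum>k<q. c k (pI I y) * m k y)))))"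
proof -
 define PE where "PE = PiE (-I) (%j. {..<deg0 r Q j})"
 have "finite PE" unfolding PE_def by (intro finite_PiE) auto
 then obtain e where e: "bij_betw e {0..<card PE} PE" using ex_bij_betw_nat_finite by blast
 define m where "m k y = (\<Prod>j\<in>-I. (y $ j) ^ e k j)" for k and y :: "complex^'n"
 have mh: "hol UNIV UNIV (m k)" for k
  unfolding m_def[abs_def] by (intro hol_prod hol_power hol_component)
 have "\<exists>c. (\<forall>k<card PE. hol V D1 (c k)) & (\<forall>y\<in>X \<inter> Om I D1 r. p y = (\<Sum>k<card PE. c k (pI I y) * m k y))"
  if D1: "ropen V D1 & convex D1 & 0 \<in> D1 & D1 \<subseteq> D" and p: "hol UNIV (Om I D1 r) p" for D1 p
 proof -
  have T1: "tower X I D1 s r Q H {}" using tower_restrict[OF tow] D1 by blast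
  interpret C: cover X I D1 s r Q H by unfold_locales (rule T1)
  have O: "C.OmJ (-I) = Om I D1 r" by (auto simp: C.OmJ_def Om_def)
  obtain c where c: "\<forall>\<kappa>. hol V D1 (c \<kappa>)" "\<forall>y\<in>Om I D1 r. (\<forall>j\<in>-I. Q j (pI I y + (y $ j) *s ax j) = 0) -->
   p y = (\<Sum>\<kappa>\<in>PE. c \<kappa> (pI I y) * (\<Prod>j\<in>-I. (y $ j) ^ \<kappa> j))"
   using C.iterated_division[of "-I" p] p unfolding O PE_def by auto
  have "p y = (\<Sum>k<card PE. c (e k) (pI I y) * m k y)" if y: "y \<in> X \<inter> Om I D1 r" for y
  proof -
   have "p y = (\<Sum>\<kappa>\<in>PE. c \<kappa> (pI I y) * (\<Prod>j\<in>-I. (y $ j) ^ \<kappa> j))"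
    using c(2) y towerQ(6)[OF T1] by simp
   also have "\<dots> = (\<Sum>k\<in>{0..<card PE}. c (e k) (pI I y) * (\<Prod>j\<in>-I. (y $ j) ^ e k j))"
    by (rule sum.reindex_bij_betw[OF e, symmetric])
   finally show ?thesis by (simp add: m_def atLeast0LessThan)
  qed
  then show ?thesis using c(1) by (intro exI[of _ "%k. c (e k)"]) auto
 qed
 then show ?thesis using mh by (intro exI[of _ "card PE"] exI[of _ m]) blast
qed

lemma Ck_on_continuous: "Ck_on m g W ==> continuous_on W g"
 by (cases m) (auto intro!: continuous_at_imp_continuous_on differentiable_imp_continuous_within)

lemma Ck_on_variety_continuous:
 assumes "Ck_on_variety m \<phi> Y"
 shows "continuous_on Y \<phi>"
 unfolding continuous_on_iff
proof (intro ballI allI impI)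
 fix y0 and e :: real assume y0: "y0 \<in> Y" and e: "e > 0"
 obtain W g where W: "open W" "y0 \<in> W" "Ck_on m g W" "\<forall>z\<in>Y \<inter> W. \<phi> z = g z"
  using assms y0 unfolding Ck_on_variety_def by blast
 obtain d where d: "d > 0" "!!y. y \<in> W ==> dist y y0 < d ==> dist (g y) (g y0) < e"
  using Ck_on_continuous[OF W(3)] W(2) e unfolding continuous_on_iff by metis
 obtain d' where d': "d' > 0" "ball y0 d' \<subseteq> W" using W(1,2) open_contains_ball by blast
 have "dist (\<phi> y) (\<phi> y0) < e" if "y \<in> Y" "dist y y0 < min d d'" for y
 proof -
  have "y \<in> W" using that d'(2) by (auto simp: dist_commute)
  then show ?thesis using d(2) that W(2,4) y0 by auto
 qed
 then show "\<exists>d>0. \<forall>x'\<in>Y. dist x' y0 < d --> dist (\<phi> x') (\<phi> y0) < e"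
  using d(1) d'(1) by (intro exI[of _ "min d d'"]) auto
qed

lemma hol_translate: "hol UNIV UNIV f ==> hol UNIV UNIV (%y. f (y - a))"
 by (rule hol_compose_lin[where M = "%v. v"]) (auto intro!: continuous_intros simp: algebra_simps)

text \<open>At each point of the fibre a Taylor polynomial splits into a holomorphic part and mixed
  terms. One entire \<open>p\<close> interpolates the holomorphic parts to order
  \<open>K * N\<close>, which by the Hoelder bound is order \<open>N\<close> on the base.
  Multiplication by \<open>m\<close> keeps the mixed form, as it only changes the holomorphic
  factors \<open>A\<close>.\<close>

lemma (in cover) approx:
 assumes b: "b \<in> D"
  and K: "\<forall>y0\<in>fib b. \<exists>C d. d > 0 & (\<forall>y\<in>X \<inter> Om'. dist y y0 < d --> norm (y - y0) ^ K <= C * norm (pI I y - b))"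
  and \<phi>: "Ck_on_variety (K * N) \<phi> (X \<inter> Om')"
 shows "\<exists>p. hol UNIV UNIV p & (\<forall>m. hol UNIV UNIV m --> (\<forall>y0\<in>fib b. mixed (%y. (\<phi> y - p y) * m y) b N y0))"
proof -
 define P where "P = (%y0 p0 q A B C e. hol UNIV UNIV p0 & (\<forall>\<nu><q::nat. hol UNIV UNIV (A \<nu>) & hol UNIV UNIV (B \<nu>) & B \<nu> y0 = 0) & e > (0::real) &
  (\<forall>y\<in>X \<inter> Om'. dist y y0 < e --> cmod (\<phi> y - p0 y - (\<Sum>\<nu><q. A \<nu> y * cnj (B \<nu> y))) <= C * norm (y - y0) ^ (K * N)))"
 have "\<exists>p0 q A B C e. P y0 p0 q A B C e" if y0: "y0 \<in> fib b" for y0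
 proof -
  have "y0 \<in> X \<inter> Om'" using y0 by (simp add: fib_def)
  then obtain W g where W: "open W" "y0 \<in> W" "Ck_on (K * N) g W" "\<forall>z\<in>X \<inter> Om' \<inter> W. \<phi> z = g z"
   using \<phi> unfolding Ck_on_variety_def by blast
  obtain f e C where f: "hpoly f" "e > 0" "\<forall>h. norm h < e --> cmod (g (y0 + h) - f h) <= C * norm h ^ (K * N)"
   using taylor_hpoly[OF W(3,1,2)] by blast
  obtain p q A B where s: "hol UNIV UNIV p" "\<forall>\<nu><q::nat. hol UNIV UNIV (A \<nu>) & hol UNIV UNIV (B \<nu>) & B \<nu> 0 = 0"
   "f = (%h. p h + (\<Sum>\<nu><q. A \<nu> h * cnj (B \<nu> h)))"
   using hpoly_split[OF f(1)] by (elim exE conjE) (rule that, assumption+)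
  obtain d' where d': "d' > 0" "ball y0 d' \<subseteq> W" using W(1,2) open_contains_ball by blast
  have "cmod (\<phi> y - p (y - y0) - (\<Sum>\<nu><q. A \<nu> (y - y0) * cnj (B \<nu> (y - y0)))) <= C * norm (y - y0) ^ (K * N)"
   if y: "y \<in> X \<inter> Om'" "dist y y0 < min e d'" for y
  proof -
   have "y \<in> W" using y(2) d'(2) by (auto simp: dist_commute)
   then have "\<phi> y = g (y0 + (y - y0))" using W(4) y(1) by simp
   then show ?thesis using f(3)[rule_format, of "y - y0"] y(2) unfolding s(3) by (simp add: dist_norm diff_diff_eq)
  qed
  then have "P y0 (%y. p (y - y0)) q (%\<nu> y. A \<nu> (y - y0)) (%\<nu> y. B \<nu> (y - y0)) C (min e d')"
   unfolding P_def using hol_translate s(1,2) f(2) d'(1) by auto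
  then show ?thesis by blast
 qed
 then have "\<forall>y0. \<exists>p0 q A B C e. y0 \<in> fib b --> P y0 p0 q A B C e" by blast
 then obtain p0 q A B C e where PP: "!!y0. y0 \<in> fib b --> P y0 (p0 y0) (q y0) (A y0) (B y0) (C y0) (e y0)" by metis
 note ff = fib_finite[OF b]
 obtain w where w: "!!a. hol UNIV UNIV (w a)" "!!a V. a \<in> fib b ==> vo V (K * N) (%z. w a z - 1) a"
  "!!a c V. a \<in> fib b ==> c \<in> fib b ==> a ~= c ==> vo V (K * N) (w a) c"
  using interpolation[OF ff, of "K * N"] by metis
 define p where "p y = (\<Sum>a\<in>fib b. p0 a y * w a y)" for y
 have p0h: "a \<in> fib b ==> hol UNIV UNIV (p0 a)" for a using PP[of a] by (simp add: P_def)
 have ph: "hol UNIV UNIV p" unfolding p_def[abs_def] by (intro hol_sum hol_mult w p0h)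
 have "mixed (%y. (\<phi> y - p y) * m y) b N y0" if m: "hol UNIV UNIV m" and y0: "y0 \<in> fib b" for m y0
 proof -
  have Py: "\<forall>\<nu><q y0. hol UNIV UNIV (A y0 \<nu>) & hol UNIV UNIV (B y0 \<nu>) & B y0 \<nu> y0 = 0" "e y0 > 0"
   "!!y. y \<in> X \<inter> Om' ==> dist y y0 < e y0 ==> cmod (\<phi> y - p0 y0 y - (\<Sum>\<nu><q y0. A y0 \<nu> y * cnj (B y0 \<nu> y))) <= C y0 * norm (y - y0) ^ (K * N)"
   using PP[of y0] y0 unfolding P_def by blast+
  have c: "continuous_on UNIV (p0 a)" if "a \<in> fib b" for a by (rule hol_continuous[OF p0h[OF that]])
  have "vo UNIV (K * N) (%z. (- p0 y0 z) * (w y0 z - 1) + (\<Sum>a\<in>fib b - {y0}. (- p0 a z) * w a z)) y0"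
   by (intro vo_add vo_sum vo_mult[of UNIV _ _ _ UNIV] w continuous_intros c y0) (use y0 in auto)
  moreover have "(- p0 y0 z) * (w y0 z - 1) + (\<Sum>a\<in>fib b - {y0}. (- p0 a z) * w a z) = p0 y0 z - p z" for z
   unfolding p_def sum.remove[OF ff y0] by (simp add: sum_negf algebra_simps)
  ultimately have "vo UNIV (K * N) (%z. p0 y0 z - p z) y0" by simp
  then obtain C1 e1 where C1: "e1 > 0" "C1 >= 0" "!!z. dist z y0 < e1 ==> cmod (p0 y0 z - p z) <= C1 * norm (z - y0) ^ (K * N)"
   by (rule voE) blast
  obtain C2 d where C2: "d > 0" "\<forall>y\<in>X \<inter> Om'. dist y y0 < d --> norm (y - y0) ^ K <= C2 * norm (pI I y - b)" using K y0 by blast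
  obtain e2 where e2: "e2 > 0" "!!z. dist z y0 < e2 ==> norm (m z) <= norm (m y0) + 1"
   by (rule ropen_bounded_near[OF hol_continuous[OF m], of UNIV y0]) auto
  define e' where "e' = min (min (e y0) e1) (min d e2)"
  define C' where "C' = (\<bar>C y0\<bar> + C1) * \<bar>C2\<bar> ^ N * (norm (m y0) + 1)"
  show ?thesis
   unfolding mixed_def
  proof (rule exI[of _ e'], rule exI[of _ C'], rule exI[of _ "q y0"], rule exI[of _ "%\<nu> y. A y0 \<nu> y * m y"], rule exI[of _ "B y0"], intro conjI ballI impI)
   show "0 < e'" using Py(2) C1(1) C2(1) e2(1) by (simp add: e'_def)
   show "\<forall>\<nu><q y0. hol UNIV UNIV (%y. A y0 \<nu> y * m y) & hol UNIV UNIV (B y0 \<nu>) & B y0 \<nu> y0 = 0"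
    using Py(1) hol_mult m by blast
   fix y assume y: "y \<in> X \<inter> Om'" "dist y y0 < e'"
   let ?S = "\<Sum>\<nu><q y0. A y0 \<nu> y * cnj (B y0 \<nu> y)"
   have "norm (y - y0) ^ K <= \<bar>C2\<bar> * norm (pI I y - b)"
   proof -
    have "norm (y - y0) ^ K <= C2 * norm (pI I y - b)" using C2(2) y by (simp add: e'_def)
    also have "\<dots> <= \<bar>C2\<bar> * norm (pI I y - b)" by (intro mult_right_mono) auto
    finally show ?thesis .
   qed
   then have "(norm (y - y0) ^ K) ^ N <= (\<bar>C2\<bar> * norm (pI I y - b)) ^ N" by (intro power_mono) auto
   then have hK: "norm (y - y0) ^ (K * N) <= \<bar>C2\<bar> ^ N * norm (pI I y - b) ^ N" by (simp add: power_mult power_mult_distrib)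
   have "cmod (\<phi> y - p y - ?S) <= cmod (\<phi> y - p0 y0 y - ?S) + cmod (p0 y0 y - p y)"
    using norm_triangle_ineq[of "\<phi> y - p0 y0 y - ?S" "p0 y0 y - p y"] by (simp add: algebra_simps)
   also have "\<dots> <= \<bar>C y0\<bar> * norm (y - y0) ^ (K * N) + C1 * norm (y - y0) ^ (K * N)"
   proof (intro add_mono)
    have "cmod (\<phi> y - p0 y0 y - ?S) <= C y0 * norm (y - y0) ^ (K * N)" by (rule Py(3)[OF y(1)]) (use y(2) in \<open>simp add: e'_def\<close>)
    also have "\<dots> <= \<bar>C y0\<bar> * norm (y - y0) ^ (K * N)" by (intro mult_right_mono) auto
    finally show "cmod (\<phi> y - p0 y0 y - ?S) <= \<bar>C y0\<bar> * norm (y - y0) ^ (K * N)" .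
    show "cmod (p0 y0 y - p y) <= C1 * norm (y - y0) ^ (K * N)" by (rule C1(3)) (use y(2) in \<open>simp add: e'_def\<close>)
   qed
   also have "\<dots> = (\<bar>C y0\<bar> + C1) * norm (y - y0) ^ (K * N)" by (simp add: distrib_right)
   also have "\<dots> <= (\<bar>C y0\<bar> + C1) * (\<bar>C2\<bar> ^ N * norm (pI I y - b) ^ N)" using C1(2) by (intro mult_left_mono hK) auto
   finally have 1: "cmod (\<phi> y - p y - ?S) <= (\<bar>C y0\<bar> + C1) * (\<bar>C2\<bar> ^ N * norm (pI I y - b) ^ N)" .
   have "(\<phi> y - p y) * m y - (\<Sum>\<nu><q y0. A y0 \<nu> y * m y * cnj (B y0 \<nu> y)) = (\<phi> y - p y - ?S) * m y"
    unfolding left_diff_distrib sum_distrib_right by (simp add: mult_ac)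
   also have "cmod \<dots> <= ((\<bar>C y0\<bar> + C1) * (\<bar>C2\<bar> ^ N * norm (pI I y - b) ^ N)) * (norm (m y0) + 1)"
    unfolding norm_mult by (intro mult_mono 1 e2(2)) (use y(2) C1(2) in \<open>auto simp: e'_def\<close>)
   finally show "cmod ((\<phi> y - p y) * m y - (\<Sum>\<nu><q y0. A y0 \<nu> y * m y * cnj (B y0 \<nu> y))) <= C' * norm (pI I y - b) ^ N"
    by (simp add: C'_def mult_ac)
  qed
 qed
 then show ?thesis using ph by blast
qed

section \<open>The local theorem on a branched cover\<close>

lemma (in bcover) Tr_combination:
 assumes "x \<in> D"
 shows "Tr (%y. (\<phi> y - (\<Sum>j<q. u j (pI I y) * m j y)) * \<mu> y) x = Tr (%y. \<phi> y * \<mu> y) x - (\<Sum>j<q. u j x * Tr (%y. m j y * \<mu> y) x)"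
proof -
 have "Tr (%y. (\<phi> y - (\<Sum>j<q. u j (pI I y) * m j y)) * \<mu> y) x = (\<Sum>y\<in>fib x. \<phi> y * \<mu> y - (\<Sum>j<q. u j x * (m j y * \<mu> y)))"
  unfolding Tr_def by (intro sum.cong refl) (auto simp: fib_def left_diff_distrib sum_distrib_right mult.assoc)
 also have "\<dots> = (\<Sum>y\<in>fib x. \<phi> y * \<mu> y) - (\<Sum>j<q. \<Sum>y\<in>fib x. u j x * (m j y * \<mu> y))"
  unfolding sum_subtractf by (subst sum.swap) (rule refl)
 finally show ?thesis by (simp add: Tr_def sum_distrib_left)
qed

text \<open>\<open>G\<close> is the matrix of the trace form on the monomials and \<open>g\<close>
  the vector of traces of \<phi> against them. A solution \<open>u\<close> makes
  \<open>\<phi> - f\<close> orthogonal to all monomials; these span the functions on every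
  unbranched fibre, whence \<open>\<phi> = f\<close> there, and everywhere by density and
  continuity.\<close>

lemma (in pcover) local_theorem:
 "\<exists>m D1. ropen V D1 & convex D1 & 0 \<in> D1 & D1 \<subseteq> D &
  (\<forall>\<phi>. bcover.wh X I D1 r \<phi> & Ck_on_variety m \<phi> (X \<inter> Om I D1 r) -->
   (\<exists>f. hol UNIV (Om I D1 r) f & (\<forall>y\<in>X \<inter> Om I D1 r. \<phi> y = f y)))"
proof -
 obtain q m where m: "\<forall>k<q::nat. hol UNIV UNIV (m k)"
  and span: "\<forall>D1. ropen V D1 & convex D1 & 0 \<in> D1 & D1 \<subseteq> D --> (\<forall>p. hol UNIV (Om I D1 r) p -->
   (\<exists>c. (\<forall>k<q. hol V D1 (c k)) & (\<forall>y\<in>X \<inter> Om I D1 r. p y = (\<Sum>k<q. c k (pI I y) * m k y))))"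
  using monomials by (elim exE conjE) (rule that, assumption+)
 define G where "G j c = TX (%y. m j y * m c y)" for j c
 have Gt: "hol V D (G j c)" "x \<in> D ==> \<delta> x ~= 0 ==> G j c x = Tr (%y. m j y * m c y) x" if "j < q" "c < q" for j c x
 proof -
  have h: "hol UNIV UNIV (%y. m j y * m c y)" using that m by (intro hol_mult) auto
  have c: "continuous_on (X \<inter> Om') (%y. m j y * m c y)" using hol_continuous[OF h] by (rule continuous_on_subset) simp
  show "hol V D (G j c)" "x \<in> D ==> \<delta> x ~= 0 ==> G j c x = Tr (%y. m j y * m c y) x"
   unfolding G_def using TX[OF wh_hol[OF hol_subset[OF h]] c] by auto
 qed
 have "\<exists>N D1. ropen V D1 & convex D1 & 0 \<in> D1 & D1 \<subseteq> D &
  (\<forall>g. (\<forall>c\<in>{..<q}. hol V D1 (g c)) &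
   (\<forall>b\<in>D1. \<exists>u. (\<forall>j\<in>{..<q}. hol V D1 (u j)) & (\<forall>c\<in>{..<q}. vo V N (%z. g c z - (\<Sum>j\<in>{..<q}. u j z * G j c z)) b)) -->
   (\<exists>u. (\<forall>j\<in>{..<q}. hol V D1 (u j)) & (\<forall>c\<in>{..<q}. \<forall>z\<in>D1. g c z = (\<Sum>j\<in>{..<q}. u j z * G j c z))))"
  by (rule module_membership[OF EI_subspace D(1,3) finite_lessThan finite_lessThan]) (use Gt(1) in auto)
 then obtain N D1 where D1: "ropen V D1" "convex D1" "0 \<in> D1" "D1 \<subseteq> D" and mem:
  "\<forall>g. (\<forall>c\<in>{..<q}. hol V D1 (g c)) &
   (\<forall>b\<in>D1. \<exists>u. (\<forall>j\<in>{..<q}. hol V D1 (u j)) & (\<forall>c\<in>{..<q}. vo V N (%z. g c z - (\<Sum>j\<in>{..<q}. u j z * G j c z)) b)) -->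
   (\<exists>u. (\<forall>j\<in>{..<q}. hol V D1 (u j)) & (\<forall>c\<in>{..<q}. \<forall>z\<in>D1. g c z = (\<Sum>j\<in>{..<q}. u j z * G j c z)))"
  by (elim exE conjE) (rule that, assumption+)
 \<comment> \<open>The setting is rebuilt over the smaller base; the fibres over \<open>D1\<close>,
   and with them the traces, are unchanged.\<close>
 interpret C: pcover X I D1 s r Q H \<delta> M by (rule pcover_restrict[OF D1])
 have fibeq: "C.fib x = fib x" if "x \<in> D1" for x using that D1(4) by (auto simp: fib_def C.fib_def Om_def)
 have GC: "G j c x = C.Tr (%y. m j y * m c y) x" if "j < q" "c < q" "x \<in> D1" "\<delta> x ~= 0" for j c x
  using Gt(2)[OF that(1,2)] that(3,4) D1(4) fibeq[OF that(3)] by (auto simp: Tr_def C.Tr_def)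
 obtain K where K: "\<forall>b\<in>D1. \<forall>y0\<in>C.fib b. \<exists>C d. d > 0 & (\<forall>y\<in>X \<inter> C.Om'. dist y y0 < d --> norm (y - y0) ^ K <= C * norm (pI I y - b))"
  using C.fib_hoelder by blast
 have span1: "\<exists>c. (\<forall>k<q. hol V D1 (c k)) & (\<forall>y\<in>X \<inter> C.Om'. p y = (\<Sum>k<q. c k (pI I y) * m k y))"
  if "hol UNIV C.Om' p" for p
  using span D1 that by blast
 have main: "\<exists>f. hol UNIV C.Om' f & (\<forall>y\<in>X \<inter> C.Om'. \<phi> y = f y)"
  if w: "C.wh \<phi>" and ck: "Ck_on_variety (K * N) \<phi> (X \<inter> C.Om')" for \<phi>
 proof -
  have \<phi>c: "continuous_on (X \<inter> C.Om') \<phi>" by (rule Ck_on_variety_continuous[OF ck])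
  have mc: "continuous_on A (m c)" if "c < q" for A c
  proof -
   have "hol UNIV UNIV (m c)" using m that by blast
   then show ?thesis using continuous_on_subset[OF hol_continuous] by blast
  qed
  define g where "g c = C.TX (%y. \<phi> y * m c y)" for c
  have gt: "hol V D1 (g c)" "x \<in> D1 ==> \<delta> x ~= 0 ==> g c x = C.Tr (%y. \<phi> y * m c y) x" if c: "c < q" for c x
  proof -
   have "hol UNIV UNIV (m c)" using m c by blast
   then have 1: "C.wh (%y. \<phi> y * m c y)" by (intro C.wh_mult[OF w] C.wh_hol) (rule hol_subset[OF _ subset_UNIV])
   have 2: "continuous_on (X \<inter> C.Om') (%y. \<phi> y * m c y)" by (intro continuous_intros \<phi>c mc[OF c])
   show "hol V D1 (g c)" "x \<in> D1 ==> \<delta> x ~= 0 ==> g c x = C.Tr (%y. \<phi> y * m c y) x"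
    unfolding g_def using C.TX[OF 1 2] by auto
  qed
  have "\<exists>u. (\<forall>j\<in>{..<q}. hol V D1 (u j)) & (\<forall>c\<in>{..<q}. vo V N (%z. g c z - (\<Sum>j\<in>{..<q}. u j z * G j c z)) b)" if b: "b \<in> D1" for b
  proof -
   obtain p where p: "hol UNIV UNIV p" "\<forall>m. hol UNIV UNIV m --> (\<forall>y0\<in>C.fib b. C.mixed (%y. (\<phi> y - p y) * m y) b N y0)"
    using C.approx[OF b bspec[OF K b] ck] by blast
   obtain u where u: "\<forall>k<q. hol V D1 (u k)" "\<forall>y\<in>X \<inter> C.Om'. p y = (\<Sum>k<q. u k (pI I y) * m k y)"
    using span1[OF hol_subset[OF p(1)]] by blast
   have "vo V N (%z. g c z - (\<Sum>j\<in>{..<q}. u j z * G j c z)) b" if c: "c < q" for c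
   proof (rule C.order_trace[where \<xi> = "%y. (\<phi> y - p y) * m c y", OF _ _ b])
    show "hol V D1 (%z. g c z - (\<Sum>j\<in>{..<q}. u j z * G j c z))"
     by (intro hol_diff hol_sum hol_mult gt(1)[OF c] hol_subset[OF Gt(1)[OF _ c] D1(4)]) (use u(1) in auto)
    fix x assume x: "x \<in> D1" "\<delta> x ~= 0"
    have "C.Tr (%y. (\<phi> y - p y) * m c y) x = C.Tr (%y. (\<phi> y - (\<Sum>j<q. u j (pI I y) * m j y)) * m c y) x"
     unfolding C.Tr_def by (intro sum.cong refl) (use u(2) in \<open>simp add: C.fib_def\<close>)
    then show "g c x - (\<Sum>j\<in>{..<q}. u j x * G j c x) = C.Tr (%y. (\<phi> y - p y) * m c y) x"
     unfolding C.Tr_combination[OF x(1)] using gt(2)[OF c x] GC[OF _ c x] by simp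
   next
    show "C.mixed (%y. (\<phi> y - p y) * m c y) b N y0" if "y0 \<in> C.fib b" for y0 using p(2) m c that by blast
   qed
   then show ?thesis using u(1) by (intro exI[of _ u]) auto
  qed
  then have "(\<forall>c\<in>{..<q}. hol V D1 (g c)) &
   (\<forall>b\<in>D1. \<exists>u. (\<forall>j\<in>{..<q}. hol V D1 (u j)) & (\<forall>c\<in>{..<q}. vo V N (%z. g c z - (\<Sum>j\<in>{..<q}. u j z * G j c z)) b))"
   using gt(1) by simp
  from mem[rule_format, OF this]
  obtain u where u: "\<forall>j\<in>{..<q}. hol V D1 (u j)" "\<forall>c\<in>{..<q}. \<forall>z\<in>D1. g c z = (\<Sum>j\<in>{..<q}. u j z * G j c z)"
   by (elim exE conjE) (rule that)
  define f where "f y = (\<Sum>j<q. u j (pI I y) * m j y)" for y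
  have fh: "hol UNIV C.Om' f"
   unfolding f_def[abs_def]
  proof (intro hol_sum hol_mult)
   fix j assume j: "j \<in> {..<q}"
   show "hol UNIV C.Om' (%y. u j (pI I y))" by (rule C.hol_pI) (use u(1) j in auto)
   show "hol UNIV C.Om' (m j)" by (rule hol_subset[OF _ subset_UNIV]) (use m j in auto)
  qed
  have eq0: "\<phi> y = f y" if y: "y \<in> X \<inter> C.Om'" "\<delta> (pI I y) ~= 0" for y
  proof -
   define x where "x = pI I y"
   have x: "x \<in> D1" "\<delta> x ~= 0" using y C.pI_D by (auto simp: x_def)
   have yf: "y \<in> C.fib x" using y by (simp add: C.fib_def x_def)
   have ff: "finite (C.fib x)" by (rule C.fib_finite[OF x(1)])
   have Tz: "C.Tr (%y. (\<phi> y - f y) * m c y) x = 0" if c: "c < q" for c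
    unfolding f_def C.Tr_combination[OF x(1)] using gt(2)[OF c x] GC[OF _ c x] u(2) c x(1) by simp
   \<comment> \<open>A function that is 1 at \<open>y\<close> and 0 at the other points of the
     fibre. On the fibre it is a linear combination of the monomials, so the orthogonality isolates
     the value at \<open>y\<close>.\<close>
   obtain e where e: "!!a. hol UNIV UNIV (e a)" "!!a V. a \<in> C.fib x ==> vo V 1 (%z. e a z - 1) a"
    "!!a c V. a \<in> C.fib x ==> c \<in> C.fib x ==> a ~= c ==> vo V 1 (e a) c"
    using interpolation[OF ff, of 1] by metis
   have e1: "e y y = 1" using vo_zero_at[OF e(2)[OF yf, of UNIV]] by simp
   have e0: "e y z = 0" if "z \<in> C.fib x" "z ~= y" for z using vo_zero_at[OF e(3)[OF yf that(1), of UNIV]] that(2) by simp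
   obtain c where c: "\<forall>y'\<in>X \<inter> C.Om'. e y y' = (\<Sum>k<q. c k (pI I y') * m k y')" using span1[OF hol_subset[OF e(1)]] by blast
   have "\<phi> y - f y = (\<Sum>z\<in>C.fib x. (\<phi> z - f z) * e y z)"
    unfolding sum.remove[OF ff yf] using e0 e1 by (simp add: sum.neutral)
   also have "\<dots> = (\<Sum>z\<in>C.fib x. \<Sum>k<q. c k x * ((\<phi> z - f z) * m k z))"
    by (intro sum.cong refl) (use c in \<open>auto simp: C.fib_def sum_distrib_left mult_ac\<close>)
   also have "\<dots> = (\<Sum>k<q. c k x * C.Tr (%y. (\<phi> y - f y) * m k y) x)"
    by (subst sum.swap) (simp add: C.Tr_def sum_distrib_left)
   also have "\<dots> = 0" using Tz by simp
   finally show ?thesis by simp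
  qed
  have "\<phi> y = f y" if y: "y \<in> X \<inter> C.Om'" for y
  proof (rule ccontr)
   assume ne: "\<phi> y ~= f y"
   have "continuous_on (X \<inter> C.Om') (%y. \<phi> y - f y)"
    by (intro continuous_intros \<phi>c continuous_on_subset[OF hol_continuous[OF fh]]) auto
   then obtain d where d: "d > 0" "!!y'. y' \<in> X \<inter> C.Om' ==> dist y' y < d ==> dist (\<phi> y' - f y') (\<phi> y - f y) < cmod (\<phi> y - f y)"
    unfolding continuous_on_iff using y ne by (metis eq_iff_diff_eq_0 zero_less_norm_iff)
   obtain y' where y': "y' \<in> X \<inter> C.Om' \<inter> ball y d" "\<delta> (pI I y') ~= 0"
    using C.dense[OF y, of "ball y d"] d(1) by auto
   then have "\<phi> y' = f y'" using eq0 by blast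
   then show False using d(2)[of y'] y'(1) by (simp add: dist_norm norm_minus_commute dist_commute)
  qed
  then show ?thesis using fh by blast
 qed
 then show ?thesis using D1 by (intro exI[of _ "K * N"] exI[of _ D1]) blast
qed

section \<open>Charts of the regular part\<close>

lemma ciso_affine:
 assumes "ciso A B"
 shows "open S ==> open ((%y. a + A y) -` S)" "open S ==> open ((%y. a + A y) ` S)"
  "a + A (B (z - a)) = z" "B ((a + A y) - a) = y" "z \<in> (%y. a + A y) ` S \<longleftrightarrow> B (z - a) \<in> S"
proof -
 have AB: "A (B x) = x" "B (A x) = x" for x using assms by (auto simp: ciso_def)
 show "open S ==> open ((%y. a + A y) -` S)"
  by (rule open_vimage, assumption) (intro continuous_intros ciso_continuous[OF assms])
 show 1: "a + A (B (z - a)) = z" and 2: "B ((a + A y) - a) = y" for z y using AB by simp_all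
 show 3: "z \<in> (%y. a + A y) ` S \<longleftrightarrow> B (z - a) \<in> S" for z
 proof
  assume "B (z - a) \<in> S"
  then show "z \<in> (%y. a + A y) ` S" by (rule rev_image_eqI) (simp add: AB)
 qed (auto simp: AB)
 have "(%y. a + A y) ` S = (%z. B (z - a)) -` S" using 3 by blast
 moreover have "continuous_on UNIV (%z. B (z - a))"
  by (rule continuous_on_compose2[OF ciso_continuous[OF ciso_sym[OF assms], of UNIV]]) (auto intro!: continuous_intros)
 ultimately show "open S ==> open ((%y. a + A y) ` S)" by (simp add: open_vimage)
qed

lemma ciso_pullback:
 assumes AB: "ciso A B" and f: "hol UNIV T f" and W: "!!z. z \<in> W ==> B (z - a) \<in> T"
 shows "hol UNIV W (%z. f (B (z - a)))"
proof (rule hol_compose_lin[OF f, where M = B])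
 show "continuous_on W (%z. B (z - a))"
  by (rule continuous_on_compose2[OF ciso_continuous[OF ciso_sym[OF AB], of UNIV]]) (auto intro!: continuous_intros)
 show "B v \<in> UNIV & B (z + t *s v - a) = B (z - a) + t *s B v" for z v t
 proof -
  have e: "z + t *s v - a = (z - a) + t *s v" by simp
  show ?thesis unfolding e using AB by (simp add: ciso_def)
 qed
qed (use W in auto)

lemma holo_on_components_continuous:
 assumes "\<forall>i. holo_on (%z. f z $ i) S"
 shows "continuous_on S f"
proof (rule holE_imp_continuous)
 fix k
 have "\<exists>L. ((%z. f z $ k) has_derivative L) (at z within S)" if "z \<in> S" for z
  using assms that unfolding holo_on_def by blast
 then show "continuous_on S (%x. f x $ k)"
  unfolding continuous_on_eq_continuous_within using has_derivative_continuous by blast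
qed

text \<open>The inverse chart restricted to its coordinate slice parametrises a piece of
  \<open>Z\<close>; the affine coordinates \<open>a + A y\<close> transport it to the form that
  \<open>thin\<close> and \<open>pure\<close> speak of.\<close>

lemma chart_piece:
 fixes Z :: "(complex^'n) set"
 assumes ch: "submanifold_chart Z W \<Phi> J" and z: "z \<in> Z" "z \<in> W" and \<Omega>: "open \<Omega>" "z \<in> \<Omega>" and AB: "ciso A B"
 shows "\<exists>S j. ropen (EI (- J)) S & S ~= {} & continuous_on S j & inj_on j S & j ` S \<subseteq> {y. a + A y \<in> Z & a + A y \<in> \<Omega>}"
proof -
 have bi: "open W" "open (\<Phi> ` W)" "inj_on \<Phi> W" "\<forall>i. holo_on (%w. inv_into W \<Phi> w $ i) (\<Phi> ` W)"
  and ZW: "\<Phi> ` (Z \<inter> W) = {w \<in> \<Phi> ` W. \<forall>i\<in>J. w $ i = 0}"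
  using ch unfolding submanifold_chart_def biholomorphic_on_def by auto
 have ic: "continuous_on (\<Phi> ` W) (inv_into W \<Phi>)" by (rule holo_on_components_continuous[OF bi(4)])
 define S where "S = EI (-J) \<inter> (\<Phi> ` W \<inter> inv_into W \<Phi> -` \<Omega>)"
 define j where "j w = B (inv_into W \<Phi> w - a)" for w
 have "open (\<Phi> ` W \<inter> inv_into W \<Phi> -` \<Omega>)" by (rule continuous_open_preimage[OF ic bi(2) \<Omega>(1)])
 then have "ropen (EI (-J)) S" unfolding S_def by (rule openin_open_Int)
 moreover have "\<Phi> z \<in> S"
 proof -
  have "\<Phi> z \<in> {w \<in> \<Phi> ` W. \<forall>i\<in>J. w $ i = 0}" unfolding ZW[symmetric] using z by blast
  then show ?thesis using z \<Omega> inv_into_f_f[OF bi(3) z(2)] by (simp add: S_def EI_def)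
 qed
 moreover have "continuous_on S j"
  unfolding j_def
  by (rule continuous_on_compose2[OF ciso_continuous[OF ciso_sym[OF AB], of UNIV]])
   (auto intro!: continuous_intros continuous_on_subset[OF ic] simp: S_def)
 moreover have "inj_on j S"
 proof (rule inj_onI)
  fix w w' assume w: "w \<in> S" "w' \<in> S" "j w = j w'"
  then have "a + A (j w) = a + A (j w')" by simp
  then have "inv_into W \<Phi> w = inv_into W \<Phi> w'" unfolding j_def ciso_affine(3)[OF AB] .
  then show "w = w'" using w(1,2) inv_into_injective by (fastforce simp: S_def)
 qed
 moreover have "j ` S \<subseteq> {y. a + A y \<in> Z & a + A y \<in> \<Omega>}"
 proof
  fix y assume "y \<in> j ` S"
  then obtain w where w: "w \<in> S" "y = j w" by blast
  have e: "a + A y = inv_into W \<Phi> w" unfolding w(2) j_def ciso_affine(3)[OF AB] ..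
  have "w \<in> \<Phi> ` (Z \<inter> W)" unfolding ZW using w(1) by (auto simp: S_def EI_def)
  then obtain x where x: "x \<in> Z" "x \<in> W" "w = \<Phi> x" by blast
  have "inv_into W \<Phi> w = x" unfolding x(3) by (rule inv_into_f_f[OF bi(3) x(2)])
  then show "y \<in> {y. a + A y \<in> Z & a + A y \<in> \<Omega>}" using x w(1) e by (auto simp: S_def)
 qed
 ultimately show ?thesis by blast
qed

lemma codim_piece:
 fixes Z :: "(complex^'n) set"
 assumes cl: "z \<in> closure (regular_part_codim Z p)" and \<Omega>: "open \<Omega>" "z \<in> \<Omega>" and AB: "ciso A B"
 shows "\<exists>T S j. subspace T & dim T = 2 * (CARD('n) - p) & ropen T S & S ~= {} & continuous_on S j & inj_on j S &
  (j :: complex^'n => complex^'n) ` S \<subseteq> {y. a + A y \<in> Z & a + A y \<in> \<Omega>}"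
proof -
 obtain z' where z': "z' \<in> regular_part_codim Z p" "z' \<in> \<Omega>"
  using cl \<Omega> unfolding closure_iff_nhds_not_empty by blast
 then obtain W \<Phi> J where ch: "submanifold_chart Z W \<Phi> J" "z' \<in> Z" "z' \<in> W" "card J = p"
  unfolding regular_part_codim_def by blast
 obtain S j where "ropen (EI (- J)) S" "S ~= {}" "continuous_on S j" "inj_on j S" "j ` S \<subseteq> {y. a + A y \<in> Z & a + A y \<in> \<Omega>}"
  using chart_piece[OF ch(1-3) \<Omega>(1) z'(2) AB] by blast
 moreover have "dim (EI (- J)) = 2 * (CARD('n) - p)"
  unfolding dim_EI using ch(4) by (simp add: Compl_eq_Diff_UNIV card_Diff_subset)
 ultimately show ?thesis using csubspace_subspace[OF EI_subspace] by blast
qed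

text \<open>If every sheet left \<open>X\<close> somewhere, the product over the sheets of one
  violated equation each would be holomorphic and not identically zero; but over every point of
  \<open>B\<close> some sheet meets \<open>X\<close>, which makes the product vanish. This comes
  before purity: it helps to identify the dimension of the base.\<close>

lemma (in cover) full_sheet:
 assumes U: "open U" "0 \<in> U"
 shows "\<exists>x0 B L \<sigma> \<eta> l. sheets x0 B L \<sigma> \<eta> & l \<in> L & (\<forall>x\<in>B. \<sigma> l x \<in> X) & \<sigma> l x0 \<in> U"
proof (rule branching)
 fix \<delta> M
 assume \<delta>: "hol V D \<delta>" "\<exists>x\<in>D. \<delta> x ~= 0"
   "!!x0. x0 \<in> D ==> \<delta> x0 ~= 0 ==> \<exists>B L \<sigma> \<eta>. sheets x0 B L \<sigma> \<eta> & card L <= M"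
 obtain x1 where x1: "x1 \<in> D" "\<delta> x1 ~= 0" using \<delta>(2) by blast
 obtain e where e: "e > 0" "ball 0 e \<subseteq> U" using U open_contains_ball by blast
 obtain d where d: "d > 0" "!!y. y \<in> X \<inter> Om' ==> norm (pI I y) < d ==> norm y < e" using X_small[OF e(1)] by metis
 obtain x0 where x0: "x0 \<in> D" "dist x0 0 < d" "\<delta> x0 ~= 0"
  by (rule hol_nonzero_dense[OF EI_subspace D(1,2) \<delta>(1) x1 D(3) d(1)])
 obtain B L \<sigma> \<eta> where sh: "sheets x0 B L \<sigma> \<eta>" using \<delta>(3)[OF x0(1,3)] by blast
 have "\<exists>l\<in>L. \<forall>x\<in>B. \<sigma> l x \<in> X"
 proof (rule ccontr)
  assume neg: "~ ?thesis"
  have "\<exists>h x. h \<in> H & x \<in> B & h (\<sigma> l x) ~= 0" if l: "l \<in> L" for l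
  proof -
   obtain x where x: "x \<in> B" "\<sigma> l x \<notin> X" using neg l by blast
   then have "\<sigma> l x \<notin> X \<inter> Om'" "\<sigma> l x \<in> Om'" using sheetsD(9)[OF sh l x(1)] by auto
   then show ?thesis using x(1) unfolding XH by blast
  qed
  then obtain h x where hx: "!!l. l \<in> L ==> h l \<in> H & x l \<in> B & h l (\<sigma> l (x l)) ~= 0" by metis
  have "\<exists>z\<in>B. (\<Prod>l\<in>L. h l (\<sigma> l z)) ~= 0"
  proof (rule hol_prod_nonzero[OF EI_subspace sheetsD(1,2)[OF sh] _ sheetsD(5)[OF sh]])
   show "B ~= {}" using sheetsD(3)[OF sh] by blast
   fix l assume l: "l \<in> L"
   show "\<exists>z\<in>B. h l (\<sigma> l z) ~= 0" using hx[OF l] by blast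
   show "hol V B (%x. h l (\<sigma> l x))"
    by (rule hol_compose_map[OF EI_subspace sheetsD(1)[OF sh] Om_open Hh sheetsD(7)[OF sh l] sheetsD(9)[OF sh l]])
     (use hx[OF l] in auto)
  qed
  then obtain z where z: "z \<in> B" "(\<Prod>l\<in>L. h l (\<sigma> l z)) ~= 0" by blast
  have "z \<in> pI I ` (X \<inter> Om')" unfolding XD using z(1) sheetsD(4)[OF sh] by blast
  then obtain y where y: "y \<in> X \<inter> Om'" "pI I y = z" by blast
  then obtain l where l: "l \<in> L" "y = \<sigma> l z" using sheetsD(12)[OF sh] z(1) by blast
  have "h l y = 0" using y(1) hx[OF l(1)] unfolding XH by blast
  then show False using z(2) l sheetsD(5)[OF sh] by (auto simp: prod_zero_iff)
 qed
 then obtain l where l: "l \<in> L" "\<forall>x\<in>B. \<sigma> l x \<in> X" by blast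
 note b0 = sheetsD(3)[OF sh]
 have "norm (\<sigma> l x0) < e" by (rule d(2)) (use l b0 sheetsD(8,9)[OF sh l(1) b0] x0(2) in auto)
 then show ?thesis using sh l e(2) by (intro exI conjI) (assumption+, auto)
qed

text \<open>A sheet lying on \<open>X\<close> is a graph over \<open>B\<close>, and
  \<open>\<Psi>\<close> straightens it by replacing the fibre coordinates of \<open>y\<close> by its
  offset from the sheet. Since \<open>\<Phi>\<close> maps \<open>Z \<inter> W\<close> exactly onto
  \<open>B\<close>, holomorphy in this chart is holomorphy along the sheet.\<close>

lemma (in cover) graph_chart:
 assumes AB: "ciso A A'" and XZ: "X = {y. a + A y \<in> Z}"
  and sh: "sheets x0 B L \<sigma> \<eta>" and l: "l \<in> L" and full: "!!x. x \<in> B ==> \<sigma> l x \<in> X"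
  and \<Omega>: "open \<Omega>" "!!x. x \<in> B ==> a + A (\<sigma> l x) \<in> \<Omega>"
 shows "\<exists>W \<Phi>. submanifold_chart Z W \<Phi> (- I) & W \<subseteq> \<Omega> & \<Phi> ` (Z \<inter> W) = B &
  (\<forall>x\<in>B. inv_into W \<Phi> x = a + A (\<sigma> l x) & a + A (\<sigma> l x) \<in> Z \<inter> W)"
proof -
 obtain O1 where O: "open O1" "B = V \<inter> O1" using sheetsD(1)[OF sh] unfolding openin_open by auto
 define T where "T = pI I -` O1"
 have T: "open T" "pI I y \<in> B \<longleftrightarrow> y \<in> T" for y
  unfolding T_def using O by (auto intro!: open_vimage continuous_pI continuous_on_id)
 define s where "s y = \<sigma> l (pI I y)" for y
 have ps: "pI I (s y) = pI I y" if "y \<in> T" for y unfolding s_def by (rule sheetsD(8)[OF sh l]) (use that T in auto)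
 have sh': "hol UNIV T (%y. s y $ k)" for k
  unfolding s_def
  by (rule hol_compose_lin[OF sheetsD(7)[OF sh l], where M = "pI I"]) (use T(2) in \<open>auto intro!: continuous_intros simp: pI_line\<close>)
 have sc: "continuous_on T s" by (rule holE_imp_continuous) (rule hol_continuous[OF sh'])
 \<comment> \<open>The ball of radius \<eta> keeps the other sheets out of the chart, so that the
   variety is exactly one graph there.\<close>
 define W' where "W' = (Om' \<inter> T \<inter> ball (\<sigma> l x0) \<eta>) \<inter> (%y. a + A y) -` \<Omega>"
 have W'o: "open W'" unfolding W'_def by (intro open_Int Om_open T open_ball ciso_affine(1)[OF AB] \<Omega>)
 have W'T: "W' \<subseteq> T" by (auto simp: W'_def)
 define \<Psi> where "\<Psi> y = y - (s y - pI I y)" for y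
 define \<Psi>' where "\<Psi>' y = y + (s y - pI I y)" for y
 have p\<Psi>: "pI I (\<Psi> y) = pI I y" "pI I (\<Psi>' y) = pI I y" if y: "y \<in> T" for y
 proof -
  have "s y $ i = y $ i" if "i \<in> I" for i using arg_cong[OF ps[OF y], of "%v. v $ i"] that by simp
  then show "pI I (\<Psi> y) = pI I y" "pI I (\<Psi>' y) = pI I y" by (auto simp: \<Psi>_def \<Psi>'_def vec_eq_iff)
 qed
 have sp: "s (\<Psi> y) = s y" "s (\<Psi>' y) = s y" if "y \<in> T" for y using p\<Psi>[OF that] by (auto simp: s_def)
 have inv: "\<Psi>' (\<Psi> y) = y" "\<Psi> (\<Psi>' y) = y" if "y \<in> T" for y
  using sp[OF that] p\<Psi>[OF that] by (simp_all add: \<Psi>'_def[of "\<Psi> y"] \<Psi>_def[of "\<Psi>' y"]) (simp_all add: \<Psi>_def \<Psi>'_def)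
 have T\<Psi>: "\<Psi> y \<in> T" "\<Psi>' y \<in> T" if "y \<in> T" for y using that p\<Psi>[OF that] T(2) by metis+
 define R where "R = T \<inter> \<Psi>' -` W'"
 have "continuous_on T \<Psi>'" unfolding \<Psi>'_def by (intro continuous_intros sc)
 then have Ro: "open R" unfolding R_def by (rule continuous_open_preimage[OF _ T(1) W'o])
 have Rimg: "\<Psi> ` W' = R"
 proof (intro set_eqI iffI)
  fix w assume w: "w \<in> R"
  then have "w = \<Psi> (\<Psi>' w)" "\<Psi>' w \<in> W'" using inv(2)[of w] by (auto simp: R_def)
  then show "w \<in> \<Psi> ` W'" by blast
 qed (use W'T T\<Psi> inv in \<open>auto simp: R_def\<close>)
 define W where "W = (%y. a + A y) ` W'"
 define \<Phi> where "\<Phi> z = \<Psi> (A' (z - a))" for z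
 have Wi: "z \<in> W \<longleftrightarrow> A' (z - a) \<in> W'" for z unfolding W_def by (rule ciso_affine(5)[OF AB])
 have \<Phi>A: "\<Phi> (a + A y) = \<Psi> y" for y unfolding \<Phi>_def ciso_affine(4)[OF AB] ..
 have \<Phi>W: "\<Phi> ` W = R" unfolding W_def image_image \<Phi>A Rimg ..
 have inj: "inj_on \<Phi> W"
 proof (rule inj_onI)
  fix z z' assume z: "z \<in> W" "z' \<in> W" "\<Phi> z = \<Phi> z'"
  have "A' (z - a) \<in> T" "A' (z' - a) \<in> T" using z Wi W'T by auto
  then have "A' (z - a) = A' (z' - a)" using z(3) inv(1) unfolding \<Phi>_def by metis
  then show "z = z'" using ciso_affine(3)[OF AB, of a] by metis
 qed
 have inv_eq: "inv_into W \<Phi> w = a + A (\<Psi>' w)" if w: "w \<in> R" for w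
 proof (rule inv_into_f_eq[OF inj])
  show "a + A (\<Psi>' w) \<in> W" using w by (auto simp: W_def R_def)
  show "\<Phi> (a + A (\<Psi>' w)) = w" unfolding \<Phi>A using inv(2) w by (auto simp: R_def)
 qed
 have bih: "biholomorphic_on \<Phi> W"
  unfolding biholomorphic_on_def \<Phi>W
 proof (intro conjI allI)
  show Wo: "open W" unfolding W_def by (rule ciso_affine(2)[OF AB W'o])
  show "open R" "inj_on \<Phi> W" by fact+
  fix i
  have "hol UNIV T (%y. \<Psi> y $ i)"
   unfolding \<Psi>_def vector_minus_component
   by (intro hol_diff hol_component sh' hol_compose_lin[OF hol_component[of UNIV UNIV i], where L = "pI I" and M = "pI I"])
    (auto intro!: continuous_intros simp: pI_line)
  then have "hol UNIV W (%z. \<Psi> (A' (z - a)) $ i)"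
   by (rule ciso_pullback[OF AB]) (use Wi W'T in blast)
  then show "holo_on (%z. \<Phi> z $ i) W" unfolding \<Phi>_def by (rule hol_imp_holo_on[OF Wo])
  have Ah: "hol UNIV UNIV (%y. (a + A y) $ i)"
   by (rule hol_compose_lin[OF hol_component[of UNIV UNIV i], where M = A])
    (use AB ciso_continuous[OF AB] in \<open>auto intro!: continuous_intros simp: ciso_def add.assoc\<close>)
  have "hol UNIV R (%w. (a + A (\<Psi>' w)) $ i)"
  proof (rule hol_compose_map[OF _ _ open_UNIV Ah])
   show "hol UNIV R (%x. \<Psi>' x $ k)" for k
   proof (rule hol_subset)
    show "hol UNIV T (%x. \<Psi>' x $ k)"
     unfolding \<Psi>'_def vector_minus_component vector_add_component
     by (intro hol_add hol_diff hol_component sh' hol_compose_lin[OF hol_component[of UNIV UNIV k], where L = "pI I" and M = "pI I"])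
      (auto intro!: continuous_intros simp: pI_line)
   qed (auto simp: R_def)
  qed (use Ro in auto)
  then have "hol UNIV R (%w. inv_into W \<Phi> w $ i)"
   by (rule hol_cong[rotated 2]) (use Ro inv_eq in auto)
  then show "holo_on (%w. inv_into W \<Phi> w $ i) R" by (rule hol_imp_holo_on[OF Ro])
 qed
 have graph: "y \<in> X \<longleftrightarrow> \<Psi> y \<in> V" if y: "y \<in> W'" for y
 proof -
  have yT: "y \<in> T" and yB: "pI I y \<in> B" using y W'T T(2) by auto
  have "\<Psi> y \<in> V \<longleftrightarrow> \<Psi> y = pI I y" using p\<Psi>(1)[OF yT] pI_id pI_EI by metis
  also have "\<dots> \<longleftrightarrow> y = s y" by (auto simp: \<Psi>_def)
  also have "\<dots> \<longleftrightarrow> y \<in> X"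
  proof
   assume "y = s y" then show "y \<in> X" using full[OF yB] by (simp add: s_def)
  next
   assume "y \<in> X"
   then show "y = s y" unfolding s_def
    by (intro sheet_near[OF sh l _ yB]) (use y in \<open>auto simp: W'_def dist_commute\<close>)
  qed
  finally show ?thesis by simp
 qed
 have img: "\<Phi> ` (Z \<inter> W) = {w \<in> R. \<forall>i\<in>-I. w $ i = 0}"
 proof -
  have "Z \<inter> W = (%y. a + A y) ` (X \<inter> W')" by (auto simp: W_def XZ)
  then have "\<Phi> ` (Z \<inter> W) = \<Psi> ` (X \<inter> W')" by (simp add: image_image \<Phi>A)
  also have "\<dots> = {w \<in> \<Psi> ` W'. w \<in> V}" using graph by blast
  finally show ?thesis unfolding Rimg by (auto simp: EI_def)
 qed
 have RB: "{w \<in> R. \<forall>i\<in>-I. w $ i = 0} = B"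
 proof (intro set_eqI iffI)
  fix w assume "w \<in> {w \<in> R. \<forall>i\<in>-I. w $ i = 0}"
  then have "pI I w = w" "w \<in> T" by (auto simp: R_def EI_def intro: pI_id)
  then show "w \<in> B" using T(2) by metis
 next
  fix w assume w: "w \<in> B"
  then have wV: "w \<in> V" using O by blast
  have pw: "pI I w = w" by (rule pI_id[OF wV])
  have "w \<in> T" using w T(2) pw by metis
  moreover have "\<Psi>' w = \<sigma> l w" by (simp add: \<Psi>'_def s_def pw)
  moreover have "\<sigma> l w \<in> W'"
  proof -
   have "\<sigma> l w \<in> T" using T(2)[of "\<sigma> l w"] sheetsD(8)[OF sh l w] w by simp
   then show ?thesis using sheetsD(9,10)[OF sh l w] \<Omega>(2)[OF w] by (simp add: W'_def dist_commute)
  qed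
  ultimately show "w \<in> {w \<in> R. \<forall>i\<in>-I. w $ i = 0}" using wV by (auto simp: R_def EI_def)
 qed
 have invB: "inv_into W \<Phi> x = a + A (\<sigma> l x) & a + A (\<sigma> l x) \<in> Z \<inter> W" if x: "x \<in> B" for x
 proof -
  have xR: "x \<in> R" using x RB by blast
  have px: "pI I x = x" using x O pI_id by blast
  have e: "\<Psi>' x = \<sigma> l x" by (simp add: \<Psi>'_def s_def px)
  have "a + A (\<sigma> l x) \<in> W" using xR e unfolding W_def R_def by (intro image_eqI[OF refl]) simp
  then show ?thesis using inv_eq[OF xR] full[OF x] e XZ by auto
 qed
 have W\<Omega>: "W \<subseteq> \<Omega>" by (auto simp: W_def W'_def)
 have "submanifold_chart Z W \<Phi> (- I)" unfolding submanifold_chart_def \<Phi>W using bih img by (rule conjI)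
 moreover have "\<Phi> ` (Z \<inter> W) = B" unfolding img RB ..
 ultimately show ?thesis using W\<Omega> invB by (intro exI[of _ W] exI[of _ \<Phi>] conjI) simp_all
qed

section \<open>Local form at a point of the variety and globalisation\<close>

lemma Ck_on_cong:
 assumes "Ck_on m f W" "open W" "!!x. x \<in> W ==> f x = g x"
 shows "Ck_on m g W"
 using assms
proof (induction m arbitrary: f g)
 case 0
 then show ?case using continuous_on_cong by (metis Ck_on.simps(1))
next
 case (Suc m)
 have d: "(g has_derivative frechet_derivative f (at x)) (at x)" if x: "x \<in> W" for x
 proof (rule has_derivative_transform_within_open[OF _ Suc.prems(2) x Suc.prems(3)])
  show "(f has_derivative frechet_derivative f (at x)) (at x)"
   using Suc.prems(1) x by (simp add: frechet_derivative_works)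
 qed
 have "frechet_derivative g (at x) = frechet_derivative f (at x)" if "x \<in> W" for x
  using frechet_derivative_at[OF d[OF that]] by simp
 then have "Ck_on m (%x. frechet_derivative g (at x) v) W" for v
  using Suc.IH[of "%x. frechet_derivative f (at x) v" "%x. frechet_derivative g (at x) v"] Suc.prems(1,2) by simp
 moreover have "g differentiable (at x)" if "x \<in> W" for x using d[OF that] by (rule differentiableI)
 ultimately show ?case by simp
qed

lemma Ck_on_affine:
 fixes A :: "'a::euclidean_space => 'a"
 assumes "Ck_on m g W" "open W" "linear A"
 shows "Ck_on m (%y. g (a + A y)) ((%y. a + A y) -` W)"
 using assms
proof (induction m arbitrary: g)
 case 0
 have "continuous_on UNIV (%y. a + A y)" using 0(3) by (intro continuous_intros linear_continuous_on linear_conv_bounded_linear[THEN iffD1])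
 then show ?case using 0(1) by (auto intro!: continuous_on_compose2[of W g] intro: continuous_on_subset)
next
 case (Suc m)
 have Ac: "continuous_on UNIV (%y. a + A y)" using Suc.prems(3) by (intro continuous_intros linear_continuous_on linear_conv_bounded_linear[THEN iffD1])
 have Wo: "open ((%y. a + A y) -` W)" by (rule open_vimage[OF Suc.prems(2) Ac])
 have d: "((%y. g (a + A y)) has_derivative (%v. frechet_derivative g (at (a + A y)) (A v))) (at y)" if "a + A y \<in> W" for y
 proof -
  have "(g has_derivative frechet_derivative g (at (a + A y))) (at (a + A y))"
   using Suc.prems(1) that by (simp add: frechet_derivative_works)
  moreover have "((%y. a + A y) has_derivative A) (at y)"
   using has_derivative_add[OF has_derivative_const linear_imp_has_derivative[OF Suc.prems(3)]] by simp
  ultimately show ?thesis using diff_chain_at by (fastforce simp: o_def)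
 qed
 have "Ck_on m (%y. frechet_derivative (%y. g (a + A y)) (at y) v) ((%y. a + A y) -` W)" for v
 proof (rule Ck_on_cong[OF Suc.IH[of "%x. frechet_derivative g (at x) (A v)"] Wo])
  fix y assume "y \<in> (%y. a + A y) -` W"
  then show "frechet_derivative g (at (a + A y)) (A v) = frechet_derivative (%y. g (a + A y)) (at y) v"
   using frechet_derivative_at[OF d[of y]] by (metis vimageE)
 qed (use Suc.prems in auto)
 moreover have "(%y. g (a + A y)) differentiable (at y)" if "y \<in> (%y. a + A y) -` W" for y
  by (rule differentiableI[OF d]) (use that in simp)
 ultimately show ?case by simp
qed

lemma Ck_on_mono: "Ck_on m f W ==> k <= m ==> Ck_on k f W"
proof (induction m arbitrary: f k)
 case (Suc m)
 show ?case
 proof (cases k)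
  case 0
  then show ?thesis using Ck_on_continuous[OF Suc.prems(1)] by simp
 next
  case (Suc k')
  then show ?thesis using Suc.prems Suc.IH by auto
 qed
qed simp

lemma Ck_on_variety_mono: "Ck_on_variety m \<phi> Z ==> k <= m ==> Ck_on_variety k \<phi> Z"
 unfolding Ck_on_variety_def using Ck_on_mono by meson

text \<open>The degenerate tower with nothing eliminated: the projection is the identity and the
  same functions serve as \<open>H\<close> and \<open>F\<close>. With no coordinate outside
  \<open>UNIV\<close>, the radii and the equations \<open>Q\<close> are arbitrary.\<close>

lemma initial_tower:
 fixes Z :: "(complex^'n) set"
 assumes Z: "analytic_subset U Z" and a: "a \<in> Z"
 shows "\<exists>D F. tower {y. a + y \<in> Z} UNIV D s r Q F F"
proof -
 obtain W F where W: "open W" "a \<in> W" "W \<subseteq> U" "finite F" "\<forall>f\<in>F. holo_on f W" "Z \<inter> W = {z\<in>W. \<forall>f\<in>F. f z = 0}"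
 proof -
  have "a \<in> U" using Z a by (auto simp: analytic_subset_def)
  then have "\<exists>W F. open W & a \<in> W & W \<subseteq> U & finite F & (\<forall>f\<in>F. holo_on f W) & Z \<inter> W = {z\<in>W. \<forall>f\<in>F. f z = 0}"
   using Z by (simp add: analytic_subset_def)
  then show thesis by (elim exE conjE) (rule that)
 qed
 obtain e where e: "e > 0" "ball a e \<subseteq> W" using W open_contains_ball by blast
 have aW: "a + y \<in> W" if "y \<in> ball 0 e" for y using that e(2) by (auto simp: dist_norm subset_eq)
 define F' where "F' = (%f y. f (a + y)) ` F"
 have h: "hol UNIV (ball 0 e) f" if f: "f \<in> F'" for f
 proof -
  obtain g where g: "g \<in> F" "f = (%y. g (a + y))" using f by (auto simp: F'_def)
  have "hol UNIV W g" by (rule holo_on_imp_hol) (use W g in auto)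
  then show ?thesis unfolding g(2)
  proof (rule hol_compose_lin[where M = "%v. v"])
   show "a + z \<in> W" if "z \<in> ball 0 e" for z by (rule aW[OF that])
  qed (auto intro!: continuous_intros)
 qed
 have Om: "Om UNIV (ball 0 e) r = ball 0 e" for r :: "'n => real"
  by (auto simp: Om_def pI_id)
 have X: "{y. a + y \<in> Z} \<inter> ball 0 e = {y \<in> ball 0 e. \<forall>h\<in>F'. h y = 0}"
 proof (intro set_eqI)
  fix y
  have "a + y \<in> Z \<longleftrightarrow> (\<forall>f\<in>F. f (a + y) = 0)" if "y \<in> ball 0 e" using aW[OF that] W(6)[THEN eqset_imp_iff, of "a + y"] by simp
  then show "y \<in> {y. a + y \<in> Z} \<inter> ball 0 e \<longleftrightarrow> y \<in> {y \<in> ball 0 e. \<forall>h\<in>F'. h y = 0}" unfolding F'_def by auto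
 qed
 have pU: "pI UNIV y = y" for y :: "complex^'n" by (simp add: pI_id)
 then have "tower {y. a + y \<in> Z} UNIV (ball 0 e) s r Q F' F'"
  unfolding tower_def Om X using e(1) a h W(4) by (simp add: F'_def pU)
 then show ?thesis by blast
qed

lemma submanifold_chart_restrict:
 assumes "submanifold_chart Z W \<Phi> J" "W \<subseteq> V"
 shows "submanifold_chart (Z \<inter> V) W \<Phi> J"
proof -
 have "Z \<inter> V \<inter> W = Z \<inter> W" using assms(2) by blast
 then show ?thesis using assms(1) by (simp add: submanifold_chart_def)
qed

text \<open>Two inequalities. A chart piece of codimension \<open>p\<close> near \<open>a\<close>
  fits into the tower, whose dimension is bounded by \<open>dim_bound\<close>; conversely
  \<open>full_sheet\<close> and \<open>graph_chart\<close> give regular points of codimension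
  \<open>CARD('n) - card I\<close> arbitrarily near \<open>a\<close>, so this number is at least
  \<open>p\<close>.\<close>

lemma tower_codim:
 fixes Z :: "(complex^'n) set"
 assumes Z: "pure_codim Z p" and a: "a \<in> Z" and AB: "ciso A B" and tow: "tower {y. a + A y \<in> Z} I D s r Q H {}"
 shows "card I = CARD('n) - p"
proof -
 interpret cover "{y. a + A y \<in> Z}" I D s r Q H by unfold_locales (rule tow)
 have A0: "A 0 = 0" by (rule ciso_zero[OF AB])
 have ca: "has_codim_at Z a p" using Z a by (simp add: pure_codim_def)
 obtain U where U: "open U" "0 \<in> U" "thin (Suc (dim V)) ({y. a + A y \<in> Z} \<inter> U)" using dim_bound[OF tow] by blast
 have "open ((%y. a + A y) ` U)" by (rule ciso_affine(2)[OF AB U(1)])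
 moreover have "a \<in> (%y. a + A y) ` U" by (rule image_eqI[OF _ U(2)]) (simp add: A0)
 moreover have "a \<in> closure (regular_part_codim Z p)" using ca by (simp add: has_codim_at_def)
 ultimately have "\<exists>T S j. subspace T & dim T = 2 * (CARD('n) - p) & ropen T S & S ~= {} & continuous_on S j & inj_on j S &
  (j :: complex^'n => complex^'n) ` S \<subseteq> {y. a + A y \<in> Z & a + A y \<in> (%y. a + A y) ` U}"
  by (intro codim_piece[OF _ _ _ AB])
 then obtain T S and j :: "complex^'n => complex^'n" where T: "subspace T" "dim T = 2 * (CARD('n) - p)" "ropen T S" "S ~= {}" "continuous_on S j" "inj_on j S"
  "j ` S \<subseteq> {y. a + A y \<in> Z & a + A y \<in> (%y. a + A y) ` U}"
  by (elim exE conjE) (rule that)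
 have "{y. a + A y \<in> Z & a + A y \<in> (%y. a + A y) ` U} \<subseteq> {y. a + A y \<in> Z} \<inter> U"
  using ciso_affine(4,5)[OF AB] by auto
 then have "~ Suc (dim V) <= dim T" using thinD[OF U(3) T(1) _ T(3-6)] T(7) by blast
 then have le1: "CARD('n) - p <= card I" unfolding T(2) by (simp add: dim_EI)
 have "a \<in> closure (regular_part_codim Z (CARD('n) - card I))"
  unfolding closure_iff_nhds_not_empty
 proof (intro allI impI)
  fix O' O1 assume O1: "O1 \<subseteq> O'" "a \<in> O1" "open O1"
  have "open ((%y. a + A y) -` O1)" "0 \<in> (%y. a + A y) -` O1" using ciso_affine(1)[OF AB O1(3)] O1(2) A0 by auto
  from full_sheet[OF this] obtain x0 B' L \<sigma> \<eta> l where sh: "sheets x0 B' L \<sigma> \<eta>" "l \<in> L"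
   "\<forall>x\<in>B'. \<sigma> l x \<in> {y. a + A y \<in> Z}" "\<sigma> l x0 \<in> (%y. a + A y) -` O1" by blast
  obtain W \<Phi> where W: "submanifold_chart Z W \<Phi> (- I)" "\<forall>x\<in>B'. inv_into W \<Phi> x = a + A (\<sigma> l x) & a + A (\<sigma> l x) \<in> Z \<inter> W"
   using graph_chart[OF AB refl sh(1,2) _ open_UNIV] sh(3) by blast
  have "card (- I) = CARD('n) - card I" by (simp add: Compl_eq_Diff_UNIV card_Diff_subset)
  then have "a + A (\<sigma> l x0) \<in> regular_part_codim Z (CARD('n) - card I)"
   unfolding regular_part_codim_def using W sheetsD(3)[OF sh(1)] by blast
  then show "regular_part_codim Z (CARD('n) - card I) \<inter> O' ~= {}" using sh(4) O1(1) by blast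
 qed
 then have "~ CARD('n) - card I < p" using ca unfolding has_codim_at_def by blast
 moreover have "card I <= CARD('n)" by (rule card_mono) auto
 ultimately show ?thesis using le1 by linarith
qed

text \<open>\<phi> will be given on a neighbourhood that is known only after all the sets
  \<open>Va\<close> and exponents \<open>m\<close> are chosen, hence the quantifier over
  \<open>V'\<close>. Charts of \<open>Z\<close> inside \<open>Va\<close> are also charts of
  \<open>Z \<inter> V'\<close>.\<close>

lemma local_form:
 fixes U Z :: "(complex^'n) set"
 assumes U: "open U" and Z: "analytic_subset U Z" "pure_codim Z p" and a: "a \<in> Z"
 shows "\<exists>Va m. open Va & a \<in> Va & Va \<subseteq> U & (\<forall>V' \<phi>. Va \<subseteq> V' & Ck_on_variety m \<phi> (Z \<inter> V') &
  holomorphic_on_regular_part \<phi> (Z \<inter> V') --> (\<exists>f. holo_on f Va & (\<forall>z\<in>Z \<inter> Va. \<phi> z = f z)))"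
proof -
 have ZU: "Z \<subseteq> U" using Z(1) by (simp add: analytic_subset_def)
 obtain D0 F0 where "tower {y. a + y \<in> Z} UNIV D0 undefined undefined undefined F0 F0" using initial_tower[OF Z(1) a] by blast
 from elimination[OF this] obtain A A' I D s r Q H where AB: "ciso A A'" and tow0: "tower (A -` {y. a + y \<in> Z}) I D s r Q H {}" by blast
 define X where "X = {y. a + A y \<in> Z}"
 have tow: "tower X I D s r Q H {}" using tow0 by (simp add: X_def vimage_def)
 interpret c: cover X I D s r Q H by unfold_locales (rule tow)
 have cI: "card I = CARD('n) - p" by (rule tower_codim[OF Z(2) a AB tow[unfolded X_def]])
 \<comment> \<open>Every point of the variety is a limit of regular points of codimension
   \<open>p\<close>, whose charts have real dimension \<open>2 * (CARD('n) - p)\<close>; by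
   \<open>tower_codim\<close> this is the dimension of the base.\<close>
 have c.pure
  unfolding c.pure_def
 proof (intro ballI allI impI, elim conjE)
  fix y W assume y: "y \<in> X \<inter> c.Om'" and W: "open W" "y \<in> W"
  have zz: "a + A y \<in> closure (regular_part_codim Z p)" using Z(2) y unfolding pure_codim_def has_codim_at_def X_def by blast
  have "open ((%y. a + A y) ` W)" "a + A y \<in> (%y. a + A y) ` W" using ciso_affine(2)[OF AB W(1)] W(2) by auto
  from codim_piece[OF zz this AB, of a] obtain T S j where T: "subspace T" "dim T = 2 * (CARD('n) - p)" "ropen T S" "S ~= {}" "continuous_on S j" "inj_on j S"
   "(j :: complex^'n => complex^'n) ` S \<subseteq> {y'. a + A y' \<in> Z & a + A y' \<in> (%y. a + A y) ` W}"
   by (elim exE conjE) (rule that)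
  have "{y'. a + A y' \<in> Z & a + A y' \<in> (%y. a + A y) ` W} \<subseteq> X \<inter> W" using ciso_affine(4,5)[OF AB] by (auto simp: X_def)
  then have "j ` S \<subseteq> X \<inter> W" using T(7) by blast
  moreover have "dim T = dim c.V" using T(2) cI by (simp add: dim_EI)
  ultimately show "\<exists>T S j. subspace T & dim T = dim c.V & ropen T S & S ~= {} &
    continuous_on S j & inj_on j S & (j :: complex^'n => complex^'n) ` S \<subseteq> X \<inter> W"
   using T(1,3-6) by blast
 qed
 from c.pure_pcover[OF this] obtain D' \<delta> M where "pcover X I D' s r Q H \<delta> M" by blast
 then interpret pc: pcover X I D' s r Q H \<delta> M .
 obtain m D1 where D1: "ropen pc.V D1" "convex D1" "0 \<in> D1" "D1 \<subseteq> D'" and main: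
  "\<forall>\<phi>. bcover.wh X I D1 r \<phi> & Ck_on_variety m \<phi> (X \<inter> Om I D1 r) --> (\<exists>f. hol UNIV (Om I D1 r) f & (\<forall>y\<in>X \<inter> Om I D1 r. \<phi> y = f y))"
  using pc.local_theorem by blast
 interpret C: pcover X I D1 s r Q H \<delta> M by (rule pc.pcover_restrict[OF D1])
 define Va where "Va = (%y. a + A y) ` C.Om' \<inter> U"
 have Vao: "open Va" unfolding Va_def by (intro open_Int ciso_affine(2)[OF AB C.Om_open] U)
 have aVa: "a \<in> Va" using C.Om_0 ciso_zero[OF AB] ZU a unfolding Va_def by (intro IntI image_eqI[OF _ C.Om_0]) auto
 have inVa: "a + A y \<in> Z \<inter> Va" if "y \<in> X \<inter> C.Om'" for y using that ZU by (auto simp: X_def Va_def)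
 have "\<exists>f. holo_on f Va & (\<forall>z\<in>Z \<inter> Va. \<phi> z = f z)"
  if V': "Va \<subseteq> V'" and ck: "Ck_on_variety m \<phi> (Z \<inter> V')" and hr: "holomorphic_on_regular_part \<phi> (Z \<inter> V')" for V' \<phi>
 proof -
  \<comment> \<open>By \<open>graph_chart\<close> each sheet inside the variety is the slice of a
    chart, so the hypothesis on the regular part applies to it.\<close>
  have "C.wh (%y. \<phi> (a + A y))"
   unfolding C.wh_def
  proof (intro allI impI ballI)
   fix x0 B L \<sigma> \<eta> l assume fs: "C.fsheets x0 B L \<sigma> \<eta>" and l: "l \<in> (L :: ('n => nat) set)"
   note sh = C.fsheetsD(1)[OF fs]
   have in': "a + A (\<sigma> l x) \<in> Va" if "x \<in> B" for x
    using inVa C.fsheetsD(2)[OF fs l that] C.sheetsD(9)[OF sh l that] by blast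
   obtain W \<Phi> where W: "submanifold_chart Z W \<Phi> (- I)" "W \<subseteq> Va" "\<Phi> ` (Z \<inter> W) = B"
    "\<forall>x\<in>B. inv_into W \<Phi> x = a + A (\<sigma> l x) & a + A (\<sigma> l x) \<in> Z \<inter> W"
    using C.graph_chart[OF AB X_def sh l C.fsheetsD(2)[OF fs l] Vao in'] by blast
   have WV: "W \<subseteq> V'" using W(2) V' by blast
   have "holo_on (\<phi> \<circ> inv_into W \<Phi>) (\<Phi> ` (Z \<inter> V' \<inter> W))"
    using hr submanifold_chart_restrict[OF W(1) WV] unfolding holomorphic_on_regular_part_def by blast
   moreover have "Z \<inter> V' \<inter> W = Z \<inter> W" using WV by blast
   ultimately have "holo_on (\<phi> \<circ> inv_into W \<Phi>) B" using W(3) by simp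
   then have "hol C.V B (\<phi> \<circ> inv_into W \<Phi>)" by (rule holo_on_imp_hol[OF EI_subspace C.sheetsD(1)[OF sh]])
   then show "hol C.V B (%x. \<phi> (a + A (\<sigma> l x)))"
    by (rule hol_cong[OF EI_subspace C.sheetsD(1)[OF sh]]) (use W(4) in simp)
  qed
  moreover have "Ck_on_variety m (%y. \<phi> (a + A y)) (X \<inter> C.Om')"
   unfolding Ck_on_variety_def
  proof
   fix y assume y: "y \<in> X \<inter> C.Om'"
   then have "a + A y \<in> Z \<inter> V'" using inVa V' by blast
   then obtain W g where W: "open W" "a + A y \<in> W" "Ck_on m g W" "\<forall>z\<in>Z \<inter> V' \<inter> W. \<phi> z = g z"
    using ck unfolding Ck_on_variety_def by blast
   have "a + A z \<in> Z \<inter> V' \<inter> W" if "z \<in> X \<inter> C.Om' \<inter> (%y. a + A y) -` W" for z using inVa V' that by blast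
   then have "\<forall>z\<in>X \<inter> C.Om' \<inter> (%y. a + A y) -` W. \<phi> (a + A z) = g (a + A z)" using W(4) by blast
   then show "\<exists>W g. open W & y \<in> W & Ck_on m g W & (\<forall>z\<in>X \<inter> C.Om' \<inter> W. \<phi> (a + A z) = g z)"
    using W(2) ciso_affine(1)[OF AB W(1)] Ck_on_affine[OF W(3,1) ciso_linear[OF AB]]
    by (intro exI[of _ "(%y. a + A y) -` W"] exI[of _ "%y. g (a + A y)"] conjI) auto
  qed
  ultimately obtain f where f: "hol UNIV C.Om' f" "\<forall>y\<in>X \<inter> C.Om'. \<phi> (a + A y) = f y" using main by blast
  have "hol UNIV Va (%z. f (A' (z - a)))"
   by (rule ciso_pullback[OF AB f(1)]) (use ciso_affine(5)[OF AB, of _ a C.Om'] in \<open>auto simp: Va_def\<close>)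
  then have "holo_on (%z. f (A' (z - a))) Va" by (rule hol_imp_holo_on[OF Vao])
  moreover have "\<phi> z = f (A' (z - a))" if z: "z \<in> Z \<inter> Va" for z
  proof -
   have "A' (z - a) \<in> C.Om'" using z ciso_affine(5)[OF AB, of z a C.Om'] by (auto simp: Va_def)
   moreover have "A' (z - a) \<in> X" using z ciso_affine(3)[OF AB, of a z] by (simp add: X_def)
   ultimately have "\<phi> (a + A (A' (z - a))) = f (A' (z - a))" using f(2) by blast
   then show ?thesis unfolding ciso_affine(3)[OF AB] .
  qed
  ultimately show ?thesis by blast
 qed
 then show ?thesis using Vao aVa by (intro exI[of _ Va] exI[of _ m]) (auto simp: Va_def)
qed

lemma analytic_subset_avoid:
 assumes Z: "analytic_subset U Z" and a: "a \<in> U" "a \<notin> Z"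
 shows "\<exists>Va. open Va & a \<in> Va & Va \<subseteq> U & Z \<inter> Va = {}"
proof -
 obtain W F where W: "open W" "a \<in> W" "W \<subseteq> U" "\<forall>f\<in>F. holo_on f W" "Z \<inter> W = {z\<in>W. \<forall>f\<in>F. f z = 0}"
 proof -
  have "\<exists>W F. open W & a \<in> W & W \<subseteq> U & finite F & (\<forall>f\<in>F. holo_on f W) & Z \<inter> W = {z\<in>W. \<forall>f\<in>F. f z = 0}"
   using Z a(1) by (simp add: analytic_subset_def)
  then show thesis by (elim exE conjE) (rule that)
 qed
 obtain f where f: "f \<in> F" "f a ~= 0" using W(2,5) a(2) by blast
 have "continuous_on W f"
  by (rule hol_continuous[OF holo_on_imp_hol[of UNIV]]) (use W f in auto)
 then have "open (W \<inter> f -` (-{0}))" by (rule continuous_open_preimage[OF _ W(1)]) (simp add: open_Compl)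
 moreover have "Z \<inter> (W \<inter> f -` (-{0})) = {}" using W(5) f(1) by blast
 ultimately show ?thesis using W(2,3) f(2) by (intro exI[of _ "W \<inter> f -` (-{0})"]) auto
qed

theorem corollary1p4:
 fixes U Z :: "(complex^'n) set" and p :: nat
 assumes "open U" and "cball 0 1 \<subseteq> U"
  and "analytic_subset U Z"
  and "pure_codim Z p"
 shows "\<exists>V m. open V \<and> cball 0 1 \<subseteq> V \<and> V \<subseteq> U \<and>
  (\<forall>\<phi>. Ck_on_variety m \<phi> (Z \<inter> V) \<and> holomorphic_on_regular_part \<phi> (Z \<inter> V)
   \<longrightarrow> strongly_holomorphic_on \<phi> (Z \<inter> V))"
proof -
 define P where "P Va m \<longleftrightarrow> open Va & Va \<subseteq> U & (\<forall>V' \<phi>. Va \<subseteq> V' & Ck_on_variety m \<phi> (Z \<inter> V') &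
  holomorphic_on_regular_part \<phi> (Z \<inter> V') --> (\<exists>f. holo_on f Va & (\<forall>z\<in>Z \<inter> Va. \<phi> z = f z)))" for Va m
 have "\<exists>Va m. a \<in> Va & P Va m" if a: "a \<in> cball 0 1" for a
 proof (cases "a \<in> Z")
  case True
  from local_form[OF assms(1,3,4) this] show ?thesis
   unfolding P_def by (elim exE conjE) (intro exI conjI, assumption+)
 next
  case False
  obtain Va where Va: "open Va" "a \<in> Va" "Va \<subseteq> U" "Z \<inter> Va = {}" using analytic_subset_avoid[OF assms(3) _ False] a assms(2) by blast
  have "holo_on (%_. 0) Va" by (rule hol_imp_holo_on[OF Va(1)]) simp
  then have "\<exists>f. holo_on f Va & (\<forall>z\<in>Z \<inter> Va. \<phi> z = f z)" for \<phi> using Va(4) by blast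
  then show ?thesis using Va(1-3) unfolding P_def by (intro exI[of _ Va]) simp
 qed
 then obtain W m where W: "!!a. a \<in> cball 0 1 ==> a \<in> W a" "!!a. a \<in> cball 0 1 ==> P (W a) (m a)" by metis
 have "cball (0::complex^'n) 1 \<subseteq> (\<Union>a\<in>cball 0 1. W a)" using W(1) by blast
 then obtain T where T: "T \<subseteq> cball 0 1" "finite T" "cball 0 1 \<subseteq> (\<Union>a\<in>T. W a)"
  using compactE_image[OF compact_cball, of "cball 0 1" W 0 1] W(2) unfolding P_def by blast
 define V where "V = (\<Union>a\<in>T. W a)"
 \<comment> \<open>Any common upper bound of the finitely many exponents will do.\<close>
 define k where "k = (\<Sum>a\<in>T. m a)"
 have WP: "open (W a)" "W a \<subseteq> U" if "a \<in> T" for a using W(2) T(1) that unfolding P_def by blast+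
 have "strongly_holomorphic_on \<phi> (Z \<inter> V)"
  if ck: "Ck_on_variety k \<phi> (Z \<inter> V)" and hr: "holomorphic_on_regular_part \<phi> (Z \<inter> V)" for \<phi>
  unfolding strongly_holomorphic_on_def
 proof
  fix z assume z: "z \<in> Z \<inter> V"
  then obtain a where a: "a \<in> T" "z \<in> W a" by (auto simp: V_def)
  have WV: "W a \<subseteq> V" using a(1) by (auto simp: V_def)
  have "m a <= k" unfolding k_def by (rule member_le_sum[OF a(1) _ T(2)]) simp
  then have "Ck_on_variety (m a) \<phi> (Z \<inter> V)" by (rule Ck_on_variety_mono[OF ck])
  moreover have "P (W a) (m a)" using W(2) T(1) a(1) by blast
  ultimately obtain f where f: "holo_on f (W a)" "\<forall>z\<in>Z \<inter> W a. \<phi> z = f z" using WV hr unfolding P_def by blast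
  show "\<exists>W g. open W & z \<in> W & holo_on g W & (\<forall>z\<in>Z \<inter> V \<inter> W. \<phi> z = g z)"
   by (rule exI[of _ "W a"], rule exI[of _ f]) (use f a WP in auto)
 qed
 moreover have "open V" unfolding V_def by (intro open_UN ballI WP)
 moreover have "cball 0 1 \<subseteq> V" using T(3) by (simp add: V_def)
 moreover have "V \<subseteq> U" using WP(2) by (auto simp: V_def)
 ultimately show ?thesis by blast
qed

end
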